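(* Assume that $G$ is a real form of $U^{\mathbb C}$ and that $x\in Z$ is such that $X=U^{\mathbb C}\cdot x$ is compact. Let $\mathcal O$ be the unique closed $G$-orbit in $X$. Let $\mathfrak a\subset\mathfrak p$ be an Abelian subalgebra and let $\mu_{\mathfrak a}:X\to\mathfrak a$ be the corresponding $A=\exp(\mathfrak a)$-gradient map. Then $\mu_{\mathfrak a}(X)=\mu_{\mathfrak a}(\mathcal O)$.
   Context: Let $U$ be a compact connected Lie group with Lie algebra $\mathfrak u$ and let $U^{\mathbb C}$ be its complexification, with Lie algebra $\mathfrak u^{\mathbb C}=\mathfrak u\oplus i\mathfrak u$. Let $G\subset U^{\mathbb C}$ be a connected compatible subgroup with Lie algebra $\mathfrak g$; compatible means that $G$ is closed and, with $K:=G\cap U$ and $\mathfrak p:=\mathfrak g\cap i\mathfrak u$, the map $K\times\mathfrak p\to G$, $(k,\beta)\mapsto k\exp(\beta)$, is a diffeomorphism. Then $\mathfrak g=\mathfrak k\oplus\mathfrak p$, where $\mathfrak k$ is the Lie algebra of $K$. That $G$ is a real form of $U^{\mathbb C}$ means $\mathfrak u=\mathfrak k\oplus i\mathfrak p$, so that $\mathfrak g^{\mathbb C}=\mathfrak u^{\mathbb C}$. Let $(Z,\omega)$ be a Kähler manifold with complex structure $J$ and Kähler metric $(v,w)=\omega(v,Jw)$, with a holomorphic action of $U^{\mathbb C}$ such that $\omega$ is $U$-invariant, and let $\mu:Z\to\mathfrak u^*$ be a $U$-equivariant momentum map: $d\mu^\xi=i_{\xi_Z}\omega$ for all $\xi\in\mathfrak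 u$, where $\mu^\xi(z)=\langle\mu(z),\xi\rangle$ and $\xi_Z(z)=\frac{d}{dt}\big|_{t=0}\exp(t\xi)\cdot z$. Fix an $\mathrm{Ad}(U)$-invariant inner product on $\mathfrak u$, identify $\mathfrak u^*$ with $\mathfrak u$, and transport the inner product to $i\mathfrak u$ by multiplication by $i$. The gradient map $\mu_{\mathfrak p}:Z\to\mathfrak p$ is defined by $\langle\mu_{\mathfrak p}(z),\beta\rangle=\mu^{-i\beta}(z)$ for $\beta\in\mathfrak p$. For an Abelian subalgebra $\mathfrak a\subset\mathfrak p$, the gradient map associated to $A=\exp(\mathfrak a)$ is $\mu_{\mathfrak a}=\pi_{\mathfrak a}\circ\mu_{\mathfrak p}$, where $\pi_{\mathfrak a}:\mathfrak p\to\mathfrak a$ is the orthogonal projection. It is a known result (Wolf) that when $G$ is a real form and $U^{\mathbb C}\cdot x$ is compact, $G$ has a unique closed orbit in $U^{\mathbb C}\cdot x$. *)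

theory Defs
  imports "HOL-Analysis.Analysis" "HOL-Algebra.Group_Action"
begin

section \<open>Complex manifolds\<close>

text \<open>
  A manifold is a Hausdorff, second countable type \<open>'a\<close> with an atlas whose charts take values in
  a finite-dimensional normed space \<open>'e\<close> (possibly of dimension 0).  A complex manifold comes in
  addition with a linear \<open>j\<close> on \<open>'e\<close> with \<open>j\<^sup>2 = -1\<close>, and its transition maps have
  \<open>j\<close>-linear derivatives.
\<close>

type_synonym ('a, 'e) chart = "'a set \<times> ('a \<Rightarrow> 'e)"

abbreviation chart_dom :: "('a, 'e) chart \<Rightarrow> 'a set" where
  "chart_dom c \<equiv> fst c"

abbreviation chart_map :: "('a, 'e) chart \<Rightarrow> 'a \<Rightarrow> 'e" where
  "chart_map c \<equiv> snd c"

abbreviation chart_inv :: "('a, 'e) chart \<Rightarrow> 'e \<Rightarrow> 'a" where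
  "chart_inv c \<equiv> inv_into (chart_dom c) (chart_map c)"

definition is_chart :: "('a::topological_space, 'e::real_normed_vector) chart \<Rightarrow> bool" where
  "is_chart c \<longleftrightarrow> open (chart_dom c) \<and> open (chart_map c ` chart_dom c) \<and>
     homeomorphism (chart_dom c) (chart_map c ` chart_dom c) (chart_map c) (chart_inv c)"

definition complex_structure :: "('e::real_normed_vector \<Rightarrow> 'e) \<Rightarrow> bool" where
  "complex_structure j \<longleftrightarrow> linear j \<and> (\<forall>v. j (j v) = - v)"

definition complex_differentiable_at ::
  "('e::real_normed_vector \<Rightarrow> 'e) \<Rightarrow> ('f::real_normed_vector \<Rightarrow> 'f) \<Rightarrow> ('e \<Rightarrow> 'f) \<Rightarrow> 'e \<Rightarrow> bool" where
  "complex_differentiable_at j k f x \<longleftrightarrow>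
     (\<exists>D. (f has_derivative D) (at x) \<and> (\<forall>v. D (j v) = k (D v)))"

definition holomorphic_map ::
  "('e::real_normed_vector \<Rightarrow> 'e) \<Rightarrow> ('a::topological_space, 'e) chart set \<Rightarrow>
   ('f::real_normed_vector \<Rightarrow> 'f) \<Rightarrow> ('b::topological_space, 'f) chart set \<Rightarrow> ('a \<Rightarrow> 'b) \<Rightarrow> bool" where
  "holomorphic_map j A k B f \<longleftrightarrow> continuous_on UNIV f \<and>
     (\<forall>c\<in>A. \<forall>d\<in>B. \<forall>x \<in> chart_map c ` (chart_dom c \<inter> f -` chart_dom d).
        complex_differentiable_at j k (chart_map d \<circ> f \<circ> chart_inv c) x)"

definition complex_manifold ::
  "('e::real_normed_vector \<Rightarrow> 'e) \<Rightarrow> ('a::{t2_space, second_countable_topology}, 'e) chart set \<Rightarrow> bool" where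
  "complex_manifold j A \<longleftrightarrow>
     (\<exists>S::'e set. finite S \<and> span S = UNIV) \<and> complex_structure j \<and>
     (\<forall>c\<in>A. is_chart c) \<and> (\<Union>c\<in>A. chart_dom c) = UNIV \<and>
     (\<forall>c\<in>A. \<forall>d\<in>A. \<forall>x \<in> chart_map c ` (chart_dom c \<inter> chart_dom d).
        complex_differentiable_at j j (chart_map d \<circ> chart_inv c) x)"

definition prod_atlas :: "('a, 'e) chart set \<Rightarrow> ('b, 'f) chart set \<Rightarrow> ('a \<times> 'b, 'e \<times> 'f) chart set" where
  "prod_atlas A B =
     {(chart_dom c \<times> chart_dom d, map_prod (chart_map c) (chart_map d)) | c d. c \<in> A \<and> d \<in> B}"

definition vec_atlas :: "('e, 'e) chart set" where
  "vec_atlas = {(UNIV, id)}"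


section \<open>Smooth maps and tangent maps\<close>

text \<open>
  \<open>Ck_on k S f\<close>: \<open>f\<close> is \<open>k\<close> times continuously differentiable on the open set \<open>S\<close>
  of a finite-dimensional space.
\<close>

primrec Ck_on :: "nat \<Rightarrow> 'e::real_normed_vector set \<Rightarrow> ('e \<Rightarrow> 'f::real_normed_vector) \<Rightarrow> bool" where
  "Ck_on 0 S f \<longleftrightarrow> continuous_on S f"
| "Ck_on (Suc k) S f \<longleftrightarrow>
     (\<exists>f'. (\<forall>x\<in>S. (f has_derivative f' x) (at x)) \<and> (\<forall>v. Ck_on k S (\<lambda>x. f' x v)))"

definition smooth_map_on ::
  "('a::topological_space, 'e::real_normed_vector) chart set \<Rightarrow>
   ('b::topological_space, 'f::real_normed_vector) chart set \<Rightarrow> 'a set \<Rightarrow> ('a \<Rightarrow> 'b) \<Rightarrow> bool" where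
  "smooth_map_on A B W f \<longleftrightarrow> open W \<and> continuous_on W f \<and>
     (\<forall>c\<in>A. \<forall>d\<in>B. \<forall>k.
        Ck_on k (chart_map c ` (chart_dom c \<inter> W \<inter> f -` chart_dom d)) (chart_map d \<circ> f \<circ> chart_inv c))"

text \<open>
  Smoothness of a map on an arbitrary subset \<open>S\<close> means that it extends smoothly near every point
  of \<open>S\<close>.  For embedded submanifolds this is the usual notion.
\<close>

definition smooth_on_subset ::
  "('a::topological_space, 'e::real_normed_vector) chart set \<Rightarrow>
   ('b::topological_space, 'f::real_normed_vector) chart set \<Rightarrow> 'a set \<Rightarrow> ('a \<Rightarrow> 'b) \<Rightarrow> bool" where
  "smooth_on_subset A B S f \<longleftrightarrow>
     (\<forall>p\<in>S. \<exists>W F. p \<in> W \<and> smooth_map_on A B W F \<and> (\<forall>q \<in> S \<inter> W. F q = f q))"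

definition diffeomorphism_on ::
  "('a::topological_space, 'e::real_normed_vector) chart set \<Rightarrow>
   ('b::topological_space, 'f::real_normed_vector) chart set \<Rightarrow> 'a set \<Rightarrow> 'b set \<Rightarrow> ('a \<Rightarrow> 'b) \<Rightarrow> bool" where
  "diffeomorphism_on A B S T f \<longleftrightarrow>
     bij_betw f S T \<and> smooth_on_subset A B S f \<and> smooth_on_subset B A T (inv_into S f)"

text \<open>
  Every tangent space is identified with the model space \<open>'e\<close> by means of a chosen chart at
  the base point.  In a complex manifold the complex structure on each tangent space is then \<open>j\<close>.
\<close>

definition chart_at :: "('a, 'e) chart set \<Rightarrow> 'a \<Rightarrow> ('a, 'e) chart" where
  "chart_at A p = (SOME c. c \<in> A \<and> p \<in> chart_dom c)"

definition tangent_map ::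
  "('a, 'e::real_normed_vector) chart set \<Rightarrow> ('b, 'f::real_normed_vector) chart set \<Rightarrow>
   ('a \<Rightarrow> 'b) \<Rightarrow> 'a \<Rightarrow> 'e \<Rightarrow> 'f" where
  "tangent_map A B f p =
     frechet_derivative (chart_map (chart_at B (f p)) \<circ> f \<circ> chart_inv (chart_at A p))
       (at (chart_map (chart_at A p) p))"


section \<open>Complex Lie groups\<close>

definition complex_lie_group ::
  "'g::{t2_space, second_countable_topology} monoid \<Rightarrow> ('l::real_normed_vector \<Rightarrow> 'l) \<Rightarrow>
   ('g, 'l) chart set \<Rightarrow> bool" where
  "complex_lie_group L i A \<longleftrightarrow> group L \<and> carrier L = UNIV \<and> complex_manifold i A \<and>
     holomorphic_map (map_prod i i) (prod_atlas A A) i A (\<lambda>(g, h). g \<otimes>\<^bsub>L\<^esub> h) \<and>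
     holomorphic_map i A i A (\<lambda>g. inv\<^bsub>L\<^esub> g)"

text \<open>
  The Lie algebra of \<open>L\<close> is the tangent space at the identity, hence the model space \<open>'l\<close>;
  multiplication by the imaginary unit on it is \<open>i\<close>.
\<close>

definition one_parameter_subgroup ::
  "'g::topological_space monoid \<Rightarrow> ('g, 'l::real_normed_vector) chart set \<Rightarrow> 'l \<Rightarrow> (real \<Rightarrow> 'g) \<Rightarrow> bool" where
  "one_parameter_subgroup L A \<xi> \<gamma> \<longleftrightarrow> continuous_on UNIV \<gamma> \<and>
     (\<forall>s t. \<gamma> (s + t) = \<gamma> s \<otimes>\<^bsub>L\<^esub> \<gamma> t) \<and>
     ((\<lambda>t. chart_map (chart_at A \<one>\<^bsub>L\<^esub>) (\<gamma> t)) has_vector_derivative \<xi>) (at 0)"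

definition lie_exp :: "'g::topological_space monoid \<Rightarrow> ('g, 'l::real_normed_vector) chart set \<Rightarrow> 'l \<Rightarrow> 'g" where
  "lie_exp L A \<xi> = (THE \<gamma>. one_parameter_subgroup L A \<xi> \<gamma>) 1"

definition Ad :: "'g monoid \<Rightarrow> ('g, 'l::real_normed_vector) chart set \<Rightarrow> 'g \<Rightarrow> 'l \<Rightarrow> 'l" where
  "Ad L A g = tangent_map A A (\<lambda>h. g \<otimes>\<^bsub>L\<^esub> h \<otimes>\<^bsub>L\<^esub> inv\<^bsub>L\<^esub> g) \<one>\<^bsub>L\<^esub>"

definition lie_bracket ::
  "'g::topological_space monoid \<Rightarrow> ('g, 'l::real_normed_vector) chart set \<Rightarrow> 'l \<Rightarrow> 'l \<Rightarrow> 'l" where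
  "lie_bracket L A \<xi> \<eta> = vector_derivative (\<lambda>t. Ad L A (lie_exp L A (t *\<^sub>R \<xi>)) \<eta>) (at 0)"

text \<open>The Lie algebra of a closed subgroup \<open>H\<close>, as a subalgebra of that of \<open>L\<close>.\<close>

definition lie_algebra_of ::
  "'g::topological_space monoid \<Rightarrow> ('g, 'l::real_normed_vector) chart set \<Rightarrow> 'g set \<Rightarrow> 'l set" where
  "lie_algebra_of L A H = {\<xi>. \<forall>t. lie_exp L A (t *\<^sub>R \<xi>) \<in> H}"

definition abelian_subalgebra ::
  "'g::topological_space monoid \<Rightarrow> ('g, 'l::real_normed_vector) chart set \<Rightarrow> 'l set \<Rightarrow> bool" where
  "abelian_subalgebra L A \<aa> \<longleftrightarrow> subspace \<aa> \<and> (\<forall>\<xi>\<in>\<aa>. \<forall>\<eta>\<in>\<aa>. lie_bracket L A \<xi> \<eta> = 0)"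

definition direct_sum_decomposition :: "'l::real_vector set \<Rightarrow> 'l set \<Rightarrow> 'l set \<Rightarrow> bool" where
  "direct_sum_decomposition S V W \<longleftrightarrow> S = {v + w | v w. v \<in> V \<and> w \<in> W} \<and> V \<inter> W = {0}"

text \<open>
  \<open>L\<close> is the complexification of its compact connected subgroup \<open>U\<close>: its Lie algebra is
  \<open>\<uu> \<oplus> i\<uu>\<close>, and the polar map \<open>U \<times> i\<uu> \<rightarrow> L\<close> is a diffeomorphism.  Being a compact
  subgroup of \<open>L\<close>, \<open>U\<close> is automatically a Lie group.
\<close>

definition complexification_of ::
  "'g::{t2_space, second_countable_topology} monoid \<Rightarrow> ('l::real_normed_vector \<Rightarrow> 'l) \<Rightarrow>
   ('g, 'l) chart set \<Rightarrow> 'g set \<Rightarrow> bool" where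
  "complexification_of L i A U \<longleftrightarrow> complex_lie_group L i A \<and>
     subgroup U L \<and> compact U \<and> connected U \<and>
     direct_sum_decomposition UNIV (lie_algebra_of L A U) (i ` lie_algebra_of L A U) \<and>
     diffeomorphism_on (prod_atlas A vec_atlas) A (U \<times> i ` lie_algebra_of L A U) UNIV
       (\<lambda>(u, \<beta>). u \<otimes>\<^bsub>L\<^esub> lie_exp L A \<beta>)"

definition \<pp>_part ::
  "'g::topological_space monoid \<Rightarrow> ('l::real_normed_vector \<Rightarrow> 'l) \<Rightarrow> ('g, 'l) chart set \<Rightarrow>
   'g set \<Rightarrow> 'g set \<Rightarrow> 'l set" where
  "\<pp>_part L i A U G = lie_algebra_of L A G \<inter> i ` lie_algebra_of L A U"

definition compatible_subgroup ::
  "'g::topological_space monoid \<Rightarrow> ('l::real_normed_vector \<Rightarrow> 'l) \<Rightarrow> ('g, 'l) chart set \<Rightarrow>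
   'g set \<Rightarrow> 'g set \<Rightarrow> bool" where
  "compatible_subgroup L i A U G \<longleftrightarrow> subgroup G L \<and> closed G \<and>
     diffeomorphism_on (prod_atlas A vec_atlas) A ((G \<inter> U) \<times> \<pp>_part L i A U G) G
       (\<lambda>(k, \<beta>). k \<otimes>\<^bsub>L\<^esub> lie_exp L A \<beta>)"

definition real_form ::
  "'g::topological_space monoid \<Rightarrow> ('l::real_normed_vector \<Rightarrow> 'l) \<Rightarrow> ('g, 'l) chart set \<Rightarrow>
   'g set \<Rightarrow> 'g set \<Rightarrow> bool" where
  "real_form L i A U G \<longleftrightarrow>
     direct_sum_decomposition (lie_algebra_of L A U)
       (lie_algebra_of L A (G \<inter> U)) (i ` \<pp>_part L i A U G)"


section \<open>Kaehler manifolds and momentum maps\<close>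

text \<open>
  A 2-form is given by a bilinear form on each tangent space \<open>'e\<close>; \<open>pullback_chart\<close> is
  its expression in the coordinates of the chart \<open>c\<close>.
\<close>

definition pullback_chart ::
  "('z, 'e::real_normed_vector) chart set \<Rightarrow> ('z \<Rightarrow> 'e \<Rightarrow> 'e \<Rightarrow> real) \<Rightarrow> ('z, 'e) chart \<Rightarrow>
   'e \<Rightarrow> 'e \<Rightarrow> 'e \<Rightarrow> real" where
  "pullback_chart A \<omega> c x v w =
     \<omega> (chart_inv c x) (tangent_map vec_atlas A (chart_inv c) x v) (tangent_map vec_atlas A (chart_inv c) x w)"

definition smooth_two_form ::
  "('z, 'e::real_normed_vector) chart set \<Rightarrow> ('z \<Rightarrow> 'e \<Rightarrow> 'e \<Rightarrow> real) \<Rightarrow> bool" where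
  "smooth_two_form A \<omega> \<longleftrightarrow>
     (\<forall>z. (\<forall>v. linear (\<omega> z v)) \<and> (\<forall>v w. \<omega> z v w = - \<omega> z w v)) \<and>
     (\<forall>c\<in>A. \<forall>v w k. Ck_on k (chart_map c ` chart_dom c) (\<lambda>x. pullback_chart A \<omega> c x v w))"

text \<open>For constant vector fields, \<open>d\<omega>(u, v, w)\<close> is the cyclic sum of \<open>D\<^sub>u \<omega>(v, w)\<close>.\<close>

definition closed_two_form ::
  "('z, 'e::real_normed_vector) chart set \<Rightarrow> ('z \<Rightarrow> 'e \<Rightarrow> 'e \<Rightarrow> real) \<Rightarrow> bool" where
  "closed_two_form A \<omega> \<longleftrightarrow>
     (\<forall>c\<in>A. \<forall>x \<in> chart_map c ` chart_dom c. \<forall>u v w.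
        frechet_derivative (\<lambda>y. pullback_chart A \<omega> c y v w) (at x) u +
        frechet_derivative (\<lambda>y. pullback_chart A \<omega> c y w u) (at x) v +
        frechet_derivative (\<lambda>y. pullback_chart A \<omega> c y u v) (at x) w = 0)"

text \<open>The Kaehler metric is \<open>(v, w) \<mapsto> \<omega>(v, J w)\<close>; its symmetry is the \<open>J\<close>-invariance of \<open>\<omega>\<close>.\<close>

definition kaehler_manifold ::
  "('e::real_normed_vector \<Rightarrow> 'e) \<Rightarrow> ('z::{t2_space, second_countable_topology}, 'e) chart set \<Rightarrow>
   ('z \<Rightarrow> 'e \<Rightarrow> 'e \<Rightarrow> real) \<Rightarrow> bool" where
  "kaehler_manifold J A \<omega> \<longleftrightarrow> complex_manifold J A \<and> smooth_two_form A \<omega> \<and> closed_two_form A \<omega> \<and>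
     (\<forall>z v w. \<omega> z v (J w) = \<omega> z w (J v)) \<and> (\<forall>z v. v \<noteq> 0 \<longrightarrow> \<omega> z v (J v) > 0)"

definition holomorphic_action ::
  "'g::topological_space monoid \<Rightarrow> ('l::real_normed_vector \<Rightarrow> 'l) \<Rightarrow> ('g, 'l) chart set \<Rightarrow>
   ('e::real_normed_vector \<Rightarrow> 'e) \<Rightarrow> ('z::topological_space, 'e) chart set \<Rightarrow> ('g \<Rightarrow> 'z \<Rightarrow> 'z) \<Rightarrow> bool" where
  "holomorphic_action L i A J B \<phi> \<longleftrightarrow> group_action L UNIV \<phi> \<and>
     holomorphic_map (map_prod i J) (prod_atlas A B) J B (\<lambda>(g, z). \<phi> g z)"

definition invariant_two_form ::
  "('z, 'e::real_normed_vector) chart set \<Rightarrow> ('g \<Rightarrow> 'z \<Rightarrow> 'z) \<Rightarrow> 'g set \<Rightarrow>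
   ('z \<Rightarrow> 'e \<Rightarrow> 'e \<Rightarrow> real) \<Rightarrow> bool" where
  "invariant_two_form B \<phi> U \<omega> \<longleftrightarrow>
     (\<forall>u\<in>U. \<forall>z v w. \<omega> (\<phi> u z) (tangent_map B B (\<phi> u) z v) (tangent_map B B (\<phi> u) z w) = \<omega> z v w)"

definition fundamental_vector_field ::
  "'g::topological_space monoid \<Rightarrow> ('g, 'l::real_normed_vector) chart set \<Rightarrow>
   ('z, 'e::real_normed_vector) chart set \<Rightarrow> ('g \<Rightarrow> 'z \<Rightarrow> 'z) \<Rightarrow> 'l \<Rightarrow> 'z \<Rightarrow> 'e" where
  "fundamental_vector_field L A B \<phi> \<xi> z =
     vector_derivative (\<lambda>t. chart_map (chart_at B z) (\<phi> (lie_exp L A (t *\<^sub>R \<xi>)) z)) (at 0)"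

text \<open>
  An element of \<open>\<uu>\<^sup>*\<close> is a function \<open>'l \<Rightarrow> real\<close> that is linear on \<open>\<uu>\<close>, its values outside
  \<open>\<uu>\<close> being irrelevant; thus \<open>\<mu> z \<xi>\<close> is the pairing of \<open>\<mu>(z)\<close> with \<open>\<xi>\<close>.
\<close>

definition momentum_map ::
  "'g::topological_space monoid \<Rightarrow> ('g, 'l::real_normed_vector) chart set \<Rightarrow> 'g set \<Rightarrow>
   ('z::topological_space, 'e::real_normed_vector) chart set \<Rightarrow> ('g \<Rightarrow> 'z \<Rightarrow> 'z) \<Rightarrow>
   ('z \<Rightarrow> 'e \<Rightarrow> 'e \<Rightarrow> real) \<Rightarrow> ('z \<Rightarrow> 'l \<Rightarrow> real) \<Rightarrow> bool" where
  "momentum_map L A U B \<phi> \<omega> \<mu> \<longleftrightarrow> (let \<uu> = lie_algebra_of L A U in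
     (\<forall>z. \<forall>\<xi>\<in>\<uu>. \<forall>\<eta>\<in>\<uu>. \<forall>a b. \<mu> z (a *\<^sub>R \<xi> + b *\<^sub>R \<eta>) = a * \<mu> z \<xi> + b * \<mu> z \<eta>) \<and>
     (\<forall>\<xi>\<in>\<uu>. smooth_map_on B vec_atlas UNIV (\<lambda>z. \<mu> z \<xi>)) \<and>
     (\<forall>u\<in>U. \<forall>z. \<forall>\<xi>\<in>\<uu>. \<mu> (\<phi> u z) \<xi> = \<mu> z (Ad L A (inv\<^bsub>L\<^esub> u) \<xi>)) \<and>
     (\<forall>\<xi>\<in>\<uu>. \<forall>z v. tangent_map B vec_atlas (\<lambda>z. \<mu> z \<xi>) z v =
        \<omega> z (fundamental_vector_field L A B \<phi> \<xi> z) v))"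


section \<open>Gradient maps\<close>

definition inner_product_on :: "'l::real_vector set \<Rightarrow> ('l \<Rightarrow> 'l \<Rightarrow> real) \<Rightarrow> bool" where
  "inner_product_on V ip \<longleftrightarrow>
     (\<forall>x\<in>V. \<forall>y\<in>V. \<forall>z\<in>V. \<forall>a b. ip (a *\<^sub>R x + b *\<^sub>R y) z = a * ip x z + b * ip y z) \<and>
     (\<forall>x\<in>V. \<forall>y\<in>V. ip x y = ip y x) \<and> (\<forall>x\<in>V. x \<noteq> 0 \<longrightarrow> ip x x > 0)"

definition Ad_invariant_inner_product ::
  "'g::topological_space monoid \<Rightarrow> ('g, 'l::real_normed_vector) chart set \<Rightarrow> 'g set \<Rightarrow>
   ('l \<Rightarrow> 'l \<Rightarrow> real) \<Rightarrow> bool" where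
  "Ad_invariant_inner_product L A U ip \<longleftrightarrow>
     inner_product_on (lie_algebra_of L A U) ip \<and>
     (\<forall>u\<in>U. \<forall>\<xi>\<in>lie_algebra_of L A U. \<forall>\<eta>\<in>lie_algebra_of L A U.
        ip (Ad L A u \<xi>) (Ad L A u \<eta>) = ip \<xi> \<eta>)"

text \<open>
  The inner product on \<open>i\<uu>\<close> for which multiplication by \<open>i\<close> is an isometry \<open>\<uu> \<rightarrow> i\<uu>\<close>;
  the inverse of this isometry is \<open>\<beta> \<mapsto> - i \<beta>\<close>.
\<close>

definition transported_ip :: "('l::real_vector \<Rightarrow> 'l) \<Rightarrow> ('l \<Rightarrow> 'l \<Rightarrow> real) \<Rightarrow> 'l \<Rightarrow> 'l \<Rightarrow> real" where
  "transported_ip i ip \<beta> \<beta>' = ip (- i \<beta>) (- i \<beta>')"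

definition gradient_map ::
  "('l::real_vector \<Rightarrow> 'l) \<Rightarrow> ('l \<Rightarrow> 'l \<Rightarrow> real) \<Rightarrow> 'l set \<Rightarrow> ('z \<Rightarrow> 'l \<Rightarrow> real) \<Rightarrow> 'z \<Rightarrow> 'l" where
  "gradient_map i ip \<pp> \<mu> z =
     (THE m. m \<in> \<pp> \<and> (\<forall>\<beta>\<in>\<pp>. transported_ip i ip m \<beta> = \<mu> z (- i \<beta>)))"

definition orthogonal_projection ::
  "('l::real_vector \<Rightarrow> 'l \<Rightarrow> real) \<Rightarrow> 'l set \<Rightarrow> 'l \<Rightarrow> 'l" where
  "orthogonal_projection ip W v = (THE w. w \<in> W \<and> (\<forall>b\<in>W. ip (v - w) b = 0))"

definition abelian_gradient_map ::
  "('l::real_vector \<Rightarrow> 'l) \<Rightarrow> ('l \<Rightarrow> 'l \<Rightarrow> real) \<Rightarrow> 'l set \<Rightarrow> 'l set \<Rightarrow> ('z \<Rightarrow> 'l \<Rightarrow> real) \<Rightarrow> 'z \<Rightarrow> 'l" where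
  "abelian_gradient_map i ip \<pp> \<aa> \<mu> =
     orthogonal_projection (transported_ip i ip) \<aa> \<circ> gradient_map i ip \<pp> \<mu>"

definition closed_orbits_in ::
  "'g monoid \<Rightarrow> ('g \<Rightarrow> 'z::topological_space \<Rightarrow> 'z) \<Rightarrow> 'g set \<Rightarrow> 'z set \<Rightarrow> 'z set set" where
  "closed_orbits_in L \<phi> G X =
     {O' \<in> orbits (L\<lparr>carrier := G\<rparr>) X \<phi>. closedin (top_of_set X) O'}"

end

theory Submission
  imports Defs "HOL-Complex_Analysis.Complex_Analysis" "Jordan_Normal_Form.Determinant"
begin

text \<open>
  Write \<open>\<mu>\<^sup>v\<close> for the \<open>v\<close>-component of the momentum map. Along the flow of \<open>i v\<close>, the function \<open>\<mu>\<^sup>v\<close>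
  increases to a limit \<open>lam v y\<close>. At a maximum point \<open>z\<close> of \<open>\<mu>\<^sup>v\<close> on the compact orbit, every eigenvector of
  \<open>ad (i v)\<close> with positive eigenvalue stabilises \<open>z\<close>. Hence a point \<open>g x\<close> flows to the maximum as soon as a
  determinant \<open>D g\<close>, holomorphic in \<open>g\<close> and not identically zero, does not vanish; since the Lie algebra is
  \<open>\<gg> + i \<gg>\<close>, such a function does not vanish identically on any translate of \<open>G\<close>. So every
  \<open>G\<close>-orbit contains a point \<open>y\<close> that flows to the maximum simultaneously in the directions of a given finite
  net of the unit sphere of \<open>\<aa>\<close>.

  The pull-back of the \<open>\<aa>\<close>-gradient map to \<open>A \<cdot> y\<close> is the gradient of a convex potential \<open>psi\<close> on
  \<open>\<aa>\<close>. For a value \<open>\<xi>\<close> attained on \<open>X\<close>, the choice of \<open>y\<close> makes \<open>psi - \<xi> + \<epsilon> norm\<close> coercive,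
  and at its minimum the gradient map is within \<open>\<epsilon>\<close> of \<open>\<xi>\<close>. Compactness of the closed orbit gives \<open>\<xi>\<close> itself.
\<close>

section \<open>Finite-dimensional normed spaces\<close>

text \<open>The limit along the gradient flow is governed by a dichotomy. Moving a point in the
  direction w moves the flowed point in the direction \<open>AD (EXP (t *\<^sub>R i v)) w\<close>.
  Eigenvectors with nonpositive eigenvalue are not expanded, and the derivative of the momentum
  component dies out along the flow, so these directions cannot change the limit. Expanded
  eigenvectors are replaced by their translates from the maximum, which do not move the point at
  all. The determinant expresses that both kinds together span. One such function controls one
  direction and a product controls finitely many; this forces a net and an error \<epsilon> in place
  of all directions at once. Holomorphy enters only through functions of one complex variable: a
  countable zero set neither contains the real line nor disconnects the plane. The model spaces are
  merely normed with a finite spanning set, and the exponential is given by a defining property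
  only; hence compactness, the exponential and the adjoint representation are built from squaring in
  a chart and Cauchy estimates.\<close>

definition bounded_seq_compact :: "'a::real_normed_vector set \<Rightarrow> bool" where
  "bounded_seq_compact W \<longleftrightarrow> (\<forall>x::nat \<Rightarrow> 'a. range x \<subseteq> W \<longrightarrow> bounded (range x) \<longrightarrow>
     (\<exists>l\<in>W. \<exists>r. strict_mono r \<and> (x \<circ> r) \<longlonglongrightarrow> l))"

lemma bounded_seq_compactD:
  assumes "bounded_seq_compact W" "\<And>n. x n \<in> W" "\<And>n. norm (x n) \<le> K"
  obtains l r where "l \<in> W" "strict_mono (r::nat \<Rightarrow> nat)" "(x \<circ> r) \<longlonglongrightarrow> l"
proof -
  have "bounded (range x)" using assms(3) by (auto simp: bounded_iff)
  then show ?thesis using assms(1,2) that unfolding bounded_seq_compact_def by (metis image_subsetI)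
qed

lemma bounded_seq_compact_closed:
  assumes "bounded_seq_compact W" shows "closed W"
  unfolding closed_sequential_limits
proof (intro allI impI, elim conjE)
  fix x :: "nat \<Rightarrow> 'a" and l assume x: "\<forall>n. x n \<in> W" "x \<longlonglongrightarrow> l"
  then have "bounded (range x)" using convergent_imp_bounded convergent_def by blast
  then obtain m r where "m \<in> W" "strict_mono r" "(x \<circ> r) \<longlonglongrightarrow> m"
    using assms x(1) unfolding bounded_seq_compact_def by (metis image_subsetI)
  then show "l \<in> W" using LIMSEQ_subseq_LIMSEQ[OF x(2)] LIMSEQ_unique by metis
qed

text \<open>Since W is closed, v has positive distance d from it, and rescaling
  \<open>x - t *\<^sub>R v\<close> by \<open>- 1 / t\<close> gives a point of W at distance
  \<open>norm x / \<bar>t\<bar>\<close> from v.\<close>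

lemma closed_subspace_coordinate_bound:
  assumes "closed W" "subspace W" "v \<notin> W"
  obtains d where "d > 0" "\<And>x t. x - t *\<^sub>R v \<in> W \<Longrightarrow> \<bar>t\<bar> * d \<le> norm x"
proof -
  obtain d where d: "d > 0" "ball v d \<subseteq> - W"
    using assms(1,3) open_contains_ball by (metis Compl_iff open_Compl)
  have "\<bar>t\<bar> * d \<le> norm x" if w: "x - t *\<^sub>R v \<in> W" for x t
  proof (cases "t = 0")
    case False
    define w where "w = (- 1 / t) *\<^sub>R (x - t *\<^sub>R v)"
    have "w \<in> W" unfolding w_def using assms(2) w subspace_scale by blast
    then have "d \<le> norm (v - w)" using d(2) by (force simp: dist_norm)
    also have "v - w = (1 / t) *\<^sub>R x" using False by (simp add: w_def algebra_simps)
    finally have "d \<le> norm x / \<bar>t\<bar>" by simp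
    then show ?thesis using False by (simp add: field_simps)
  qed simp
  with d(1) show ?thesis using that by blast
qed

lemma span_insert_decompose:
  assumes "x \<in> span (insert v S)" obtains t where "x - t *\<^sub>R v \<in> span S"
  using assms by (auto simp: span_insert)

text \<open>Bolzano-Weierstrass, adding one spanning vector at a time. The induction hypothesis
  makes the smaller span closed, which bounds the new coordinate; one subsequence makes that
  coordinate converge and a further one the remainder.\<close>

lemma bounded_seq_compact_span:
  assumes "finite (S::'a::real_normed_vector set)"
  shows "bounded_seq_compact (span S)"
  using assms
proof (induction S)
  case empty
  show ?case unfolding bounded_seq_compact_def
    by (auto intro!: exI[of _ id] strict_mono_id simp: tendsto_eventually o_def image_subset_iff strict_mono_def)
next
  case (insert v S)
  show ?case
  proof (cases "v \<in> span S")
    case True then show ?thesis using insert by (simp add: span_redundant)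
  next
    case False
    obtain d where d: "d > 0" "\<And>x t. x - t *\<^sub>R v \<in> span S \<Longrightarrow> \<bar>t\<bar> * d \<le> norm x"
      using closed_subspace_coordinate_bound[OF bounded_seq_compact_closed[OF insert.IH] _ False] by auto
    show ?thesis unfolding bounded_seq_compact_def
    proof (intro allI impI)
      fix x :: "nat \<Rightarrow> 'a" assume x: "range x \<subseteq> span (insert v S)" and b: "bounded (range x)"
      then obtain K where K: "\<And>n. norm (x n) \<le> K" by (auto simp: bounded_iff)
      have "\<forall>n. \<exists>t. x n - t *\<^sub>R v \<in> span S" using x span_insert_decompose by blast
      then obtain t where t: "\<And>n. x n - t n *\<^sub>R v \<in> span S" by metis
      have tb: "\<bar>t n\<bar> \<le> K / d" for n
        using d(2)[OF t[of n]] K[of n] d(1) by (simp add: field_simps)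
      then have "bounded (range t)" by (auto simp: bounded_iff)
      then obtain t0 r where r: "strict_mono r" "(t \<circ> r) \<longlonglongrightarrow> t0"
        using bounded_imp_convergent_subsequence by blast
      define w where "w = (\<lambda>n. x (r n) - t (r n) *\<^sub>R v)"
      have "norm (w n) \<le> K + K / d * norm v" for n
        unfolding w_def
        using K[of "r n"] mult_right_mono[OF tb[of "r n"], of "norm v"]
        by (intro order_trans[OF norm_triangle_ineq4]) auto
      then obtain w0 q where q: "w0 \<in> span S" "strict_mono q" "(w \<circ> q) \<longlonglongrightarrow> w0"
        using bounded_seq_compactD[OF insert.IH, of w] t w_def by metis
      have "(\<lambda>n. (w \<circ> q) n + (t \<circ> r \<circ> q) n *\<^sub>R v) \<longlonglongrightarrow> w0 + t0 *\<^sub>R v"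
        by (intro tendsto_intros q(3) LIMSEQ_subseq_LIMSEQ[OF r(2) q(2)])
      moreover have "(\<lambda>n. (w \<circ> q) n + (t \<circ> r \<circ> q) n *\<^sub>R v) = x \<circ> (r \<circ> q)"
        by (auto simp: w_def)
      moreover have "w0 + t0 *\<^sub>R v \<in> span (insert v S)"
        unfolding span_insert mem_Collect_eq using q(1) by (intro exI[of _ t0]) simp
      ultimately show "\<exists>l\<in>span (insert v S). \<exists>r. strict_mono r \<and> (x \<circ> r) \<longlonglongrightarrow> l"
        using strict_mono_o[OF r(1) q(2)] by metis
    qed
  qed
qed

lemma linear_bounded_on_span:
  assumes "finite (S::'a::real_normed_vector set)" "linear (f::'a \<Rightarrow> 'b::real_normed_vector)"
  shows "\<exists>K\<ge>0. \<forall>x\<in>span S. norm (f x) \<le> K * norm x"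
  using assms(1)
proof (induction S)
  case empty then show ?case using assms(2) by (auto simp: linear_0)
next
  case (insert v S)
  show ?case
  proof (cases "v \<in> span S")
    case True then show ?thesis using insert by (simp add: span_redundant)
  next
    case False
    obtain d where d: "d > 0" "\<And>x t. x - t *\<^sub>R v \<in> span S \<Longrightarrow> \<bar>t\<bar> * d \<le> norm x"
      using closed_subspace_coordinate_bound[OF bounded_seq_compact_closed[OF bounded_seq_compact_span[OF insert.hyps(1)]] _ False] by auto
    obtain K where K: "K \<ge> 0" "\<forall>x\<in>span S. norm (f x) \<le> K * norm x" using insert.IH by blast
    define K' where "K' = K * (1 + norm v / d) + norm (f v) / d"
    have "norm (f x) \<le> K' * norm x" if x: "x \<in> span (insert v S)" for x
    proof -
      obtain t where t: "x - t *\<^sub>R v \<in> span S" using span_insert_decompose[OF x] .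
      have tb: "\<bar>t\<bar> \<le> norm x / d" using d t by (simp add: field_simps)
      have "f x = f (x - t *\<^sub>R v) + t *\<^sub>R f v"
        using assms(2) by (simp add: linear_diff linear_scale)
      then have "norm (f x) \<le> norm (f (x - t *\<^sub>R v)) + \<bar>t\<bar> * norm (f v)"
        by (metis norm_scaleR norm_triangle_ineq)
      also have "\<dots> \<le> K * norm (x - t *\<^sub>R v) + \<bar>t\<bar> * norm (f v)" using K(2) t by auto
      also have "\<dots> \<le> K * (norm x + \<bar>t\<bar> * norm v) + \<bar>t\<bar> * norm (f v)"
        using K(1) norm_triangle_ineq4[of x "t *\<^sub>R v"] by (auto intro!: mult_left_mono)
      also have "\<dots> \<le> K * (norm x + norm x / d * norm v) + norm x / d * norm (f v)"
        using K(1) tb by (intro add_mono mult_left_mono mult_right_mono) auto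
      also have "\<dots> = K' * norm x" by (simp add: K'_def algebra_simps)
      finally show ?thesis .
    qed
    moreover have "K' \<ge> 0" unfolding K'_def using K(1) d(1) by auto
    ultimately show ?thesis by blast
  qed
qed

section \<open>Complex structures, complex scalars and complex coordinates\<close>

definition clinear_map :: "('a::real_normed_vector \<Rightarrow> 'a) \<Rightarrow> ('b::real_normed_vector \<Rightarrow> 'b) \<Rightarrow> ('a \<Rightarrow> 'b) \<Rightarrow> bool" where
  "clinear_map j k f \<longleftrightarrow> linear f \<and> (\<forall>v. f (j v) = k (f v))"

text \<open>Complex scalars on a type that is only a real vector space, with j acting as the
  imaginary unit.\<close>

definition cscale :: "('a::real_normed_vector \<Rightarrow> 'a) \<Rightarrow> complex \<Rightarrow> 'a \<Rightarrow> 'a" where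
  "cscale j s v = Re s *\<^sub>R v + Im s *\<^sub>R j v"

locale fd_space =
  fixes D :: "'a::real_normed_vector itself"
  assumes fin_span: "\<exists>S::'a set. finite S \<and> span S = UNIV"
begin

lemma linear_bounded:
  assumes "linear (f::'a \<Rightarrow> 'b::real_normed_vector)" shows "bounded_linear f"
proof -
  obtain S where S: "finite S" "span S = (UNIV::'a set)" using fin_span by blast
  then obtain K where "\<forall>x. norm (f x) \<le> K * norm x" using linear_bounded_on_span[OF S(1) assms] by auto
  then show ?thesis using assms
    by (intro bounded_linear_intro[of f K]) (auto simp: linear_add linear_scale mult.commute)
qed

lemma seq_compact_UNIV: "bounded_seq_compact (UNIV::'a set)"
  using fin_span bounded_seq_compact_span by metis

lemma bounded_closed_compact:
  assumes "bounded (C::'a set)" "closed C" shows "compact C"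
  unfolding compact_eq_seq_compact_metric seq_compact_def
proof (intro allI impI)
  fix x :: "nat \<Rightarrow> 'a" assume x: "\<forall>n. x n \<in> C"
  obtain K where K: "\<And>v. v \<in> C \<Longrightarrow> norm v \<le> K" using assms(1) by (auto simp: bounded_iff)
  obtain l r where r: "strict_mono (r::nat \<Rightarrow> nat)" "(x \<circ> r) \<longlonglongrightarrow> l"
    using bounded_seq_compactD[OF seq_compact_UNIV, of x K] K x by (metis UNIV_I)
  have "l \<in> C" using assms(2) r(2) x unfolding closed_sequential_limits by (metis comp_apply)
  with r show "\<exists>l\<in>C. \<exists>r. strict_mono r \<and> (x \<circ> r) \<longlonglongrightarrow> l" by blast
qed

lemma Cauchy_converges:
  assumes "Cauchy (x::nat \<Rightarrow> 'a)" obtains l where "x \<longlonglongrightarrow> l"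
proof -
  obtain K where K: "\<And>n. norm (x n) \<le> K" using cauchy_imp_bounded[OF assms] by (auto simp: bounded_iff)
  obtain l r where "strict_mono (r::nat \<Rightarrow> nat)" "(x \<circ> r) \<longlonglongrightarrow> l"
    using bounded_seq_compactD[OF seq_compact_UNIV, of x K] K by (metis UNIV_I)
  then have "x \<longlonglongrightarrow> l" using assms by (meson Cauchy_converges_subseq)
  then show ?thesis using that by blast
qed

lemma closed_subspace:
  assumes "subspace (W::'a set)" shows "closed W"
proof -
  obtain S where S: "finite S" "span S = (UNIV::'a set)" using fin_span by blast
  obtain B where B: "B \<subseteq> W" "independent B" "W = span B"
    using basis_exists[of W] assms by (metis span_subspace)
  have "finite B"
    using B(2) S by (metis independent_span_bound subset_UNIV)
  then show ?thesis using B(3) bounded_seq_compact_closed bounded_seq_compact_span by metis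
qed

end

locale fd_complex = fd_space "TYPE('a)" for j :: "'a::real_normed_vector \<Rightarrow> 'a" +
  assumes j: "complex_structure j"
begin

lemma linear_j: "linear j" and jj [simp]: "j (j v) = - v"
  using j by (auto simp: complex_structure_def)

lemma j_simps: "j (a + b) = j a + j b" "j (r *\<^sub>R a) = r *\<^sub>R j a" "j (- a) = - j a" "j (a - b) = j a - j b" "j 0 = 0"
  using linear_j by (auto simp: linear_add linear_scale linear_neg linear_diff linear_0)

lemma bounded_linear_j: "bounded_linear j" by (rule linear_bounded[OF linear_j])

lemma cscale_simps:
  "cscale j s (a + b) = cscale j s a + cscale j s b"
  "cscale j (s + t) a = cscale j s a + cscale j t a"
  "cscale j s (cscale j t a) = cscale j (s * t) a"
  "cscale j s (r *\<^sub>R a) = r *\<^sub>R cscale j s a"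
  "cscale j (of_real r) a = r *\<^sub>R a"
  "cscale j s (j a) = j (cscale j s a)"
  "cscale j \<i> a = j a" "cscale j 0 a = 0" "cscale j 1 a = a" "cscale j s 0 = 0"
  "cscale j s (- a) = - cscale j s a" "cscale j (- s) a = - cscale j s a"
  "cscale j s (a - b) = cscale j s a - cscale j s b"
  by (auto simp: cscale_def j_simps algebra_simps)

lemma clinear_cscale:
  assumes "clinear_map j k f" shows "f (cscale j s v) = cscale k s (f v)"
  using assms by (auto simp: clinear_map_def cscale_def linear_add linear_scale)

lemma cscale_bound: "\<exists>K\<ge>1. \<forall>s v. norm (cscale j s v) \<le> K * cmod s * norm v"
proof -
  obtain K where K: "\<And>v. norm (j v) \<le> norm v * K" "K > 0"
    using bounded_linear.pos_bounded[OF bounded_linear_j] by blast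
  have "norm (cscale j s v) \<le> (1 + K) * cmod s * norm v" for s v
  proof -
    have "norm (cscale j s v) \<le> \<bar>Re s\<bar> * norm v + \<bar>Im s\<bar> * norm (j v)"
      unfolding cscale_def by (metis norm_scaleR norm_triangle_ineq)
    also have "\<dots> \<le> cmod s * norm v + cmod s * (norm v * K)"
      by (intro add_mono mult_mono K abs_Re_le_cmod abs_Im_le_cmod) auto
    finally show ?thesis by (simp add: algebra_simps)
  qed
  then show ?thesis using K(2) by (intro exI[of _ "1 + K"]) auto
qed

text \<open>A real basis serves as a generating family over the complex numbers, so the coefficients
  are not unique. \<open>l b\<close> is the complex-linear part of the b-th real coordinate: v and
  \<open>- j (j v)\<close> each contribute half of v.\<close>

lemma complex_coordinates:
  obtains I :: "'a set" and l :: "'a \<Rightarrow> 'a \<Rightarrow> complex" where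
    "finite I" "\<And>b. clinear_map j ((*) \<i>) (l b)" "\<And>v. v = (\<Sum>b\<in>I. cscale j (l b v) b)"
proof -
  obtain S where S: "finite S" "span S = (UNIV::'a set)" using fin_span by blast
  obtain B :: "'a set" where B: "independent B" "span B = UNIV"
    using basis_exists[of UNIV] by (metis UNIV_I subset_UNIV subset_antisym)
  have fB: "finite B" using B(1) S by (metis independent_span_bound subset_UNIV)
  define r where "r = representation B"
  have lin: "r (u + v) b = r u b + r v b" "r (c *\<^sub>R u) b = c * r u b" for u v b c
    using B by (auto simp: r_def representation_add representation_scale)
  have sum: "v = (\<Sum>b\<in>B. r v b *\<^sub>R b)" for v
    using sum_representation_eq[OF B(1), of v B] B fB by (auto simp: r_def)
  define l where "l b v = complex_of_real (r v b / 2) - \<i> * of_real (r (j v) b / 2)" for b v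
  have neg: "r (- v) b = - r v b" for v b using lin(2)[of "-1" v b] by simp
  have 1: "clinear_map j ((*) \<i>) (l b)" for b
    unfolding clinear_map_def
    by (auto simp: l_def lin j_simps neg add_divide_distrib complex_eq_iff intro!: linearI)
  have 2: "v = (\<Sum>b\<in>B. cscale j (l b v) b)" for v
  proof -
    have "(\<Sum>b\<in>B. cscale j (l b v) b) = (1/2) *\<^sub>R (\<Sum>b\<in>B. r v b *\<^sub>R b) - (1/2) *\<^sub>R j (\<Sum>b\<in>B. r (j v) b *\<^sub>R b)"
      unfolding linear_sum[OF linear_j] scaleR_sum_right sum_subtractf[symmetric]
      by (rule sum.cong) (auto simp: cscale_def l_def j_simps)
    also have "\<dots> = v" by (simp add: sum[symmetric] scaleR_left_distrib[symmetric] scaleR_half_double)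
    finally show ?thesis by simp
  qed
  show ?thesis using that[OF fB 1 2] .
qed

end

section \<open>Holomorphic maps between finite-dimensional spaces\<close>

text \<open>Cauchy's estimate on discs of radius \<open>R/4\<close> around the points of the closed
  half disc bounds the second derivative by \<open>2 * B / (R/4)\<^sup>2\<close>, whence the factor
  32.\<close>

lemma Taylor2_bound:
  assumes hol: "f holomorphic_on ball 0 R" and B: "\<And>s. s \<in> ball 0 R \<Longrightarrow> cmod (f s) < B"
    and s: "cmod s \<le> R / 2" and R: "R > 0"
  shows "cmod (f s - f 0 - deriv f 0 * s) \<le> 32 * B / R\<^sup>2 * (cmod s)\<^sup>2"
proof -
  have bd: "cmod ((deriv ^^ 2) f z) \<le> 32 * B / R\<^sup>2" if z: "z \<in> cball 0 (R/2)" for z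
  proof -
    have sub: "cball z (R/4) \<subseteq> ball 0 R"
    proof
      fix w assume "w \<in> cball z (R/4)"
      then have "cmod w \<le> cmod z + R/4"
        by (metis dist_norm mem_cball norm_minus_commute norm_triangle_sub add_left_mono order_trans)
      then show "w \<in> ball 0 R" using z R by simp
    qed
    have "cmod ((deriv ^^ 2) f z) \<le> fact 2 * B / (R/4)^2"
    proof (rule Cauchy_higher_deriv_bound)
      show "f holomorphic_on ball z (R/4)" using holomorphic_on_subset[OF hol] sub ball_subset_cball by blast
      show "continuous_on (cball z (R/4)) f"
        using continuous_on_subset[OF holomorphic_on_imp_continuous_on[OF hol] sub] .
      show "f w \<in> ball 0 B" if "w \<in> ball z (R/4)" for w
        using B[of w] sub that ball_subset_cball by fastforce
    qed (use R in auto)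
    then show ?thesis by (simp add: power_divide)
  qed
  have d1: "(deriv ^^ n) f holomorphic_on ball 0 R" for n
    by (rule holomorphic_higher_deriv[OF hol]) auto
  have "cmod ((deriv ^^ 0) f s - (\<Sum>i\<le>1. (deriv ^^ i) f 0 * (s - 0) ^ i / fact i))
      \<le> 32 * B / R\<^sup>2 * cmod (s - 0) ^ Suc 1 / fact 1"
  proof (rule complex_Taylor[where S = "cball 0 (R/2)"])
    fix i and x :: complex assume x: "x \<in> cball 0 (R/2)"
    then have "x \<in> ball 0 R" using R by simp
    then have "((deriv ^^ i) f has_field_derivative (deriv ^^ Suc i) f x) (at x)"
      using holomorphic_derivI[OF d1] by simp
    then show "((deriv ^^ i) f has_field_derivative (deriv ^^ Suc i) f x) (at x within cball 0 (R/2))"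
      by (rule has_field_derivative_at_within)
  qed (use bd s R in \<open>auto simp: numeral_2_eq_2\<close>)
  then show ?thesis by (simp add: algebra_simps power2_eq_square)
qed

text \<open>Cauchy's bound for the first derivative contributes 2 and the quadratic remainder 16;
  the sum is rounded up to 20.\<close>

lemma Lipschitz_at_0_bound:
  assumes hol: "f holomorphic_on ball 0 R" and B: "\<And>s. s \<in> ball 0 R \<Longrightarrow> cmod (f s) < B"
    and s: "cmod s \<le> R / 2" and R: "R > 0"
  shows "cmod (f s - f 0) \<le> 20 * B / R * cmod s"
proof -
  have B0: "B > 0" using B[of 0] R by (simp add: le_less_trans[OF norm_ge_zero])
  have "cmod ((deriv ^^ 1) f 0) \<le> fact 1 * B / (R/2)^1"
  proof (rule Cauchy_higher_deriv_bound)
    have sub: "cball 0 (R/2) \<subseteq> ball (0::complex) R" using R by auto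
    show "f holomorphic_on ball 0 (R/2)" using holomorphic_on_subset[OF hol] sub ball_subset_cball by blast
    show "continuous_on (cball 0 (R/2)) f"
      using continuous_on_subset[OF holomorphic_on_imp_continuous_on[OF hol] sub] .
    show "f w \<in> ball 0 B" if "w \<in> ball 0 (R/2)" for w
      using B[of w] R that by auto
  qed (use R in auto)
  then have d: "cmod (deriv f 0) \<le> 2 * B / R" by (simp add: mult.commute)
  have "cmod (f s - f 0) \<le> cmod (f s - f 0 - deriv f 0 * s) + cmod (deriv f 0 * s)"
    by (metis diff_add_cancel norm_triangle_ineq)
  also have "\<dots> \<le> 32 * B / R\<^sup>2 * (cmod s)\<^sup>2 + 2 * B / R * cmod s"
    unfolding norm_mult by (intro add_mono Taylor2_bound[OF assms] mult_right_mono d norm_ge_zero)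
  also have "32 * B / R\<^sup>2 * (cmod s)\<^sup>2 \<le> 32 * B / R\<^sup>2 * (R / 2 * cmod s)"
    using s B0 unfolding power2_eq_square by (intro mult_left_mono mult_right_mono) auto
  also have "\<dots> = 16 * B / R * cmod s" using R by (simp add: power2_eq_square)
  also have "16 * B / R * cmod s + 2 * B / R * cmod s = 18 * (B / R * cmod s)" by (simp add: algebra_simps)
  also have "\<dots> \<le> 20 * (B / R * cmod s)" using B0 R by (intro mult_right_mono) auto
  finally show ?thesis by simp
qed

section \<open>Calculus of complex differentiable maps\<close>

lemma complex_differentiable_at_compose:
  assumes "complex_differentiable_at j k f x" "complex_differentiable_at k m g (f x)"
  shows "complex_differentiable_at j m (\<lambda>x. g (f x)) x"
proof -
  obtain D where D: "(f has_derivative D) (at x)" "\<forall>v. D (j v) = k (D v)"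
    using assms(1) by (auto simp: complex_differentiable_at_def)
  obtain E where E: "(g has_derivative E) (at (f x))" "\<forall>v. E (k v) = m (E v)"
    using assms(2) by (auto simp: complex_differentiable_at_def)
  have "((\<lambda>x. g (f x)) has_derivative (\<lambda>v. E (D v))) (at x)"
    by (rule has_derivative_compose[OF D(1) E(1)])
  then show ?thesis using D(2) E(2) by (auto simp: complex_differentiable_at_def)
qed

lemma complex_differentiable_at_clinear:
  assumes "clinear_map j k f" "bounded_linear f"
  shows "complex_differentiable_at j k f x"
  using assms bounded_linear_imp_has_derivative[OF assms(2)]
  by (auto simp: complex_differentiable_at_def clinear_map_def)

lemma complex_differentiable_at_const:
  assumes "linear k" shows "complex_differentiable_at j k (\<lambda>_. c) x"
  using assms by (auto simp: complex_differentiable_at_def linear_0 intro!: exI[of _ "\<lambda>_. 0"])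

lemma complex_differentiable_at_add:
  assumes "complex_differentiable_at j k f x" "complex_differentiable_at j k g x" "linear k"
  shows "complex_differentiable_at j k (\<lambda>x. f x + g x) x"
proof -
  obtain D where D: "(f has_derivative D) (at x)" "\<forall>v. D (j v) = k (D v)"
    using assms(1) by (auto simp: complex_differentiable_at_def)
  obtain E where E: "(g has_derivative E) (at x)" "\<forall>v. E (j v) = k (E v)"
    using assms(2) by (auto simp: complex_differentiable_at_def)
  show ?thesis unfolding complex_differentiable_at_def
    using has_derivative_add[OF D(1) E(1)] D(2) E(2) assms(3) by (auto simp: linear_add)
qed

lemma complex_differentiable_at_complex:
  "complex_differentiable_at ((*) \<i>) ((*) \<i>) f s \<longleftrightarrow> f field_differentiable (at s)"
proof
  assume "complex_differentiable_at ((*) \<i>) ((*) \<i>) f s"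
  then obtain D where D: "(f has_derivative D) (at s)" "\<forall>v. D (\<i> * v) = \<i> * D v"
    by (auto simp: complex_differentiable_at_def)
  have lin: "linear D" using D(1) has_derivative_linear by blast
  have "D h = D 1 * h" for h
  proof -
    have "D h = D (Re h *\<^sub>R 1 + Im h *\<^sub>R (\<i> * 1))" by (rule arg_cong[of _ _ D]) (simp add: complex_eq_iff)
    also have "\<dots> = Re h *\<^sub>R D 1 + Im h *\<^sub>R (\<i> * D 1)"
      unfolding linear_add[OF lin] linear_scale[OF lin] using D(2)[rule_format, of 1] by simp
    also have "\<dots> = D 1 * h" by (simp add: complex_eq_iff)
    finally show ?thesis .
  qed
  then have "D = (*) (D 1)" by (rule ext)
  then have "(f has_field_derivative D 1) (at s)" using D(1) by (simp add: has_field_derivative_def)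
  then show "f field_differentiable (at s)" by (auto simp: field_differentiable_def)
next
  assume "f field_differentiable (at s)"
  then obtain d where "(f has_derivative (*) d) (at s)" by (auto simp: field_differentiable_def has_field_derivative_def)
  then show "complex_differentiable_at ((*) \<i>) ((*) \<i>) f s"
    by (auto simp: complex_differentiable_at_def)
qed

lemma complex_differentiable_at_isCont:
  "complex_differentiable_at j k f x \<Longrightarrow> isCont f x"
  using has_derivative_continuous by (auto simp: complex_differentiable_at_def)

section \<open>Lipschitz estimates along complex lines\<close>

context fd_complex
begin

lemma complex_differentiable_at_line:
  "complex_differentiable_at ((*) \<i>) j (\<lambda>s. y + cscale j s u) s"
proof -
  have "bounded_linear (\<lambda>s. cscale j s u)"
    unfolding cscale_def
    by (intro bounded_linear_add bounded_linear_scaleR_const bounded_linear_Re bounded_linear_Im)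
  then have "((\<lambda>s. y + cscale j s u) has_derivative (\<lambda>s. 0 + cscale j s u)) (at s)"
    by (intro has_derivative_add has_derivative_const bounded_linear_imp_has_derivative)
  then have "((\<lambda>s. y + cscale j s u) has_derivative (\<lambda>s. cscale j s u)) (at s)" by simp
  moreover have "cscale j (\<i> * s) u = j (cscale j s u)" for s
    by (simp add: cscale_def j_simps)
  ultimately show ?thesis unfolding complex_differentiable_at_def by blast
qed

lemma bounded_linear_clinear: "clinear_map j k f \<Longrightarrow> bounded_linear f"
  using linear_bounded by (auto simp: clinear_map_def)

lemma holomorphic_on_line:
  assumes "open S" "\<And>x. x \<in> S \<Longrightarrow> complex_differentiable_at j ((*) \<i>) \<rho> x"
  shows "(\<lambda>s. \<rho> (y + cscale j s u)) holomorphic_on {s. y + cscale j s u \<in> S}"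
proof -
  have "(\<lambda>s. \<rho> (y + cscale j s u)) field_differentiable (at s)" if "y + cscale j s u \<in> S" for s
    unfolding complex_differentiable_at_complex[symmetric]
    by (rule complex_differentiable_at_compose[OF complex_differentiable_at_line assms(2)[OF that]])
  then show ?thesis by (auto simp: holomorphic_on_def intro: field_differentiable_at_within)
qed

text \<open>The one-variable bound is applied on the complex line through y and x, between s = 0 and
  s = 1. This line stays in the ball for \<open>cmod s < T\<close>, and T is proportional to
  \<open>1 / norm u\<close>, which turns \<open>20 * B / T\<close> into a multiple of
  \<open>norm (x - y)\<close>.\<close>

lemma scalar_Lipschitz:
  assumes r: "r > 0" and cd: "\<And>x. x \<in> ball 0 r \<Longrightarrow> complex_differentiable_at j ((*) \<i>) \<rho> x"
    and B: "\<And>x. x \<in> ball 0 r \<Longrightarrow> cmod (\<rho> x) < B"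
  shows "\<exists>L r'. L > 0 \<and> r' > 0 \<and> r' \<le> r \<and>
    (\<forall>x\<in>ball 0 r'. \<forall>y\<in>ball 0 r'. cmod (\<rho> x - \<rho> y) \<le> L * norm (x - y))"
proof -
  obtain K where K: "K \<ge> 1" "\<And>s v. norm (cscale j s v) \<le> K * cmod s * norm v"
    using cscale_bound by blast
  have B0: "B > 0" using B[of 0] r by (simp add: le_less_trans[OF norm_ge_zero])
  \<comment> \<open>This radius gives \<open>norm u < r / (4 * K)\<close> and hence
    \<open>T \<ge> 2\<close>, so that s = 1 lies in the half disc.\<close>
  define r' where "r' = r / (8 * K)"
  define L where "L = 40 * B * K / r"
  have r': "r' > 0" "r' \<le> r" "r' \<le> r / 2" using r K(1) by (auto simp: r'_def field_simps)
  have "cmod (\<rho> x - \<rho> y) \<le> L * norm (x - y)" if x: "x \<in> ball 0 r'" and y: "y \<in> ball 0 r'" for x y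
  proof (cases "x = y")
    case False
    define u where "u = x - y"
    have u: "norm u > 0" "norm u < r / (4 * K)"
      using False x y norm_triangle_ineq4[of x y] by (auto simp: u_def r'_def)
    define T where "T = r / (2 * K * norm u)"
    have T: "T > 0" "2 \<le> T" using u r K(1) by (auto simp: T_def field_simps)
    have in_ball: "y + cscale j s u \<in> ball 0 r" if s: "s \<in> ball 0 T" for s
    proof -
      have "norm (y + cscale j s u) \<le> norm y + K * cmod s * norm u"
        using K(2)[of s u] norm_triangle_ineq order_trans add_left_mono by blast
      also have "\<dots> < r / 2 + K * T * norm u"
        using y r'(3) s K(1) u(1) by (intro add_strict_mono mult_strict_right_mono mult_strict_left_mono) auto
      also have "K * T * norm u = r / 2" using u(1) K(1) by (simp add: T_def)
      finally show ?thesis by simp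
    qed
    have "cmod ((\<lambda>s. \<rho> (y + cscale j s u)) 1 - (\<lambda>s. \<rho> (y + cscale j s u)) 0) \<le> 20 * B / T * cmod 1"
    proof (rule Lipschitz_at_0_bound)
      have "(\<lambda>s. \<rho> (y + cscale j s u)) holomorphic_on {s. y + cscale j s u \<in> ball 0 r}"
        by (rule holomorphic_on_line[OF open_ball]) (rule cd)
      then show "(\<lambda>s. \<rho> (y + cscale j s u)) holomorphic_on ball 0 T"
        by (rule holomorphic_on_subset) (use in_ball in auto)
    qed (use T B in_ball in auto)
    then show ?thesis using u(1) by (simp add: cscale_simps u_def L_def T_def)
  qed (use r B0 K(1) in \<open>auto simp: L_def\<close>)
  moreover have "L > 0" using r B0 K(1) by (auto simp: L_def)
  ultimately show ?thesis using r' by blast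
qed

text \<open>Scaling both points by s gives a function h of s with a double zero at 0, because \<rho>
  has derivative 0 there. The Lipschitz bound makes h proportional to \<open>norm (a - b)\<close>;
  its Taylor estimate at s = 1, on a disc of radius inversely proportional to the larger of the two
  norms, supplies the remaining factor.\<close>

lemma scalar_quadratic_Lipschitz:
  assumes r: "r > 0" and cd: "\<And>x. x \<in> ball 0 r \<Longrightarrow> complex_differentiable_at j ((*) \<i>) \<rho> x"
    and B: "\<And>x. x \<in> ball 0 r \<Longrightarrow> cmod (\<rho> x) < B"
    and d0: "(\<rho> has_derivative (\<lambda>_. 0)) (at 0)"
  shows "\<exists>C r'. C > 0 \<and> r' > 0 \<and> r' \<le> r \<and>
    (\<forall>a\<in>ball 0 r'. \<forall>b\<in>ball 0 r'. cmod (\<rho> a - \<rho> b) \<le> C * (norm a + norm b) * norm (a - b))"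
proof -
  obtain K where K: "K \<ge> 1" "\<And>s v. norm (cscale j s v) \<le> K * cmod s * norm v"
    using cscale_bound by blast
  have "\<exists>L r'. L > 0 \<and> r' > 0 \<and> r' \<le> r \<and>
      (\<forall>x\<in>ball 0 r'. \<forall>y\<in>ball 0 r'. cmod (\<rho> x - \<rho> y) \<le> L * norm (x - y))"
    by (rule scalar_Lipschitz[OF r cd B])
  then obtain L r1 where L: "L > 0" "r1 > 0" "r1 \<le> r"
    "\<And>x y. x \<in> ball 0 r1 \<Longrightarrow> y \<in> ball 0 r1 \<Longrightarrow> cmod (\<rho> x - \<rho> y) \<le> L * norm (x - y)"
    by blast
  define r' where "r' = r1 / (2 * K)"
  define C where "C = 32 * L * K\<^sup>2 / r1"
  have "r1 \<le> r1 * (2 * K)" using mult_left_mono[of 1 "2 * K" r1] L(2) K(1) by simp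
  then have r': "r' > 0" "r' \<le> r1" using L(2) K(1) by (auto simp: r'_def divide_le_eq)
  have "cmod (\<rho> a - \<rho> b) \<le> C * (norm a + norm b) * norm (a - b)"
    if a: "a \<in> ball 0 r'" and b: "b \<in> ball 0 r'" for a b
  proof (cases "a = b")
    case False
    define m where "m = max (norm a) (norm b)"
    have m: "m > 0" "m < r'" using False a b by (auto simp: m_def less_max_iff_disj)
    define T where "T = r1 / (K * m)"
    have T: "T \<ge> 2" using m L(2) K(1) by (simp add: T_def r'_def field_simps)
    have in_ball: "cscale j s v \<in> ball 0 r1" if s: "s \<in> ball 0 T" and v: "norm v \<le> m" for s v
    proof -
      have "norm (cscale j s v) \<le> K * cmod s * norm v" using K by blast
      also have "\<dots> \<le> K * cmod s * m" using v K(1) by (intro mult_left_mono) auto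
      also have "\<dots> < K * T * m" using s K(1) m by (intro mult_strict_right_mono mult_strict_left_mono) auto
      also have "\<dots> = r1" using m K(1) by (simp add: T_def)
      finally show ?thesis by simp
    qed
    have nm: "norm a \<le> m" "norm b \<le> m" by (auto simp: m_def)
    define h where "h = (\<lambda>s. \<rho> (0 + cscale j s a) - \<rho> (0 + cscale j s b))"
    have cdl: "\<And>x. x \<in> ball 0 r1 \<Longrightarrow> complex_differentiable_at j ((*) \<i>) \<rho> x" using cd L(3) by auto
    have "(\<lambda>s. \<rho> (0 + cscale j s v)) holomorphic_on {s. 0 + cscale j s v \<in> ball 0 r1}" for v
      by (rule holomorphic_on_line[OF open_ball]) (rule cdl)
    then have "(\<lambda>s. \<rho> (0 + cscale j s v)) holomorphic_on ball 0 T" if "norm v \<le> m" for v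
      by (rule holomorphic_on_subset) (use in_ball that in auto)
    then have hol: "h holomorphic_on ball 0 T" unfolding h_def
      using nm by (intro holomorphic_on_diff) auto
    have line0: "((\<lambda>s. \<rho> (0 + cscale j s v)) has_derivative (\<lambda>_. 0)) (at 0)" for v
    proof -
      obtain D' where D': "((\<lambda>s. 0 + cscale j s v) has_derivative D') (at 0)"
        using complex_differentiable_at_line[of 0 v 0] by (auto simp: complex_differentiable_at_def)
      show ?thesis
        using has_derivative_compose[OF D', of \<rho> "\<lambda>_. 0"] d0 by (simp add: cscale_simps)
    qed
    have "(h has_derivative (\<lambda>v. 0 - 0)) (at 0)" unfolding h_def
      by (intro has_derivative_diff line0)
      moreover have "(*) (0::complex) = (\<lambda>_. 0)" by auto
    ultimately have "(h has_field_derivative 0) (at 0)" by (simp add: has_field_derivative_def)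
    then have dh: "deriv h 0 = 0" by (rule DERIV_imp_deriv)
    have h0: "h 0 = 0" by (simp add: h_def cscale_simps)
    have hb: "cmod (h s) < L * (K * T * norm (a - b))" if s: "s \<in> ball 0 T" for s
    proof -
      have "cmod (h s) \<le> L * norm (cscale j s a - cscale j s b)"
        unfolding h_def using L(4) in_ball[OF s] nm by simp
      also have "\<dots> \<le> L * (K * cmod s * norm (a - b))"
        using K(2)[of s "a - b"] L(1) by (intro mult_left_mono) (auto simp: cscale_simps)
      also have "\<dots> < L * (K * T * norm (a - b))"
        using s L(1) K(1) False by (intro mult_strict_left_mono mult_strict_right_mono) auto
      finally show ?thesis .
    qed
    have "cmod (h 1 - h 0 - deriv h 0 * 1) \<le> 32 * (L * (K * T * norm (a - b))) / T\<^sup>2 * (cmod 1)\<^sup>2"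
      by (rule Taylor2_bound[OF hol hb]) (use T in auto)
    then have "cmod (\<rho> a - \<rho> b) \<le> 32 * L * K * norm (a - b) / T"
      using T by (simp add: dh h0 power2_eq_square) (simp add: h_def cscale_simps algebra_simps)
    also have "\<dots> = C * m * norm (a - b)" using m K(1) L(2) by (simp add: T_def C_def power2_eq_square)
    also have "\<dots> \<le> C * (norm a + norm b) * norm (a - b)"
      using L K(1) by (intro mult_right_mono mult_left_mono) (auto simp: m_def C_def)
    finally show ?thesis .
  qed auto
  moreover have "C > 0" "r' \<le> r" using L K(1) r' by (auto simp: C_def)
  ultimately show ?thesis using r'(1) by blast
qed

text \<open>The coordinates of a vector in the target space reduce vector-valued estimates to scalar ones.\<close>

lemma quadratic_Lipschitz:
  fixes R :: "'b::real_normed_vector \<Rightarrow> 'a" and j' :: "'b \<Rightarrow> 'b"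
  assumes "fd_complex j'"
    and r: "r > 0" and cd: "\<And>x. x \<in> ball 0 r \<Longrightarrow> complex_differentiable_at j' j R x"
    and d0: "(R has_derivative (\<lambda>_. 0)) (at 0)"
  shows "\<exists>C r'. C > 0 \<and> r' > 0 \<and> r' \<le> r \<and>
    (\<forall>a\<in>ball 0 r'. \<forall>b\<in>ball 0 r'. norm (R a - R b) \<le> C * (norm a + norm b) * norm (a - b))"
proof -
  interpret b: fd_complex j' by fact
  obtain I :: "'a set" and l :: "'a \<Rightarrow> 'a \<Rightarrow> complex" where
    I: "finite I" and l: "\<And>b. clinear_map j ((*) \<i>) (l b)" and sum: "\<And>v. v = (\<Sum>b\<in>I. cscale j (l b v) b)"
    using complex_coordinates by blast
  obtain K where K: "K \<ge> 1" "\<And>s v. norm (cscale j s v) \<le> K * cmod s * norm v"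
    using cscale_bound by blast
  have bl: "bounded_linear (l b)" for b using bounded_linear_clinear[OF l] .
  have cont0: "isCont R 0" using complex_differentiable_at_isCont[OF cd[of 0]] r by simp
  have "\<exists>d>0. \<forall>x. dist x 0 < d \<longrightarrow> dist (R x) (R 0) < 1"
    using cont0[unfolded continuous_at_eps_delta, rule_format, of 1] by simp
  then obtain r0 where r0: "r0 > 0" "\<And>x. norm x < r0 \<Longrightarrow> norm (R x - R 0) < 1"
    by (auto simp: dist_norm)
  define r1 where "r1 = min r r0"
  have r1: "r1 > 0" "r1 \<le> r" using r r0 by (auto simp: r1_def)
  define P where "P k C r' \<longleftrightarrow> C > 0 \<and> r' > 0 \<and> r' \<le> r1 \<and> (\<forall>a\<in>ball 0 r'. \<forall>b\<in>ball 0 r'.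
     cmod (l k (R a) - l k (R b)) \<le> C * (norm a + norm b) * norm (a - b))" for k C r'
  have "\<exists>C r'. P k C r'" for k
  proof -
    obtain Kl where Kl: "\<And>v. cmod (l k v) \<le> norm v * Kl" "Kl > 0"
      using bounded_linear.pos_bounded[OF bl[of k]] by blast
    have bd: "cmod (l k (R x)) < (norm (R 0) + 1) * Kl" if "x \<in> ball 0 r1" for x
    proof -
      have "norm (R x) < norm (R 0) + 1" using r0(2)[of x] that norm_triangle_sub[of "R x" "R 0"] by (simp add: r1_def)
      then show ?thesis using Kl by (meson le_less_trans mult_strict_right_mono)
    qed
    have d: "((\<lambda>x. l k (R x)) has_derivative (\<lambda>_. 0)) (at 0)"
      using bounded_linear.has_derivative[OF bl[of k] d0] l[of k] by (simp add: clinear_map_def linear_0)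
    have cd': "complex_differentiable_at j' ((*) \<i>) (\<lambda>x. l k (R x)) x" if "x \<in> ball 0 r1" for x
      using complex_differentiable_at_compose[OF cd complex_differentiable_at_clinear[OF l bl]] that r1(2) by simp
    show ?thesis unfolding P_def
      by (rule b.scalar_quadratic_Lipschitz[OF r1(1) cd' bd d])
  qed
  then obtain C r' where "\<And>k. P k (C k) (r' k)" by metis
  then have C: "\<And>k. C k > 0" "\<And>k. r' k > 0" "\<And>k. r' k \<le> r1"
    "\<And>k a b. a \<in> ball 0 (r' k) \<Longrightarrow> b \<in> ball 0 (r' k) \<Longrightarrow> cmod (l k (R a) - l k (R b)) \<le> C k * (norm a + norm b) * norm (a - b)"
    by (auto simp: P_def)
  define rr where "rr = Min (insert r1 (r' ` I))"
  define CC where "CC = (\<Sum>k\<in>I. K * C k * norm k) + 1"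
  have "rr \<le> r1" using I by (simp add: rr_def)
  then have "rr \<le> r" using r1(2) by linarith
  then have rr: "rr > 0" "rr \<le> r" "\<And>k. k \<in> I \<Longrightarrow> rr \<le> r' k"
    using I C(2) r1 by (auto simp: rr_def)
  have CC: "CC > 0" unfolding CC_def using K(1) C(1)
    by (intro add_nonneg_pos sum_nonneg mult_nonneg_nonneg) (auto simp: less_imp_le)
  have *: "norm (R a - R b) \<le> CC * (norm a + norm b) * norm (a - b)" if a: "a \<in> ball 0 rr" and b: "b \<in> ball 0 rr" for a b
  proof -
    have "norm (R a - R b) = norm (\<Sum>k\<in>I. cscale j (l k (R a - R b)) k)"
      by (rule arg_cong[OF sum])
    also have "\<dots> \<le> (\<Sum>k\<in>I. K * (C k * (norm a + norm b) * norm (a - b)) * norm k)"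
    proof (rule sum_norm_le)
      fix k assume k: "k \<in> I"
      have "cmod (l k (R a - R b)) \<le> C k * (norm a + norm b) * norm (a - b)"
        using C(4)[of a k b] rr(3)[OF k] a b l[of k] by (auto simp: clinear_map_def linear_diff)
      then have "K * cmod (l k (R a - R b)) * norm k \<le> K * (C k * (norm a + norm b) * norm (a - b)) * norm k"
        using K(1) by (intro mult_right_mono mult_left_mono) auto
      then show "norm (cscale j (l k (R a - R b)) k) \<le> K * (C k * (norm a + norm b) * norm (a - b)) * norm k"
        using K(2) order_trans by blast
    qed
    also have "\<dots> = (CC - 1) * (norm a + norm b) * norm (a - b)"
      unfolding CC_def by (simp add: sum_distrib_right) (simp add: ac_simps)
    also have "\<dots> \<le> CC * (norm a + norm b) * norm (a - b)"
      by (intro mult_right_mono) auto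
    finally show ?thesis .
  qed
  then show ?thesis using CC rr(1,2) by (intro exI[of _ CC] exI[of _ rr] conjI ballI)
qed

end

section \<open>Iterating a doubling map\<close>

text \<open>
  In a chart around the identity, squaring in a Lie group has the form \<open>sq a = 2 a + O(\<bar>a\<bar>\<^sup>2)\<close>.
  The exponential map is the limit of \<open>sq\<^sup>n (a / 2\<^sup>n)\<close>.
\<close>

locale doubling_map = fd_space "TYPE('a)" for sq :: "'a::real_normed_vector \<Rightarrow> 'a" +
  fixes C r :: real
  assumes C: "C > 0" and r: "r > 0" and sq0: "sq 0 = 0"
    and quad: "\<And>a b. norm a < r \<Longrightarrow> norm b < r \<Longrightarrow>
      norm (sq a - sq b - 2 *\<^sub>R (a - b)) \<le> C * (norm a + norm b) * norm (a - b)"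
begin

definition iter :: "nat \<Rightarrow> 'a \<Rightarrow> 'a" where
  "iter n a = (sq ^^ n) ((1 / 2 ^ n) *\<^sub>R a)"

text \<open>Small enough for \<open>C * rad \<le> 1 / 4\<close>, which makes all iterates Lipschitz
  with constant 2 and their limit a small perturbation of the identity.\<close>

definition rad :: real where "rad = min r (1 / (4 * C))"

lemma rad: "rad > 0" "rad \<le> r" "C * rad \<le> 1 / 4"
proof -
  show "rad > 0" "rad \<le> r" using C r by (auto simp: rad_def)
  have "rad \<le> 1 / (4 * C)" by (simp add: rad_def)
  then show "C * rad \<le> 1 / 4" using C by (simp add: field_simps)
qed

lemma iter_Suc: "iter (Suc n) a = sq (iter n ((1/2) *\<^sub>R a))"
  by (simp add: iter_def mult.commute)

lemma iter_0 [simp]: "iter n 0 = 0"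
  by (induction n) (auto simp: iter_Suc sq0, simp add: iter_def)

text \<open>The constant \<open>2 * C\<close> reproduces itself: after halving the arguments the
  induction hypothesis contributes \<open>C / 2\<close>, doubling turns this into C, and the defect
  of \<open>sq\<close> adds another C. Uniformity in n is the point.\<close>

lemma iter_estimate:
  assumes "norm a < rad" "norm b < rad"
  shows "norm (iter n a - iter n b - (a - b)) \<le> 2 * C * (norm a + norm b) * norm (a - b)"
  using assms
proof (induction n arbitrary: a b)
  case 0 then show ?case using C by (simp add: iter_def)
next
  case (Suc n)
  have key: "norm (iter n ((1/2) *\<^sub>R c) - iter n ((1/2) *\<^sub>R d) - (1/2) *\<^sub>R (c - d)) \<le> C / 2 * (norm c + norm d) * norm (c - d)"
    "norm (iter n ((1/2) *\<^sub>R c) - iter n ((1/2) *\<^sub>R d)) \<le> 3 / 4 * norm (c - d)"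
    if cd: "norm c < rad" "norm d < rad" for c d
  proof -
    have cd2: "(1/2) *\<^sub>R c - (1/2) *\<^sub>R d = (1/2) *\<^sub>R (c - d)" by (simp add: scaleR_right_diff_distrib)
    have "norm (iter n ((1/2) *\<^sub>R c) - iter n ((1/2) *\<^sub>R d) - ((1/2) *\<^sub>R c - (1/2) *\<^sub>R d))
        \<le> 2 * C * (norm ((1/2) *\<^sub>R c) + norm ((1/2) *\<^sub>R d)) * norm ((1/2) *\<^sub>R c - (1/2) *\<^sub>R d)"
      by (rule Suc.IH) (use cd rad(1) in auto)
    then show *: "norm (iter n ((1/2) *\<^sub>R c) - iter n ((1/2) *\<^sub>R d) - (1/2) *\<^sub>R (c - d)) \<le> C / 2 * (norm c + norm d) * norm (c - d)"
      unfolding cd2 norm_scaleR by (simp add: distrib_left distrib_right)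
    have "C / 2 * (norm c + norm d) \<le> C / 2 * (rad + rad)" using cd C by (intro mult_left_mono) auto
    also have "\<dots> \<le> 1 / 4" using rad(3) by simp
    finally have "C / 2 * (norm c + norm d) * norm (c - d) \<le> 1 / 4 * norm (c - d)" by (intro mult_right_mono) auto
    with * have "norm (iter n ((1/2) *\<^sub>R c) - iter n ((1/2) *\<^sub>R d) - (1/2) *\<^sub>R (c - d)) \<le> 1 / 4 * norm (c - d)" by linarith
    then show "norm (iter n ((1/2) *\<^sub>R c) - iter n ((1/2) *\<^sub>R d)) \<le> 3 / 4 * norm (c - d)"
      using norm_triangle_sub[of "iter n ((1/2) *\<^sub>R c) - iter n ((1/2) *\<^sub>R d)" "(1/2) *\<^sub>R (c - d)"] by simp
  qed
  define x where "x = iter n ((1/2) *\<^sub>R a)"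
  define y where "y = iter n ((1/2) *\<^sub>R b)"
  have x: "norm x \<le> 3 / 4 * norm a" and y: "norm y \<le> 3 / 4 * norm b"
    using key(2)[of a 0] key(2)[of b 0] Suc.prems rad(1) by (auto simp: x_def y_def)
  have xr: "norm x < r" "norm y < r" using x y Suc.prems rad by auto
  have "norm (sq x - sq y - (a - b)) \<le> norm (sq x - sq y - 2 *\<^sub>R (x - y)) + norm (2 *\<^sub>R (x - y - (1/2) *\<^sub>R (a - b)))"
    by (rule order_trans[OF _ norm_triangle_ineq]) (simp add: algebra_simps scaleR_2)
  also have "norm (sq x - sq y - 2 *\<^sub>R (x - y)) \<le> C * (norm x + norm y) * norm (x - y)"
    using quad[OF xr] .
  also have "C * (norm x + norm y) * norm (x - y) \<le> C * (norm a + norm b) * norm (a - b)"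
  proof (intro mult_mono)
    show "norm (x - y) \<le> norm (a - b)"
      using key(2)[OF Suc.prems] norm_ge_zero[of "a - b"] unfolding x_def y_def by linarith
    show "norm x + norm y \<le> norm a + norm b"
      using x y norm_ge_zero[of a] norm_ge_zero[of b] by linarith
  qed (use C in auto)
  also have "norm (2 *\<^sub>R (x - y - (1/2) *\<^sub>R (a - b))) \<le> C * (norm a + norm b) * norm (a - b)"
    using key(1)[OF Suc.prems] unfolding x_def y_def norm_scaleR by simp
  finally have "norm (sq x - sq y - (a - b)) \<le>
      C * (norm a + norm b) * norm (a - b) + C * (norm a + norm b) * norm (a - b)" by simp
  also have "\<dots> = 2 * C * (norm a + norm b) * norm (a - b)" by (simp add: algebra_simps)
  finally show ?case unfolding iter_Suc x_def y_def .
qed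

lemma iter_Lipschitz:
  assumes "norm a < rad" "norm b < rad"
  shows "norm (iter n a - iter n b) \<le> 2 * norm (a - b)"
proof -
  have "2 * C * (norm a + norm b) \<le> 2 * C * (rad + rad)" using assms C by (intro mult_left_mono) auto
  also have "\<dots> \<le> 1" using rad(3) by simp
  finally have "2 * C * (norm a + norm b) * norm (a - b) \<le> 1 * norm (a - b)" by (intro mult_right_mono) auto
  with iter_estimate[OF assms, of n]
  have "norm (iter n a - iter n b - (a - b)) \<le> norm (a - b)" by linarith
  then show ?thesis using norm_triangle_sub[of "iter n a - iter n b" "a - b"] by simp
qed

lemma iter_bound: "norm a < rad \<Longrightarrow> norm (iter n a) \<le> 2 * norm a"
  using iter_Lipschitz[of a 0 n] rad(1) by simp

lemma pow_iter: "(sq ^^ n) a = iter n (2 ^ n *\<^sub>R a)"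
  by (simp add: iter_def)

text \<open>Absorbing the innermost squaring, \<open>iter (Suc n) a\<close> is
  \<open>iter n b\<close> with b close to a by a factor \<open>(1/2) ^ n\<close>; the uniform
  Lipschitz bound of \<open>iter n\<close> does the rest.\<close>

lemma iter_step:
  assumes a: "norm a < rad / 2"
  shows "norm (iter (Suc n) a - iter n a) \<le> 2 * C * (norm a)\<^sup>2 * (1/2) ^ n"
proof -
  define b where "b = 2 ^ n *\<^sub>R sq ((1 / 2 ^ Suc n) *\<^sub>R a)"
  have eq: "iter (Suc n) a = iter n b"
    unfolding b_def iter_def by (simp del: funpow.simps add: funpow_Suc_right)
  define c where "c = (1 / 2 ^ Suc n) *\<^sub>R a"
  have "norm c = norm a / 2 ^ Suc n" by (simp add: c_def)
  also have "\<dots> \<le> norm a / 1" by (intro divide_left_mono one_le_power) auto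
  finally have "norm c < r" using a rad by simp
  then have "norm (sq c - 2 *\<^sub>R c) \<le> C * norm c * norm c" using quad[of c 0] r sq0 by simp
  then have "norm (2 ^ n *\<^sub>R (sq c - 2 *\<^sub>R c)) \<le> 2 ^ n * (C * norm c * norm c)"
    unfolding norm_scaleR by simp
  also have "2 ^ n *\<^sub>R (sq c - 2 *\<^sub>R c) = b - a"
    by (simp add: b_def c_def scaleR_right_diff_distrib)
  also have "2 ^ n * (C * norm c * norm c) = C * (norm a)\<^sup>2 * (1/2) ^ n / 4"
    by (simp add: c_def power2_eq_square power_one_over field_simps)
  finally have d: "norm (b - a) \<le> C * (norm a)\<^sup>2 * (1/2) ^ n / 4" .
  also have "\<dots> \<le> C * (norm a)\<^sup>2"
  proof -
    have "(1/2::real) ^ n / 4 \<le> 1" using power_le_one[of "1/2::real" n] by simp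
    then have "C * (norm a)\<^sup>2 * ((1/2) ^ n / 4) \<le> C * (norm a)\<^sup>2 * 1" using C by (intro mult_left_mono) auto
    then show ?thesis by simp
  qed
  also have "\<dots> \<le> C * (rad * norm a)"
    using a C rad(1) unfolding power2_eq_square by (intro mult_left_mono mult_right_mono) auto
  also have "\<dots> = (C * rad) * norm a" by simp
  also have "\<dots> \<le> 1 / 4 * norm a" using rad(3) by (intro mult_right_mono) auto
  finally have "norm b < rad"
    using a norm_triangle_sub[of b a] norm_ge_zero[of a] rad(1) by linarith
  then have "norm (iter n b - iter n a) \<le> 2 * norm (b - a)"
    using iter_Lipschitz[of b a n] a rad(1) by simp
  also have "\<dots> \<le> 2 * (C * (norm a)\<^sup>2 * (1/2) ^ n / 4)" using d by simp
  also have "\<dots> \<le> 2 * C * (norm a)\<^sup>2 * (1/2) ^ n" using C by simp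
  finally show ?thesis by (simp add: eq)
qed

lemma iter_diff:
  assumes a: "norm a < rad / 2" and "m \<le> n"
  shows "norm (iter n a - iter m a) \<le> 4 * C * (norm a)\<^sup>2 * ((1/2) ^ m - (1/2) ^ n)"
  using assms(2)
proof (induction rule: dec_induct)
  case (step k)
  have "norm (iter (Suc k) a - iter m a) \<le> norm (iter (Suc k) a - iter k a) + norm (iter k a - iter m a)"
    by (rule order_trans[OF _ norm_triangle_ineq]) simp
  also have "\<dots> \<le> 2 * C * (norm a)\<^sup>2 * (1/2) ^ k + 4 * C * (norm a)\<^sup>2 * ((1/2) ^ m - (1/2) ^ k)"
    using step.IH iter_step[OF a] by (rule add_mono[rotated])
  also have "\<dots> = 4 * C * (norm a)\<^sup>2 * ((1/2) ^ m - (1/2) ^ Suc k)" by (simp add: algebra_simps)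
  finally show ?case .
qed simp

definition lim_map :: "'a \<Rightarrow> 'a" where "lim_map a = lim (\<lambda>n. iter n a)"

lemma iter_converges:
  assumes a: "norm a < rad / 2"
  shows "(\<lambda>n. iter n a) \<longlonglongrightarrow> lim_map a"
proof -
  have "Cauchy (\<lambda>n. iter n a)"
  proof (rule CauchyI)
    fix e :: real assume e: "e > 0"
    define K where "K = 4 * C * (norm a)\<^sup>2 + 1"
    have K: "K > 0" using C by (auto simp: K_def intro: add_nonneg_pos)
    obtain N where N: "(1/2::real) ^ N < e / K" using real_arch_pow_inv[of "e / K" "1/2"] e K by auto
    have bd: "norm (iter n a - iter m a) < e" if "m \<ge> N" "n \<ge> m" for m n
    proof -
      have "norm (iter n a - iter m a) \<le> 4 * C * (norm a)\<^sup>2 * ((1/2) ^ m - (1/2) ^ n)"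
        using iter_diff[OF a that(2)] .
      also have "\<dots> \<le> K * (1/2) ^ N"
      proof (rule mult_mono)
        have "(1/2::real) ^ m \<le> (1/2) ^ N" "(0::real) \<le> (1/2) ^ n"
          using that(1) by (intro power_decreasing) auto
        then show "(1/2::real) ^ m - (1/2) ^ n \<le> (1/2) ^ N" by linarith
        show "(0::real) \<le> (1/2) ^ m - (1/2) ^ n"
          using that(2) by (simp add: power_decreasing)
      qed (use K in \<open>auto simp: K_def\<close>)
      also have "\<dots> < e" using N K by (simp add: field_simps)
      finally show ?thesis .
    qed
    show "\<exists>M. \<forall>m\<ge>M. \<forall>n\<ge>M. norm (iter m a - iter n a) < e"
    proof (intro exI[of _ N] allI impI)
      fix m n assume "N \<le> m" "N \<le> n"
      then show "norm (iter m a - iter n a) < e"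
        using bd[of m n] bd[of n m] by (cases "n \<ge> m") (auto simp: norm_minus_commute)
    qed
  qed
  then obtain l where "(\<lambda>n. iter n a) \<longlonglongrightarrow> l" by (rule Cauchy_converges)
  then show ?thesis unfolding lim_map_def using limI by metis
qed

lemma iter_lim_dist:
  assumes a: "norm a < rad / 2"
  shows "norm (lim_map a - iter m a) \<le> 4 * C * (norm a)\<^sup>2 * (1/2) ^ m"
proof (rule tendsto_upperbound)
  show "(\<lambda>n. norm (iter n a - iter m a)) \<longlonglongrightarrow> norm (lim_map a - iter m a)"
    by (intro tendsto_intros iter_converges a)
  show "\<forall>\<^sub>F n in sequentially. norm (iter n a - iter m a) \<le> 4 * C * (norm a)\<^sup>2 * (1/2) ^ m"
    unfolding eventually_sequentially
  proof (intro exI[of _ m] allI impI)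
    fix n assume "m \<le> n"
    then have "norm (iter n a - iter m a) \<le> 4 * C * (norm a)\<^sup>2 * ((1/2) ^ m - (1/2) ^ n)" using iter_diff[OF a] by blast
    also have "\<dots> \<le> 4 * C * (norm a)\<^sup>2 * (1/2) ^ m" using C by (intro mult_left_mono) auto
    finally show "norm (iter n a - iter m a) \<le> 4 * C * (norm a)\<^sup>2 * (1/2) ^ m" .
  qed
qed simp

lemma lim_estimate:
  assumes "norm a < rad / 2" "norm b < rad / 2"
  shows "norm (lim_map a - lim_map b - (a - b)) \<le> 2 * C * (norm a + norm b) * norm (a - b)"
proof (rule tendsto_upperbound)
  show "(\<lambda>n. norm (iter n a - iter n b - (a - b))) \<longlonglongrightarrow> norm (lim_map a - lim_map b - (a - b))"
    by (intro tendsto_intros iter_converges assms)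
  show "\<forall>\<^sub>F n in sequentially. norm (iter n a - iter n b - (a - b)) \<le> 2 * C * (norm a + norm b) * norm (a - b)"
    using iter_estimate assms rad(1) by (intro always_eventually) auto
qed simp

lemma lim_0 [simp]: "lim_map 0 = 0"
  using iter_converges[of 0] rad(1) LIMSEQ_unique[of "\<lambda>_. 0" 0 "lim_map 0"] by simp

lemma lim_Lipschitz:
  assumes "norm a < rad / 2" "norm b < rad / 2"
  shows "norm (lim_map a - lim_map b) \<le> 2 * norm (a - b)"
proof (rule tendsto_upperbound)
  show "(\<lambda>n. norm (iter n a - iter n b)) \<longlonglongrightarrow> norm (lim_map a - lim_map b)"
    by (intro tendsto_intros iter_converges assms)
  show "\<forall>\<^sub>F n in sequentially. norm (iter n a - iter n b) \<le> 2 * norm (a - b)"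
    using iter_Lipschitz assms rad(1) by (intro always_eventually) auto
qed simp

lemma lim_bound: "norm a < rad / 2 \<Longrightarrow> norm (lim_map a) \<le> 2 * norm a"
  using lim_Lipschitz[of a 0] rad(1) by simp

lemma continuous_on_lim_map: "continuous_on (ball 0 (rad / 2)) lim_map"
  unfolding continuous_on_iff
proof (intro ballI allI impI)
  fix a :: 'a and e :: real assume a: "a \<in> ball 0 (rad / 2)" and e: "e > 0"
  show "\<exists>d>0. \<forall>b\<in>ball 0 (rad / 2). dist b a < d \<longrightarrow> dist (lim_map b) (lim_map a) < e"
  proof (intro exI[of _ "e / 2"] conjI ballI impI)
    fix b assume "b \<in> ball 0 (rad / 2)" "dist b a < e / 2"
    then show "dist (lim_map b) (lim_map a) < e" using lim_Lipschitz[of b a] a by (simp add: dist_norm)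
  qed (use e in simp)
qed

text \<open>The limit sees only the first order of x: all sequences with
  \<open>2 ^ n *\<^sub>R x n\<close> tending to a lead to the same point. This later identifies
  powers of arbitrary curves with the exponential.\<close>

lemma pow_tendsto:
  assumes a: "norm a < rad / 2" and lim: "(\<lambda>n. 2 ^ n *\<^sub>R x n) \<longlonglongrightarrow> a"
  shows "(\<lambda>n. (sq ^^ n) (x n)) \<longlonglongrightarrow> lim_map a"
proof -
  have ev: "\<forall>\<^sub>F n in sequentially. norm (2 ^ n *\<^sub>R x n) < rad"
    using order_tendstoD(2)[OF tendsto_norm[OF lim], of rad] a rad(1) by simp
  have "(\<lambda>n. iter n (2 ^ n *\<^sub>R x n) - iter n a) \<longlonglongrightarrow> 0"
  proof (rule Lim_null_comparison)
    show "\<forall>\<^sub>F n in sequentially. norm (iter n (2 ^ n *\<^sub>R x n) - iter n a) \<le> 2 * norm (2 ^ n *\<^sub>R x n - a)"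
      using ev by eventually_elim (use a rad(1) in \<open>auto intro!: iter_Lipschitz\<close>)
    have "(\<lambda>n. 2 * norm (2 ^ n *\<^sub>R x n - a)) \<longlonglongrightarrow> 2 * norm (a - a)" by (intro tendsto_intros lim)
    then show "(\<lambda>n. 2 * norm (2 ^ n *\<^sub>R x n - a)) \<longlonglongrightarrow> 0" by simp
  qed
  from tendsto_add[OF this iter_converges[OF a]] show ?thesis by (simp add: pow_iter)
qed

text \<open>Squaring in coordinates is group squaring only inside the chart, so every intermediate
  power has to be controlled, not only the last.\<close>

lemma pow_stays:
  assumes lim: "(\<lambda>n. 2 ^ n *\<^sub>R x n) \<longlonglongrightarrow> a" and a: "norm a < rad / 2"
  shows "\<forall>\<^sub>F n in sequentially. \<forall>k\<le>n. norm ((sq ^^ k) (x n)) < rad"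
proof -
  have "\<forall>\<^sub>F n in sequentially. norm (2 ^ n *\<^sub>R x n) < rad / 2"
    using order_tendstoD(2)[OF tendsto_norm[OF lim], of "rad / 2"] a by simp
  then show ?thesis
  proof eventually_elim
    case (elim n)
    show ?case
    proof (intro allI impI)
      fix k assume k: "k \<le> n"
      have "norm (2 ^ k *\<^sub>R x n) \<le> norm (2 ^ n *\<^sub>R x n)"
        using k by (auto intro!: mult_right_mono power_increasing)
      then have *: "norm (2 ^ k *\<^sub>R x n) < rad / 2" using elim by simp
      then have "norm (iter k (2 ^ k *\<^sub>R x n)) \<le> 2 * norm (2 ^ k *\<^sub>R x n)"
        using rad(1) by (intro iter_bound) simp
      then show "norm ((sq ^^ k) (x n)) < rad" using * by (simp add: pow_iter)
    qed
  qed
qed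

text \<open>On the ball used here \<open>lim_map\<close> differs from the identity by a map with
  Lipschitz constant 1/4, so the preimage is the fixed point of the contraction f.\<close>

lemma lim_map_surj:
  assumes y: "norm y < rad / 8"
  shows "\<exists>a. norm a < rad / 2 \<and> lim_map a = y"
proof -
  define f where "f a = a - (lim_map a - y)" for a
  have sub: "norm a < rad / 2" if "a \<in> cball 0 (rad / 4)" for a using that rad(1) by simp
  have est: "norm (f a - f b) \<le> 1 / 4 * norm (a - b)" if ab: "a \<in> cball 0 (rad / 4)" "b \<in> cball 0 (rad / 4)" for a b
  proof -
    have "norm (f a - f b) = norm (lim_map a - lim_map b - (a - b))"
      unfolding f_def by (subst norm_minus_commute) (simp add: algebra_simps)
    also have "\<dots> \<le> 2 * C * (norm a + norm b) * norm (a - b)" using lim_estimate sub ab by blast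
    also have "\<dots> \<le> 2 * C * (rad / 4 + rad / 4) * norm (a - b)"
      using ab C by (intro mult_right_mono mult_left_mono add_mono) auto
    also have "\<dots> = (C * rad) * norm (a - b)" by simp
    also have "\<dots> \<le> 1 / 4 * norm (a - b)" using rad(3) by (intro mult_right_mono) auto
    finally show ?thesis .
  qed
  have "\<exists>!a\<in>cball 0 (rad / 4). f a = a"
  proof (rule Banach_fix)
    show "complete (cball (0::'a) (rad / 4))"
      by (intro compact_imp_complete bounded_closed_compact) auto
    show "cball (0::'a) (rad / 4) \<noteq> {}" using rad(1) by simp
    show "f ` cball 0 (rad / 4) \<subseteq> cball 0 (rad / 4)"
    proof (rule image_subsetI)
      fix a :: 'a assume a: "a \<in> cball 0 (rad / 4)"
      have "norm (f a - f 0) \<le> 1 / 4 * norm (a - 0)" using est[OF a, of 0] rad(1) by simp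
      then have "norm (f a - y) \<le> rad / 16" using a by (simp add: f_def)
      then show "f a \<in> cball 0 (rad / 4)" using y norm_triangle_sub[of "f a" y] rad(1) by simp
    qed
    show "dist (f x) (f y) \<le> 1 / 4 * dist x y" if "x \<in> cball 0 (rad / 4)" "y \<in> cball 0 (rad / 4)" for x y
      using est[OF that] by (simp add: dist_norm)
  qed auto
  then obtain a where "a \<in> cball 0 (rad / 4)" "f a = a" by blast
  then show ?thesis using sub by (intro exI[of _ a]) (auto simp: f_def)
qed

end

section \<open>Holomorphic functions of one variable depending on a parameter\<close>

text \<open>The difference quotient of step h approximates the derivative with error at most
  \<open>K * h\<close>, uniformly in w, and for fixed h it is continuous in w.\<close>

lemma isCont_deriv_parameter:
  fixes g :: "'w::t2_space \<Rightarrow> complex \<Rightarrow> complex"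
  assumes R: "R > 0" and V: "open V" "w0 \<in> V"
    and hol: "\<And>w. w \<in> V \<Longrightarrow> g w holomorphic_on ball 0 R"
    and B: "\<And>w s. w \<in> V \<Longrightarrow> s \<in> ball 0 R \<Longrightarrow> cmod (g w s) < B"
    and cont: "\<And>s. s \<in> ball 0 R \<Longrightarrow> isCont (\<lambda>w. g w s) w0"
  shows "isCont (\<lambda>w. deriv (g w) 0) w0"
  unfolding continuous_at tendsto_iff
proof (intro allI impI)
  fix e :: real assume e: "e > 0"
  have B0: "B > 0" using B[OF V(2), of 0] R by (simp add: le_less_trans[OF norm_ge_zero])
  define K where "K = 32 * B / R\<^sup>2"
  have K: "K > 0" using B0 R by (simp add: K_def)
  define h where "h = min (R / 2) (e / (4 * K))"
  have h: "h > 0" "h \<le> R / 2" "K * h \<le> e / 4" using R e K by (auto simp: h_def min_def field_simps)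
  define q where "q w = (g w (of_real h) - g w 0) / of_real h" for w
  have hb: "complex_of_real h \<in> ball 0 R" "0 \<in> ball 0 R" using h R by auto
  have "isCont q w0" unfolding q_def by (intro continuous_intros cont hb) (use h in auto)
  then have "\<forall>\<^sub>F w in at w0. dist (q w) (q w0) < e / 4"
    unfolding isCont_def by (rule tendstoD) (use e in simp)
  moreover have "\<forall>\<^sub>F w in at w0. w \<in> V" using V by (rule eventually_at_in_open')
  ultimately show "\<forall>\<^sub>F w in at w0. dist (deriv (g w) 0) (deriv (g w0) 0) < e"
  proof eventually_elim
    case (elim w)
    have d: "dist (deriv (g w) 0) (q w) \<le> e / 4" if "w \<in> V" for w
    proof -
      have "cmod (g w (of_real h) - g w 0 - deriv (g w) 0 * of_real h) \<le> 32 * B / R\<^sup>2 * (cmod (of_real h))\<^sup>2"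
        by (rule Taylor2_bound[OF hol[OF that] B[OF that]]) (use h R in auto)
      then have "cmod (g w (of_real h) - g w 0 - deriv (g w) 0 * of_real h) / h \<le> K * h"
        using h by (simp add: K_def power2_eq_square field_simps)
      moreover have "deriv (g w) 0 - q w = - (g w (of_real h) - g w 0 - deriv (g w) 0 * of_real h) / of_real h"
        using h by (simp add: q_def field_simps)
      ultimately have "dist (deriv (g w) 0) (q w) \<le> K * h"
        using h by (simp add: dist_norm norm_divide norm_minus_commute)
      then show ?thesis using h(3) by linarith
    qed
    show ?case using d[OF elim(2)] d[OF V(2)] elim(1) e
      dist_triangle[of "deriv (g w) 0" "deriv (g w0) 0" "q w"]
      dist_triangle[of "q w" "deriv (g w0) 0" "q w0"] dist_commute[of "q w0" "deriv (g w0) 0"]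
      by linarith
  qed
qed

text \<open>The same quotients, now holomorphic in w, converge uniformly as the step
  shrinks.\<close>

lemma holomorphic_deriv_parameter:
  fixes g :: "complex \<Rightarrow> complex \<Rightarrow> complex"
  assumes R: "R > 0" and S: "open S"
    and hol: "\<And>w. w \<in> S \<Longrightarrow> g w holomorphic_on ball 0 R"
    and B: "\<And>w s. w \<in> S \<Longrightarrow> s \<in> ball 0 R \<Longrightarrow> cmod (g w s) < B"
    and hol2: "\<And>s. s \<in> ball 0 R \<Longrightarrow> (\<lambda>w. g w s) holomorphic_on S"
  shows "(\<lambda>w. deriv (g w) 0) holomorphic_on S"
proof (cases "S = {}")
  case False
  then obtain w0 where w0: "w0 \<in> S" by blast
  have B0: "B > 0" using B[OF w0, of 0] R by (simp add: le_less_trans[OF norm_ge_zero])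
  define K where "K = 32 * B / R\<^sup>2"
  have K: "K > 0" using B0 R by (simp add: K_def)
  define h where "h n = R / (2 * (real n + 1))" for n :: nat
  have h: "h n > 0" "h n \<le> R / 2" for n
    using R by (auto simp: h_def field_simps)
  define q where "q n w = (g w (of_real (h n)) - g w 0) / of_real (h n)" for n w
  have hb: "complex_of_real (h n) \<in> ball 0 R" "0 \<in> ball 0 R" for n using h[of n] R by auto
  have d: "dist (q n w) (deriv (g w) 0) \<le> K * h n" if "w \<in> S" for w n
  proof -
    have "cmod (g w (of_real (h n)) - g w 0 - deriv (g w) 0 * of_real (h n)) \<le> 32 * B / R\<^sup>2 * (cmod (of_real (h n)))\<^sup>2"
      by (rule Taylor2_bound[OF hol[OF that] B[OF that]]) (use h[of n] R in auto)
    then have "cmod (g w (of_real (h n)) - g w 0 - deriv (g w) 0 * of_real (h n)) / h n \<le> K * h n"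
      using h[of n] by (simp add: K_def power2_eq_square field_simps)
    moreover have "q n w - deriv (g w) 0 = (g w (of_real (h n)) - g w 0 - deriv (g w) 0 * of_real (h n)) / of_real (h n)"
      using h[of n] by (simp add: q_def field_simps)
    ultimately show ?thesis using h[of n] by (simp add: dist_norm norm_divide)
  qed
  have hlim: "(\<lambda>n. K * h n) \<longlonglongrightarrow> 0" unfolding h_def by real_asymp
  show ?thesis
  proof (rule holomorphic_uniform_sequence[OF S])
    show "q n holomorphic_on S" for n
      unfolding q_def by (intro holomorphic_intros hol2 hb) (use h[of n] in auto)
    fix x assume "x \<in> S"
    then obtain r where r: "r > 0" "cball x r \<subseteq> S" using S open_contains_cball by blast
    have "uniform_limit (cball x r) q (\<lambda>w. deriv (g w) 0) sequentially"
      unfolding uniform_limit_iff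
    proof (intro allI impI)
      fix e :: real assume "e > 0"
      then have "\<forall>\<^sub>F n in sequentially. K * h n < e" using order_tendstoD(2)[OF hlim] by simp
      then show "\<forall>\<^sub>F n in sequentially. \<forall>w\<in>cball x r. dist (q n w) (deriv (g w) 0) < e"
        proof eventually_elim
        case (elim n)
        show ?case
        proof
          fix w assume "w \<in> cball x r"
          then have "dist (q n w) (deriv (g w) 0) \<le> K * h n" using r(2) by (intro d) auto
          then show "dist (q n w) (deriv (g w) 0) < e" using elim by linarith
        qed
      qed
    qed
    then show "\<exists>d>0. cball x d \<subseteq> S \<and> uniform_limit (cball x d) q (\<lambda>w. deriv (g w) 0) sequentially"
      using r by blast
  qed
qed (simp add: holomorphic_on_def)

lemma (in fd_complex) complex_differentiable_at_from_functionals: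
  assumes "\<And>l. clinear_map j ((*) \<i>) l \<Longrightarrow> (\<lambda>s. l (v s)) field_differentiable (at s)"
  shows "complex_differentiable_at ((*) \<i>) j v s"
proof -
  obtain I :: "'a set" and l :: "'a \<Rightarrow> 'a \<Rightarrow> complex" where
    I: "finite I" and l: "\<And>b. clinear_map j ((*) \<i>) (l b)" and sum: "\<And>v. v = (\<Sum>b\<in>I. cscale j (l b v) b)"
    using complex_coordinates by blast
  have one: "complex_differentiable_at ((*) \<i>) j (\<lambda>s. cscale j (l b (v s)) b) s" for b
  proof -
    have "complex_differentiable_at ((*) \<i>) ((*) \<i>) (\<lambda>s. l b (v s)) s"
      unfolding complex_differentiable_at_complex by (rule assms[OF l])
    then show ?thesis
      using complex_differentiable_at_compose[OF _ complex_differentiable_at_line[of 0 b]] by simp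
  qed
  have "complex_differentiable_at ((*) \<i>) j (\<lambda>s. \<Sum>b\<in>J. cscale j (l b (v s)) b) s" if "finite J" for J
    using that
  proof induction
    case empty then show ?case by (simp add: complex_differentiable_at_const linear_j)
  next
    case (insert b J) then show ?case
      by (simp add: complex_differentiable_at_add one linear_j)
  qed
  from this[OF I] show ?thesis unfolding sum[symmetric] .
qed

section \<open>Holomorphy of the limit of the iterated doubling map\<close>

locale holomorphic_doubling_map = doubling_map sq C r + fd_complex j
  for sq :: "'a::real_normed_vector \<Rightarrow> 'a" and C r and j :: "'a \<Rightarrow> 'a" +
  assumes sq_diff: "\<And>a. norm a < r \<Longrightarrow> complex_differentiable_at j j sq a"
begin

lemma iter_diff_at: "norm a < rad \<Longrightarrow> complex_differentiable_at j j (iter n) a"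
proof (induction n arbitrary: a)
  case 0
  have "complex_differentiable_at j j (\<lambda>a. a) a"
    by (auto simp: complex_differentiable_at_def intro!: exI[of _ "\<lambda>a. a"])
  moreover have "iter 0 = (\<lambda>a. a)" by (auto simp: iter_def)
  ultimately show ?case by simp
next
  case (Suc n)
  have h: "complex_differentiable_at j j (\<lambda>a. (1/2) *\<^sub>R a) a"
    unfolding complex_differentiable_at_def
    by (intro exI[of _ "\<lambda>a. (1/2) *\<^sub>R a"]) (auto intro!: derivative_eq_intros simp: j_simps)
  have nh: "norm ((1/2) *\<^sub>R a) < rad" using Suc.prems rad(1) by simp
  have "norm (iter n ((1/2) *\<^sub>R a)) \<le> 2 * norm ((1/2) *\<^sub>R a)" by (rule iter_bound[OF nh])
  then have "norm (iter n ((1/2) *\<^sub>R a)) < r" using Suc.prems rad by simp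
  from complex_differentiable_at_compose[OF complex_differentiable_at_compose[OF h Suc.IH[OF nh]] sq_diff[OF this]]
  show ?case by (simp add: iter_Suc[abs_def])
qed

text \<open>Each iterate is complex differentiable and the error bound \<open>iter_lim_dist\<close>
  is uniform on the ball. Complex lines are used because the theorem on uniform limits concerns one
  variable.\<close>

lemma lim_map_line:
  assumes "norm (x + cscale j s0 y) < rad / 2"
  shows "complex_differentiable_at ((*) \<i>) j (\<lambda>s. lim_map (x + cscale j s y)) s0"
proof (rule complex_differentiable_at_from_functionals)
  fix l assume l: "clinear_map j ((*) \<i>) l"
  then have bl: "bounded_linear l" by (rule bounded_linear_clinear)
  define S where "S = {s. x + cscale j s y \<in> ball 0 (rad / 2)}"
  have cont: "continuous_on UNIV (\<lambda>s. x + cscale j s y)"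
    unfolding cscale_def by (intro continuous_intros)
  have "S = (\<lambda>s. x + cscale j s y) -` ball 0 (rad / 2)" by (auto simp: S_def)
  then have S: "open S" using open_vimage[OF open_ball cont] by simp
  have "(\<lambda>s. l (lim_map (x + cscale j s y))) holomorphic_on S"
  proof (rule holomorphic_uniform_sequence[OF S])
    fix n
    have cd: "complex_differentiable_at j ((*) \<i>) (\<lambda>a. l (iter n a)) a" if "a \<in> ball 0 (rad / 2)" for a
      using that rad(1) by (intro complex_differentiable_at_compose[OF iter_diff_at complex_differentiable_at_clinear[OF l bl]]) simp
    show "(\<lambda>s. l (iter n (x + cscale j s y))) holomorphic_on S"
      unfolding S_def by (rule holomorphic_on_line[OF open_ball]) (rule cd)
  next
    fix s assume "s \<in> S"
    then obtain d where d: "d > 0" "cball s d \<subseteq> S" using S open_contains_cball by blast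
    obtain K where K: "\<And>v. cmod (l v) \<le> norm v * K" "K > 0" using bounded_linear.pos_bounded[OF bl] by blast
    have lim: "(\<lambda>n. 4 * C * (rad / 2)\<^sup>2 * (1/2) ^ n * K) \<longlonglongrightarrow> 0"
      by (intro tendsto_mult_left_zero tendsto_mult_right_zero LIMSEQ_realpow_zero) auto
    have "uniform_limit (cball s d) (\<lambda>n s. l (iter n (x + cscale j s y))) (\<lambda>s. l (lim_map (x + cscale j s y))) sequentially"
      unfolding uniform_limit_iff
    proof (intro allI impI)
      fix e :: real assume "e > 0"
      then have "\<forall>\<^sub>F n in sequentially. 4 * C * (rad / 2)\<^sup>2 * (1/2) ^ n * K < e"
        using order_tendstoD(2)[OF lim] by simp
      then show "\<forall>\<^sub>F n in sequentially. \<forall>t\<in>cball s d.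
          dist (l (iter n (x + cscale j t y))) (l (lim_map (x + cscale j t y))) < e"
      proof eventually_elim
        case (elim n)
        show ?case
        proof
          fix t assume "t \<in> cball s d"
          define a where "a = x + cscale j t y"
          have a: "norm a < rad / 2" using \<open>t \<in> cball s d\<close> d(2) by (auto simp: S_def a_def)
          have "dist (l (iter n a)) (l (lim_map a)) = cmod (l (lim_map a - iter n a))"
            using bl by (simp add: dist_norm norm_minus_commute linear_simps)
          also have "\<dots> \<le> norm (lim_map a - iter n a) * K" by (rule K)
          also have "\<dots> \<le> 4 * C * (norm a)\<^sup>2 * (1/2) ^ n * K"
            using iter_lim_dist[OF a] K(2) by (intro mult_right_mono) auto
          also have "\<dots> \<le> 4 * C * (rad / 2)\<^sup>2 * (1/2) ^ n * K"
            using a C K(2) by (intro mult_right_mono mult_left_mono power_mono) auto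
          finally show "dist (l (iter n (x + cscale j t y))) (l (lim_map (x + cscale j t y))) < e"
            using elim unfolding a_def by linarith
        qed
      qed
    qed
    then show "\<exists>d>0. cball s d \<subseteq> S \<and> uniform_limit (cball s d) (\<lambda>n s. l (iter n (x + cscale j s y)))
        (\<lambda>s. l (lim_map (x + cscale j s y))) sequentially" using d by blast
  qed
  moreover have "s0 \<in> S" using assms by (simp add: S_def)
  ultimately show "(\<lambda>s. l (lim_map (x + cscale j s y))) field_differentiable at s0"
    using S by (auto simp: holomorphic_on_open field_differentiable_def)
qed

end

section \<open>Derivatives in charts\<close>

definition vec_chart :: "('e, 'e) chart" where "vec_chart = (UNIV, id)"

definition prod_chart :: "('a, 'e) chart \<Rightarrow> ('b, 'f) chart \<Rightarrow> ('a \<times> 'b, 'e \<times> 'f) chart" where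
  "prod_chart c d = (chart_dom c \<times> chart_dom d, map_prod (chart_map c) (chart_map d))"

text \<open>Continuity is a separate requirement: \<open>chart_map d\<close> is arbitrary outside
  \<open>chart_dom d\<close>, so differentiability of the coordinate expression alone does not keep
  f in the chart. The charts are explicit so that derivatives at different points can be compared in
  one chart.\<close>

definition mder :: "('a::t2_space, 'e::real_normed_vector) chart \<Rightarrow> ('b::t2_space, 'f::real_normed_vector) chart \<Rightarrow>
    ('a \<Rightarrow> 'b) \<Rightarrow> 'a \<Rightarrow> ('e \<Rightarrow> 'f) \<Rightarrow> bool" where
  "mder c d f p D \<longleftrightarrow> is_chart c \<and> is_chart d \<and> p \<in> chart_dom c \<and> f p \<in> chart_dom d \<and> isCont f p \<and>
     ((chart_map d \<circ> f \<circ> chart_inv c) has_derivative D) (at (chart_map c p))"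

lemma chart_facts:
  assumes "is_chart c"
  shows "open (chart_dom c)" "open (chart_map c ` chart_dom c)" "inj_on (chart_map c) (chart_dom c)"
    "\<And>p. p \<in> chart_dom c \<Longrightarrow> chart_inv c (chart_map c p) = p"
    "\<And>x. x \<in> chart_map c ` chart_dom c \<Longrightarrow> chart_map c (chart_inv c x) = x"
    "\<And>x. x \<in> chart_map c ` chart_dom c \<Longrightarrow> chart_inv c x \<in> chart_dom c"
    "continuous_on (chart_dom c) (chart_map c)" "continuous_on (chart_map c ` chart_dom c) (chart_inv c)"
proof -
  have h: "homeomorphism (chart_dom c) (chart_map c ` chart_dom c) (chart_map c) (chart_inv c)"
    using assms by (simp add: is_chart_def)
  show "open (chart_dom c)" "open (chart_map c ` chart_dom c)" using assms by (auto simp: is_chart_def)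
  show "chart_inv c (chart_map c p) = p" if "p \<in> chart_dom c" for p using h that by (auto simp: homeomorphism_def)
  then show "inj_on (chart_map c) (chart_dom c)" by (rule inj_on_inverseI)
  show "chart_map c (chart_inv c x) = x" if "x \<in> chart_map c ` chart_dom c" for x using that by (rule f_inv_into_f)
  show "chart_inv c x \<in> chart_dom c" if "x \<in> chart_map c ` chart_dom c" for x using that by (rule inv_into_into)
  show "continuous_on (chart_dom c) (chart_map c)" "continuous_on (chart_map c ` chart_dom c) (chart_inv c)"
    using h by (auto simp: homeomorphism_def)
qed

lemma isCont_chart_map: "is_chart c \<Longrightarrow> p \<in> chart_dom c \<Longrightarrow> isCont (chart_map c) p"
  using chart_facts(1,7) continuous_on_eq_continuous_at by blast

lemma isCont_chart_inv: "is_chart c \<Longrightarrow> x \<in> chart_map c ` chart_dom c \<Longrightarrow> isCont (chart_inv c) x"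
  using chart_facts(2,8) continuous_on_eq_continuous_at by blast

lemma is_chart_vec [simp]: "is_chart vec_chart"
  by (simp add: is_chart_def vec_chart_def homeomorphism_def)

lemma vec_chart_simps [simp]: "chart_dom vec_chart = UNIV" "chart_map vec_chart = id" "chart_inv vec_chart = id"
  by (auto simp: vec_chart_def)

lemma prod_chart_simps [simp]:
  "chart_dom (prod_chart c d) = chart_dom c \<times> chart_dom d"
  "chart_map (prod_chart c d) = map_prod (chart_map c) (chart_map d)"
  by (auto simp: prod_chart_def)

lemma prod_chart_inv:
  assumes "is_chart c" "is_chart d" "x \<in> chart_map c ` chart_dom c" "y \<in> chart_map d ` chart_dom d"
  shows "chart_inv (prod_chart c d) (x, y) = (chart_inv c x, chart_inv d y)"
proof -
  obtain p q where pq: "p \<in> chart_dom c" "x = chart_map c p" "q \<in> chart_dom d" "y = chart_map d q"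
    using assms(3,4) by blast
  have "inj_on (map_prod (chart_map c) (chart_map d)) (chart_dom c \<times> chart_dom d)"
    using chart_facts(3)[OF assms(1)] chart_facts(3)[OF assms(2)] by (rule map_prod_inj_on)
  moreover have "chart_inv c x = p" "chart_inv d y = q"
    using pq chart_facts(4)[OF assms(1)] chart_facts(4)[OF assms(2)] by auto
  ultimately show ?thesis unfolding prod_chart_simps using pq by (intro inv_into_f_eq) auto
qed

lemma is_chartI:
  assumes "open S" "open (f ` S)" "inj_on f S" "continuous_on S f" "continuous_on (f ` S) (inv_into S f)"
  shows "is_chart (S, f)"
  using assms unfolding is_chart_def homeomorphism_def by (auto simp: inv_into_f_f)

lemma is_chart_prod:
  assumes "is_chart c" "is_chart d" shows "is_chart (prod_chart c d)"
proof -
  note C = chart_facts[OF assms(1)] and D = chart_facts[OF assms(2)]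
  have img: "chart_map (prod_chart c d) ` chart_dom (prod_chart c d) = (chart_map c ` chart_dom c) \<times> (chart_map d ` chart_dom d)"
    by force
  have inj: "inj_on (chart_map (prod_chart c d)) (chart_dom (prod_chart c d))"
    using C(3) D(3) by (auto simp: inj_on_def)
  have c1: "continuous_on (chart_dom (prod_chart c d)) (chart_map (prod_chart c d))"
    unfolding prod_chart_simps map_prod_def case_prod_beta
    by (intro continuous_on_Pair continuous_on_compose2[OF C(7) continuous_on_fst] continuous_on_compose2[OF D(7) continuous_on_snd] continuous_on_id) auto
  have c2: "continuous_on ((chart_map c ` chart_dom c) \<times> (chart_map d ` chart_dom d)) (\<lambda>z. (chart_inv c (fst z), chart_inv d (snd z)))"
    by (intro continuous_on_Pair continuous_on_compose2[OF C(8) continuous_on_fst] continuous_on_compose2[OF D(8) continuous_on_snd] continuous_on_id) auto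
  have c3: "continuous_on ((chart_map c ` chart_dom c) \<times> (chart_map d ` chart_dom d)) (chart_inv (prod_chart c d))"
    by (rule continuous_on_eq[OF c2]) (use prod_chart_inv[OF assms] in force)
  have "is_chart (chart_dom (prod_chart c d), chart_map (prod_chart c d))"
  proof (rule is_chartI[OF _ _ inj c1])
    show "open (chart_dom (prod_chart c d))" using C(1) D(1) by (simp add: open_Times)
    show "open (chart_map (prod_chart c d) ` chart_dom (prod_chart c d))" unfolding img using C(2) D(2) by (rule open_Times)
    show "continuous_on (chart_map (prod_chart c d) ` chart_dom (prod_chart c d)) (chart_inv (prod_chart c d))"
      unfolding img by (rule c3)
  qed
  then show ?thesis by (simp only: prod.collapse)
qed

lemma mderD:
  assumes "mder c d f p D"
  shows "is_chart c" "is_chart d" "p \<in> chart_dom c" "f p \<in> chart_dom d" "isCont f p"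
    "((\<lambda>x. chart_map d (f (chart_inv c x))) has_derivative D) (at (chart_map c p))"
  using assms by (auto simp: mder_def o_def)

lemma mder_linear: "mder c d f p D \<Longrightarrow> linear D"
  using mderD(6) has_derivative_linear by blast

lemma mder_unique: "mder c d f p D \<Longrightarrow> mder c d f p E \<Longrightarrow> D = E"
  using mderD(6) has_derivative_unique by blast

lemma mder_cong:
  assumes "mder c d f p D" "open S" "p \<in> S" "\<And>q. q \<in> S \<Longrightarrow> f q = g q"
  shows "mder c d g p D"
proof -
  note M = mderD[OF assms(1)]
  have "\<forall>\<^sub>F q in nhds p. f q = g q" using assms(2-4) eventually_nhds by blast
  then have ic: "isCont g p" using M(5) isCont_cong by blast
  have "open (chart_inv c -` S \<inter> chart_map c ` chart_dom c)"
    using continuous_open_preimage[OF chart_facts(8)[OF M(1)] chart_facts(2)[OF M(1)] assms(2)] by (simp add: Int_commute)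
  moreover have "chart_map c p \<in> chart_inv c -` S \<inter> chart_map c ` chart_dom c"
    using M(1,3) assms(3) by (auto simp: chart_facts(4))
  moreover have "chart_map d (f (chart_inv c x)) = chart_map d (g (chart_inv c x))"
    if "x \<in> chart_inv c -` S \<inter> chart_map c ` chart_dom c" for x using that assms(4) by auto
  ultimately have "((\<lambda>x. chart_map d (g (chart_inv c x))) has_derivative D) (at (chart_map c p))"
    using has_derivative_transform_within_open[OF M(6)] by metis
  then show ?thesis using M ic assms(3,4) unfolding mder_def by (auto simp: o_def)
qed

text \<open>Continuity keeps f inside \<open>chart_dom d\<close> near p, where the inserted pair of
  \<open>chart_map d\<close> and \<open>chart_inv d\<close> cancels.\<close>

lemma mder_compose:
  assumes "mder c d f p D" "mder d e g (f p) E"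
  shows "mder c e (\<lambda>q. g (f q)) p (\<lambda>v. E (D v))"
proof -
  note M = mderD[OF assms(1)] and N = mderD[OF assms(2)]
  have ic: "isCont (\<lambda>q. g (f q)) p" using isCont_o2[OF M(5) N(5)] .
  have fi: "chart_inv c (chart_map c p) = p" using chart_facts(4)[OF M(1,3)] .
  have D: "((\<lambda>x. chart_map e (g (chart_inv d (chart_map d (f (chart_inv c x)))))) has_derivative (\<lambda>v. E (D v))) (at (chart_map c p))"
    using has_derivative_compose[OF M(6), of "\<lambda>y. chart_map e (g (chart_inv d y))" E] N(6) fi by simp
  have cont: "isCont (\<lambda>x. f (chart_inv c x)) (chart_map c p)"
    using isCont_o2[OF isCont_chart_inv[OF M(1)], of "chart_map c p" f] M(3,5) fi by simp
  then have "((\<lambda>x. f (chart_inv c x)) \<longlongrightarrow> f p) (at (chart_map c p))"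
    using fi by (simp add: isCont_def)
  from topological_tendstoD[OF this chart_facts(1)[OF M(2)] M(4)]
  obtain S where S0: "open S" "chart_map c p \<in> S"
    "\<And>x. x \<in> S \<Longrightarrow> x \<noteq> chart_map c p \<Longrightarrow> f (chart_inv c x) \<in> chart_dom d"
    unfolding eventually_at_topological by auto
  have S: "open S" "chart_map c p \<in> S" "\<And>x. x \<in> S \<Longrightarrow> f (chart_inv c x) \<in> chart_dom d"
    using S0 fi M(4) by metis+
  have "((\<lambda>x. chart_map e (g (f (chart_inv c x)))) has_derivative (\<lambda>v. E (D v))) (at (chart_map c p))"
    by (rule has_derivative_transform_within_open[OF D S(1,2)]) (use S(3) chart_facts(4)[OF M(2)] in simp)
  then show ?thesis using M N ic unfolding mder_def by (auto simp: o_def)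
qed

lemma mder_Pair:
  assumes "mder c d f p D" "mder c e g p E"
  shows "mder c (prod_chart d e) (\<lambda>q. (f q, g q)) p (\<lambda>v. (D v, E v))"
proof -
  note M = mderD[OF assms(1)] and N = mderD[OF assms(2)]
  have "((\<lambda>x. chart_map (prod_chart d e) (f (chart_inv c x), g (chart_inv c x))) has_derivative (\<lambda>v. (D v, E v))) (at (chart_map c p))"
    using has_derivative_Pair[OF M(6) N(6)] by simp
  moreover have "isCont (\<lambda>q. (f q, g q)) p" using M(5) N(5) by (rule isCont_Pair)
  ultimately show ?thesis using M N is_chart_prod[OF M(2) N(2)] unfolding mder_def by (auto simp: o_def)
qed

lemma mder_const:
  assumes "is_chart c" "is_chart d" "p \<in> chart_dom c" "q \<in> chart_dom d"
  shows "mder c d (\<lambda>_. q) p (\<lambda>_. 0)"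
  using assms unfolding mder_def by (simp add: o_def)

lemma mder_id:
  assumes "is_chart c" "p \<in> chart_dom c"
  shows "mder c c (\<lambda>q. q) p (\<lambda>v. v)"
proof -
  have "((\<lambda>x. chart_map c (chart_inv c x)) has_derivative (\<lambda>v. v)) (at (chart_map c p))"
    by (rule has_derivative_transform_within_open[OF has_derivative_ident chart_facts(2)[OF assms(1)]]) (use assms chart_facts(5)[OF assms(1)] in auto)
  then show ?thesis using assms unfolding mder_def by (simp add: o_def)
qed

lemma mder_vec: "(f has_derivative D) (at x) \<Longrightarrow> mder vec_chart vec_chart f x D"
  unfolding mder_def by (auto simp: o_def has_derivative_continuous)

lemma mder_vec_iff:
  assumes "is_chart d"
  shows "mder vec_chart d f x D \<longleftrightarrow> f x \<in> chart_dom d \<and> isCont f x \<and> ((\<lambda>y. chart_map d (f y)) has_derivative D) (at x)"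
  using assms unfolding mder_def by (auto simp: o_def)

lemma mder_chart_inv:
  assumes "is_chart c" "x \<in> chart_map c ` chart_dom c"
  shows "mder vec_chart c (chart_inv c) x (\<lambda>v. v)"
proof -
  have "((\<lambda>x. chart_map c (chart_inv c x)) has_derivative (\<lambda>v. v)) (at x)"
    by (rule has_derivative_transform_within_open[OF has_derivative_ident chart_facts(2)[OF assms(1)]]) (use assms chart_facts(5)[OF assms(1)] in auto)
  then show ?thesis unfolding mder_vec_iff[OF assms(1)]
    using assms isCont_chart_inv[OF assms] chart_facts(6)[OF assms(1)] by auto
qed

lemma mder_chart_map:
  assumes "is_chart c" "p \<in> chart_dom c"
  shows "mder c vec_chart (chart_map c) p (\<lambda>v. v)"
  using mder_id[OF assms] isCont_chart_map[OF assms] assms unfolding mder_def by (simp add: o_def)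

lemma vec_atlas_eq: "vec_atlas = {vec_chart}" by (simp add: vec_atlas_def vec_chart_def)

lemma prod_atlas_eq: "prod_atlas A B = {prod_chart c d | c d. c \<in> A \<and> d \<in> B}"
  by (simp add: prod_atlas_def prod_chart_def)

lemma holomorphic_map_mder:
  assumes "holomorphic_map j A k B f" "c \<in> A" "d \<in> B" "is_chart c" "is_chart d" "p \<in> chart_dom c" "f p \<in> chart_dom d"
    and "linear j"
  shows "\<exists>D. clinear_map j k D \<and> mder c d f p D"
proof -
  have "isCont f p" using assms(1) by (auto simp: holomorphic_map_def continuous_on_eq_continuous_at)
  moreover have "complex_differentiable_at j k (chart_map d \<circ> f \<circ> chart_inv c) (chart_map c p)"
    using assms(1,2,3,6,7) unfolding holomorphic_map_def by auto
  ultimately show ?thesis using assms(4-7) unfolding complex_differentiable_at_def mder_def clinear_map_def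
    by (auto dest: has_derivative_linear)
qed

lemma mder_imp_complex_differentiable:
  "mder vec_chart vec_chart f x D \<Longrightarrow> clinear_map j k D \<Longrightarrow> complex_differentiable_at j k f x"
  by (auto simp: mder_def complex_differentiable_at_def clinear_map_def o_def)

lemma complex_differentiable_imp_mder:
  "complex_differentiable_at j k f x \<Longrightarrow> \<exists>D. clinear_map j k D \<and> mder vec_chart vec_chart f x D"
  unfolding complex_differentiable_at_def clinear_map_def by (auto dest: mder_vec has_derivative_linear)

lemma clinear_map_compose: "clinear_map j k D \<Longrightarrow> clinear_map k m E \<Longrightarrow> clinear_map j m (\<lambda>v. E (D v))"
  by (auto simp: clinear_map_def intro: linear_compose[unfolded o_def])

section \<open>The exponential map of a complex Lie group\<close>

definition hol_at :: "('e::real_normed_vector \<Rightarrow> 'e) \<Rightarrow> ('a::t2_space, 'e) chart \<Rightarrow>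
    ('f::real_normed_vector \<Rightarrow> 'f) \<Rightarrow> ('b::t2_space, 'f) chart \<Rightarrow> ('a \<Rightarrow> 'b) \<Rightarrow> 'a \<Rightarrow> bool" where
  "hol_at j c k d f p \<longleftrightarrow> (\<exists>D. clinear_map j k D \<and> mder c d f p D)"

lemma hol_at_compose:
  "hol_at j c k d f p \<Longrightarrow> hol_at k d m e g (f p) \<Longrightarrow> hol_at j c m e (\<lambda>q. g (f q)) p"
  unfolding hol_at_def using mder_compose clinear_map_compose by blast

lemma hol_at_Pair:
  assumes "hol_at j c k d f p" "hol_at j c m e g p"
  shows "hol_at j c (map_prod k m) (prod_chart d e) (\<lambda>q. (f q, g q)) p"
proof -
  obtain D E where DE: "clinear_map j k D" "mder c d f p D" "clinear_map j m E" "mder c e g p E"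
    using assms by (auto simp: hol_at_def)
  have "clinear_map j (map_prod k m) (\<lambda>v. (D v, E v))"
    using DE(1,3) by (auto simp: clinear_map_def intro!: linearI simp: linear_add linear_scale)
  then show ?thesis unfolding hol_at_def using mder_Pair[OF DE(2,4)] by blast
qed

lemma hol_at_const:
  assumes "is_chart c" "is_chart d" "p \<in> chart_dom c" "q \<in> chart_dom d" "linear k"
  shows "hol_at j c k d (\<lambda>_. q) p"
  unfolding hol_at_def using mder_const[OF assms(1-4)] assms(5)
  by (intro exI[of _ "\<lambda>_. 0"]) (auto simp: clinear_map_def linear_0 intro!: linearI)

lemma hol_at_id:
  assumes "is_chart c" "p \<in> chart_dom c" shows "hol_at j c j c (\<lambda>q. q) p"
  unfolding hol_at_def using mder_id[OF assms] by (intro exI[of _ "\<lambda>v. v"]) (auto simp: clinear_map_def intro!: linearI)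

lemma hol_at_cong:
  "hol_at j c k d f p \<Longrightarrow> open S \<Longrightarrow> p \<in> S \<Longrightarrow> (\<And>q. q \<in> S \<Longrightarrow> f q = g q) \<Longrightarrow> hol_at j c k d g p"
  unfolding hol_at_def using mder_cong by blast

lemma hol_atD:
  assumes "hol_at j c k d f p"
  shows "is_chart c" "is_chart d" "p \<in> chart_dom c" "f p \<in> chart_dom d" "isCont f p"
proof -
  obtain D where "mder c d f p D" using assms by (auto simp: hol_at_def)
  from mderD[OF this] show "is_chart c" "is_chart d" "p \<in> chart_dom c" "f p \<in> chart_dom d" "isCont f p"
    by auto
qed

lemma hol_at_vec_iff: "hol_at j vec_chart k vec_chart f x \<longleftrightarrow> complex_differentiable_at j k f x"
  unfolding hol_at_def using mder_imp_complex_differentiable complex_differentiable_imp_mder by blast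

lemma chart_at_props:
  assumes "(\<Union>c\<in>A. chart_dom c) = UNIV"
  shows "chart_at A p \<in> A" "p \<in> chart_dom (chart_at A p)"
proof -
  have "\<exists>c. c \<in> A \<and> p \<in> chart_dom c" using assms by blast
  from someI_ex[OF this] show "chart_at A p \<in> A" "p \<in> chart_dom (chart_at A p)"
    unfolding chart_at_def by auto
qed

lemma vector_derivative_quotient:
  assumes "(f has_vector_derivative v) (at (0::real))"
  shows "((\<lambda>t. (f t - f 0) /\<^sub>R t) \<longlongrightarrow> v) (at 0)"
proof -
  have "((\<lambda>h. norm (f (0 + h) - f 0 - h *\<^sub>R v) / norm h) \<longlongrightarrow> 0) (at 0)"
    using assms by (simp add: has_vector_derivative_def has_derivative_at)
  moreover have "\<forall>\<^sub>F h in at 0. norm (f (0 + h) - f 0 - h *\<^sub>R v) / norm h = norm ((f h - f 0) /\<^sub>R h - v)"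
    unfolding eventually_at
  proof (intro exI[of _ 1] conjI ballI impI)
    fix h :: real assume "h \<noteq> 0 \<and> dist h 0 < 1"
    then have "(f h - f 0) /\<^sub>R h - v = (f h - f 0 - h *\<^sub>R v) /\<^sub>R h"
      by (simp add: scaleR_right_diff_distrib)
    then show "norm (f (0 + h) - f 0 - h *\<^sub>R v) / norm h = norm ((f h - f 0) /\<^sub>R h - v)"
      by (simp add: divide_inverse_commute)
  qed simp
  ultimately have "((\<lambda>h. norm ((f h - f 0) /\<^sub>R h - v)) \<longlongrightarrow> 0) (at 0)"
    by (rule Lim_transform_eventually)
  then show ?thesis by (simp add: tendsto_norm_zero_iff LIM_zero_iff)
qed

section \<open>Complex manifolds and complex Lie groups in coordinates\<close>

locale cplx_manifold =
  fixes j :: "'e::real_normed_vector \<Rightarrow> 'e" and A :: "('a::{t2_space, second_countable_topology}, 'e) chart set"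
  assumes manifold: "complex_manifold j A"
begin

lemma chart_at_in: "chart_at A p \<in> A" and chart_at_dom [simp]: "p \<in> chart_dom (chart_at A p)"
proof -
  have "(\<Union>c\<in>A. chart_dom c) = UNIV" using manifold by (simp add: complex_manifold_def)
  from chart_at_props[OF this] show "chart_at A p \<in> A" "p \<in> chart_dom (chart_at A p)" .
qed

lemma is_chart: "c \<in> A \<Longrightarrow> is_chart c"
  using manifold by (auto simp: complex_manifold_def)

lemma is_chart_at [simp]: "is_chart (chart_at A p)"
  using is_chart chart_at_in by blast

lemma fd_complex_model: "fd_complex j"
  using manifold by unfold_locales (auto simp: complex_manifold_def)

lemma hol_transition:
  assumes "c \<in> A" "d \<in> A" "p \<in> chart_dom c" "p \<in> chart_dom d"
  shows "hol_at j c j d (\<lambda>q. q) p"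
proof -
  have "complex_differentiable_at j j (chart_map d \<circ> chart_inv c) (chart_map c p)"
    using manifold assms unfolding complex_manifold_def by blast
  then obtain D where D: "((\<lambda>x. chart_map d (chart_inv c x)) has_derivative D) (at (chart_map c p))" "\<forall>v. D (j v) = j (D v)"
    by (auto simp: complex_differentiable_at_def o_def)
  then have "mder c d (\<lambda>q. q) p D" using assms is_chart unfolding mder_def by (simp add: o_def)
  moreover have "clinear_map j j D" using D has_derivative_linear by (auto simp: clinear_map_def)
  ultimately show ?thesis by (auto simp: hol_at_def)
qed

end

locale clie_group = group L + cplx_manifold i A
  for L :: "'g::{t2_space, second_countable_topology} monoid" (structure)
    and i :: "'l::real_normed_vector \<Rightarrow> 'l" and A :: "('g, 'l) chart set" +
  assumes lie_group: "complex_lie_group L i A"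
begin

sublocale fd_complex i by (rule fd_complex_model)

lemma carrier_UNIV [simp]: "carrier L = UNIV" using lie_group by (simp add: complex_lie_group_def)

lemma linear_prod_i: "linear (map_prod i i)"
  by (auto intro!: linearI simp: j_simps)

lemma hol_mult:
  assumes "hol_at j s i c f p" "hol_at j s i d g p" "c \<in> A" "d \<in> A" "e \<in> A" "f p \<otimes> g p \<in> chart_dom e"
  shows "hol_at j s i e (\<lambda>q. f q \<otimes> g q) p"
proof -
  have "hol_at (map_prod i i) (prod_chart c d) i e (\<lambda>(g, h). g \<otimes> h) (f p, g p)"
    unfolding hol_at_def
  proof (rule holomorphic_map_mder)
    show "holomorphic_map (map_prod i i) (prod_atlas A A) i A (\<lambda>(g, h). g \<otimes> h)"
      using lie_group by (simp add: complex_lie_group_def)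
    show "prod_chart c d \<in> prod_atlas A A" using assms(3,4) unfolding prod_atlas_eq by blast
    show "is_chart (prod_chart c d)" using assms(3,4) by (intro is_chart_prod is_chart)
    show "(f p, g p) \<in> chart_dom (prod_chart c d)" using hol_atD(4)[OF assms(1)] hol_atD(4)[OF assms(2)] by simp
    show "is_chart e" using assms(5) by (rule is_chart)
    show "(case (f p, g p) of (g, h) \<Rightarrow> g \<otimes> h) \<in> chart_dom e" using assms(6) by simp
  qed (rule assms linear_prod_i)+
  from hol_at_compose[OF hol_at_Pair[OF assms(1,2)] this] show ?thesis by simp
qed

lemma hol_inv:
  assumes "hol_at j s i c f p" "c \<in> A" "e \<in> A" "inv (f p) \<in> chart_dom e"
  shows "hol_at j s i e (\<lambda>q. inv (f q)) p"
proof -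
  have "hol_at i c i e (\<lambda>g. inv g) (f p)"
    unfolding hol_at_def
  proof (rule holomorphic_map_mder)
    show "holomorphic_map i A i A (\<lambda>g. inv g)"
      using lie_group by (simp add: complex_lie_group_def)
    show "is_chart c" "is_chart e" using assms(2,3) by (auto intro: is_chart)
    show "f p \<in> chart_dom c" using hol_atD(4)[OF assms(1)] .
  qed (rule assms linear_j)+
  from hol_at_compose[OF assms(1) this] show ?thesis .
qed

lemma isCont_mult: "isCont f p \<Longrightarrow> isCont g p \<Longrightarrow> isCont (\<lambda>q. f q \<otimes> g q) p"
proof -
  assume fg: "isCont f p" "isCont g p"
  have "continuous_on UNIV (\<lambda>(g, h). g \<otimes> h)"
    using lie_group by (simp add: complex_lie_group_def holomorphic_map_def)
  then have "isCont (\<lambda>(g, h). g \<otimes> h) (f p, g p)" by (simp add: continuous_on_eq_continuous_at)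
  from isCont_o2[OF isCont_Pair[OF fg] this] show ?thesis by simp
qed

lemma isCont_inv: "isCont f p \<Longrightarrow> isCont (\<lambda>q. inv (f q)) p"
proof -
  assume f: "isCont f p"
  have "continuous_on UNIV (\<lambda>g. inv g)"
    using lie_group by (simp add: complex_lie_group_def holomorphic_map_def)
  then have "isCont (\<lambda>g. inv g) (f p)" by (simp add: continuous_on_eq_continuous_at)
  from isCont_o2[OF f this] show ?thesis .
qed

lemma isCont_nat_pow: "isCont f p \<Longrightarrow> isCont (\<lambda>q. f q [^] (n::nat)) p"
  by (induction n) (auto intro: isCont_mult)

lemma isCont_int_pow: "isCont f p \<Longrightarrow> isCont (\<lambda>q. f q [^] (n::int)) p"
  unfolding int_pow_def2 by (cases "n < 0") (simp_all only: if_True if_False isCont_nat_pow isCont_inv)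

abbreviation c0 where "c0 \<equiv> chart_at A \<one>"

lemma c0: "c0 \<in> A" "is_chart c0" "\<one> \<in> chart_dom c0"
  using chart_at_in by auto

definition kk :: "'g \<Rightarrow> 'l" where "kk g = chart_map c0 g - chart_map c0 \<one>"
definition ee :: "'l \<Rightarrow> 'g" where "ee a = chart_inv c0 (chart_map c0 \<one> + a)"

lemma ee_0 [simp]: "ee 0 = \<one>" using chart_facts(4)[OF c0(2,3)] by (simp add: ee_def)
lemma kk_1 [simp]: "kk \<one> = 0" by (simp add: kk_def)
lemma ee_kk: "g \<in> chart_dom c0 \<Longrightarrow> ee (kk g) = g"
  using chart_facts(4)[OF c0(2)] by (simp add: ee_def kk_def)

definition ee_dom where "ee_dom = {a. chart_map c0 \<one> + a \<in> chart_map c0 ` chart_dom c0}"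

lemma ee_dom: "open ee_dom" "0 \<in> ee_dom"
proof -
  have "ee_dom = (\<lambda>a. chart_map c0 \<one> + a) -` (chart_map c0 ` chart_dom c0)" by (auto simp: ee_dom_def)
  moreover have "open \<dots>" by (intro open_vimage chart_facts(2)[OF c0(2)] continuous_intros)
  ultimately show "open ee_dom" by simp
  show "0 \<in> ee_dom" using c0 by (simp add: ee_dom_def)
qed

lemma mder_ee: "a \<in> ee_dom \<Longrightarrow> mder vec_chart c0 ee a (\<lambda>v. v)"
proof -
  assume a: "a \<in> ee_dom"
  have "((\<lambda>a. chart_map c0 \<one> + a) has_derivative (\<lambda>v. v)) (at a)" by (auto intro!: derivative_eq_intros)
  from mder_compose[OF mder_vec[OF this] mder_chart_inv[OF c0(2)]] a show ?thesis
    by (simp add: ee_dom_def ee_def[abs_def])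
qed

lemma mder_kk: "g \<in> chart_dom c0 \<Longrightarrow> mder c0 vec_chart kk g (\<lambda>v. v)"
proof -
  assume g: "g \<in> chart_dom c0"
  have "((\<lambda>a. a - chart_map c0 \<one>) has_derivative (\<lambda>v. v)) (at (chart_map c0 g))" by (auto intro!: derivative_eq_intros)
  from mder_compose[OF mder_chart_map[OF c0(2) g] mder_vec[OF this]] show ?thesis
    by (simp add: kk_def[abs_def])
qed

lemma clinear_id: "clinear_map j j (\<lambda>v. v)" by (auto simp: clinear_map_def intro!: linearI)

lemma hol_ee: "a \<in> ee_dom \<Longrightarrow> hol_at i vec_chart i c0 ee a"
  and hol_kk: "g \<in> chart_dom c0 \<Longrightarrow> hol_at i c0 i vec_chart kk g"
  unfolding hol_at_def using mder_ee mder_kk clinear_id by blast+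

lemma isCont_ee: "a \<in> ee_dom \<Longrightarrow> isCont ee a" using hol_atD(5)[OF hol_ee] .

text \<open>The derivative of multiplication at the unit is linear in the pair and is the identity
  on each factor, since multiplying by the unit changes nothing; hence it is addition.\<close>

lemma mder_mult_one:
  assumes f: "mder s c0 f p F" "f p = \<one>" and g: "mder s c0 g p G" "g p = \<one>"
  shows "mder s c0 (\<lambda>q. f q \<otimes> g q) p (\<lambda>v. F v + G v)"
proof -
  have "hol_at (map_prod i i) (prod_chart c0 c0) i c0 (\<lambda>(g, h). g \<otimes> h) (\<one>, \<one>)"
    unfolding hol_at_def
  proof (rule holomorphic_map_mder)
    show "holomorphic_map (map_prod i i) (prod_atlas A A) i A (\<lambda>(g, h). g \<otimes> h)"
      using lie_group by (simp add: complex_lie_group_def)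
    show "prod_chart c0 c0 \<in> prod_atlas A A" using c0(1) unfolding prod_atlas_eq by blast
  qed (use c0 in \<open>auto simp: is_chart_prod linear_prod_i\<close>)
  then obtain D where D: "mder (prod_chart c0 c0) c0 (\<lambda>(g, h). g \<otimes> h) (\<one>, \<one>) D"
    by (auto simp: hol_at_def)
  have "mder c0 c0 (\<lambda>g. (\<lambda>(g, h). g \<otimes> h) (g, \<one>)) \<one> (\<lambda>v. D (v, 0))"
    by (rule mder_compose[OF mder_Pair[OF mder_id mder_const] D]) (use c0 in auto)
  then have "mder c0 c0 (\<lambda>g. g) \<one> (\<lambda>v. D (v, 0))" by simp
  from mder_unique[OF this mder_id[OF c0(2,3)]] have 1: "D (v, 0) = v" for v by (rule fun_cong)
  have "mder c0 c0 (\<lambda>g. (\<lambda>(g, h). g \<otimes> h) (\<one>, g)) \<one> (\<lambda>v. D (0, v))"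
    by (rule mder_compose[OF mder_Pair[OF mder_const mder_id] D]) (use c0 in auto)
  then have "mder c0 c0 (\<lambda>g. g) \<one> (\<lambda>v. D (0, v))" by simp
  from mder_unique[OF this mder_id[OF c0(2,3)]] have 2: "D (0, v) = v" for v by (rule fun_cong)
  have "D (v, w) = v + w" for v w
    using linear_add[OF mder_linear[OF D], of "(v, 0)" "(0, w)"] 1 2 by simp
  then show ?thesis
    using mder_compose[OF mder_Pair[OF f(1) g(1)], of c0 "\<lambda>(g, h). g \<otimes> h" D] D f(2) g(2) by simp
qed

lemma mder_inv_one:
  assumes f: "mder s c0 f p F" "f p = \<one>"
  shows "mder s c0 (\<lambda>q. inv (f q)) p (\<lambda>v. - F v)"
proof -
  have "hol_at i c0 i c0 (\<lambda>g. inv g) \<one>"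
    by (rule hol_inv[OF hol_at_id]) (use c0 in auto)
  then obtain D where D: "mder c0 c0 (\<lambda>g. inv g) \<one> D" by (auto simp: hol_at_def)
  have "mder c0 c0 (\<lambda>g. g \<otimes> inv g) \<one> (\<lambda>v. v + D v)"
    by (rule mder_mult_one[OF mder_id _ D]) (use c0 in auto)
  then have "mder c0 c0 (\<lambda>g. \<one>) \<one> (\<lambda>v. v + D v)" by simp
  from mder_unique[OF this mder_const[OF c0(2,2,3,3)]] have "D v = - v" for v
    by (simp add: fun_eq_iff) (metis add.inverse_unique)
  then show ?thesis using mder_compose[OF f(1), of c0 "\<lambda>g. inv g" D] D f(2) by simp
qed

lemma mder_nat_pow_one:
  assumes f: "mder s c0 f p F" "f p = \<one>"
  shows "mder s c0 (\<lambda>q. f q [^] (n::nat)) p (\<lambda>v. real n *\<^sub>R F v)"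
proof (induction n)
  case 0 show ?case using mder_const[OF mderD(1)[OF f(1)] c0(2) mderD(3)[OF f(1)] c0(3)] by simp
next
  case (Suc n)
  show ?case using mder_mult_one[OF Suc _ f] f(2) by (simp add: algebra_simps)
qed

lemma mder_int_pow_one:
  assumes f: "mder s c0 f p F" "f p = \<one>"
  shows "mder s c0 (\<lambda>q. f q [^] (n::int)) p (\<lambda>v. of_int n *\<^sub>R F v)"
proof (cases n rule: int_cases2)
  case (nonneg k)
  show ?thesis using mder_nat_pow_one[OF f, of k] unfolding nonneg int_pow_int by simp
next
  case (nonpos k)
  have "f p [^] k = \<one>" using f(2) by simp
  from mder_inv_one[OF mder_nat_pow_one[OF f, of k] this]
  show ?thesis unfolding nonpos by (simp add: int_pow_neg_int)
qed

section \<open>Squaring near the identity and the local exponential map\<close>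

definition sqm :: "'l \<Rightarrow> 'l" where "sqm a = kk (ee a \<otimes> ee a)"

text \<open>One predicate for both constants and the domain conditions lets \<open>dC\<close> and
  \<open>dr\<close> be chosen once, as the interpretation of the doubling map requires.\<close>

definition good :: "real \<Rightarrow> real \<Rightarrow> bool" where
  "good C r \<longleftrightarrow> holomorphic_doubling_map sqm C r i \<and>
     (\<forall>a. norm a < r \<longrightarrow> a \<in> ee_dom \<and> ee a \<otimes> ee a \<in> chart_dom c0)"

text \<open>Squaring minus doubling has derivative 0 at the origin and is complex differentiable
  near it, so \<open>quadratic_Lipschitz\<close> gives the defect estimate; holomorphy takes the
  place of bounds on second derivatives.\<close>

lemma ex_good: "\<exists>C r. good C r"
proof -
  have "isCont (\<lambda>a. ee a \<otimes> ee a) 0" using isCont_mult isCont_ee ee_dom(2) by blast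
  then have "((\<lambda>a. ee a \<otimes> ee a) \<longlongrightarrow> \<one>) (at 0)" by (simp add: isCont_def)
  from topological_tendstoD[OF this chart_facts(1)[OF c0(2)] c0(3)]
  have "\<forall>\<^sub>F a in at 0. ee a \<otimes> ee a \<in> chart_dom c0" .
  moreover have "\<forall>\<^sub>F a in at 0. a \<in> ee_dom" using ee_dom by (rule eventually_at_in_open')
  ultimately have "\<forall>\<^sub>F a in at 0. a \<in> ee_dom \<and> ee a \<otimes> ee a \<in> chart_dom c0" by eventually_elim simp
  then obtain r1 where r1: "r1 > 0" and r1': "\<And>a. a \<noteq> 0 \<Longrightarrow> norm a < r1 \<Longrightarrow> a \<in> ee_dom \<and> ee a \<otimes> ee a \<in> chart_dom c0"
    unfolding eventually_at by (auto simp: dist_norm)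
  have ball: "a \<in> ee_dom" "ee a \<otimes> ee a \<in> chart_dom c0" if "norm a < r1" for a
    using r1'[of a] that ee_dom(2) c0 by (cases "a = 0"; simp)+
  have cd: "complex_differentiable_at i i sqm a" if "norm a < r1" for a
  proof -
    have "hol_at i vec_chart i c0 (\<lambda>a. ee a \<otimes> ee a) a"
      by (rule hol_mult[OF hol_ee hol_ee c0(1) c0(1) c0(1)]) (use ball[OF that] in auto)
    from hol_at_compose[OF this hol_kk] ball(2)[OF that] show ?thesis
      by (simp add: hol_at_vec_iff[symmetric] sqm_def[abs_def])
  qed
  have "mder vec_chart c0 (\<lambda>a. ee a \<otimes> ee a) 0 (\<lambda>v. v + v)"
    by (rule mder_mult_one[OF mder_ee _ mder_ee]) (use ee_dom in auto)
  from mder_compose[OF this, of vec_chart kk "\<lambda>v. v"] mder_kk[OF c0(3)]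
  have "mder vec_chart vec_chart sqm 0 (\<lambda>v. v + v)" by (simp add: sqm_def[abs_def])
  then have d0: "(sqm has_derivative (\<lambda>v. v + v)) (at 0)" by (auto simp: mder_def o_def)
  define R where "R a = sqm a + (- 2) *\<^sub>R a" for a
  have "((\<lambda>a. sqm a + (- 2) *\<^sub>R a) has_derivative (\<lambda>v. (v + v) + (- 2) *\<^sub>R v)) (at 0)"
    by (intro has_derivative_add d0 has_derivative_scaleR_right has_derivative_ident)
  moreover have "(\<lambda>v::'l. (v + v) + (- 2) *\<^sub>R v) = (\<lambda>_. 0)" by (auto simp: scaleR_2[symmetric])
  ultimately have dR: "(R has_derivative (\<lambda>_. 0)) (at 0)" by (simp add: R_def[abs_def])
  have lin: "complex_differentiable_at i i (\<lambda>a. (- 2) *\<^sub>R a) x" for x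
    unfolding complex_differentiable_at_def
    by (intro exI[of _ "\<lambda>a. (- 2) *\<^sub>R a"] conjI has_derivative_scaleR_right has_derivative_ident) (simp add: j_simps)
  have cdR: "complex_differentiable_at i i R a" if "a \<in> ball 0 r1" for a
    unfolding R_def using that by (intro complex_differentiable_at_add cd lin linear_j) simp
  obtain C r where Cr: "C > 0" "r > 0" "r \<le> r1"
    and q: "\<forall>a\<in>ball 0 r. \<forall>b\<in>ball 0 r. norm (R a - R b) \<le> C * (norm a + norm b) * norm (a - b)"
    using quadratic_Lipschitz[OF fd_complex_model r1 cdR dR] by auto
  have "good C r"
    unfolding good_def
  proof (intro conjI allI impI)
    show "holomorphic_doubling_map sqm C r i"
    proof unfold_locales
      show "sqm 0 = 0" by (simp add: sqm_def)
      fix a b :: 'l assume "norm a < r" "norm b < r"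
      then have "norm (R a - R b) \<le> C * (norm a + norm b) * norm (a - b)" using q by simp
      moreover have "R a - R b = sqm a - sqm b - 2 *\<^sub>R (a - b)" by (simp add: R_def algebra_simps)
      ultimately show "norm (sqm a - sqm b - 2 *\<^sub>R (a - b)) \<le> C * (norm a + norm b) * norm (a - b)" by simp
    qed (use Cr cd in auto)
  qed (use ball Cr in auto)
  then show ?thesis by blast
qed

definition dC where "dC = (SOME C. \<exists>r. good C r)"
definition dr where "dr = (SOME r. good dC r)"

lemma good: "good dC dr"
proof -
  have "\<exists>r. good dC r" unfolding dC_def using someI_ex[OF ex_good] .
  then show ?thesis unfolding dr_def by (rule someI_ex)
qed

sublocale dm: holomorphic_doubling_map sqm dC dr i
  using good by (simp add: good_def)

abbreviation rad where "rad \<equiv> dm.rad"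
abbreviation lim_map where "lim_map \<equiv> dm.lim_map"

lemma rad_pos: "rad > 0" using dm.rad by simp

lemma rad_dom:
  assumes "norm a < rad" shows "a \<in> ee_dom" "ee a \<otimes> ee a = ee (sqm a)"
proof -
  have "norm a < dr" using assms dm.rad by simp
  then have a: "a \<in> ee_dom" "ee a \<otimes> ee a \<in> chart_dom c0" using good by (auto simp: good_def)
  then show "a \<in> ee_dom" "ee a \<otimes> ee a = ee (sqm a)" by (auto simp: sqm_def ee_kk)
qed

lemma ee_pow:
  assumes "\<And>k. k < n \<Longrightarrow> norm ((sqm ^^ k) a) < rad"
  shows "ee a [^] (2 ^ n :: nat) = ee ((sqm ^^ n) a)"
  using assms
proof (induction n)
  case (Suc n)
  have "ee a [^] (2 ^ Suc n :: nat) = ee a [^] (2 ^ n :: nat) \<otimes> ee a [^] (2 ^ n :: nat)"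
    by (simp add: nat_pow_mult mult_2)
  then show ?case using Suc rad_dom(2)[of "(sqm ^^ n) a"] by simp
qed simp

definition expl where "expl a = ee (lim_map a)"

lemma lim_dom: "norm a < rad / 2 \<Longrightarrow> lim_map a \<in> ee_dom"
  using dm.lim_bound[of a] by (intro rad_dom) simp

lemma pow_limit:
  assumes a: "norm a < rad / 2" and lim: "(\<lambda>n. 2 ^ n *\<^sub>R kk (g n)) \<longlonglongrightarrow> a"
    and dom: "\<forall>\<^sub>F n in sequentially. g n \<in> chart_dom c0"
  shows "(\<lambda>n. g n [^] (2 ^ n :: nat)) \<longlonglongrightarrow> expl a"
proof -
  have "(\<lambda>n. ee ((sqm ^^ n) (kk (g n)))) \<longlonglongrightarrow> ee (lim_map a)"
    using isCont_tendsto_compose[OF isCont_ee[OF lim_dom[OF a]] dm.pow_tendsto[OF a lim]] .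
  moreover have "\<forall>\<^sub>F n in sequentially. ee ((sqm ^^ n) (kk (g n))) = g n [^] (2 ^ n :: nat)"
    using dom dm.pow_stays[OF lim a]
  proof eventually_elim
    case (elim n)
    then show ?case using ee_pow[of n "kk (g n)"] by (simp add: ee_kk)
  qed
  ultimately show ?thesis unfolding expl_def by (rule Lim_transform_eventually)
qed

text \<open>To first order only the velocity v of the curve matters, so its dyadic powers converge
  to the local exponential. Identities for the exponential follow by a suitable choice of the
  curve.\<close>

lemma curve_pow_limit:
  assumes g: "mder vec_chart c0 g (0::real) (\<lambda>t. t *\<^sub>R v)" "g 0 = \<one>" and t: "norm (t *\<^sub>R v) < rad / 2"
  shows "(\<lambda>n. g (t / 2 ^ n) [^] (2 ^ n :: nat)) \<longlonglongrightarrow> expl (t *\<^sub>R v)"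
proof (rule pow_limit[OF t])
  have lim0: "(\<lambda>n. t / 2 ^ n) \<longlonglongrightarrow> 0" by real_asymp
  have "isCont g 0" using mderD(5)[OF g(1)] .
  from isCont_tendsto_compose[OF this lim0] have "(\<lambda>n. g (t / 2 ^ n)) \<longlonglongrightarrow> \<one>" using g(2) by simp
  from topological_tendstoD[OF this chart_facts(1)[OF c0(2)] c0(3)]
  show "\<forall>\<^sub>F n in sequentially. g (t / 2 ^ n) \<in> chart_dom c0" .
  have "mder vec_chart vec_chart (\<lambda>t. kk (g t)) 0 (\<lambda>t. t *\<^sub>R v)"
    using mder_compose[OF g(1), of vec_chart kk "\<lambda>v. v"] mder_kk[OF c0(3)] g(2) by simp
  then have "((\<lambda>t. kk (g t)) has_vector_derivative v) (at 0)"
    by (simp add: mder_def o_def has_vector_derivative_def)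
  then have d: "((\<lambda>t. kk (g t) /\<^sub>R t) \<longlongrightarrow> v) (at 0)"
    using vector_derivative_quotient[of "\<lambda>t. kk (g t)" v] g(2) by simp
  show "(\<lambda>n. 2 ^ n *\<^sub>R kk (g (t / 2 ^ n))) \<longlonglongrightarrow> t *\<^sub>R v"
  proof (cases "t = 0")
    case False
    have "filterlim (\<lambda>n. t / 2 ^ n) (at 0) sequentially"
      using lim0 False by (intro filterlim_atI) auto
    from tendsto_scaleR[OF tendsto_const[of t] filterlim_compose[OF d this]] False
    show ?thesis by (simp add: field_simps)
  qed (simp add: g(2))
qed

end

section \<open>One-parameter subgroups and the global exponential map\<close>

context clie_group
begin

lemma pow_swap: "(g [^] (z::int)) [^] (n::nat) = (g [^] n) [^] z"
proof -
  have "(g [^] z) [^] (int n) = (g [^] int n) [^] z"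
    by (simp add: int_pow_pow mult.commute)
  then show ?thesis by (simp add: int_pow_int)
qed

lemma mder_scale_curve:
  assumes "mder vec_chart c0 f 0 (\<lambda>v. v)"
  shows "mder vec_chart c0 (\<lambda>t::real. f (t *\<^sub>R v)) 0 (\<lambda>t. t *\<^sub>R v)"
proof -
  have "((\<lambda>t::real. t *\<^sub>R v) has_derivative (\<lambda>t. t *\<^sub>R v)) (at 0)" by (auto intro!: derivative_eq_intros)
  from mder_compose[OF mder_vec[OF this], of c0 f "\<lambda>v. v"] assms show ?thesis by simp
qed

lemma mder_expl: "mder vec_chart c0 expl 0 (\<lambda>v. v)"
proof -
  have "(lim_map has_derivative (\<lambda>v. v)) (at 0)"
  proof (rule has_derivativeI_sandwich[where e = "rad / 2" and H = "\<lambda>h. 2 * dC * norm h"])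
    show "((\<lambda>h. 2 * dC * norm h) \<longlongrightarrow> 0) (at (0::'l))"
      by (intro tendsto_mult_right_zero tendsto_norm_zero tendsto_ident_at)
    fix h :: 'l assume h: "h \<noteq> 0" "dist h 0 < rad / 2"
    then have "norm (lim_map h - h) \<le> 2 * dC * norm h * norm h"
      using dm.lim_estimate[of h 0] rad_pos by simp
    then show "norm (lim_map h - lim_map 0 - (h - 0)) / norm (h - 0) \<le> 2 * dC * norm h"
      using h by (simp add: divide_le_eq)
  qed (use rad_pos in auto)
  from mder_compose[OF mder_vec[OF this], of c0 ee "\<lambda>v. v"] mder_ee[OF ee_dom(2)]
  show ?thesis by (simp add: expl_def[abs_def])
qed

lemma expl_0 [simp]: "expl 0 = \<one>" by (simp add: expl_def)

lemma isCont_expl: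
  assumes "norm a < rad / 2" shows "isCont expl a"
proof -
  have "isCont lim_map a"
    using dm.continuous_on_lim_map assms by (simp add: continuous_on_eq_continuous_at)
  from isCont_o2[OF this isCont_ee[OF lim_dom[OF assms]]] show ?thesis by (simp add: expl_def[abs_def])
qed

text \<open>The z-th power of the curve \<open>ee (t *\<^sub>R h)\<close> has velocity
  \<open>of_int z *\<^sub>R h\<close>, and taking the z-th power commutes with dyadic powers and
  their limit.\<close>

lemma expl_int:
  assumes h: "norm h < rad / 2" and zh: "norm (of_int z *\<^sub>R h) < rad / 2"
  shows "expl (of_int z *\<^sub>R h) = expl h [^] z"
proof -
  have m: "mder vec_chart c0 (\<lambda>t::real. ee (t *\<^sub>R h)) 0 (\<lambda>t. t *\<^sub>R h)"
    by (rule mder_scale_curve[OF mder_ee[OF ee_dom(2)]])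
  have "mder vec_chart c0 (\<lambda>t::real. ee (t *\<^sub>R h) [^] z) 0 (\<lambda>t. t *\<^sub>R (of_int z *\<^sub>R h))"
    using mder_int_pow_one[OF m, of z] by (simp add: mult.commute)
  from curve_pow_limit[OF this, of 1] zh
  have 1: "(\<lambda>n. (ee ((1 / 2 ^ n) *\<^sub>R h) [^] z) [^] (2 ^ n :: nat)) \<longlonglongrightarrow> expl (of_int z *\<^sub>R h)"
    by simp
  have "(\<lambda>n. ee ((1 / 2 ^ n) *\<^sub>R h) [^] (2 ^ n :: nat)) \<longlonglongrightarrow> expl h"
    using curve_pow_limit[OF m, of 1] h by simp
  then have "(\<lambda>n. (ee ((1 / 2 ^ n) *\<^sub>R h) [^] (2 ^ n :: nat)) [^] z) \<longlonglongrightarrow> expl h [^] z"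
    using isCont_tendsto_compose[OF isCont_int_pow[OF continuous_ident]] by blast
  with 1 show ?thesis unfolding pow_swap by (rule LIMSEQ_unique)
qed

text \<open>Dyadic rounding makes both parameters integer multiples of one step, where additivity is
  a law of powers; continuity carries it to the limit. The bound \<open>rad / 8\<close> leaves room
  for the sum of two rounded parameters, each at most 2 in absolute value.\<close>

lemma expl_add_unit:
  assumes v: "norm v < rad / 8" and s: "\<bar>s\<bar> \<le> 1" and t: "\<bar>t\<bar> \<le> 1"
  shows "expl ((s + t) *\<^sub>R v) = expl (s *\<^sub>R v) \<otimes> expl (t *\<^sub>R v)"
proof -
  define fl where "fl s n = real_of_int \<lfloor>2 ^ n * s\<rfloor> / 2 ^ n" for s :: real and n :: nat
  have fl: "fl s n \<le> s" "s - 1 / 2 ^ n \<le> fl s n" for s n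
  proof -
    have "real_of_int \<lfloor>2 ^ n * s\<rfloor> / 2 ^ n \<le> (2 ^ n * s) / 2 ^ n" by (intro divide_right_mono) auto
    then show "fl s n \<le> s" by (simp add: fl_def)
    have "(2 ^ n * s - 1) / 2 ^ n \<le> real_of_int \<lfloor>2 ^ n * s\<rfloor> / 2 ^ n"
      by (intro divide_right_mono) (linarith, simp)
    then show "s - 1 / 2 ^ n \<le> fl s n" by (simp add: fl_def diff_divide_distrib)
  qed
  have fl_lim: "(\<lambda>n. fl s n) \<longlonglongrightarrow> s" for s
  proof (rule tendsto_sandwich[OF always_eventually always_eventually])
    show "\<forall>n. s - 1 / 2 ^ n \<le> fl s n" "\<forall>n. fl s n \<le> s" using fl by auto
    show "(\<lambda>n. s - 1 / 2 ^ n) \<longlonglongrightarrow> s" by real_asymp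
  qed auto
  have one: "1 / 2 ^ n \<le> (1::real)" for n by simp
  have bd: "\<bar>fl s n\<bar> \<le> 2" if "\<bar>s\<bar> \<le> 1" for s n
    using fl(1)[of s n] fl(2)[of s n] one[of n] that by linarith
  have nv: "norm (c *\<^sub>R v) < rad / 2" if "\<bar>c\<bar> \<le> 4" for c
  proof -
    have "norm (c *\<^sub>R v) \<le> 4 * norm v" using that by (simp add: mult_right_mono)
    then show ?thesis using v by simp
  qed
  have eq: "expl ((fl s n + fl t n) *\<^sub>R v) = expl (fl s n *\<^sub>R v) \<otimes> expl (fl t n *\<^sub>R v)" for n
  proof -
    define h where "h = (1 / 2 ^ n) *\<^sub>R v"
    have h: "norm h < rad / 2" using nv[of "1 / 2 ^ n"] one[of n] by (simp add: h_def)
    have e: "fl r n *\<^sub>R v = of_int \<lfloor>2 ^ n * r\<rfloor> *\<^sub>R h" for r by (simp add: fl_def h_def)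
    have e2: "(fl s n + fl t n) *\<^sub>R v = of_int (\<lfloor>2 ^ n * s\<rfloor> + \<lfloor>2 ^ n * t\<rfloor>) *\<^sub>R h"
      by (simp add: scaleR_left_distrib e)
    have "expl (fl r n *\<^sub>R v) = expl h [^] \<lfloor>2 ^ n * r\<rfloor>" if "\<bar>r\<bar> \<le> 1" for r
      unfolding e by (intro expl_int h, unfold e[symmetric], intro nv, use bd[OF that, of n] in linarith)
    from this[OF s] this[OF t]
    have "expl (fl s n *\<^sub>R v) = expl h [^] \<lfloor>2 ^ n * s\<rfloor>" "expl (fl t n *\<^sub>R v) = expl h [^] \<lfloor>2 ^ n * t\<rfloor>" .
    moreover have "expl ((fl s n + fl t n) *\<^sub>R v) = expl h [^] (\<lfloor>2 ^ n * s\<rfloor> + \<lfloor>2 ^ n * t\<rfloor>)"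
      unfolding e2 by (intro expl_int h, unfold e2[symmetric], intro nv, use bd[OF s, of n] bd[OF t, of n] in linarith)
    ultimately show ?thesis by (simp add: int_pow_mult)
  qed
  have lim: "(\<lambda>n. expl (c n *\<^sub>R v)) \<longlonglongrightarrow> expl (c' *\<^sub>R v)" if "c \<longlonglongrightarrow> c'" "\<bar>c'\<bar> \<le> 4" for c c'
    by (rule isCont_tendsto_compose[OF isCont_expl[OF nv[OF that(2)]]]) (intro tendsto_intros that)
  have "(\<lambda>n. expl ((fl s n + fl t n) *\<^sub>R v)) \<longlonglongrightarrow> expl ((s + t) *\<^sub>R v)"
    by (rule lim[OF tendsto_add[OF fl_lim fl_lim]]) (use s t in linarith)
  moreover have "(\<lambda>n. expl ((fl s n + fl t n) *\<^sub>R v)) \<longlonglongrightarrow> expl (s *\<^sub>R v) \<otimes> expl (t *\<^sub>R v)"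
  proof -
    have l: "(\<lambda>n. (expl (fl s n *\<^sub>R v), expl (fl t n *\<^sub>R v))) \<longlonglongrightarrow> (expl (s *\<^sub>R v), expl (t *\<^sub>R v))"
      by (intro tendsto_Pair lim fl_lim) (use s t in linarith)+
    have "isCont (\<lambda>x. fst x \<otimes> snd x) (expl (s *\<^sub>R v), expl (t *\<^sub>R v))"
      by (intro isCont_mult isCont_fst isCont_snd continuous_ident)
    from isCont_tendsto_compose[OF this l] show ?thesis by (simp add: eq)
  qed
  ultimately show ?thesis by (rule LIMSEQ_unique)
qed

lemma expl_add:
  assumes "norm (s *\<^sub>R v) < rad / 8" "norm (t *\<^sub>R v) < rad / 8"
  shows "expl ((s + t) *\<^sub>R v) = expl (s *\<^sub>R v) \<otimes> expl (t *\<^sub>R v)"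
proof -
  define m where "m = max \<bar>s\<bar> \<bar>t\<bar>"
  show ?thesis
  proof (cases "m = 0")
    case True
    then have "s = 0" "t = 0" by (auto simp: m_def max_def split: if_splits)
    then show ?thesis by simp
  next
    case False
    then have m: "m > 0" by (auto simp: m_def max_def split: if_splits)
    have "norm (m *\<^sub>R v) < rad / 8" using assms by (auto simp: m_def max_def)
    moreover have "\<bar>s / m\<bar> \<le> 1" "\<bar>t / m\<bar> \<le> 1" using m by (auto simp: m_def abs_divide)
    ultimately have "expl ((s / m + t / m) *\<^sub>R (m *\<^sub>R v)) = expl ((s / m) *\<^sub>R (m *\<^sub>R v)) \<otimes> expl ((t / m) *\<^sub>R (m *\<^sub>R v))"
      by (rule expl_add_unit)
    then show ?thesis using m by (simp add: add_divide_distrib[symmetric])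
  qed
qed

text \<open>\<open>expl\<close> is meaningful only near 0, so the argument is halved until it is small and the
  result is squared back.\<close>

definition small :: "nat \<Rightarrow> 'l \<Rightarrow> bool" where "small n a \<longleftrightarrow> norm a < 2 ^ n * (rad / 8)"

definition EXP :: "'l \<Rightarrow> 'g" where
  "EXP a = expl ((1 / 2 ^ (LEAST n. small n a)) *\<^sub>R a) [^] (2 ^ (LEAST n. small n a) :: nat)"

lemma ex_small: "\<exists>n. small n a"
proof -
  obtain n where "norm a / (rad / 8) < 2 ^ n" using real_arch_pow[of 2 "norm a / (rad / 8)"] by auto
  then show ?thesis using rad_pos by (intro exI[of _ n]) (simp add: small_def field_simps)
qed

lemma small_mono:
  assumes "small m a" "m \<le> n" shows "small n a"
proof -
  have "(2::real) ^ m * (rad / 8) \<le> 2 ^ n * (rad / 8)" using assms(2) rad_pos by (intro mult_right_mono power_increasing) auto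
  then show ?thesis using assms(1) by (simp add: small_def)
qed

lemma smallD: "small n a \<Longrightarrow> norm ((1 / 2 ^ n) *\<^sub>R a) < rad / 8"
  by (simp add: small_def field_simps)

lemma expl_double:
  assumes "norm a < rad / 8" shows "expl a = expl ((1/2) *\<^sub>R a) \<otimes> expl ((1/2) *\<^sub>R a)"
  using expl_add[of "1/2" a "1/2"] assms norm_ge_zero[of a] by simp

text \<open>Any sufficient number of halvings gives the same value, since one more halving is undone
  by one more squaring.\<close>

lemma EXP_eq:
  assumes "small n a" shows "EXP a = expl ((1 / 2 ^ n) *\<^sub>R a) [^] (2 ^ n :: nat)"
proof -
  define m where "m = (LEAST n. small n a)"
  have m: "small m a" unfolding m_def by (rule LeastI_ex[OF ex_small])
  have "m \<le> n" unfolding m_def using assms by (rule Least_le)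
  then have "expl ((1 / 2 ^ n) *\<^sub>R a) [^] (2 ^ n :: nat) = expl ((1 / 2 ^ m) *\<^sub>R a) [^] (2 ^ m :: nat)"
  proof (induction rule: dec_induct)
    case (step k)
    have "norm ((1 / 2 ^ k) *\<^sub>R a) < rad / 8" by (rule smallD[OF small_mono[OF m step(1)]])
    from expl_double[OF this]
    have "expl ((1 / 2 ^ k) *\<^sub>R a) = expl ((1 / 2 ^ Suc k) *\<^sub>R a) [^] (2::nat)"
      by (simp add: numeral_2_eq_2)
    then have "expl ((1 / 2 ^ k) *\<^sub>R a) [^] (2 ^ k :: nat) = expl ((1 / 2 ^ Suc k) *\<^sub>R a) [^] (2 ^ Suc k :: nat)"
      by (simp add: nat_pow_pow)
    then show ?case using step by simp
  qed simp
  then show ?thesis by (simp add: EXP_def m_def)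
qed

lemma EXP_local: "norm a < rad / 8 \<Longrightarrow> EXP a = expl a"
  using EXP_eq[of 0 a] by (simp add: small_def)

lemma EXP_0 [simp]: "EXP 0 = \<one>" using EXP_local[of 0] rad_pos by simp

lemma EXP_add: "EXP ((s + t) *\<^sub>R v) = EXP (s *\<^sub>R v) \<otimes> EXP (t *\<^sub>R v)"
proof -
  obtain k1 k2 k3 where k: "small k1 (s *\<^sub>R v)" "small k2 (t *\<^sub>R v)" "small k3 ((s + t) *\<^sub>R v)"
    using ex_small by metis
  define n where "n = max k1 (max k2 k3)"
  have n: "small n (s *\<^sub>R v)" "small n (t *\<^sub>R v)" "small n ((s + t) *\<^sub>R v)"
    by (rule small_mono[OF k(1)] small_mono[OF k(2)] small_mono[OF k(3)], simp add: n_def)+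
  define w where "w = (1 / 2 ^ n) *\<^sub>R v"
  have w: "norm (s *\<^sub>R w) < rad / 8" "norm (t *\<^sub>R w) < rad / 8"
    using smallD[OF n(1)] smallD[OF n(2)] by (auto simp: w_def)
  have e: "(1 / 2 ^ n) *\<^sub>R (c *\<^sub>R v) = c *\<^sub>R w" for c by (simp add: w_def)
  \<comment> \<open>Additivity in both orders shows that the factors commute, as
    \<open>pow_mult_distrib\<close> demands.\<close>
  have "expl (s *\<^sub>R w) \<otimes> expl (t *\<^sub>R w) = expl (t *\<^sub>R w) \<otimes> expl (s *\<^sub>R w)"
    using expl_add[OF w] expl_add[OF w(2,1)] by (simp add: add.commute)
  then have "(expl (s *\<^sub>R w) \<otimes> expl (t *\<^sub>R w)) [^] (2 ^ n :: nat)
      = expl (s *\<^sub>R w) [^] (2 ^ n :: nat) \<otimes> expl (t *\<^sub>R w) [^] (2 ^ n :: nat)"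
    by (intro pow_mult_distrib) auto
  then show ?thesis unfolding EXP_eq[OF n(1)] EXP_eq[OF n(2)] EXP_eq[OF n(3)] e expl_add[OF w] .
qed

lemma isCont_EXP: "isCont EXP a"
proof -
  obtain n where n: "small n a" using ex_small by blast
  define S where "S = {a. small n a}"
  have S: "open S" "a \<in> S" unfolding S_def small_def using n by (auto intro!: open_Collect_less continuous_intros simp: small_def)
  have "norm ((1 / 2 ^ n) *\<^sub>R a) < rad / 2" using smallD[OF n] rad_pos by linarith
  then have "isCont expl ((1 / 2 ^ n) *\<^sub>R a)" by (rule isCont_expl)
  then have "isCont (\<lambda>b. expl ((1 / 2 ^ n) *\<^sub>R b)) a"
    by (intro isCont_o2[of a "\<lambda>b. (1 / 2 ^ n) *\<^sub>R b" expl] continuous_intros)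
  then have 1: "isCont (\<lambda>b. expl ((1 / 2 ^ n) *\<^sub>R b) [^] (2 ^ n :: nat)) a" by (rule isCont_nat_pow)
  have "\<forall>\<^sub>F b in nhds a. expl ((1 / 2 ^ n) *\<^sub>R b) [^] (2 ^ n :: nat) = EXP b"
    unfolding eventually_nhds using S EXP_eq by (intro exI[of _ S]) (auto simp: S_def)
  from isCont_cong[OF this] 1 show ?thesis by simp
qed

lemma mder_EXP: "mder vec_chart c0 EXP 0 (\<lambda>v. v)"
  by (rule mder_cong[OF mder_expl open_ball, of 0 "rad / 8"]) (use rad_pos EXP_local in auto)

lemma mder_EXP_curve: "mder vec_chart c0 (\<lambda>t::real. EXP (t *\<^sub>R v)) 0 (\<lambda>t. t *\<^sub>R v)"
  by (rule mder_scale_curve[OF mder_EXP])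

text \<open>A homomorphism equals the dyadic powers of its values at \<open>t / 2 ^ n\<close>
  exactly, while these powers tend to the exponential. This gives uniqueness of one-parameter
  subgroups and reduces later identities to comparing velocities.\<close>

lemma hom_curve_eq:
  assumes hom: "\<And>s t. g (s + t) = g s \<otimes> g t" and d: "mder vec_chart c0 g (0::real) (\<lambda>t. t *\<^sub>R v)"
  shows "g t = EXP (t *\<^sub>R v)"
proof -
  have "g 0 \<otimes> g 0 = g 0" using hom[of 0 0] by simp
  then have g0: "g 0 = \<one>" using l_cancel_one[of "g 0" "g 0"] by simp
  have pow: "g t = g (t / 2 ^ n) [^] (2 ^ n :: nat)" for t n
  proof (induction n arbitrary: t)
    case (Suc n)
    have "g t = g (t / 2) \<otimes> g (t / 2)" using hom[of "t/2" "t/2"] by simp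
    also have "\<dots> = g (t / 2 / 2 ^ n) [^] (2 ^ n :: nat) \<otimes> g (t / 2 / 2 ^ n) [^] (2 ^ n :: nat)" using Suc by metis
    also have "\<dots> = g (t / 2 / 2 ^ n) [^] (2 ^ n + 2 ^ n :: nat)" by (rule nat_pow_mult) simp
    also have "t / 2 / 2 ^ n = t / 2 ^ Suc n" by simp
    also have "(2 ^ n + 2 ^ n :: nat) = 2 ^ Suc n" by simp
    finally show ?case .
  qed simp
  obtain n where n: "small n (t *\<^sub>R v)" using ex_small by blast
  define u where "u = t / 2 ^ n"
  have u: "norm (u *\<^sub>R v) < rad / 8" using smallD[OF n] by (simp add: u_def)
  have "(\<lambda>k. g (u / 2 ^ k) [^] (2 ^ k :: nat)) \<longlonglongrightarrow> expl (u *\<^sub>R v)"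
    by (rule curve_pow_limit[OF d g0]) (use u rad_pos in linarith)
  then have "g u = expl (u *\<^sub>R v)" unfolding pow[symmetric] by (simp add: LIMSEQ_const_iff)
  then show ?thesis using pow[of t n] EXP_eq[OF n] by (simp add: u_def)
qed

lemma lie_exp_EXP: "lie_exp L A v = EXP v"
proof -
  have cont: "continuous_on UNIV (\<lambda>t::real. EXP (t *\<^sub>R v))"
    by (auto simp: continuous_on_eq_continuous_at intro!: isCont_o2[OF _ isCont_EXP] continuous_intros)
  have 1: "one_parameter_subgroup L A v (\<lambda>t. EXP (t *\<^sub>R v))"
    using mder_EXP_curve[of v] cont EXP_add
    unfolding one_parameter_subgroup_def by (auto simp: mder_vec_iff has_vector_derivative_def)
  have 2: "g = (\<lambda>t. EXP (t *\<^sub>R v))" if g: "one_parameter_subgroup L A v g" for g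
  proof
    fix t
    have c: "continuous_on UNIV g" and h: "\<And>s t. g (s + t) = g s \<otimes> g t"
      and d: "((\<lambda>t. chart_map c0 (g t)) has_derivative (\<lambda>t. t *\<^sub>R v)) (at 0)"
      using g by (auto simp: one_parameter_subgroup_def has_vector_derivative_def)
    have "g 0 \<otimes> g 0 = g 0" using h[of 0 0] by simp
    then have g0: "g 0 = \<one>" using l_cancel_one[of "g 0" "g 0"] by simp
    have "isCont g 0" using c by (simp add: continuous_on_eq_continuous_at)
    then have "mder vec_chart c0 g 0 (\<lambda>t. t *\<^sub>R v)" using d g0 by (simp add: mder_vec_iff)
    then show "g t = EXP (t *\<^sub>R v)" using hom_curve_eq[OF h] by blast
  qed
  have "(THE g. one_parameter_subgroup L A v g) = (\<lambda>t. EXP (t *\<^sub>R v))"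
    using 1 2 by (rule the_equality)
  then show ?thesis by (simp add: lie_exp_def)
qed

lemma EXP_minus: "EXP (- v) = inv (EXP v)"
proof -
  have "EXP v \<otimes> EXP (- v) = \<one>" using EXP_add[of 1 "-1" v] by simp
  then show ?thesis using inv_equality[of "EXP (-v)" "EXP v"] inv_comm by simp
qed

lemma EXP_nat_pow: "EXP (real n *\<^sub>R v) = EXP v [^] n"
  by (induction n) (use EXP_add[of "real _" 1 v] in \<open>auto simp: add.commute[of 1]\<close>)

lemma EXP_limit:
  assumes g: "mder vec_chart c0 g (0::real) (\<lambda>t. t *\<^sub>R v)" "g 0 = \<one>" and t: "norm (t *\<^sub>R v) < rad / 8"
  shows "(\<lambda>n. g (t / 2 ^ n) [^] (2 ^ n :: nat)) \<longlonglongrightarrow> EXP (t *\<^sub>R v)"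
  using curve_pow_limit[OF g, of t] t rad_pos EXP_local[OF t] by simp

lemma EXP_surj_near_one: "\<exists>V. open V \<and> \<one> \<in> V \<and> V \<subseteq> range EXP"
proof -
  define V where "V = chart_dom c0 \<inter> kk -` ball 0 (rad / 8)"
  have "open V" unfolding V_def
  proof (rule continuous_open_preimage)
    show "continuous_on (chart_dom c0) kk" unfolding kk_def by (intro continuous_intros chart_facts(7)[OF c0(2)])
  qed (use chart_facts(1)[OF c0(2)] in auto)
  moreover have "\<one> \<in> V" using c0 rad_pos by (simp add: V_def)
  moreover have "V \<subseteq> range EXP"
  proof
    fix g assume g: "g \<in> V"
    then obtain a where a: "norm a < rad / 2" "lim_map a = kk g" using dm.lim_map_surj[of "kk g"] by (auto simp: V_def)
    have "g = expl a" using a g ee_kk[of g] by (simp add: expl_def V_def)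
    \<comment> \<open>\<open>lim_map_surj\<close> places a only within \<open>rad / 2\<close>,
      whereas \<open>EXP\<close> and \<open>expl\<close> agree below \<open>rad / 8\<close>; hence
      the detour through an eighth of a.\<close>
    also have "expl a = expl ((1/8) *\<^sub>R a) [^] (8::int)"
    proof -
      have "norm ((1/8) *\<^sub>R a) < rad / 2" "norm (of_int 8 *\<^sub>R ((1/8) *\<^sub>R a)) < rad / 2"
        using a(1) norm_ge_zero[of a] rad_pos by auto
      from expl_int[OF this] show ?thesis by simp
    qed
    also have "\<dots> = EXP ((1/8) *\<^sub>R a) [^] (8::nat)"
      using EXP_local[of "(1/8) *\<^sub>R a"] a(1) rad_pos int_pow_int[of L "expl ((1/8) *\<^sub>R a)" 8] by simp
    also have "\<dots> = EXP (real 8 *\<^sub>R ((1/8) *\<^sub>R a))" by (rule EXP_nat_pow[symmetric])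
    finally show "g \<in> range EXP" by blast
  qed
  ultimately show ?thesis by blast
qed

lemma hol_EXP_line_small:
  assumes "norm (x + cscale i s y) < rad / 8"
  shows "hol_at ((*) \<i>) vec_chart i c0 (\<lambda>s. EXP (x + cscale i s y)) s"
proof -
  have lt: "norm (x + cscale i s y) < rad / 2" using assms rad_pos by linarith
  have "hol_at ((*) \<i>) vec_chart i vec_chart (\<lambda>s. lim_map (x + cscale i s y)) s"
    unfolding hol_at_vec_iff by (rule dm.lim_map_line[OF lt])
  from hol_at_compose[OF this hol_ee[OF lim_dom[OF lt]]]
  have h: "hol_at ((*) \<i>) vec_chart i c0 (\<lambda>s. expl (x + cscale i s y)) s" by (simp add: expl_def)
  define S where "S = {s. norm (x + cscale i s y) < rad / 8}"
  have "open S" unfolding S_def cscale_def by (intro open_Collect_less continuous_intros)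
  then show ?thesis
    by (rule hol_at_cong[OF h]) (use assms EXP_local in \<open>auto simp: S_def\<close>)
qed

end

section \<open>The adjoint representation\<close>

context clie_group
begin

abbreviation AD where "AD \<equiv> Ad L A"

lemma hol_const:
  assumes "is_chart s" "p \<in> chart_dom s" shows "hol_at j s i (chart_at A g) (\<lambda>_. g) p"
  by (rule hol_at_const[OF assms(1) is_chart_at assms(2) chart_at_dom linear_j])

lemma hol_conj:
  assumes f: "hol_at j s i c f p" "c \<in> A" and h: "hol_at j s i d h p" "d \<in> A"
    and e: "e \<in> A" "f p \<otimes> h p \<otimes> inv (f p) \<in> chart_dom e"
  shows "hol_at j s i e (\<lambda>q. f q \<otimes> h q \<otimes> inv (f q)) p"
proof -
  have 1: "hol_at j s i (chart_at A (f p \<otimes> h p)) (\<lambda>q. f q \<otimes> h q) p"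
    by (rule hol_mult[OF f(1) h(1) f(2) h(2) chart_at_in chart_at_dom])
  have 2: "hol_at j s i (chart_at A (inv (f p))) (\<lambda>q. inv (f q)) p"
    by (rule hol_inv[OF f chart_at_in chart_at_dom])
  show ?thesis by (rule hol_mult[OF 1 2 chart_at_in chart_at_in e])
qed

lemma hol_conj_one: "hol_at i c0 i c0 (\<lambda>h. g \<otimes> h \<otimes> inv g) \<one>"
  by (rule hol_conj[OF hol_const chart_at_in hol_at_id c0(1) c0(1)]) (use c0 in auto)

lemma mder_Ad: "mder c0 c0 (\<lambda>h. g \<otimes> h \<otimes> inv g) \<one> (AD g)"
  and clinear_Ad: "clinear_map i i (AD g)"
proof -
  obtain D where D: "clinear_map i i D" "mder c0 c0 (\<lambda>h. g \<otimes> h \<otimes> inv g) \<one> D"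
    using hol_conj_one by (auto simp: hol_at_def)
  have "frechet_derivative (chart_map c0 \<circ> (\<lambda>h. g \<otimes> h \<otimes> inv g) \<circ> chart_inv c0) (at (chart_map c0 \<one>)) = D"
    using frechet_derivative_at[OF mderD(6)[OF D(2)]] by (simp add: o_def)
  then have "AD g = D" by (simp add: Ad_def tangent_map_def[abs_def])
  with D show "mder c0 c0 (\<lambda>h. g \<otimes> h \<otimes> inv g) \<one> (AD g)" "clinear_map i i (AD g)" by auto
qed

lemma linear_Ad: "linear (AD g)" using clinear_Ad by (simp add: clinear_map_def)

lemma Ad_simps: "AD g (v + w) = AD g v + AD g w" "AD g (c *\<^sub>R v) = c *\<^sub>R AD g v" "AD g 0 = 0"
  "AD g (i v) = i (AD g v)" "AD g (cscale i s v) = cscale i s (AD g v)"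
  using linear_Ad[of g] clinear_Ad[of g] clinear_cscale[OF clinear_Ad]
  by (auto simp: linear_add linear_scale linear_0 clinear_map_def)

lemma Ad_mult: "AD (g \<otimes> h) v = AD g (AD h v)"
proof -
  have "mder c0 c0 (\<lambda>k. (\<lambda>k. g \<otimes> k \<otimes> inv g) (h \<otimes> k \<otimes> inv h)) \<one> (\<lambda>v. AD g (AD h v))"
    by (rule mder_compose[OF mder_Ad]) (use mder_Ad in simp)
  moreover have "(\<lambda>k. (\<lambda>k. g \<otimes> k \<otimes> inv g) (h \<otimes> k \<otimes> inv h)) = (\<lambda>k. (g \<otimes> h) \<otimes> k \<otimes> inv (g \<otimes> h))"
    by (simp add: m_assoc inv_mult_group)
  ultimately show ?thesis using mder_unique[OF mder_Ad[of "g \<otimes> h"]] by (simp add: fun_eq_iff)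
qed

lemma Ad_one: "AD \<one> v = v"
proof -
  have "mder c0 c0 (\<lambda>h. h) \<one> (AD \<one>)" using mder_Ad[of \<one>] by simp
  from mder_unique[OF this mder_id] show ?thesis using c0 by (simp add: fun_eq_iff)
qed

text \<open>Conjugation turns the one-parameter subgroup of v into another one, whose velocity is
  \<open>AD g v\<close>.\<close>

lemma EXP_Ad: "g \<otimes> EXP v \<otimes> inv g = EXP (AD g v)"
proof -
  define f where "f t = g \<otimes> EXP (t *\<^sub>R v) \<otimes> inv g" for t :: real
  have "f (s + t) = f s \<otimes> f t" for s t
  proof -
    have "inv g \<otimes> (g \<otimes> (EXP (t *\<^sub>R v) \<otimes> inv g)) = EXP (t *\<^sub>R v) \<otimes> inv g"
      by (simp add: m_assoc[symmetric])
    then show ?thesis unfolding f_def EXP_add by (simp add: m_assoc)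
  qed
  moreover have "mder vec_chart c0 f (0::real) (\<lambda>t. t *\<^sub>R AD g v)"
    using mder_compose[OF mder_EXP_curve[of v], of c0 "\<lambda>h. g \<otimes> h \<otimes> inv g" "AD g"] mder_Ad[of g]
    by (simp add: f_def[abs_def] Ad_simps)
  ultimately have "f 1 = EXP (1 *\<^sub>R AD g v)" by (rule hom_curve_eq)
  then show ?thesis by (simp add: f_def)
qed

lemma EXP_direction_eq:
  assumes "\<And>t. EXP (t *\<^sub>R a) = EXP (t *\<^sub>R b)" shows "a = b"
proof -
  have "(\<lambda>t. t *\<^sub>R a) = (\<lambda>t::real. t *\<^sub>R b)"
    using mder_unique[OF mder_EXP_curve[of a]] mder_EXP_curve[of b] assms by simp
  from fun_cong[OF this, of 1] show ?thesis by simp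
qed

lemma EXP_commute_add:
  assumes "\<And>s t. EXP (s *\<^sub>R a) \<otimes> EXP (t *\<^sub>R b) = EXP (t *\<^sub>R b) \<otimes> EXP (s *\<^sub>R a)"
  shows "EXP (a + b) = EXP a \<otimes> EXP b"
proof -
  define f where "f t = EXP (t *\<^sub>R a) \<otimes> EXP (t *\<^sub>R b)" for t :: real
  have "f (s + t) = f s \<otimes> f t" for s t
  proof -
    have "EXP (t *\<^sub>R a) \<otimes> (EXP (s *\<^sub>R b) \<otimes> EXP (t *\<^sub>R b)) = EXP (s *\<^sub>R b) \<otimes> (EXP (t *\<^sub>R a) \<otimes> EXP (t *\<^sub>R b))"
      using assms[of t s] by (simp add: m_assoc[symmetric])
    then show ?thesis unfolding f_def EXP_add by (simp add: m_assoc)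
  qed
  moreover have "mder vec_chart c0 f (0::real) (\<lambda>t. t *\<^sub>R (a + b))"
    using mder_mult_one[OF mder_EXP_curve[of a] _ mder_EXP_curve[of b]]
    by (simp add: f_def[abs_def] scaleR_right_distrib)
  ultimately have "f 1 = EXP (1 *\<^sub>R (a + b))" by (rule hom_curve_eq)
  then show ?thesis by (simp add: f_def)
qed

lemma EXP_add_if_Ad_fixes:
  assumes "\<And>t. AD (EXP (t *\<^sub>R a)) b = b"
  shows "EXP (a + b) = EXP a \<otimes> EXP b"
proof (rule EXP_commute_add)
  fix s t
  have "EXP (s *\<^sub>R a) \<otimes> EXP (t *\<^sub>R b) \<otimes> inv (EXP (s *\<^sub>R a)) = EXP (t *\<^sub>R b)"
    by (simp add: EXP_Ad Ad_simps assms)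
  then have "EXP (s *\<^sub>R a) \<otimes> EXP (t *\<^sub>R b) \<otimes> inv (EXP (s *\<^sub>R a)) \<otimes> EXP (s *\<^sub>R a) = EXP (t *\<^sub>R b) \<otimes> EXP (s *\<^sub>R a)"
    by simp
  then show "EXP (s *\<^sub>R a) \<otimes> EXP (t *\<^sub>R b) = EXP (t *\<^sub>R b) \<otimes> EXP (s *\<^sub>R a)" by (simp add: m_assoc)
qed

lemma Ad_EXP_self: "AD (EXP v) v = v"
proof (rule EXP_direction_eq)
  fix t :: real
  have "EXP v \<otimes> EXP (t *\<^sub>R v) = EXP (t *\<^sub>R v) \<otimes> EXP v"
    using EXP_add[of 1 t v] EXP_add[of t 1 v] by (simp add: add.commute)
  then have "EXP v \<otimes> EXP (t *\<^sub>R v) \<otimes> inv (EXP v) = EXP (t *\<^sub>R v)" by (simp add: m_assoc)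
  then show "EXP (t *\<^sub>R AD (EXP v) v) = EXP (t *\<^sub>R v)" by (simp add: EXP_Ad Ad_simps)
qed

text \<open>\<open>AD\<close> is complex linear, so for nonzero s fixing \<open>cscale i s v\<close>
  is the same as fixing v.\<close>

lemma Ad_EXP_cscale_self: "AD (EXP (cscale i s v)) v = v"
proof (cases "s = 0")
  case False
  have "cscale i s (AD (EXP (cscale i s v)) v) = cscale i s v"
    using Ad_EXP_self[of "cscale i s v"] by (simp add: Ad_simps)
  then have "cscale i (inverse s) (cscale i s (AD (EXP (cscale i s v)) v)) = cscale i (inverse s) (cscale i s v)" by simp
  then show ?thesis using False by (simp add: cscale_simps)
qed (simp add: cscale_simps Ad_one)

lemma EXP_cscale_add: "EXP (cscale i (s + t) v) = EXP (cscale i s v) \<otimes> EXP (cscale i t v)"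
  unfolding cscale_simps(2)
proof (rule EXP_add_if_Ad_fixes)
  fix r :: real
  have "r *\<^sub>R cscale i s v = cscale i (of_real r * s) v" by (simp add: cscale_def scaleR_right_distrib)
  then show "AD (EXP (r *\<^sub>R cscale i s v)) (cscale i t v) = cscale i t v"
    by (simp add: Ad_simps Ad_EXP_cscale_self)
qed

subsection \<open>Holomorphic dependence\<close>

text \<open>Keeps conjugates inside the chart; the bound 1 on their coordinates is the one that the
  parameter lemma for derivatives requires.\<close>

lemma conj_small:
  "\<exists>e>0. e \<le> rad / 8 \<and> (\<forall>a b. norm a < e \<longrightarrow> norm b < e \<longrightarrow> b \<in> ee_dom \<and>
     EXP a \<otimes> ee b \<otimes> inv (EXP a) \<in> chart_dom c0 \<and> norm (kk (EXP a \<otimes> ee b \<otimes> inv (EXP a))) < 1)"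
proof -
  define F where "F x = EXP (fst x) \<otimes> ee (snd x) \<otimes> inv (EXP (fst x))" for x :: "'l \<times> 'l"
  have F0: "F (0, 0) = \<one>" by (simp add: F_def)
  have i1: "isCont (\<lambda>x. EXP (fst x)) ((0, 0) :: 'l \<times> 'l)"
    by (rule isCont_o2[OF isCont_fst[OF continuous_ident] isCont_EXP])
  have i2: "isCont (\<lambda>x. ee (snd x)) ((0, 0) :: 'l \<times> 'l)"
    by (rule isCont_o2[OF isCont_snd[OF continuous_ident]]) (simp add: isCont_ee ee_dom)
  have "isCont F (0, 0)" unfolding F_def by (intro isCont_mult isCont_inv i1 i2)
  then have lim: "(F \<longlongrightarrow> \<one>) (at (0, 0))" using F0 by (simp add: isCont_def)
  define V where "V = chart_dom c0 \<inter> kk -` ball 0 1"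
  have V: "open V" unfolding V_def
  proof (rule continuous_open_preimage)
    show "continuous_on (chart_dom c0) kk" unfolding kk_def by (intro continuous_intros chart_facts(7)[OF c0(2)])
  qed (use chart_facts(1)[OF c0(2)] in auto)
  have "\<one> \<in> V" using c0 by (simp add: V_def)
  from topological_tendstoD[OF lim V this] obtain d where d: "d > 0" "\<And>x. x \<noteq> (0, 0) \<Longrightarrow> dist x (0, 0) < d \<Longrightarrow> F x \<in> V"
    unfolding eventually_at by auto
  obtain d2 where d2: "d2 > 0" "ball 0 d2 \<subseteq> ee_dom" using ee_dom open_contains_ball by blast
  define e where "e = Min {d / 2, d2, rad / 8}"
  have e: "e > 0" "e \<le> d / 2" "e \<le> d2" "e \<le> rad / 8" using d d2 rad_pos by (auto simp: e_def)
  show ?thesis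
  proof (intro exI[of _ e] conjI allI impI)
    fix a b :: 'l assume ab: "norm a < e" "norm b < e"
    show "b \<in> ee_dom" using ab e d2 by auto
    have "norm (a, b) \<le> norm a + norm b" by (rule norm_Pair_le)
    then have "dist (a, b) (0, 0) < d" using ab e by (simp add: dist_norm)
    then have "F (a, b) \<in> V" using d(2)[of "(a, b)"] F0 \<open>\<one> \<in> V\<close> by (cases "(a, b) = (0, 0)") auto
    then show "EXP a \<otimes> ee b \<otimes> inv (EXP a) \<in> chart_dom c0" "norm (kk (EXP a \<otimes> ee b \<otimes> inv (EXP a))) < 1"
      by (auto simp: F_def V_def)
  qed (use e in auto)
qed

lemma open_line: "open {s. norm (x + cscale i s y) < e}"
  unfolding cscale_def by (intro open_Collect_less continuous_intros)

text \<open>\<open>AD g v\<close> is the t-derivative at 0 of the coordinates of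
  \<open>g \<otimes> ee (cscale i t v) \<otimes> inv g\<close>. These are bounded and holomorphic
  separately in t and in the parameter of g, so \<open>holomorphic_deriv_parameter\<close>
  applies.\<close>

lemma Ad_EXP_hol_small:
  "\<exists>e>0. \<forall>x y v l. clinear_map i ((*) \<i>) l \<longrightarrow>
     (\<lambda>s. l (AD (EXP (x + cscale i s y)) v)) holomorphic_on {s. norm (x + cscale i s y) < e}"
proof -
  obtain e where e: "e > 0" "e \<le> rad / 8" and ee1: "\<And>a b. norm (a::'l) < e \<Longrightarrow> norm b < e \<Longrightarrow> b \<in> ee_dom"
    and ee2: "\<And>a b. norm a < e \<Longrightarrow> norm b < e \<Longrightarrow> EXP a \<otimes> ee b \<otimes> inv (EXP a) \<in> chart_dom c0"
    and ee3: "\<And>a b. norm a < e \<Longrightarrow> norm b < e \<Longrightarrow> norm (kk (EXP a \<otimes> ee b \<otimes> inv (EXP a))) < 1"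
    using conj_small by blast
  obtain K where K: "K \<ge> 1" "\<And>s v. norm (cscale i s v) \<le> K * cmod s * norm v" using cscale_bound by blast
  have "(\<lambda>s. l (AD (EXP (x + cscale i s y)) v)) holomorphic_on {s. norm (x + cscale i s y) < e}"
    if l: "clinear_map i ((*) \<i>) l" for x y v l
  proof -
    define S where "S = {s. norm (x + cscale i s y) < e}"
    have S: "open S" unfolding S_def by (rule open_line)
    have bl: "bounded_linear l" by (rule bounded_linear_clinear[OF l])
    obtain Kl where Kl: "\<And>v. cmod (l v) \<le> norm v * Kl" "Kl > 0" using bounded_linear.pos_bounded[OF bl] by blast
    \<comment> \<open>Keeps \<open>cscale i t v\<close> below e on the disc; adding 1 to
      \<open>norm v\<close> covers v = 0.\<close>
    define R where "R = e / (K * (norm v + 1))"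
    have R: "R > 0" using e K by (simp add: R_def add_nonneg_pos)
    have small: "norm (cscale i t v) < e" if "t \<in> ball 0 R" for t
    proof -
      have "norm (cscale i t v) \<le> K * cmod t * norm v" by (rule K)
      also have "\<dots> \<le> K * cmod t * (norm v + 1)" using K(1) by (intro mult_left_mono) auto
      also have "\<dots> < K * R * (norm v + 1)"
        using that K(1) by (intro mult_strict_right_mono mult_strict_left_mono) (auto intro: add_nonneg_pos)
      also have "\<dots> = e"
        using K(1) norm_ge_zero[of v] unfolding R_def by (simp add: add_nonneg_eq_0_iff)
      finally show ?thesis .
    qed
    define g where "g s t = l (kk (EXP (x + cscale i s y) \<otimes> ee (cscale i t v) \<otimes> inv (EXP (x + cscale i s y))))" for s t
    have cd_l: "hol_at i vec_chart ((*) \<i>) vec_chart l z" for z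
      unfolding hol_at_vec_iff by (rule complex_differentiable_at_clinear[OF l bl])
    have line: "hol_at ((*) \<i>) vec_chart i vec_chart (\<lambda>t. cscale i t v) t" for t
      unfolding hol_at_vec_iff using complex_differentiable_at_line[of 0 v t] by simp
    have lin_i: "linear ((*) \<i>)" by (auto intro!: linearI simp: algebra_simps)
    have hol_t: "(g s) field_differentiable (at t)" if s: "s \<in> S" and t: "t \<in> ball 0 R" for s t
    proof -
      let ?a = "x + cscale i s y"
      have a: "norm ?a < e" using s by (simp add: S_def)
      have h1: "hol_at ((*) \<i>) vec_chart i c0 (\<lambda>t. ee (cscale i t v)) t"
        by (rule hol_at_compose[OF line hol_ee[OF ee1[OF a small[OF t]]]])
      have "hol_at ((*) \<i>) vec_chart i c0 (\<lambda>t. EXP ?a \<otimes> ee (cscale i t v) \<otimes> inv (EXP ?a)) t"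
        by (rule hol_conj[OF hol_const chart_at_in h1 c0(1) c0(1) ee2[OF a small[OF t]]]) auto
      from hol_at_compose[OF hol_at_compose[OF this hol_kk[OF ee2[OF a small[OF t]]]] cd_l]
      show ?thesis by (simp add: g_def[abs_def] hol_at_vec_iff complex_differentiable_at_complex)
    qed
    have hol_s: "(\<lambda>s. g s t) field_differentiable (at s)" if s: "s \<in> S" and t: "t \<in> ball 0 R" for s t
    proof -
      have a: "norm (x + cscale i s y) < e" using s by (simp add: S_def)
      have h1: "hol_at ((*) \<i>) vec_chart i c0 (\<lambda>s. EXP (x + cscale i s y)) s"
        by (rule hol_EXP_line_small) (use a e in simp)
      have "hol_at ((*) \<i>) vec_chart i c0 (\<lambda>s. EXP (x + cscale i s y) \<otimes> ee (cscale i t v) \<otimes> inv (EXP (x + cscale i s y))) s"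
        by (rule hol_conj[OF h1 c0(1) hol_const chart_at_in c0(1) ee2[OF a small[OF t]]]) auto
      from hol_at_compose[OF hol_at_compose[OF this hol_kk[OF ee2[OF a small[OF t]]]] cd_l]
      show ?thesis by (simp add: g_def[abs_def] hol_at_vec_iff complex_differentiable_at_complex)
    qed
    have "(\<lambda>s. deriv (g s) 0) holomorphic_on S"
    proof (rule holomorphic_deriv_parameter[OF R S])
      show "g s holomorphic_on ball 0 R" if "s \<in> S" for s
        using hol_t[OF that] by (auto simp: holomorphic_on_def intro: field_differentiable_at_within)
      show "(\<lambda>s. g s t) holomorphic_on S" if "t \<in> ball 0 R" for t
        using hol_s[OF _ that] by (auto simp: holomorphic_on_def intro: field_differentiable_at_within)
      show "cmod (g s t) < Kl" if s: "s \<in> S" and t: "t \<in> ball 0 R" for s t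
      proof -
        have "norm (x + cscale i s y) < e" using s by (simp add: S_def)
        from ee3[OF this small[OF t]] show ?thesis
          unfolding g_def using Kl by (intro le_less_trans[OF Kl(1)]) simp
      qed
    qed
    moreover have "deriv (g s) 0 = l (AD (EXP (x + cscale i s y)) v)" for s
    proof -
      let ?g = "EXP (x + cscale i s y)"
      obtain D where D: "mder vec_chart vec_chart (\<lambda>t. cscale i t v) 0 D" "D = (\<lambda>t. cscale i t v)"
      proof -
        have "bounded_linear (\<lambda>t. cscale i t v)" unfolding cscale_def
          by (intro bounded_linear_add bounded_linear_scaleR_const bounded_linear_Re bounded_linear_Im)
        from that[OF mder_vec[OF bounded_linear_imp_has_derivative[OF this]]] show thesis by simp
      qed
      have m1: "mder vec_chart c0 (\<lambda>t. ee (cscale i t v)) 0 (\<lambda>t. cscale i t v)"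
        using mder_compose[OF D(1), of c0 ee "\<lambda>v. v"] D(2) mder_ee[OF ee_dom(2)] by (simp add: cscale_simps)
      have m2: "mder vec_chart c0 (\<lambda>t. ?g \<otimes> ee (cscale i t v) \<otimes> inv ?g) 0 (\<lambda>t. AD ?g (cscale i t v))"
        using mder_compose[OF m1, of c0 "\<lambda>h. ?g \<otimes> h \<otimes> inv ?g" "AD ?g"] mder_Ad[of ?g] by (simp add: cscale_simps)
      have m3: "mder vec_chart vec_chart (\<lambda>t. kk (?g \<otimes> ee (cscale i t v) \<otimes> inv ?g)) 0 (\<lambda>t. AD ?g (cscale i t v))"
        using mder_compose[OF m2, of vec_chart kk "\<lambda>v. v"] mder_kk[OF c0(3)] by (simp add: cscale_simps)
      have m4: "mder vec_chart vec_chart (g s) 0 (\<lambda>t. l (AD ?g (cscale i t v)))"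
        using mder_compose[OF m3, of vec_chart l l] mder_vec[OF bounded_linear_imp_has_derivative[OF bl]]
        by (simp add: g_def[abs_def])
      have "(\<lambda>t. l (AD ?g (cscale i t v))) = (*) (l (AD ?g v))"
        using clinear_cscale[OF l] by (auto simp: Ad_simps cscale_def complex_eq_iff)
      then have "(g s has_field_derivative l (AD ?g v)) (at 0)"
        using m4 by (simp add: mder_def has_field_derivative_def o_def)
      then show ?thesis by (rule DERIV_imp_deriv)
    qed
    ultimately show ?thesis by (simp add: S_def)
  qed
  with e show ?thesis by blast
qed

text \<open>\<open>AD (EXP a)\<close> is the square of \<open>AD\<close> at the exponential of half
  of a, and matrix coefficients of a square are sums of products of matrix coefficients; so the
  region of holomorphy doubles at each step.\<close>

lemma Ad_EXP_entire:
  assumes l: "clinear_map i ((*) \<i>) l"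
  shows "(\<lambda>s. l (AD (EXP (x + cscale i s y)) v)) holomorphic_on UNIV"
proof -
  obtain e where e: "e > 0" and small: "\<And>x y v l. clinear_map i ((*) \<i>) l \<Longrightarrow>
     (\<lambda>s. l (AD (EXP (x + cscale i s y)) v)) holomorphic_on {s. norm (x + cscale i s y) < e}"
    using Ad_EXP_hol_small by blast
  obtain I :: "'l set" and co :: "'l \<Rightarrow> 'l \<Rightarrow> complex" where
    I: "finite I" and co: "\<And>b. clinear_map i ((*) \<i>) (co b)" and sum: "\<And>v. v = (\<Sum>b\<in>I. cscale i (co b v) b)"
    using complex_coordinates by blast
  have step: "(\<lambda>s. l (AD (EXP (x + cscale i s y)) v)) holomorphic_on {s. norm (x + cscale i s y) < 2 ^ m * e}"
    if "clinear_map i ((*) \<i>) l" for m x y v l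
    using that
  proof (induction m arbitrary: x y v l)
    case 0 then show ?case using small by simp
  next
    case (Suc m)
    define z where "z s = (1/2) *\<^sub>R x + cscale i s ((1/2) *\<^sub>R y)" for s
    have z2: "z s = (1/2) *\<^sub>R (x + cscale i s y)" for s
      unfolding z_def cscale_simps by (simp add: scaleR_right_distrib)
    have z: "x + cscale i s y = z s + z s" for s
      unfolding z2 by (simp add: scaleR_left_distrib[symmetric])
    have E: "EXP (x + cscale i s y) = EXP (z s) \<otimes> EXP (z s)" for s
      unfolding z using EXP_add[of 1 1 "z s"] by (simp add: scaleR_2)
    have lin: "linear l" using Suc.prems by (simp add: clinear_map_def)
    have eq: "l (AD (EXP (x + cscale i s y)) v) = (\<Sum>b\<in>I. co b (AD (EXP (z s)) v) * l (AD (EXP (z s)) b))" for s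
    proof -
      have "l (AD (EXP (x + cscale i s y)) v) = l (AD (EXP (z s)) (AD (EXP (z s)) v))" by (simp add: E Ad_mult)
      also have "AD (EXP (z s)) v = (\<Sum>b\<in>I. cscale i (co b (AD (EXP (z s)) v)) b)" by (rule sum)
      also have "l (AD (EXP (z s)) \<dots>) = (\<Sum>b\<in>I. l (AD (EXP (z s)) (cscale i (co b (AD (EXP (z s)) v)) b)))"
        by (simp add: linear_sum[OF linear_Ad] linear_sum[OF lin])
      also have "\<dots> = (\<Sum>b\<in>I. co b (AD (EXP (z s)) v) * l (AD (EXP (z s)) b))"
        using clinear_cscale[OF Suc.prems] by (intro sum.cong) (auto simp: Ad_simps cscale_def complex_eq_iff)
      finally show ?thesis .
    qed
    have sub: "{s. norm (x + cscale i s y) < 2 ^ Suc m * e} = {s. norm (z s) < 2 ^ m * e}"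
      unfolding z by (simp add: scaleR_2[symmetric])
    have h: "(\<lambda>s. l' (AD (EXP (z s)) w)) holomorphic_on {s. norm (z s) < 2 ^ m * e}"
      if "clinear_map i ((*) \<i>) l'" for l' w
      unfolding z_def by (rule Suc.IH[OF that])
    show ?case unfolding eq sub by (intro holomorphic_intros h co Suc.prems)
  qed
  show ?thesis unfolding holomorphic_on_def
  proof
    fix s
    obtain m where "norm (x + cscale i s y) / e < 2 ^ m" using real_arch_pow[of 2 "norm (x + cscale i s y) / e"] by auto
    then have m: "s \<in> {s. norm (x + cscale i s y) < 2 ^ m * e}" using e by (simp add: field_simps)
    then have "(\<lambda>s. l (AD (EXP (x + cscale i s y)) v)) field_differentiable (at s)"
      using step[OF l, of x y v m] open_line by (meson holomorphic_on_imp_differentiable_at)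
    then show "(\<lambda>s. l (AD (EXP (x + cscale i s y)) v)) field_differentiable (at s within UNIV)" by simp
  qed
qed

subsection \<open>The Lie bracket\<close>

text \<open>The bracket is defined by a real derivative; holomorphy of the adjoint action upgrades
  it to a complex one, which gives complex linearity in y.\<close>

lemma bracket_complex_derivative:
  "((\<lambda>s. AD (EXP (cscale i s y)) v) has_derivative (\<lambda>s. cscale i s (lie_bracket L A y v))) (at 0)"
proof -
  have "complex_differentiable_at ((*) \<i>) i (\<lambda>s. AD (EXP (0 + cscale i s y)) v) 0"
    by (rule complex_differentiable_at_from_functionals)
       (use Ad_EXP_entire[of _ 0 y v] in \<open>simp add: holomorphic_on_def\<close>)
  then obtain D where D: "((\<lambda>s. AD (EXP (cscale i s y)) v) has_derivative D) (at 0)" "\<And>s. D (\<i> * s) = i (D s)"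
    by (auto simp: complex_differentiable_at_def)
  have lin: "linear D" using D(1) has_derivative_linear by blast
  have Deq: "D s = cscale i s (D 1)" for s
  proof -
    have "D s = D (Re s *\<^sub>R 1 + Im s *\<^sub>R (\<i> * 1))" by (rule arg_cong[of _ _ D]) (simp add: complex_eq_iff)
    then show ?thesis unfolding linear_add[OF lin] linear_scale[OF lin] D(2) cscale_def .
  qed
  have "((\<lambda>t::real. of_real t :: complex) has_derivative of_real) (at 0)"
    by (intro bounded_linear_imp_has_derivative bounded_linear_of_real)
  from has_derivative_compose[OF this, of "\<lambda>s. AD (EXP (cscale i s y)) v" D] D(1)
  have "((\<lambda>t::real. AD (EXP (t *\<^sub>R y)) v) has_derivative (\<lambda>t. t *\<^sub>R D 1)) (at 0)"
    by (simp add: cscale_simps Deq[of "of_real _"])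
  then have "((\<lambda>t::real. AD (EXP (t *\<^sub>R y)) v) has_vector_derivative D 1) (at 0)"
    by (simp add: has_vector_derivative_def)
  then have "lie_bracket L A y v = D 1"
    unfolding lie_bracket_def lie_exp_EXP by (rule vector_derivative_at)
  moreover have "D = (\<lambda>s. cscale i s (D 1))" using Deq by (rule ext)
  ultimately show ?thesis using D(1) by simp
qed

lemma bracket_derivative_0: "((\<lambda>t::real. AD (EXP (t *\<^sub>R y)) v) has_vector_derivative lie_bracket L A y v) (at 0)"
proof -
  have "((\<lambda>t::real. of_real t :: complex) has_derivative of_real) (at 0)"
    by (intro bounded_linear_imp_has_derivative bounded_linear_of_real)
  from has_derivative_compose[OF this, of "\<lambda>s. AD (EXP (cscale i s y)) v"
      "\<lambda>s. cscale i s (lie_bracket L A y v)"] bracket_complex_derivative[of y v]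
  show ?thesis by (simp add: cscale_simps has_vector_derivative_def)
qed

lemma bracket_i: "lie_bracket L A (i y) v = i (lie_bracket L A y v)"
proof -
  have "((\<lambda>t::real. \<i> * of_real t :: complex) has_derivative (\<lambda>t. \<i> * of_real t)) (at 0)"
    by (intro bounded_linear_imp_has_derivative bounded_linear_const_mult bounded_linear_of_real)
  from has_derivative_compose[OF this, of "\<lambda>s. AD (EXP (cscale i s y)) v"
      "\<lambda>s. cscale i s (lie_bracket L A y v)"] bracket_complex_derivative[of y v]
  have "((\<lambda>t::real. AD (EXP (t *\<^sub>R i y)) v) has_vector_derivative i (lie_bracket L A y v)) (at 0)"
    by (simp add: cscale_def has_vector_derivative_def j_simps)
  from vector_derivative_unique_at[OF bracket_derivative_0 this] show ?thesis .
qed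

lemma bracket_derivative:
  "((\<lambda>t::real. AD (EXP (t *\<^sub>R y)) v) has_vector_derivative AD (EXP (t0 *\<^sub>R y)) (lie_bracket L A y v)) (at t0)"
proof -
  have "((\<lambda>t::real. t - t0) has_vector_derivative 1) (at t0)" by (auto intro!: derivative_eq_intros)
  moreover have "((\<lambda>t::real. AD (EXP (t *\<^sub>R y)) v) has_vector_derivative lie_bracket L A y v) (at (t0 - t0))"
    using bracket_derivative_0 by simp
  ultimately have "(((\<lambda>t::real. AD (EXP (t *\<^sub>R y)) v) \<circ> (\<lambda>t. t - t0)) has_vector_derivative 1 *\<^sub>R lie_bracket L A y v) (at t0)"
    by (rule vector_diff_chain_at)
  then have "((\<lambda>t. AD (EXP ((t - t0) *\<^sub>R y)) v) has_vector_derivative lie_bracket L A y v) (at t0)" by (simp add: o_def)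
  note d = bounded_linear.has_vector_derivative[OF linear_bounded[OF linear_Ad[of "EXP (t0 *\<^sub>R y)"]] this]
  have eq: "AD (EXP (t0 *\<^sub>R y)) (AD (EXP ((t - t0) *\<^sub>R y)) v) = AD (EXP (t *\<^sub>R y)) v" for t
  proof -
    have "EXP (t *\<^sub>R y) = EXP (t0 *\<^sub>R y) \<otimes> EXP ((t - t0) *\<^sub>R y)" using EXP_add[of t0 "t - t0" y] by simp
    then show ?thesis by (simp only: Ad_mult)
  qed
  show ?thesis using d unfolding eq .
qed

lemma bracket_linear:
  "lie_bracket L A y (v + w) = lie_bracket L A y v + lie_bracket L A y w"
  "lie_bracket L A y (c *\<^sub>R v) = c *\<^sub>R lie_bracket L A y v"
  "lie_bracket L A y (i v) = i (lie_bracket L A y v)"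
proof -
  note d = bracket_derivative_0[of y] and u = vector_derivative_unique_at[OF bracket_derivative_0[of y]]
  show "lie_bracket L A y (v + w) = lie_bracket L A y v + lie_bracket L A y w"
    by (rule u) (use has_vector_derivative_add[OF d d] in \<open>simp add: Ad_simps\<close>)
  show "lie_bracket L A y (c *\<^sub>R v) = c *\<^sub>R lie_bracket L A y v"
    by (rule u) (use bounded_linear.has_vector_derivative[OF bounded_linear_scaleR_right d] in \<open>simp add: Ad_simps\<close>)
  show "lie_bracket L A y (i v) = i (lie_bracket L A y v)"
    by (rule u) (use bounded_linear.has_vector_derivative[OF bounded_linear_j d] in \<open>simp add: Ad_simps\<close>)
qed

text \<open>Uniqueness for a linear differential equation: the curve multiplied by
  \<open>exp (- (c * t))\<close> has derivative 0.\<close>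

lemma Ad_EXP_eigenvector:
  assumes "lie_bracket L A y v = c *\<^sub>R v"
  shows "AD (EXP (t *\<^sub>R y)) v = exp (c * t) *\<^sub>R v"
proof -
  define f where "f t = exp (- (c * t)) *\<^sub>R AD (EXP (t *\<^sub>R y)) v" for t
  have "(f has_derivative (\<lambda>_. 0)) (at t)" for t
  proof -
    have 1: "((\<lambda>t. exp (- (c * t))) has_field_derivative (- c) * exp (- (c * t))) (at t)"
      by (auto intro!: derivative_eq_intros)
    have "(f has_vector_derivative exp (- (c * t)) *\<^sub>R AD (EXP (t *\<^sub>R y)) (c *\<^sub>R v) + ((- c) * exp (- (c * t))) *\<^sub>R AD (EXP (t *\<^sub>R y)) v) (at t)"
      unfolding f_def using has_vector_derivative_scaleR[OF 1 bracket_derivative[of y v t]] assms by simp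
    then have "(f has_vector_derivative 0) (at t)" by (simp add: Ad_simps mult.commute)
    then show ?thesis by (simp add: has_vector_derivative_def)
  qed
  then obtain k where k: "\<And>t. f t = k" using has_derivative_zero_constant[of UNIV f] by (auto simp: has_derivative_at_withinI)
  have "f t = v" using k[of t] k[of 0] by (simp add: f_def Ad_one)
  then have "exp (c * t) *\<^sub>R f t = exp (c * t) *\<^sub>R v" by simp
  then show ?thesis by (simp add: f_def exp_minus)
qed

lemma EXP_add_if_bracket_zero:
  assumes "lie_bracket L A a b = 0" shows "EXP (a + b) = EXP a \<otimes> EXP b"
  by (rule EXP_add_if_Ad_fixes) (use Ad_EXP_eigenvector[of a b 0] assms in simp)

subsection \<open>Closed subgroups and generation\<close>

lemma lie_algebra_iff: "v \<in> lie_algebra_of L A H \<longleftrightarrow> (\<forall>t. EXP (t *\<^sub>R v) \<in> H)"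
  by (simp add: lie_algebra_of_def lie_exp_EXP)

lemma subgroup_nat_pow: "subgroup H L \<Longrightarrow> g \<in> H \<Longrightarrow> g [^] (n::nat) \<in> H"
  by (induction n) (auto intro: subgroup.m_closed subgroup.one_closed)

text \<open>Closure under sums is the Lie product formula along dyadic powers, where closedness of H
  enters. It yields small multiples of \<open>a + b\<close>, and powers yield the rest.\<close>

lemma subspace_lie_algebra:
  assumes H: "subgroup H L" "closed H" shows "subspace (lie_algebra_of L A H)"
proof (rule subspaceI)
  show "0 \<in> lie_algebra_of L A H" using H by (simp add: lie_algebra_iff subgroup.one_closed)
  show "c *\<^sub>R v \<in> lie_algebra_of L A H" if "v \<in> lie_algebra_of L A H" for c v
    using that by (simp add: lie_algebra_iff)
  fix a b assume ab: "a \<in> lie_algebra_of L A H" "b \<in> lie_algebra_of L A H"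
  define f where "f t = EXP (t *\<^sub>R a) \<otimes> EXP (t *\<^sub>R b)" for t :: real
  have f: "mder vec_chart c0 f (0::real) (\<lambda>t. t *\<^sub>R (a + b))"
    using mder_mult_one[OF mder_EXP_curve[of a] _ mder_EXP_curve[of b]]
    by (simp add: f_def[abs_def] scaleR_right_distrib)
  have fH: "f t \<in> H" for t using ab H by (auto simp: f_def lie_algebra_iff intro: subgroup.m_closed)
  have small: "EXP (t *\<^sub>R (a + b)) \<in> H" if t: "norm (t *\<^sub>R (a + b)) < rad / 8" for t
  proof -
    have "(\<lambda>n. f (t / 2 ^ n) [^] (2 ^ n :: nat)) \<longlonglongrightarrow> EXP (t *\<^sub>R (a + b))"
      by (rule EXP_limit[OF f _ t]) (simp add: f_def)
    then show ?thesis
      by (rule closed_sequentially[OF H(2) subgroup_nat_pow[OF H(1) fH]])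
  qed
  show "a + b \<in> lie_algebra_of L A H" unfolding lie_algebra_iff
  proof
    fix t
    obtain n where n: "small n (t *\<^sub>R (a + b))" using ex_small by blast
    have s: "norm ((t / 2 ^ n) *\<^sub>R (a + b)) < rad / 8" using smallD[OF n] by simp
    have "EXP (t *\<^sub>R (a + b)) = EXP ((t / 2 ^ n) *\<^sub>R (a + b)) [^] (2 ^ n :: nat)"
      using EXP_eq[OF n] EXP_local[OF s] by simp
    then show "EXP (t *\<^sub>R (a + b)) \<in> H" using subgroup_nat_pow[OF H(1) small[OF s]] by simp
  qed
qed

lemma Ad_lie_algebra:
  assumes H: "subgroup H L" "g \<in> H" "v \<in> lie_algebra_of L A H"
  shows "AD g v \<in> lie_algebra_of L A H"
  unfolding lie_algebra_iff
proof
  fix t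
  have "g \<otimes> EXP (t *\<^sub>R v) \<otimes> inv g \<in> H"
    using H by (intro subgroup.m_closed[OF H(1)] subgroup.m_inv_closed[OF H(1)]) (auto simp: lie_algebra_iff)
  then show "EXP (t *\<^sub>R AD g v) \<in> H" by (simp add: EXP_Ad Ad_simps)
qed

text \<open>The subgroup generated by exponentials, as words built from the left, to provide an
  induction principle.\<close>

inductive_set exp_gen where
  "\<one> \<in> exp_gen"
| "g \<in> exp_gen \<Longrightarrow> EXP v \<otimes> g \<in> exp_gen"

text \<open>Right translates of a neighbourhood of the unit covered by \<open>EXP\<close> show that
  the set and its complement are both open.\<close>

lemma exp_gen_UNIV:
  assumes "connected (UNIV :: 'g set)" shows "exp_gen = UNIV"
proof -
  obtain V where V: "open V" "\<one> \<in> V" "V \<subseteq> range EXP" using EXP_surj_near_one by blast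
  have nb: "open ((\<lambda>h. h \<otimes> inv g) -` V)" "g \<in> (\<lambda>h. h \<otimes> inv g) -` V"
    "\<And>h. h \<in> (\<lambda>h. h \<otimes> inv g) -` V \<Longrightarrow> \<exists>v. h = EXP v \<otimes> g" for g
  proof -
    have "continuous_on UNIV (\<lambda>h. h \<otimes> inv g)"
      by (auto simp: continuous_on_eq_continuous_at intro!: isCont_mult)
    then show "open ((\<lambda>h. h \<otimes> inv g) -` V)" using V(1) by (rule open_vimage[rotated])
    show "g \<in> (\<lambda>h. h \<otimes> inv g) -` V" using V(2) by simp
    fix h assume "h \<in> (\<lambda>h. h \<otimes> inv g) -` V"
    then obtain v where "h \<otimes> inv g = EXP v" using V(3) by auto
    then have "h = EXP v \<otimes> g" by (metis UNIV_I carrier_UNIV inv_closed inv_solve_right')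
    then show "\<exists>v. h = EXP v \<otimes> g" by blast
  qed
  have "open exp_gen"
  proof (rule open_subopen[THEN iffD2], intro ballI exI conjI)
    fix g assume g: "g \<in> exp_gen"
    show "open ((\<lambda>h. h \<otimes> inv g) -` V)" "g \<in> (\<lambda>h. h \<otimes> inv g) -` V" using nb(1,2) by auto
    show "(\<lambda>h. h \<otimes> inv g) -` V \<subseteq> exp_gen"
    proof
      fix h assume "h \<in> (\<lambda>h. h \<otimes> inv g) -` V"
      then obtain v where "h = EXP v \<otimes> g" using nb(3) by blast
      then show "h \<in> exp_gen" using exp_gen.intros(2)[OF g] by simp
    qed
  qed
  moreover have "open (- exp_gen)"
  proof (rule open_subopen[THEN iffD2], intro ballI exI conjI)
    fix g assume g: "g \<in> - exp_gen"
    show "open ((\<lambda>h. h \<otimes> inv g) -` V)" "g \<in> (\<lambda>h. h \<otimes> inv g) -` V" using nb by auto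
    show "(\<lambda>h. h \<otimes> inv g) -` V \<subseteq> - exp_gen"
    proof
      fix h assume "h \<in> (\<lambda>h. h \<otimes> inv g) -` V"
      then obtain v where v: "h = EXP v \<otimes> g" using nb(3) by blast
      have "EXP (- v) \<otimes> h = g" by (simp add: v EXP_minus m_assoc[symmetric])
      then show "h \<in> - exp_gen" using g exp_gen.intros(2)[of h "- v"] by auto
    qed
  qed
  ultimately show ?thesis
    using assms exp_gen.intros(1) connectedD[OF assms, of exp_gen "- exp_gen"]
    unfolding closed_def by blast
qed

end

section \<open>Holomorphic Hamiltonian actions\<close>

lemma chart_at_vec_atlas [simp]: "chart_at vec_atlas p = vec_chart"
  unfolding chart_at_def vec_atlas_eq by (rule some_equality) auto

locale hamiltonian_action = clie_group L i A + Z: cplx_manifold J B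
  for L :: "'g::{t2_space, second_countable_topology} monoid" (structure)
    and i :: "'l::real_normed_vector \<Rightarrow> 'l" and A :: "('g, 'l) chart set"
    and J :: "'e::real_normed_vector \<Rightarrow> 'e" and B :: "('z::{t2_space, second_countable_topology}, 'e) chart set" +
  fixes U :: "'g set" and \<omega> :: "'z \<Rightarrow> 'e \<Rightarrow> 'e \<Rightarrow> real" and \<phi> :: "'g \<Rightarrow> 'z \<Rightarrow> 'z" and \<mu> :: "'z \<Rightarrow> 'l \<Rightarrow> real"
  assumes U: "subgroup U L" "closed U"
    and kaehler: "kaehler_manifold J B \<omega>"
    and action: "holomorphic_action L i A J B \<phi>"
    and momentum: "momentum_map L A U B \<phi> \<omega> \<mu>"
begin

abbreviation uu where "uu \<equiv> lie_algebra_of L A U"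

lemma subspace_uu: "subspace uu" by (rule subspace_lie_algebra[OF U])

sublocale e: fd_complex J by (rule Z.fd_complex_model)

lemma act_mult: "\<phi> (g \<otimes> h) z = \<phi> g (\<phi> h z)" and act_one [simp]: "\<phi> \<one> z = z"
proof -
  interpret group_action L UNIV \<phi> using action by (simp add: holomorphic_action_def)
  show "\<phi> (g \<otimes> h) z = \<phi> g (\<phi> h z)" by (rule composition_rule) auto
  show "\<phi> \<one> z = z" using id_eq_one by (metis UNIV_I restrict_apply')
qed

lemma act_inv [simp]: "\<phi> (inv g) (\<phi> g z) = z" "\<phi> g (\<phi> (inv g) z) = z"
  by (simp_all add: act_mult[symmetric])

lemma isCont_act: "isCont f p \<Longrightarrow> isCont h p \<Longrightarrow> isCont (\<lambda>q. \<phi> (f q) (h q)) p"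
proof -
  assume fh: "isCont f p" "isCont h p"
  have "continuous_on UNIV (\<lambda>(g, z). \<phi> g z)"
    using action by (simp add: holomorphic_action_def holomorphic_map_def)
  then have "isCont (\<lambda>(g, z). \<phi> g z) (f p, h p)" by (simp add: continuous_on_eq_continuous_at)
  from isCont_o2[OF isCont_Pair[OF fh] this] show ?thesis by simp
qed

lemma hol_act:
  assumes "hol_at j s i c f p" "hol_at j s J d h p" "c \<in> A" "d \<in> B" "e \<in> B" "\<phi> (f p) (h p) \<in> chart_dom e"
  shows "hol_at j s J e (\<lambda>q. \<phi> (f q) (h q)) p"
proof -
  have "hol_at (map_prod i J) (prod_chart c d) J e (\<lambda>(g, z). \<phi> g z) (f p, h p)"
    unfolding hol_at_def
  proof (rule holomorphic_map_mder)
    show "holomorphic_map (map_prod i J) (prod_atlas A B) J B (\<lambda>(g, z). \<phi> g z)"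
      using action by (simp add: holomorphic_action_def)
    show "prod_chart c d \<in> prod_atlas A B" using assms(3,4) unfolding prod_atlas_eq by blast
    show "is_chart (prod_chart c d)" using assms(3,4) by (intro is_chart_prod is_chart Z.is_chart)
    show "(f p, h p) \<in> chart_dom (prod_chart c d)" using hol_atD(4)[OF assms(1)] hol_atD(4)[OF assms(2)] by simp
    show "is_chart e" using assms(5) by (rule Z.is_chart)
    show "(case (f p, h p) of (g, z) \<Rightarrow> \<phi> g z) \<in> chart_dom e" using assms(6) by simp
    show "linear (map_prod i J)" by (auto intro!: linearI simp: j_simps e.j_simps)
  qed (rule assms)+
  from hol_at_compose[OF hol_at_Pair[OF assms(1,2)] this] show ?thesis by simp
qed

lemma hol_constZ:
  assumes "is_chart s" "p \<in> chart_dom s" "d \<in> B" "z \<in> chart_dom d" shows "hol_at j s J d (\<lambda>_. z) p"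
  by (rule hol_at_const[OF assms(1) Z.is_chart[OF assms(3)] assms(2,4) e.linear_j])

lemma hol_orbit:
  assumes "d \<in> B" "z \<in> chart_dom d" shows "hol_at i c0 J d (\<lambda>g. \<phi> g z) \<one>"
  by (rule hol_act[OF hol_at_id hol_constZ]) (use assms c0 in auto)

text \<open>The arguments are swapped so that \<open>fv z\<close> is the derivative at the unit of
  the orbit map of z.\<close>

definition fv where "fv z v = fundamental_vector_field L A B \<phi> v z"

lemma mder_fv: "mder c0 (chart_at B z) (\<lambda>g. \<phi> g z) \<one> (fv z)"
  and clinear_fv: "clinear_map i J (fv z)"
proof -
  obtain D where D: "clinear_map i J D" "mder c0 (chart_at B z) (\<lambda>g. \<phi> g z) \<one> D"
    using hol_orbit[OF Z.chart_at_in Z.chart_at_dom, of z] by (auto simp: hol_at_def)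
  have "fv z v = D v" for v
  proof -
    have "mder vec_chart (chart_at B z) (\<lambda>t::real. \<phi> (EXP (t *\<^sub>R v)) z) 0 (\<lambda>t. D (t *\<^sub>R v))"
      using mder_compose[OF mder_EXP_curve[of v], of "chart_at B z" "\<lambda>g. \<phi> g z" D] D(2) by simp
    then have "((\<lambda>t. chart_map (chart_at B z) (\<phi> (EXP (t *\<^sub>R v)) z)) has_vector_derivative D v) (at 0)"
      using D(1) by (simp add: mder_vec_iff has_vector_derivative_def clinear_map_def linear_scale)
    then show ?thesis unfolding fv_def fundamental_vector_field_def lie_exp_EXP by (rule vector_derivative_at)
  qed
  then have "fv z = D" by (rule ext)
  with D show "mder c0 (chart_at B z) (\<lambda>g. \<phi> g z) \<one> (fv z)" "clinear_map i J (fv z)" by auto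
qed

lemma fv_simps: "fv z (v + w) = fv z v + fv z w" "fv z (c *\<^sub>R v) = c *\<^sub>R fv z v" "fv z 0 = 0"
  "fv z (i v) = J (fv z v)"
  using clinear_fv[of z] by (auto simp: clinear_map_def linear_add linear_scale linear_0)

lemma omega: "linear (\<omega> z v)" "\<omega> z v w = - \<omega> z w v" "\<omega> z v (J w) = \<omega> z w (J v)" "v \<noteq> 0 \<Longrightarrow> \<omega> z v (J v) > 0"
  using kaehler unfolding kaehler_manifold_def smooth_two_form_def by blast+

lemma omega_simps: "\<omega> z v (a + b) = \<omega> z v a + \<omega> z v b" "\<omega> z v (c *\<^sub>R a) = c * \<omega> z v a" "\<omega> z v 0 = 0" "\<omega> z 0 v = 0"
  using omega(1)[of z v] omega(2)[of z 0 v] linear_0[OF omega(1)[of z v]] by (auto simp: linear_add linear_scale linear_0)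

lemma mu_linear:
  assumes "v \<in> uu" "w \<in> uu" shows "\<mu> z (v + w) = \<mu> z v + \<mu> z w" "\<mu> z (c *\<^sub>R v) = c * \<mu> z v"
proof -
  have *: "\<mu> z (a *\<^sub>R v + b *\<^sub>R w) = a * \<mu> z v + b * \<mu> z w" for a b
    using momentum assms by (simp add: momentum_map_def Let_def)
  show "\<mu> z (v + w) = \<mu> z v + \<mu> z w" "\<mu> z (c *\<^sub>R v) = c * \<mu> z v" using *[of 1 1] *[of c 0] by auto
qed

text \<open>\<open>chart_at\<close> may jump from point to point, so continuity of the derivative of
  the momentum makes sense only in one fixed chart; it comes from the case k = 1 of
  smoothness.\<close>

lemma mu_chart:
  assumes x: "v \<in> uu" and c: "c \<in> B"
  obtains F' where "\<And>p. p \<in> chart_dom c \<Longrightarrow> mder c vec_chart (\<lambda>z. \<mu> z v) p (F' (chart_map c p))"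
    "\<And>w. continuous_on (chart_map c ` chart_dom c) (\<lambda>y. F' y w)"
proof -
  have sm: "smooth_map_on B vec_atlas UNIV (\<lambda>z. \<mu> z v)"
    using momentum x by (simp add: momentum_map_def Let_def)
  then have "\<forall>k. Ck_on k (chart_map c ` chart_dom c) (\<lambda>y. \<mu> (chart_inv c y) v)"
    using c unfolding smooth_map_on_def vec_atlas_eq by (simp add: o_def)
  from this[rule_format, of "Suc 0"] obtain F' where F': "\<And>y. y \<in> chart_map c ` chart_dom c \<Longrightarrow> ((\<lambda>y. \<mu> (chart_inv c y) v) has_derivative F' y) (at y)"
    "\<And>w. continuous_on (chart_map c ` chart_dom c) (\<lambda>y. F' y w)" by auto
  have cont: "isCont (\<lambda>z. \<mu> z v) p" for p
    using sm by (simp add: smooth_map_on_def continuous_on_eq_continuous_at)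
  have "mder c vec_chart (\<lambda>z. \<mu> z v) p (F' (chart_map c p))" if "p \<in> chart_dom c" for p
    using F'(1)[of "chart_map c p"] that cont Z.is_chart[OF c] by (simp add: mder_def o_def)
  from that[OF this F'(2)] show thesis .
qed

lemma isCont_mu:
  assumes "v \<in> uu" shows "isCont (\<lambda>z. \<mu> z v) p"
  using momentum assms by (simp add: momentum_map_def Let_def smooth_map_on_def continuous_on_eq_continuous_at)

lemma mder_mu:
  assumes x: "v \<in> uu"
  shows "mder (chart_at B z) vec_chart (\<lambda>z. \<mu> z v) z (\<omega> z (fv z v))"
proof -
  obtain F' where F': "mder (chart_at B z) vec_chart (\<lambda>z. \<mu> z v) z (F' (chart_map (chart_at B z) z))"
    using mu_chart[OF x Z.chart_at_in[of z]] Z.chart_at_dom by metis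
  have "tangent_map B vec_atlas (\<lambda>z. \<mu> z v) z = F' (chart_map (chart_at B z) z)"
    using frechet_derivative_at[OF mderD(6)[OF F']] unfolding tangent_map_def by (simp add: o_def)
  moreover have "tangent_map B vec_atlas (\<lambda>z. \<mu> z v) z w = \<omega> z (fv z v) w" for w
    using momentum x by (simp add: momentum_map_def Let_def fv_def)
  ultimately have "F' (chart_map (chart_at B z) z) = \<omega> z (fv z v)" by (simp add: fun_eq_iff)
  with F' show ?thesis by simp
qed

text \<open>\<open>LD v w\<close> is the derivative of the component \<open>\<mu>\<^sup>v\<close> along the fundamental vector field of \<open>w\<close>.\<close>

definition LD :: "'l \<Rightarrow> 'l \<Rightarrow> 'z \<Rightarrow> real" where "LD v w z = \<omega> z (fv z v) (fv z w)"

lemma LD_linear: "LD v (a + b) z = LD v a z + LD v b z" "LD v (c *\<^sub>R a) z = c * LD v a z" "LD v 0 z = 0"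
  by (auto simp: LD_def fv_simps omega_simps)

text \<open>Symmetry of the Kaehler metric, as i acts by J on fundamental fields. It is what later
  makes the gradient map on \<aa> the gradient of a potential.\<close>

lemma LD_symmetric: "LD v (i w) z = LD w (i v) z"
  by (simp add: LD_def fv_simps omega(3))

lemma LD_nonneg: "LD v (i v) z \<ge> 0"
  using omega(4)[of "fv z v" z] by (cases "fv z v = 0") (auto simp: LD_def fv_simps omega_simps)

lemma LD_zero_imp: "LD v (i v) z = 0 \<Longrightarrow> fv z v = 0"
  using omega(4)[of "fv z v" z] by (auto simp: LD_def fv_simps)

lemma LD_derivative:
  assumes x: "v \<in> uu" and g: "mder vec_chart c0 g (t0::real) (\<lambda>t. t *\<^sub>R w)" "g t0 = \<one>"
  shows "((\<lambda>t. \<mu> (\<phi> (g t) z) v) has_real_derivative LD v w z) (at t0)"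
proof -
  have "mder c0 vec_chart (\<lambda>g. \<mu> (\<phi> g z) v) \<one> (\<lambda>w. \<omega> z (fv z v) (fv z w))"
    using mder_compose[OF mder_fv[of z], of vec_chart "\<lambda>z. \<mu> z v" "\<omega> z (fv z v)"] mder_mu[OF x, of z] by simp
  then have "mder vec_chart vec_chart (\<lambda>t. \<mu> (\<phi> (g t) z) v) t0 (\<lambda>t. \<omega> z (fv z v) (fv z (t *\<^sub>R w)))"
    using mder_compose[OF g(1), of vec_chart "\<lambda>g. \<mu> (\<phi> g z) v" "\<lambda>w. \<omega> z (fv z v) (fv z w)"] g(2) by simp
  then show ?thesis
    by (simp add: mder_def o_def has_field_derivative_def LD_def fv_simps omega_simps mult_commute_abs)
qed

lemma flow_derivative:
  assumes x: "v \<in> uu"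
  shows "((\<lambda>t. \<mu> (\<phi> (EXP (t *\<^sub>R w)) z) v) has_real_derivative LD v w (\<phi> (EXP (t0 *\<^sub>R w)) z)) (at t0)"
proof -
  have "((\<lambda>t. \<mu> (\<phi> (EXP (t *\<^sub>R w)) (\<phi> (EXP (t0 *\<^sub>R w)) z)) v) has_real_derivative LD v w (\<phi> (EXP (t0 *\<^sub>R w)) z)) (at 0)"
    by (rule LD_derivative[OF x mder_EXP_curve]) simp
  then have "((\<lambda>t. \<mu> (\<phi> (EXP (t *\<^sub>R w)) (\<phi> (EXP (t0 *\<^sub>R w)) z)) v) has_real_derivative LD v w (\<phi> (EXP (t0 *\<^sub>R w)) z)) (at (- t0 + t0))"
    by simp
  then have "((\<lambda>t. \<mu> (\<phi> (EXP ((- t0 + t) *\<^sub>R w)) (\<phi> (EXP (t0 *\<^sub>R w)) z)) v) has_real_derivative LD v w (\<phi> (EXP (t0 *\<^sub>R w)) z)) (at t0)"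
    by (simp only: DERIV_shift add.commute[of "- t0"])
  moreover have "\<phi> (EXP ((- t0 + t) *\<^sub>R w)) (\<phi> (EXP (t0 *\<^sub>R w)) z) = \<phi> (EXP (t *\<^sub>R w)) z" for t
    using EXP_add[of "- t0 + t" t0 w] by (simp add: act_mult[symmetric])
  ultimately show ?thesis by simp
qed

text \<open>\<omega> and the fundamental fields are written in charts that vary with the point, so
  continuity is not immediate. In one fixed chart, \<open>LD v w z\<close> is the derivative F' of
  the momentum applied to \<open>D z w\<close>, and \<open>D z w\<close> is the complex derivative
  at s = 0 of a holomorphic curve depending continuously on z.\<close>

lemma isCont_LD:
  assumes x: "v \<in> uu" shows "isCont (LD v w) z0"
proof -
  define c where "c = chart_at B z0"
  have c: "c \<in> B" "z0 \<in> chart_dom c" "is_chart c" using Z.chart_at_in by (auto simp: c_def)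
  obtain F' where F': "\<And>p. p \<in> chart_dom c \<Longrightarrow> mder c vec_chart (\<lambda>z. \<mu> z v) p (F' (chart_map c p))"
    and F'c: "\<And>w. continuous_on (chart_map c ` chart_dom c) (\<lambda>y. F' y w)"
    using mu_chart[OF x c(1)] by blast
  have "\<forall>z\<in>chart_dom c. \<exists>D. clinear_map i J D \<and> mder c0 c (\<lambda>g. \<phi> g z) \<one> D"
    using hol_orbit[OF c(1)] by (simp add: hol_at_def)
  then obtain D where D: "\<And>z. z \<in> chart_dom c \<Longrightarrow> clinear_map i J (D z)"
    "\<And>z. z \<in> chart_dom c \<Longrightarrow> mder c0 c (\<lambda>g. \<phi> g z) \<one> (D z)" by metis
  have LD_eq: "LD v w z = F' (chart_map c z) (D z w)" if z: "z \<in> chart_dom c" for z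
  proof -
    have "mder c0 vec_chart (\<lambda>g. \<mu> (\<phi> g z) v) \<one> (\<lambda>w. F' (chart_map c z) (D z w))"
      using mder_compose[OF D(2)[OF z], of vec_chart "\<lambda>z. \<mu> z v" "F' (chart_map c z)"] F'[OF z] by simp
    moreover have "mder c0 vec_chart (\<lambda>g. \<mu> (\<phi> g z) v) \<one> (\<lambda>w. \<omega> z (fv z v) (fv z w))"
      using mder_compose[OF mder_fv[of z], of vec_chart "\<lambda>z. \<mu> z v" "\<omega> z (fv z v)"] mder_mu[OF x, of z] by simp
    ultimately show ?thesis using mder_unique by (metis LD_def)
  qed
  \<comment> \<open>A product neighbourhood of \<open>(0, z0)\<close> in the preimage of W keeps all
    the curves in the chart, with the common coordinate bound that
    \<open>isCont_deriv_parameter\<close> demands.\<close>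
  define H where "H p = \<phi> (EXP (cscale i (fst p) w)) (snd p)" for p :: "complex \<times> 'z"
  have Hc: "continuous_on UNIV H" unfolding H_def
  proof (clarsimp simp: continuous_on_eq_continuous_at)
    fix s and z :: 'z
    have "isCont (\<lambda>p. cscale i (fst p) w) (s, z)" unfolding cscale_def
      by (intro continuous_intros isCont_Re isCont_Im isCont_fst continuous_ident)
    from isCont_o2[OF this isCont_EXP]
    show "isCont (\<lambda>p. \<phi> (EXP (cscale i (fst p) w)) (snd p)) (s, z)"
      by (intro isCont_act isCont_snd continuous_ident)
  qed
  define W :: "'z set" where "W = chart_dom c \<inter> chart_map c -` ball (chart_map c z0) 1"
  have W: "open W" unfolding W_def
    by (intro continuous_open_preimage chart_facts(1,7)[OF c(3)] open_ball)
  have "H (0, z0) \<in> W" using c by (simp add: H_def cscale_simps W_def)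
  moreover have "open (H -` W)" using open_vimage[OF W Hc] .
  ultimately obtain S V where SV: "open S" "open V" "(0, z0) \<in> S \<times> V" "S \<times> V \<subseteq> H -` W"
    using open_prod_elim[of "H -` W" "(0, z0)"] by blast
  obtain r where r: "r > 0" "ball 0 r \<subseteq> S" using SV open_contains_ball by blast
  obtain K where K: "K \<ge> 1" "\<And>s v. norm (cscale i s v) \<le> K * cmod s * norm v" using cscale_bound by blast
  define R where "R = min r (rad / 8 / (K * (norm w + 1)))"
  have R: "R > 0" using r rad_pos K by (simp add: R_def add_nonneg_pos)
  have small: "norm (cscale i s w) < rad / 8" if "s \<in> ball 0 R" for s
  proof -
    have pos: "K * (norm w + 1) > 0" using K(1) by (simp add: add_nonneg_pos)
    have "norm (cscale i s w) \<le> K * cmod s * norm w" by (rule K)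
    also have "\<dots> \<le> K * cmod s * (norm w + 1)" using K(1) by (intro mult_left_mono) auto
    also have "\<dots> = cmod s * (K * (norm w + 1))" by simp
    also have "\<dots> < rad / 8" using that pos by (simp add: R_def pos_less_divide_eq)
    finally show ?thesis .
  qed
  have HW: "\<phi> (EXP (cscale i s w)) z \<in> W" if "s \<in> ball 0 R" "z \<in> V" for s z
    using SV(4) r(2) that by (auto simp: H_def R_def subset_iff)
  have V: "z \<in> chart_dom c" if "z \<in> V" for z
    using HW[of 0 z] R that by (auto simp: cscale_simps W_def)
  have cont_l: "isCont (\<lambda>z. l (D z w)) z0" if l: "clinear_map J ((*) \<i>) l" for l
  proof -
    have bl: "bounded_linear l" by (rule e.bounded_linear_clinear[OF l])
    obtain Kl where Kl: "\<And>v. cmod (l v) \<le> norm v * Kl" "Kl > 0" using bounded_linear.pos_bounded[OF bl] by blast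
    define g where "g z s = l (chart_map c (\<phi> (EXP (cscale i s w)) z))" for z s
    have "isCont (\<lambda>z. deriv (g z) 0) z0"
    proof (rule isCont_deriv_parameter[OF R SV(2)])
      show "z0 \<in> V" using SV by simp
      show "g z holomorphic_on ball 0 R" if z: "z \<in> V" for z
      proof -
        have "g z field_differentiable (at s)" if s: "s \<in> ball 0 R" for s
        proof -
          have h1: "hol_at ((*) \<i>) vec_chart i c0 (\<lambda>s. EXP (cscale i s w)) s"
            using hol_EXP_line_small[of 0 s w] small[OF s] by simp
          have "\<phi> (EXP (cscale i s w)) z \<in> chart_dom c" using HW[OF s z] by (simp add: W_def)
          then have h2: "hol_at ((*) \<i>) vec_chart J c (\<lambda>s. \<phi> (EXP (cscale i s w)) z) s"
            by (intro hol_act[OF h1 hol_constZ c0(1) c(1) c(1)]) (use c V z in auto)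
          have "hol_at J c J vec_chart (chart_map c) (\<phi> (EXP (cscale i s w)) z)"
            unfolding hol_at_def using mder_chart_map[OF c(3) hol_atD(4)[OF h2]] clinear_id by blast
          from hol_at_compose[OF h2 this]
          have h3: "hol_at ((*) \<i>) vec_chart J vec_chart (\<lambda>s. chart_map c (\<phi> (EXP (cscale i s w)) z)) s" .
          have "hol_at J vec_chart ((*) \<i>) vec_chart l y" for y
            unfolding hol_at_vec_iff by (rule complex_differentiable_at_clinear[OF l bl])
          from hol_at_compose[OF h3 this] show ?thesis
            by (simp add: g_def[abs_def] hol_at_vec_iff complex_differentiable_at_complex)
        qed
        then show ?thesis by (auto simp: holomorphic_on_def intro: field_differentiable_at_within)
      qed
      show "cmod (g z s) < (norm (chart_map c z0) + 1) * Kl" if "z \<in> V" "s \<in> ball 0 R" for z s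
      proof -
        have "dist (chart_map c z0) (chart_map c (\<phi> (EXP (cscale i s w)) z)) < 1"
          using HW[OF that(2,1)] by (simp add: W_def)
        then have "norm (chart_map c (\<phi> (EXP (cscale i s w)) z)) < norm (chart_map c z0) + 1"
          using norm_triangle_sub[of "chart_map c (\<phi> (EXP (cscale i s w)) z)" "chart_map c z0"]
          by (simp add: dist_norm norm_minus_commute)
        then show ?thesis unfolding g_def using Kl by (meson le_less_trans mult_strict_right_mono)
      qed
      show "isCont (\<lambda>z. g z s) z0" if s: "s \<in> ball 0 R" for s
      proof -
        have "\<phi> (EXP (cscale i s w)) z0 \<in> chart_dom c" using HW[OF s, of z0] SV by (simp add: W_def)
        from isCont_chart_map[OF c(3) this]
        have "isCont (\<lambda>z. chart_map c (\<phi> (EXP (cscale i s w)) z)) z0"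
          by (intro isCont_o2[of z0 "\<lambda>z. \<phi> (EXP (cscale i s w)) z" "chart_map c"] isCont_act) auto
        then show ?thesis unfolding g_def by (rule bounded_linear.isCont[OF bl])
      qed
    qed
    moreover have "deriv (g z) 0 = l (D z w)" if z: "z \<in> V" for z
    proof -
      have "bounded_linear (\<lambda>s. cscale i s w)" unfolding cscale_def
        by (intro bounded_linear_add bounded_linear_scaleR_const bounded_linear_Re bounded_linear_Im)
      from mder_vec[OF bounded_linear_imp_has_derivative[OF this]]
      have m0: "mder vec_chart vec_chart (\<lambda>s. cscale i s w) 0 (\<lambda>s. cscale i s w)" .
      have m1: "mder vec_chart c0 (\<lambda>s. EXP (cscale i s w)) 0 (\<lambda>s. cscale i s w)"
        using mder_compose[OF m0, of c0 EXP "\<lambda>v. v"] mder_EXP by (simp add: cscale_simps)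
      have m2: "mder vec_chart c (\<lambda>s. \<phi> (EXP (cscale i s w)) z) 0 (\<lambda>s. D z (cscale i s w))"
        using mder_compose[OF m1, of c "\<lambda>g. \<phi> g z" "D z"] D(2)[OF V[OF z]] by (simp add: cscale_simps)
      then have "((\<lambda>s. chart_map c (\<phi> (EXP (cscale i s w)) z)) has_derivative (\<lambda>s. D z (cscale i s w))) (at 0)"
        using c(3) by (simp add: mder_vec_iff)
      from bounded_linear.has_derivative[OF bl this]
      have "(g z has_derivative (\<lambda>s. l (D z (cscale i s w)))) (at 0)" by (simp add: g_def[abs_def])
      moreover have "(\<lambda>s. l (D z (cscale i s w))) = (*) (l (D z w))"
        using clinear_cscale[OF D(1)[OF V[OF z]]] e.clinear_cscale[OF l] by (auto simp: cscale_def complex_eq_iff)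
      ultimately have "(g z has_field_derivative l (D z w)) (at 0)" by (simp add: has_field_derivative_def)
      then show ?thesis by (rule DERIV_imp_deriv)
    qed
    moreover have "\<forall>\<^sub>F z in nhds z0. z \<in> V" using SV eventually_nhds by auto
    ultimately show ?thesis using isCont_cong[of "\<lambda>z. deriv (g z) 0" "\<lambda>z. l (D z w)" z0] by (simp add: eventually_mono)
  qed
  obtain I :: "'e set" and l :: "'e \<Rightarrow> 'e \<Rightarrow> complex" where
    I: "finite I" and l: "\<And>b. clinear_map J ((*) \<i>) (l b)" and sum: "\<And>v. v = (\<Sum>b\<in>I. cscale J (l b v) b)"
    using e.complex_coordinates by blast
  have Fc: "isCont (\<lambda>z. F' (chart_map c z) b) z0" for b
  proof -
    have "isCont (\<lambda>y. F' y b) (chart_map c z0)"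
      using F'c chart_facts(2)[OF c(3)] c(2) by (simp add: continuous_on_eq_continuous_at)
    from isCont_o2[OF isCont_chart_map[OF c(3,2)] this] show ?thesis .
  qed
  \<comment> \<open>Expanding \<open>D z w\<close> in complex coordinates leaves F' only at fixed
    vectors, where its continuity is known.\<close>
  have "isCont (\<lambda>z. \<Sum>b\<in>I. Re (l b (D z w)) * F' (chart_map c z) b + Im (l b (D z w)) * F' (chart_map c z) (J b)) z0"
    by (intro continuous_intros isCont_Re isCont_Im Fc cont_l l)
  moreover have "LD v w z = (\<Sum>b\<in>I. Re (l b (D z w)) * F' (chart_map c z) b + Im (l b (D z w)) * F' (chart_map c z) (J b))"
    if z: "z \<in> chart_dom c" for z
  proof -
    have lin: "linear (F' (chart_map c z))" using mder_linear[OF F'[OF z]] .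
    have "LD v w z = F' (chart_map c z) (\<Sum>b\<in>I. cscale J (l b (D z w)) b)"
      unfolding LD_eq[OF z] by (rule arg_cong[OF sum])
    then show ?thesis by (simp add: linear_sum[OF lin] cscale_def linear_add[OF lin] linear_scale[OF lin])
  qed
  moreover have "\<forall>\<^sub>F z in nhds z0. z \<in> chart_dom c" using c chart_facts(1) eventually_nhds by blast
  ultimately show ?thesis
    using isCont_cong[of "LD v w" "\<lambda>z. \<Sum>b\<in>I. Re (l b (D z w)) * F' (chart_map c z) b + Im (l b (D z w)) * F' (chart_map c z) (J b)" z0]
    by (simp add: eventually_mono)
qed

end

section \<open>Hermitian operators\<close>

lemma (in fd_complex) bounded_bilinear_fd:
  fixes q :: "'a \<Rightarrow> 'a \<Rightarrow> 'b::real_normed_vector"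
  assumes q1: "\<And>w. linear (\<lambda>v. q v w)" and q2: "\<And>v. linear (q v)"
  shows "bounded_bilinear q"
proof -
  obtain I :: "'a set" and l :: "'a \<Rightarrow> 'a \<Rightarrow> complex" where
    I: "finite I" and l: "\<And>b. clinear_map j ((*) \<i>) (l b)" and sum: "\<And>v. v = (\<Sum>b\<in>I. cscale j (l b v) b)"
    using complex_coordinates by blast
  have "\<exists>K\<ge>0. \<forall>v. cmod (l b v) \<le> K * norm v" for b
    using bounded_linear.nonneg_bounded[OF bounded_linear_clinear[OF l[of b]]] by (auto simp: mult.commute)
  then obtain K1 where K1: "\<And>b. K1 b \<ge> 0" "\<And>b v. cmod (l b v) \<le> K1 b * norm v" by metis
  have "\<exists>K\<ge>0. \<forall>w. norm (q b w) \<le> K * norm w" for b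
    using bounded_linear.nonneg_bounded[OF linear_bounded[OF q2[of b]]] by (auto simp: mult.commute)
  then obtain K2 where K2: "\<And>b. K2 b \<ge> 0" "\<And>b w. norm (q b w) \<le> K2 b * norm w" by metis
  define K where "K = (\<Sum>b\<in>I. K1 b * (K2 b + K2 (j b)))"
  have "norm (q v w) \<le> norm v * norm w * K" for v w
  proof -
    have "q v w = q (\<Sum>b\<in>I. cscale j (l b v) b) w" by (rule arg_cong[OF sum])
    also have "\<dots> = (\<Sum>b\<in>I. Re (l b v) *\<^sub>R q b w + Im (l b v) *\<^sub>R q (j b) w)"
      by (simp add: linear_sum[OF q1] cscale_def linear_add[OF q1] linear_scale[OF q1])
    also have "norm \<dots> \<le> (\<Sum>b\<in>I. K1 b * norm v * ((K2 b + K2 (j b)) * norm w))"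
    proof (rule sum_norm_le)
      fix b assume "b \<in> I"
      have "norm (Re (l b v) *\<^sub>R q b w + Im (l b v) *\<^sub>R q (j b) w) \<le> \<bar>Re (l b v)\<bar> * norm (q b w) + \<bar>Im (l b v)\<bar> * norm (q (j b) w)"
        using norm_triangle_ineq[of "Re (l b v) *\<^sub>R q b w" "Im (l b v) *\<^sub>R q (j b) w"] by simp
      also have "\<dots> \<le> cmod (l b v) * (K2 b * norm w) + cmod (l b v) * (K2 (j b) * norm w)"
        by (intro add_mono mult_mono K2 abs_Re_le_cmod abs_Im_le_cmod) auto
      also have "\<dots> = cmod (l b v) * ((K2 b + K2 (j b)) * norm w)" by (simp add: algebra_simps)
      also have "\<dots> \<le> K1 b * norm v * ((K2 b + K2 (j b)) * norm w)"
        using K2(1)[of b] K2(1)[of "j b"] by (intro mult_right_mono K1) auto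
      finally show "norm (Re (l b v) *\<^sub>R q b w + Im (l b v) *\<^sub>R q (j b) w) \<le> K1 b * norm v * ((K2 b + K2 (j b)) * norm w)" .
    qed
    also have "\<dots> = norm v * norm w * K"
      unfolding K_def sum_distrib_left by (rule sum.cong) auto
    finally show ?thesis .
  qed
  then show ?thesis
    by (intro bounded_bilinear.intro exI[of _ K])
       (auto simp: linear_add[OF q1] linear_add[OF q2] linear_scale[OF q1] linear_scale[OF q2])
qed

section \<open>The spectral theorem for complex-linear symmetric operators\<close>

locale hermitian_space = fd_complex j for j :: "'a::real_normed_vector \<Rightarrow> 'a" +
  fixes q :: "'a \<Rightarrow> 'a \<Rightarrow> real"
  assumes q_linear: "\<And>w. linear (\<lambda>v. q v w)" and q_sym: "\<And>v w. q v w = q w v"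
    and q_pos: "\<And>v. v \<noteq> 0 \<Longrightarrow> q v v > 0" and q_j: "\<And>v w. q (j v) (j w) = q v w"
begin

lemma q_linear2: "linear (q v)"
  using q_linear[of v] q_sym by (simp add: linear_iff)

lemma q_simps: "q (v + w) u = q v u + q w u" "q u (v + w) = q u v + q u w"
  "q (c *\<^sub>R v) u = c * q v u" "q u (c *\<^sub>R v) = c * q u v" "q (- v) u = - q v u" "q u (- v) = - q u v"
  "q (v - w) u = q v u - q w u" "q u (v - w) = q u v - q u w" "q 0 u = 0" "q u 0 = 0"
  by (simp_all add: linear_add[OF q_linear] linear_scale[OF q_linear] linear_neg[OF q_linear]
      linear_diff[OF q_linear] linear_0[OF q_linear] linear_add[OF q_linear2] linear_scale[OF q_linear2]
      linear_neg[OF q_linear2] linear_diff[OF q_linear2] linear_0[OF q_linear2])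

lemma q_j_left: "q (j v) w = - q v (j w)"
  using q_j[of "j v" w] by (simp add: q_simps)

lemma bb: "bounded_bilinear q" by (rule bounded_bilinear_fd[OF q_linear q_linear2])

definition ortho :: "nat \<Rightarrow> (nat \<Rightarrow> 'a) \<Rightarrow> bool" where
  "ortho n e \<longleftrightarrow> (\<forall>k<n. \<forall>m<n. q (e k) (e m) = (if k = m then 1 else 0) \<and> q (e k) (j (e m)) = 0)"

text \<open>The Hermitian product of v with \<open>e k\<close>; q is its real part.\<close>

definition coef :: "(nat \<Rightarrow> 'a) \<Rightarrow> nat \<Rightarrow> 'a \<Rightarrow> complex" where
  "coef e k v = Complex (q v (e k)) (q v (j (e k)))"

lemma clinear_coef: "clinear_map j ((*) \<i>) (coef e k)"
  unfolding clinear_map_def coef_def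
  by (auto intro!: linearI simp: q_simps complex_eq_iff q_j_left)

lemma ortho_coef: "ortho n e \<Longrightarrow> k < n \<Longrightarrow> m < n \<Longrightarrow> coef e k (e m) = (if k = m then 1 else 0)"
  unfolding ortho_def coef_def by (auto simp: complex_eq_iff)

text \<open>The value \<open>t = - b / A\<close> with \<open>A = \<bar>a\<bar> + 1\<close> refutes a
  nonzero b whatever the sign of a.\<close>

lemma quadratic_min:
  fixes a b :: real assumes "\<And>t. a * t\<^sup>2 + 2 * b * t \<ge> 0" shows "b = 0"
proof (rule ccontr)
  assume b: "b \<noteq> 0"
  define A where "A = \<bar>a\<bar> + 1"
  have A: "A > 0" "a < A" by (auto simp: A_def)
  have "a * (- b / A)\<^sup>2 + 2 * b * (- b / A) = b\<^sup>2 / A * (a / A - 2)"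
    using A by (simp add: power2_eq_square field_simps)
  moreover have "a / A - 2 < 0" using A by (simp add: divide_less_eq)
  moreover have "b\<^sup>2 / A > 0" using A b by simp
  ultimately show False using assms[of "- b / A"] mult_pos_neg[of "b\<^sup>2 / A" "a / A - 2"] by linarith
qed

text \<open>The Rayleigh quotient has a maximum c on the q-unit sphere of V. The first variation
  there makes \<open>c *\<^sub>R v0 - S v0\<close> orthogonal to V, to which it also
  belongs.\<close>

lemma eigenvector_in_subspace:
  assumes V: "subspace V" "V \<noteq> {0}" and S: "linear S" "\<And>v. v \<in> V \<Longrightarrow> S v \<in> V"
    and sym: "\<And>v w. q (S v) w = q v (S w)"
  shows "\<exists>v\<in>V. \<exists>c. q v v = 1 \<and> S v = c *\<^sub>R v"
proof -
  have bS: "bounded_linear S" by (rule linear_bounded[OF S(1)])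
  have cq: "continuous_on T (\<lambda>v. q v v)" "continuous_on T (\<lambda>v. q (S v) v)" for T
    by (intro bounded_bilinear.continuous_on[OF bb] bounded_linear.continuous_on[OF bS] continuous_on_id)+
  obtain v1 where v1: "v1 \<in> V" "v1 \<noteq> 0" using V subspace_0 by blast
  have "sphere (0::'a) 1 = {v. norm v = 1}" by auto
  moreover have "closed {v::'a. norm v = 1}" by (intro closed_Collect_eq continuous_intros)
  ultimately have "compact (sphere (0::'a) 1)"
    by (intro bounded_closed_compact) (auto simp: bounded_iff)
  moreover have "(1 / norm v1) *\<^sub>R v1 \<in> sphere 0 1" using v1 by simp
  ultimately obtain s where s: "s \<in> sphere 0 1" "\<And>v. v \<in> sphere 0 1 \<Longrightarrow> q s s \<le> q v v"
    using continuous_attains_inf[OF _ _ cq(1), of "sphere 0 1"] by blast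
  \<comment> \<open>The minimum of \<open>q v v\<close> on the norm sphere compares q with the norm
    and so bounds the q-unit sphere.\<close>
  define d where "d = q s s"
  have d: "d > 0" unfolding d_def using s(1) by (intro q_pos) auto
  have lower: "d * (norm v)\<^sup>2 \<le> q v v" for v
  proof (cases "v = 0")
    case False
    then have "d \<le> q ((1 / norm v) *\<^sub>R v) ((1 / norm v) *\<^sub>R v)" unfolding d_def by (intro s(2)) simp
    also have "\<dots> = q v v / (norm v)\<^sup>2" by (simp add: q_simps power2_eq_square)
    finally show ?thesis using False by (simp add: field_simps)
  qed (simp add: q_simps)
  define K where "K = {v \<in> V. q v v = 1}"
  have "compact K"
  proof (rule bounded_closed_compact)
    have "norm v \<le> 1 + 1 / d" if "v \<in> K" for v
    proof -
      have "d * (norm v)\<^sup>2 \<le> 1" using lower[of v] that by (simp add: K_def)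
      then have "(norm v)\<^sup>2 \<le> 1 / d" using d by (simp add: field_simps)
      moreover have "norm v \<le> 1 + (norm v)\<^sup>2"
      proof -
        have "2 * norm v \<le> (norm v)\<^sup>2 + 1"
          using zero_le_power2[of "norm v - 1"] unfolding power2_diff by simp
        then show ?thesis using norm_ge_zero[of v] by linarith
      qed
      ultimately show ?thesis by linarith
    qed
    then show "bounded K" by (auto simp: bounded_iff)
    have "closed (V \<inter> (\<lambda>v. q v v) -` {1})"
      by (intro closed_Int closed_subspace V closed_vimage cq(1)) auto
    moreover have "K = V \<inter> (\<lambda>v. q v v) -` {1}" by (auto simp: K_def)
    ultimately show "closed K" by simp
  qed
  have nrm: "(1 / sqrt (q v v)) *\<^sub>R v \<in> K" if "v \<in> V" "v \<noteq> 0" for v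
    using that V(1) q_pos[OF that(2)] by (simp add: K_def subspace_scale q_simps)
  obtain v0 where v0: "v0 \<in> K" "\<And>v. v \<in> K \<Longrightarrow> q (S v) v \<le> q (S v0) v0"
    using continuous_attains_sup[OF \<open>compact K\<close> _ cq(2)] nrm[OF v1] by blast
  define c where "c = q (S v0) v0"
  have v0V: "v0 \<in> V" "q v0 v0 = 1" using v0 by (auto simp: K_def)
  have h: "c * q v v - q (S v) v \<ge> 0" if v: "v \<in> V" for v
  proof (cases "v = 0")
    case False
    have p: "q v v > 0" by (rule q_pos[OF False])
    have "q (S ((1 / sqrt (q v v)) *\<^sub>R v)) ((1 / sqrt (q v v)) *\<^sub>R v) \<le> c"
      unfolding c_def by (rule v0(2)[OF nrm[OF v False]])
    then have "q (S v) v / q v v \<le> c" using p by (simp add: q_simps linear_scale[OF S(1)])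
    then show ?thesis using p by (simp add: field_simps)
  qed (simp add: q_simps linear_0[OF S(1)])
  have "c * q v0 w - q (S v0) w = 0" if w: "w \<in> V" for w
  proof (rule quadratic_min)
    fix t :: real
    have "v0 + t *\<^sub>R w \<in> V" using V(1) v0V w by (intro subspace_add subspace_scale)
    from h[OF this]
    have "0 \<le> c * (1 + 2 * t * q v0 w + t\<^sup>2 * q w w) - (c + t * q (S w) v0 + t * q (S v0) w + t\<^sup>2 * q (S w) w)"
      using v0V(2) q_sym[of w v0]
      by (simp add: q_simps linear_add[OF S(1)] linear_scale[OF S(1)] c_def power2_eq_square algebra_simps)
    also have "q (S w) v0 = q (S v0) w" using sym[of w v0] q_sym[of w "S v0"] by simp
    finally show "0 \<le> (c * q w w - q (S w) w) * t\<^sup>2 + 2 * (c * q v0 w - q (S v0) w) * t"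
      by (simp add: algebra_simps)
  qed
  then have z: "q (c *\<^sub>R v0 - S v0) w = 0" if "w \<in> V" for w using that by (simp add: q_simps)
  have "c *\<^sub>R v0 - S v0 \<in> V" using V(1) v0V S(2) by (intro subspace_diff subspace_scale)
  from z[OF this] have "c *\<^sub>R v0 - S v0 = 0" using q_pos[of "c *\<^sub>R v0 - S v0"] by force
  then show ?thesis using v0V by (intro bexI[of _ v0] exI[of _ c]) auto
qed

lemma ortho_bound:
  assumes "finite T" "span T = (UNIV::'a set)" "ortho n e" shows "n \<le> card T"
proof -
  have inj: "inj_on e {..<n}"
  proof (rule inj_onI)
    fix k m assume km: "k \<in> {..<n}" "m \<in> {..<n}" "e k = e m"
    then have "q (e k) (e k) = q (e k) (e m)" by simp
    then show "k = m" using assms(3) km(1,2) unfolding ortho_def by (auto split: if_splits)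
  qed
  have "independent (e ` {..<n})"
  proof (rule independent_if_scalars_zero)
    fix f x assume s: "(\<Sum>x\<in>e ` {..<n}. f x *\<^sub>R x) = 0" and x: "x \<in> e ` {..<n}"
    then obtain k where k: "k < n" "x = e k" by auto
    have "0 = q (\<Sum>m<n. f (e m) *\<^sub>R e m) (e k)" using s by (simp add: sum.reindex[OF inj] q_simps)
    also have "\<dots> = (\<Sum>m<n. f (e m) * q (e m) (e k))"
      using linear_sum[OF q_linear[of "e k"], of "\<lambda>m. f (e m) *\<^sub>R e m" "{..<n}"] by (simp add: q_simps)
    also have "\<dots> = (\<Sum>m<n. if m = k then f (e m) else 0)"
      using assms(3) k(1) unfolding ortho_def by (intro sum.cong) auto
    also have "\<dots> = f x" using k by simp
    finally show "f x = 0" by simp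
  qed simp
  then have "card (e ` {..<n}) \<le> card T"
    using independent_span_bound[OF assms(1), of "e ` {..<n}"] assms(2) by simp
  then show ?thesis by (simp add: card_image[OF inj])
qed

text \<open>A longest orthonormal family of eigenvectors exists because its length is bounded. The
  complement of the family and of its multiples by j is invariant under S, so unless it is zero a
  further eigenvector extends the family.\<close>

theorem spectral:
  assumes S: "linear S" "\<And>v. S (j v) = j (S v)" and sym: "\<And>v w. q (S v) w = q v (S w)"
  shows "\<exists>n e c. ortho n e \<and> (\<forall>k<n. S (e k) = (c k :: real) *\<^sub>R e k) \<and> (\<forall>v. v = (\<Sum>k<n. cscale j (coef e k v) (e k)))"
proof -
  obtain T where T: "finite T" "span T = (UNIV::'a set)" using fin_span by blast
  define P where "P n \<longleftrightarrow> (\<exists>e c. ortho n e \<and> (\<forall>k<n. S (e k) = (c k :: real) *\<^sub>R e k))" for n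
  have "P 0" by (auto simp: P_def ortho_def)
  moreover have "\<forall>n. P n \<longrightarrow> n \<le> card T" using ortho_bound[OF T] by (auto simp: P_def)
  ultimately obtain n where n: "P n" "\<And>m. P m \<Longrightarrow> m \<le> n" using Nat.ex_has_greatest_nat[of P 0 "card T"] by blast
  then obtain e c where e: "ortho n e" "\<And>k. k < n \<Longrightarrow> S (e k) = c k *\<^sub>R e k" by (auto simp: P_def)
  define V where "V = {v. \<forall>k<n. q v (e k) = 0 \<and> q v (j (e k)) = 0}"
  have V: "subspace V" unfolding V_def by (intro subspaceI) (auto simp: q_simps)
  have "V = {0}"
  proof (rule ccontr)
    assume "V \<noteq> {0}"
    moreover have "S v \<in> V" if "v \<in> V" for v
      using that e(2) unfolding V_def by (simp add: sym S(2) q_simps j_simps)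
    ultimately obtain v d where v: "v \<in> V" "q v v = 1" "S v = d *\<^sub>R v"
      using eigenvector_in_subspace[OF V _ S(1) _ sym] by blast
    define e' where "e' = e(n := v)"
    have vv: "q v (j v) = 0" using q_j_left[of v v] q_sym[of "j v" v] by simp
    have vk: "q v (e k) = 0" "q v (j (e k)) = 0" "q (e k) v = 0" "q (e k) (j v) = 0" if "k < n" for k
    proof -
      show 1: "q v (e k) = 0" "q v (j (e k)) = 0" using v(1) that by (auto simp: V_def)
      then show "q (e k) v = 0" using q_sym by metis
      show "q (e k) (j v) = 0" using 1(2) q_j_left[of "e k" v] q_sym[of v "j (e k)"] by simp
    qed
    have "ortho (Suc n) e'" using e(1) v(2) vv vk unfolding ortho_def e'_def by (auto simp: less_Suc_eq)
    moreover have "\<forall>k<Suc n. S (e' k) = (c(n := d)) k *\<^sub>R e' k" using e(2) v(3) by (auto simp: e'_def less_Suc_eq)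
    ultimately have "P (Suc n)" unfolding P_def by blast
    then show False using n(2) by force
  qed
  have "v = (\<Sum>k<n. cscale j (coef e k v) (e k))" for v
  proof -
    define s where "s = (\<Sum>k<n. cscale j (coef e k v) (e k))"
    have c: "coef e m s = coef e m v" if m: "m < n" for m
    proof -
      have lin: "linear (coef e m)" using clinear_coef by (simp add: clinear_map_def)
      have "coef e m s = (\<Sum>k<n. coef e m (cscale j (coef e k v) (e k)))"
        unfolding s_def by (rule linear_sum[OF lin])
      also have "\<dots> = (\<Sum>k<n. coef e k v * coef e m (e k))"
        using clinear_cscale[OF clinear_coef] by (intro sum.cong) (auto simp: cscale_def complex_eq_iff)
      also have "\<dots> = (\<Sum>k<n. if k = m then coef e k v else 0)"
        using ortho_coef[OF e(1) m] by (intro sum.cong) auto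
      also have "\<dots> = coef e m v" using m by simp
      finally show ?thesis .
    qed
    have "v - s \<in> V" unfolding V_def
      using c by (auto simp: q_simps coef_def complex_eq_iff)
    then have "v - s = 0" using \<open>V = {0}\<close> by simp
    then show ?thesis by (simp add: s_def)
  qed
  with e show ?thesis by blast
qed

end

section \<open>Gradient flows on a compact orbit\<close>

locale cplx_action = hamiltonian_action L i A J B U \<omega> \<phi> \<mu>
  for L :: "'g::{t2_space, second_countable_topology} monoid" (structure)
    and i :: "'l::real_normed_vector \<Rightarrow> 'l" and A :: "('g, 'l) chart set"
    and J :: "'e::real_normed_vector \<Rightarrow> 'e" and B :: "('z::{t2_space, second_countable_topology}, 'e) chart set"
    and U :: "'g set" and \<omega> :: "'z \<Rightarrow> 'e \<Rightarrow> 'e \<Rightarrow> real" and \<phi> :: "'g \<Rightarrow> 'z \<Rightarrow> 'z" and \<mu> :: "'z \<Rightarrow> 'l \<Rightarrow> real" +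
  fixes ip :: "'l \<Rightarrow> 'l \<Rightarrow> real" and x :: 'z
  assumes decomp: "direct_sum_decomposition UNIV uu (i ` uu)"
    and ip: "Ad_invariant_inner_product L A U ip"
    and conn: "connected (UNIV :: 'g set)"
    and compact_orbit: "compact (range (\<lambda>g. \<phi> g x))"
begin

abbreviation X where "X \<equiv> range (\<lambda>g. \<phi> g x)"

lemma X_act: "y \<in> X \<Longrightarrow> \<phi> g y \<in> X"
  by (auto simp: act_mult[symmetric])

subsection \<open>The Hermitian inner product on the Lie algebra\<close>

lemma ipu: "a \<in> uu \<Longrightarrow> b \<in> uu \<Longrightarrow> c \<in> uu \<Longrightarrow> ip (a + b) c = ip a c + ip b c"
  "a \<in> uu \<Longrightarrow> c \<in> uu \<Longrightarrow> ip (r *\<^sub>R a) c = r * ip a c"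
  "a \<in> uu \<Longrightarrow> b \<in> uu \<Longrightarrow> ip a b = ip b a"
  "a \<in> uu \<Longrightarrow> a \<noteq> 0 \<Longrightarrow> ip a a > 0"
  "g \<in> U \<Longrightarrow> a \<in> uu \<Longrightarrow> b \<in> uu \<Longrightarrow> ip (AD g a) (AD g b) = ip a b"
proof -
  have io: "inner_product_on uu ip" using ip by (simp add: Ad_invariant_inner_product_def)
  have lin: "a \<in> uu \<Longrightarrow> b \<in> uu \<Longrightarrow> c \<in> uu \<Longrightarrow> ip (s *\<^sub>R a + r *\<^sub>R b) c = s * ip a c + r * ip b c" for a b c s r
    using io by (simp add: inner_product_on_def)
  show "a \<in> uu \<Longrightarrow> b \<in> uu \<Longrightarrow> c \<in> uu \<Longrightarrow> ip (a + b) c = ip a c + ip b c" using lin[of a b c 1 1] by simp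
  show "a \<in> uu \<Longrightarrow> c \<in> uu \<Longrightarrow> ip (r *\<^sub>R a) c = r * ip a c" using lin[of a a c r 0] by simp
  show "a \<in> uu \<Longrightarrow> b \<in> uu \<Longrightarrow> ip a b = ip b a" "a \<in> uu \<Longrightarrow> a \<noteq> 0 \<Longrightarrow> ip a a > 0"
    using io by (auto simp: inner_product_on_def)
  show "g \<in> U \<Longrightarrow> a \<in> uu \<Longrightarrow> b \<in> uu \<Longrightarrow> ip (AD g a) (AD g b) = ip a b"
    using ip by (simp add: Ad_invariant_inner_product_def)
qed

lemma parts_unique:
  assumes "a \<in> uu" "b \<in> uu" "a' \<in> uu" "b' \<in> uu" "a + i b = a' + i b'"
  shows "a = a'" "b = b'"
proof -
  have s: "a - a' = i (b' - b)" using assms(5) by (simp add: j_simps algebra_simps)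
  have "a - a' \<in> uu" "b' - b \<in> uu" using assms subspace_uu by (auto intro: subspace_diff)
  then have "a - a' \<in> uu" "a - a' \<in> i ` uu" unfolding s by blast+
  then have "a - a' = 0" using decomp unfolding direct_sum_decomposition_def by blast
  then show "a = a'" by simp
  then have "i (i (b' - b)) = 0" using s by (simp add: j_simps)
  then show "b = b'" by simp
qed

definition pr :: "'l \<Rightarrow> 'l \<times> 'l" where
  "pr v = (SOME p. fst p \<in> uu \<and> snd p \<in> uu \<and> v = fst p + i (snd p))"

lemma pr: "fst (pr v) \<in> uu" "snd (pr v) \<in> uu" "v = fst (pr v) + i (snd (pr v))"
proof -
  obtain a b where ab: "a \<in> uu" "b \<in> i ` uu" "v = a + b" using decomp unfolding direct_sum_decomposition_def by blast
  then obtain b' where "b' \<in> uu" "b = i b'" by blast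
  with ab have "\<exists>p. fst p \<in> uu \<and> snd p \<in> uu \<and> v = fst p + i (snd p)" by (intro exI[of _ "(a, b')"]) simp
  from someI_ex[OF this] show "fst (pr v) \<in> uu" "snd (pr v) \<in> uu" "v = fst (pr v) + i (snd (pr v))"
    unfolding pr_def by auto
qed

lemma pr_eqI: "a \<in> uu \<Longrightarrow> b \<in> uu \<Longrightarrow> v = a + i b \<Longrightarrow> pr v = (a, b)"
  using parts_unique[of "fst (pr v)" "snd (pr v)" a b] pr[of v] by (metis prod.collapse)

lemma pr_simps: "pr (v + w) = pr v + pr w" "pr (c *\<^sub>R v) = c *\<^sub>R pr v" "pr (i v) = (- snd (pr v), fst (pr v))"
proof -
  note u = subspace_add[OF subspace_uu] subspace_scale[OF subspace_uu] subspace_neg[OF subspace_uu]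
  have "v + w = (fst (pr v) + fst (pr w)) + i (snd (pr v) + snd (pr w))"
  proof -
    have "v + w = (fst (pr v) + i (snd (pr v))) + (fst (pr w) + i (snd (pr w)))" by (rule arg_cong2[OF pr(3) pr(3)])
    then show ?thesis by (simp add: j_simps)
  qed
  from pr_eqI[OF _ _ this] show "pr (v + w) = pr v + pr w" using pr u by (simp add: prod_eq_iff)
  have "c *\<^sub>R v = c *\<^sub>R fst (pr v) + i (c *\<^sub>R snd (pr v))"
    using pr(3)[of v] by (metis j_simps(2) scaleR_right_distrib)
  from pr_eqI[OF _ _ this] show "pr (c *\<^sub>R v) = c *\<^sub>R pr v" using pr u by (simp add: prod_eq_iff)
  have "i v = - snd (pr v) + i (fst (pr v))"
    using arg_cong[OF pr(3)[of v], of i] by (simp add: j_simps)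
  from pr_eqI[OF _ _ this] show "pr (i v) = (- snd (pr v), fst (pr v))" using pr u by simp
qed

definition hq :: "'l \<Rightarrow> 'l \<Rightarrow> real" where
  "hq v w = ip (fst (pr v)) (fst (pr w)) + ip (snd (pr v)) (snd (pr w))"

lemma ipu0: "a \<in> uu \<Longrightarrow> ip 0 a = 0" "a \<in> uu \<Longrightarrow> b \<in> uu \<Longrightarrow> ip (- a) (- b) = ip a b"
proof -
  have neg: "ip (- a) b = - ip a b" if "a \<in> uu" "b \<in> uu" for a b
    using ipu(2)[OF that, of "- 1"] by simp
  show "a \<in> uu \<Longrightarrow> ip 0 a = 0" using ipu(2)[of a a 0] by simp
  show "a \<in> uu \<Longrightarrow> b \<in> uu \<Longrightarrow> ip (- a) (- b) = ip a b"
    using neg[of a "- b"] neg[of b a] ipu(3)[of a "- b"] ipu(3)[of b a] subspace_neg[OF subspace_uu] by simp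
qed

sublocale H: hermitian_space i hq
proof (intro hermitian_space.intro hermitian_space_axioms.intro fd_complex_axioms)
  show "linear (\<lambda>v. hq v w)" for w
    by (rule linearI) (simp_all add: hq_def pr_simps ipu pr algebra_simps)
  show "hq v w = hq w v" for v w using ipu(3) pr by (simp add: hq_def)
  show "hq v v > 0" if "v \<noteq> 0" for v
  proof -
    have nn: "ip a a \<ge> 0" if "a \<in> uu" for a using ipu(4)[OF that] ipu0(1)[OF that] that by (cases "a = 0") auto
    have "fst (pr v) \<noteq> 0 \<or> snd (pr v) \<noteq> 0" using pr(3)[of v] that by (auto simp: j_simps)
    then show ?thesis unfolding hq_def
      using nn[OF pr(1)[of v]] nn[OF pr(2)[of v]] ipu(4)[OF pr(1)[of v]] ipu(4)[OF pr(2)[of v]] by linarith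
  qed
  show "hq (i v) (i w) = hq v w" for v w by (simp add: hq_def pr_simps ipu0 pr)
qed

lemma pr_Ad:
  assumes "g \<in> U" shows "pr (AD g v) = (AD g (fst (pr v)), AD g (snd (pr v)))"
proof (rule pr_eqI)
  show "AD g (fst (pr v)) \<in> uu" "AD g (snd (pr v)) \<in> uu" using Ad_lie_algebra[OF U(1) assms] pr by auto
  show "AD g v = AD g (fst (pr v)) + i (AD g (snd (pr v)))"
    using arg_cong[OF pr(3)[of v], of "AD g"] by (simp add: Ad_simps)
qed

text \<open>Derivative at t = 0 of the invariance of \<open>hq\<close> under the one-parameter
  subgroup of v, which lies in U.\<close>

lemma bracket_skew:
  assumes v: "v \<in> uu" shows "hq (lie_bracket L A v a) b = - hq a (lie_bracket L A v b)"
proof -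
  have "((\<lambda>t. hq (AD (EXP (t *\<^sub>R v)) a) (AD (EXP (t *\<^sub>R v)) b)) has_derivative
      (\<lambda>h. hq (AD (EXP (0 *\<^sub>R v)) a) (h *\<^sub>R lie_bracket L A v b) + hq (h *\<^sub>R lie_bracket L A v a) (AD (EXP (0 *\<^sub>R v)) b))) (at 0)"
    using bounded_bilinear.FDERIV[OF H.bb] bracket_derivative_0 unfolding has_vector_derivative_def by blast
  moreover have "hq (AD (EXP (t *\<^sub>R v)) a) (AD (EXP (t *\<^sub>R v)) b) = hq a b" for t
  proof -
    have "EXP (t *\<^sub>R v) \<in> U" using v by (simp add: lie_algebra_iff)
    then show ?thesis unfolding hq_def by (simp add: pr_Ad ipu(5) pr)
  qed
  ultimately have "((\<lambda>t::real. hq a b) has_derivative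
      (\<lambda>h. hq a (h *\<^sub>R lie_bracket L A v b) + hq (h *\<^sub>R lie_bracket L A v a) b)) (at 0)" by (simp add: Ad_one)
  from fun_cong[OF has_derivative_unique[OF this has_derivative_const], of 1] show ?thesis by simp
qed

text \<open>The bracket with \<open>i v\<close> is i times the bracket with v, hence i times a skew
  complex-linear operator, hence symmetric; its eigenvalues exponentiate.\<close>

lemma eigenbasis:
  assumes v: "v \<in> uu"
  shows "\<exists>n e c. H.ortho n e \<and> (\<forall>k<n. \<forall>t. AD (EXP (t *\<^sub>R i v)) (e k) = exp (c k * t) *\<^sub>R e k) \<and>
    (\<forall>w. w = (\<Sum>k<n. cscale i (H.coef e k w) (e k)))"
proof -
  define S where "S = lie_bracket L A (i v)"
  have "linear S" unfolding S_def by (intro linearI bracket_linear)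
  moreover have "S (i w) = i (S w)" for w unfolding S_def by (rule bracket_linear)
  moreover have "hq (S a) b = hq a (S b)" for a b
  proof -
    have "hq (S a) b = - hq (lie_bracket L A v a) (i b)" by (simp add: S_def bracket_i H.q_j_left)
    also have "\<dots> = hq a (lie_bracket L A v (i b))" by (simp add: bracket_skew[OF v])
    also have "\<dots> = hq a (S b)" by (simp add: S_def bracket_i bracket_linear)
    finally show ?thesis .
  qed
  ultimately obtain n e c where "H.ortho n e" "\<forall>k<n. S (e k) = (c k :: real) *\<^sub>R e k"
    "\<forall>w. w = (\<Sum>k<n. cscale i (H.coef e k w) (e k))" using H.spectral by blast
  then show ?thesis using Ad_EXP_eigenvector unfolding S_def by blast
qed

subsection \<open>Gradient flows\<close>

abbreviation flow where "flow v t y \<equiv> \<phi> (EXP (t *\<^sub>R i v)) y"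

lemma flow_add: "flow v (s + t) y = flow v s (flow v t y)"
  by (simp add: EXP_add act_mult)

text \<open>The flow of \<open>i v\<close> is the gradient flow of the v-component of the momentum:
  the derivative \<open>LD v (i v)\<close> is the squared length of the fundamental vector.\<close>

lemma flow_mono:
  assumes "v \<in> uu" "s \<le> t" shows "\<mu> (flow v s y) v \<le> \<mu> (flow v t y) v"
  using DERIV_nonneg_imp_nondecreasing[OF assms(2)] flow_derivative[OF assms(1)] LD_nonneg by metis

lemma isCont_phi: "isCont (\<phi> g) y" by (intro isCont_act continuous_ident continuous_const)

lemma isCont_flow_time: "isCont (\<lambda>t. \<phi> (EXP (t *\<^sub>R w)) y) t0"
  by (intro isCont_act isCont_o2[OF _ isCont_EXP] continuous_intros)

lemma mu_bounded:
  assumes "v \<in> uu" shows "\<exists>K. \<forall>y\<in>X. \<mu> y v \<le> K"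
proof -
  have "continuous_on X (\<lambda>y. \<mu> y v)" using isCont_mu[OF assms] by (simp add: continuous_at_imp_continuous_on)
  from compact_continuous_image[OF this compact_orbit] have "bdd_above ((\<lambda>y. \<mu> y v) ` X)"
    by (intro bounded_imp_bdd_above compact_imp_bounded)
  then show ?thesis by (auto simp: bdd_above_def)
qed

lemma mu_max:
  assumes "v \<in> uu" shows "\<exists>g. \<forall>y\<in>X. \<mu> y v \<le> \<mu> (\<phi> g x) v"
proof -
  have "continuous_on X (\<lambda>y. \<mu> y v)" using isCont_mu[OF assms] by (simp add: continuous_at_imp_continuous_on)
  from continuous_attains_sup[OF compact_orbit _ this] show ?thesis by auto
qed

definition lam :: "'l \<Rightarrow> 'z \<Rightarrow> real" where "lam v y = lim (\<lambda>n. \<mu> (flow v (real n) y) v)"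

lemma lam_lim:
  assumes v: "v \<in> uu" and y: "y \<in> X"
  shows "(\<lambda>n. \<mu> (flow v (real n) y) v) \<longlonglongrightarrow> lam v y" "\<And>t. \<mu> (flow v t y) v \<le> lam v y"
proof -
  obtain K where K: "\<And>y. y \<in> X \<Longrightarrow> \<mu> y v \<le> K" using mu_bounded[OF v] by blast
  have inc: "incseq (\<lambda>n. \<mu> (flow v (real n) y) v)" using flow_mono[OF v] by (auto intro: incseq_SucI)
  obtain l where l: "(\<lambda>n. \<mu> (flow v (real n) y) v) \<longlonglongrightarrow> l"
    by (rule incseq_convergent[OF inc, of K]) (simp add: K X_act[OF y])
  then show lim: "(\<lambda>n. \<mu> (flow v (real n) y) v) \<longlonglongrightarrow> lam v y" unfolding lam_def by (simp add: limI)
  fix t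
  obtain n where "t \<le> real n" using real_arch_simple by blast
  then have "\<mu> (flow v t y) v \<le> \<mu> (flow v (real n) y) v" using flow_mono[OF v] by blast
  also have "\<dots> \<le> lam v y" using incseq_le[OF inc lim] .
  finally show "\<mu> (flow v t y) v \<le> lam v y" .
qed

lemma lam_lim_shift:
  assumes v: "v \<in> uu" and y: "y \<in> X"
  shows "(\<lambda>n. \<mu> (flow v (h + real n) y) v) \<longlonglongrightarrow> lam v y"
proof -
  obtain m where m: "- h \<le> real m" using real_arch_simple by blast
  show ?thesis
  proof (rule tendsto_sandwich)
    show "\<forall>\<^sub>F n in sequentially. \<mu> (flow v (real (n - m)) y) v \<le> \<mu> (flow v (h + real n) y) v"
      unfolding eventually_sequentially
      by (intro exI[of _ m] allI impI flow_mono[OF v]) (use m in \<open>simp add: of_nat_diff\<close>)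
    show "\<forall>\<^sub>F n in sequentially. \<mu> (flow v (h + real n) y) v \<le> lam v y"
      using lam_lim(2)[OF v y] by (intro always_eventually) auto
    have "filterlim (\<lambda>n. n - m) sequentially sequentially" by (rule filterlim_minus_const_nat_at_top)
    from filterlim_compose[OF lam_lim(1)[OF v y] this]
    show "(\<lambda>n. \<mu> (flow v (real (n - m)) y) v) \<longlonglongrightarrow> lam v y" .
  qed auto
qed

lemma LD_zero:
  assumes "fv z v = 0" shows "LD v w z = 0"
  using assms by (simp add: LD_def omega_simps)

text \<open>Along the flow of an accumulation point z of the trajectory the component is constant,
  equal to \<open>lam v y\<close>; so z is critical and every \<open>LD v w\<close> vanishes there.
  A subsequence staying away from 0 would contradict this.\<close>

lemma LD_tendsto_zero:
  assumes v: "v \<in> uu" and y: "y \<in> X"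
  shows "(\<lambda>n. LD v w (flow v (real n) y)) \<longlonglongrightarrow> 0"
proof (rule ccontr)
  assume "\<not> ?thesis"
  then obtain e where e: "e > 0" "\<And>N. \<exists>n\<ge>N. e \<le> \<bar>LD v w (flow v (real n) y)\<bar>"
    unfolding LIMSEQ_iff by (auto simp: not_less)
  define Q where "Q n \<longleftrightarrow> e \<le> \<bar>LD v w (flow v (real n) y)\<bar>" for n
  have "infinite {n. Q n}" unfolding infinite_nat_iff_unbounded_le using e(2) by (auto simp: Q_def)
  then obtain r where r: "strict_mono (r :: nat \<Rightarrow> nat)" "\<And>n. Q (r n)"
    using infinite_enumerate[of "{n. Q n}"] by auto
  have "seq_compact X" using compact_orbit compact_imp_seq_compact by blast
  then obtain z s where s: "z \<in> X" "strict_mono (s :: nat \<Rightarrow> nat)" "((\<lambda>n. flow v (real (r n)) y) \<circ> s) \<longlonglongrightarrow> z"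
    unfolding seq_compact_def using X_act[OF y] by metis
  define q where "q = r \<circ> s"
  have q: "strict_mono q" unfolding q_def using r s strict_mono_o by blast
  have lim: "(\<lambda>n. flow v (real (q n)) y) \<longlonglongrightarrow> z" using s(3) by (simp add: q_def o_def)
  have const: "\<mu> (flow v h z) v = lam v y" for h
  proof -
    have "isCont (\<lambda>z. \<mu> (flow v h z) v) z" by (rule isCont_o2[OF isCont_phi isCont_mu[OF v]])
    from isCont_tendsto_compose[OF this lim]
    have "(\<lambda>n. \<mu> (flow v (h + real (q n)) y) v) \<longlonglongrightarrow> \<mu> (flow v h z) v" by (simp add: flow_add)
    moreover have "(\<lambda>n. \<mu> (flow v (h + real (q n)) y) v) \<longlonglongrightarrow> lam v y"
      using LIMSEQ_subseq_LIMSEQ[OF lam_lim_shift[OF v y, of h] q] by (simp add: o_def)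
    ultimately show ?thesis by (rule LIMSEQ_unique)
  qed
  have "((\<lambda>h. \<mu> (flow v h z) v) has_real_derivative LD v (i v) (flow v 0 z)) (at 0)" by (rule flow_derivative[OF v])
  then have "LD v (i v) z = 0" unfolding const using DERIV_unique[OF _ DERIV_const] by simp
  then have "LD v w z = 0" using LD_zero_imp LD_zero by blast
  moreover have "(\<lambda>n. LD v w (flow v (real (q n)) y)) \<longlonglongrightarrow> LD v w z"
    by (rule isCont_tendsto_compose[OF isCont_LD[OF v] lim])
  ultimately have "\<forall>\<^sub>F n in sequentially. \<bar>LD v w (flow v (real (q n)) y)\<bar> < e"
    using e(1) order_tendstoD(2)[OF tendsto_rabs_zero, of _ sequentially e] by simp
  then obtain n where "\<bar>LD v w (flow v (real (q n)) y)\<bar> < e" using eventually_happens by fastforce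
  moreover have "Q (q n)" using r(2) by (simp add: q_def)
  ultimately show False by (simp add: Q_def)
qed

text \<open>A curve of velocity zero is locally constant in charts, hence constant on the connected
  set of positive times. Time 0 follows by continuity and negative times by the group law. The
  hypothesis concerns positive times because these are the ones a maximum controls.\<close>

lemma flow_constant:
  assumes crit: "\<And>t. t > 0 \<Longrightarrow> fv (\<phi> (EXP (t *\<^sub>R w)) z) w = 0"
  shows "\<phi> (EXP (t *\<^sub>R w)) z = z"
proof -
  define p where "p t = \<phi> (EXP (t *\<^sub>R w)) z" for t :: real
  have cont: "isCont p t" for t unfolding p_def by (rule isCont_flow_time)
  have m: "mder vec_chart (chart_at B (p t)) p t (\<lambda>_. 0)" if t: "t > 0" for t
  proof -
    have "((\<lambda>s. s - t) has_derivative (\<lambda>s. s)) (at t)" by (auto intro!: derivative_eq_intros)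
    from mder_compose[OF mder_vec[OF this], of c0 "\<lambda>s. EXP (s *\<^sub>R w)" "\<lambda>s. s *\<^sub>R w"] mder_EXP_curve[of w]
    have "mder vec_chart c0 (\<lambda>s. EXP ((s - t) *\<^sub>R w)) t (\<lambda>s. s *\<^sub>R w)" by simp
    from mder_compose[OF this, of "chart_at B (p t)" "\<lambda>g. \<phi> g (p t)" "fv (p t)"] mder_fv[of "p t"]
    have "mder vec_chart (chart_at B (p t)) (\<lambda>s. \<phi> (EXP ((s - t) *\<^sub>R w)) (p t)) t (\<lambda>s. fv (p t) (s *\<^sub>R w))" by simp
    moreover have "(\<lambda>s. \<phi> (EXP ((s - t) *\<^sub>R w)) (p t)) = p"
    proof
      fix s show "\<phi> (EXP ((s - t) *\<^sub>R w)) (p t) = p s"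
        using EXP_add[of "s - t" t w] by (simp add: p_def act_mult[symmetric])
    qed
    moreover have "fv (p t) w = 0" using crit[OF t] by (simp add: p_def)
    ultimately show ?thesis by (simp add: fv_simps)
  qed
  have loc: "\<forall>\<^sub>F s in at t within {0<..}. p t = p s" if t: "t \<in> {0<..}" for t
  proof -
    define c where "c = chart_at B (p t)"
    have c: "c \<in> B" "is_chart c" "p t \<in> chart_dom c" using Z.chart_at_in by (auto simp: c_def)
    have "open (p -` chart_dom c)"
      using open_vimage[OF chart_facts(1)[OF c(2)], of p] cont by (simp add: continuous_on_eq_continuous_at)
    then have "open (p -` chart_dom c \<inter> {0<..})" by (intro open_Int) auto
    then obtain d where d: "d > 0" "ball t d \<subseteq> p -` chart_dom c \<inter> {0<..}"
      using t c(3) open_contains_ball by (metis IntI vimageI2)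
    have der: "((\<lambda>s. chart_map c (p s)) has_derivative (\<lambda>_. 0)) (at s within ball t d)" if s: "s \<in> ball t d" for s
    proof -
      have ps: "p s \<in> chart_dom c" "s > 0" using d(2) s by auto
      obtain D where D: "mder (chart_at B (p s)) c (\<lambda>q. q) (p s) D"
        using Z.hol_transition[OF Z.chart_at_in c(1) Z.chart_at_dom ps(1)] by (auto simp: hol_at_def)
      have "mder vec_chart c p s (\<lambda>_. D 0)" using mder_compose[OF m[OF ps(2)], of c "\<lambda>q. q" D] D by simp
      then have "((\<lambda>s. chart_map c (p s)) has_derivative (\<lambda>_. 0)) (at s)"
        using c(2) linear_0[OF mder_linear[OF D]] by (simp add: mder_vec_iff)
      then show ?thesis by (rule has_derivative_at_withinI)
    qed
    have "\<exists>k. \<forall>s\<in>ball t d. chart_map c (p s) = k"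
      by (rule has_derivative_zero_constant[OF convex_ball der])
    then obtain k where k: "\<And>s. s \<in> ball t d \<Longrightarrow> chart_map c (p s) = k" by auto
    have eq: "p s = p t" if "s \<in> ball t d" for s
    proof (rule inj_onD[OF chart_facts(3)[OF c(2)]])
      show "chart_map c (p s) = chart_map c (p t)" using k[OF that] k[of t] d(1) by simp
      show "p s \<in> chart_dom c" "p t \<in> chart_dom c" using d(2) that c(3) by auto
    qed
    show ?thesis unfolding eventually_at using d(1)
      by (intro exI[of _ d]) (auto simp: dist_commute intro: eq[symmetric])
  qed
  have c1: "p s = p 1" if "s > 0" for s
    using connected_local_const[of "{0::real<..}" s 1 p] loc that by auto
  have "p 0 = p 1"
  proof (rule tendsto_unique[of "at_right 0"])
    show "(p \<longlongrightarrow> p 0) (at_right 0)" using cont[of 0] by (simp add: isCont_def filterlim_at_split)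
    have "\<forall>\<^sub>F s in at_right 0. p s = p 1"
      by (rule eventually_mono[OF eventually_at_right_less]) (rule c1)
    then show "(p \<longlongrightarrow> p 1) (at_right 0)" by (rule tendsto_eventually)
  qed simp
  moreover have "p 0 = z" by (simp add: p_def)
  ultimately have pos: "p s = z" if "s \<ge> 0" for s using c1[of s] that by (cases "s = 0") auto
  show ?thesis
  proof (cases "t \<ge> 0")
    case False
    have "\<phi> (EXP (t *\<^sub>R w)) (p (- t)) = z" using EXP_add[of t "- t" w, symmetric] by (simp add: p_def act_mult[symmetric])
    then show ?thesis using pos[of "- t"] False by simp
  qed (use pos in \<open>simp add: p_def\<close>)
qed

text \<open>From a maximum the monotone component cannot grow, so its derivative, a squared length,
  vanishes at positive times.\<close>

lemma max_fixed:
  assumes v: "v \<in> uu" and z: "z \<in> X" and max: "\<And>y. y \<in> X \<Longrightarrow> \<mu> y v \<le> \<mu> z v"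
  shows "flow v t z = z"
proof (rule flow_constant)
  fix t :: real assume t: "t > 0"
  have const: "\<mu> (flow v s z) v = \<mu> z v" if "s \<ge> 0" for s
  proof (rule antisym)
    show "\<mu> (flow v s z) v \<le> \<mu> z v" by (rule max[OF X_act[OF z]])
    show "\<mu> z v \<le> \<mu> (flow v s z) v" using flow_mono[OF v that, of z] by simp
  qed
  have "((\<lambda>s. \<mu> (flow v s z) v) has_real_derivative LD v (i v) (flow v t z)) (at t)" by (rule flow_derivative[OF v])
  moreover have "((\<lambda>s. \<mu> (flow v s z) v) has_real_derivative 0) (at t)"
    by (rule has_field_derivative_transform_within_open[OF DERIV_const[of "\<mu> z v"], of "{0<..}"]) (use const t in auto)
  ultimately have "LD v (i v) (flow v t z) = 0" by (rule DERIV_unique)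
  from LD_zero_imp[OF this] show "fv (flow v t z) (i v) = 0" by (simp add: fv_simps e.j_simps)
qed

text \<open>In backward time conjugation by the flow contracts the exponential of w to the unit, so
  the backward trajectory of y tends to z. By monotonicity y has at least the value of z, so it is a
  maximum too, is fixed by the flow, and equals its backward limit z.\<close>

lemma max_unipotent_fixed:
  assumes v: "v \<in> uu" and z: "z \<in> X" and max: "\<And>y. y \<in> X \<Longrightarrow> \<mu> y v \<le> \<mu> z v"
    and w: "\<And>t. AD (EXP (t *\<^sub>R i v)) w = exp (c * t) *\<^sub>R w" and c: "c > 0"
  shows "\<phi> (EXP (s *\<^sub>R w)) z = z"
proof -
  define y where "y = \<phi> (EXP (s *\<^sub>R w)) z"
  have y: "y \<in> X" using z by (simp add: y_def X_act)
  have fl: "flow v t y = \<phi> (EXP ((s * exp (c * t)) *\<^sub>R w)) z" for t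
  proof -
    have "EXP (t *\<^sub>R i v) \<otimes> EXP (s *\<^sub>R w) = EXP (s *\<^sub>R AD (EXP (t *\<^sub>R i v)) w) \<otimes> EXP (t *\<^sub>R i v)"
      using EXP_Ad[of "EXP (t *\<^sub>R i v)" "s *\<^sub>R w"] by (simp add: Ad_simps inv_solve_right')
    then have "flow v t y = \<phi> (EXP (s *\<^sub>R AD (EXP (t *\<^sub>R i v)) w)) (flow v t z)"
      unfolding y_def by (simp add: act_mult[symmetric])
    then show ?thesis using max_fixed[OF v z max] w by simp
  qed
  have "isCont (\<lambda>r. \<phi> (EXP (r *\<^sub>R w)) z) 0" by (rule isCont_flow_time)
  moreover have "(\<lambda>n. s * exp (c * - real n)) \<longlonglongrightarrow> 0" using c by real_asymp
  ultimately have "(\<lambda>n. \<phi> (EXP ((s * exp (c * - real n)) *\<^sub>R w)) z) \<longlonglongrightarrow> \<phi> (EXP (0 *\<^sub>R w)) z"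
    by (rule isCont_tendsto_compose)
  then have lim: "(\<lambda>n. flow v (- real n) y) \<longlonglongrightarrow> z" by (subst fl) simp
  have "(\<lambda>n. \<mu> (flow v (- real n) y) v) \<longlonglongrightarrow> \<mu> z v" by (rule isCont_tendsto_compose[OF isCont_mu[OF v] lim])
  moreover have "\<mu> (flow v (- real n) y) v \<le> \<mu> y v" for n using flow_mono[OF v, of "- real n" 0 y] by simp
  ultimately have "\<mu> z v \<le> \<mu> y v" by (intro LIMSEQ_le_const2) auto
  then have "\<mu> y' v \<le> \<mu> y v" if "y' \<in> X" for y' using max[OF that] by simp
  from max_fixed[OF v y this] have "flow v t y = y" for t .
  then have "(\<lambda>n::nat. y) \<longlonglongrightarrow> z" using lim by (simp del: scaleR_minus_left)
  then show ?thesis by (simp add: LIMSEQ_const_iff y_def)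
qed

end

section \<open>Cramer's rule with holomorphic entries\<close>

definition cdet :: "nat \<Rightarrow> (nat \<Rightarrow> nat \<Rightarrow> complex) \<Rightarrow> complex" where
  "cdet n M = Determinant.det (mat n n (\<lambda>(r, s). M r s))"

lemma cdet_holomorphic:
  assumes "\<And>r s. r < n \<Longrightarrow> s < n \<Longrightarrow> (\<lambda>z. M z r s) holomorphic_on S"
  shows "(\<lambda>z. cdet n (M z)) holomorphic_on S"
proof -
  have "cdet n (M z) = (\<Sum>p | p permutes {0..<n}. signof p * (\<Prod>r = 0..<n. M z r (p r)))" for z
    unfolding cdet_def det_def by (auto intro!: sum.cong prod.cong simp: permutes_in_image[of _ "{0..<n}"])
  then show ?thesis
    by (auto intro!: holomorphic_intros assms simp: permutes_in_image[of _ "{0..<n}"])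
qed

lemma cdet_identity:
  assumes "\<And>r s. r < n \<Longrightarrow> s < n \<Longrightarrow> M r s = (if r = s then 1 else 0)" shows "cdet n M = 1"
proof -
  have "mat n n (\<lambda>(r, s). M r s) = 1\<^sub>m n" by (rule eq_matI) (auto simp: assms)
  then show ?thesis by (simp add: cdet_def)
qed

text \<open>N is the adjugate: its entries are polynomials in those of M, hence holomorphic even
  where the determinant vanishes. Division by the determinant is postponed.\<close>

lemma cramer_holomorphic:
  assumes M: "\<And>r s. r < n \<Longrightarrow> s < n \<Longrightarrow> (\<lambda>z. M z r s) holomorphic_on S"
  shows "\<exists>N. (\<forall>k<n. \<forall>m<n. (\<lambda>z. N z k m) holomorphic_on S) \<and>
    (\<forall>z. \<forall>r<n. \<forall>m<n. (\<Sum>k<n. M z r k * N z k m) = (if r = m then cdet n (M z) else 0))"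
proof -
  define Mat where "Mat z = mat n n (\<lambda>(r, s). M z r s)" for z
  define N where "N z k m = adj_mat (Mat z) $$ (k, m)" for z k m
  have carr: "Mat z \<in> carrier_mat n n" for z by (simp add: Mat_def)
  have hol: "(\<lambda>z. N z k m) holomorphic_on S" if km: "k < n" "m < n" for k m
  proof -
    have eq: "N z k m = (- 1) ^ (m + k) * cdet (n - 1) (\<lambda>r s. M z (if r < m then r else Suc r) (if s < k then s else Suc s))" for z
    proof -
      have "mat_delete (Mat z) m k = mat (n - 1) (n - 1) (\<lambda>(r, s). M z (if r < m then r else Suc r) (if s < k then s else Suc s))"
        unfolding mat_delete_def by (rule eq_matI) (use km in \<open>auto simp: Mat_def\<close>)
      then show ?thesis using km carr[of z] by (simp add: N_def adj_mat_def cofactor_def cdet_def)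
    qed
    show ?thesis unfolding eq by (intro holomorphic_intros cdet_holomorphic M) auto
  qed
  have "(\<Sum>k<n. M z r k * N z k m) = (if r = m then cdet n (M z) else 0)" if rm: "r < n" "m < n" for z r m
  proof -
    have "(Mat z * adj_mat (Mat z)) $$ (r, m) = (Determinant.det (Mat z) \<cdot>\<^sub>m 1\<^sub>m n) $$ (r, m)"
      using adj_mat(2)[OF carr] by simp
    moreover have "(Mat z * adj_mat (Mat z)) $$ (r, m) = (\<Sum>k<n. M z r k * N z k m)"
      using rm carr[of z] adj_mat(1)[OF carr[of z]]
      by (auto simp: scalar_prod_def N_def Mat_def atLeast0LessThan intro!: sum.cong)
    ultimately show ?thesis using rm by (auto simp: cdet_def Mat_def)
  qed
  with hol show ?thesis by (intro exI[of _ N]) auto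
qed

text \<open>Zero sets are later compared by cardinality: two of them cannot cover the plane, and one
  cannot contain the real line.\<close>

lemma entire_countable_zeros:
  assumes f: "f holomorphic_on UNIV" "f z0 \<noteq> (0::complex)"
  shows "countable {z. f z = 0}"
proof (cases "f constant_on UNIV")
  case True
  then have "{z. f z = 0} = {}" using f(2) by (auto simp: constant_on_def)
  then show ?thesis by simp
next
  case False
  from holomorphic_countable_zeros[OF f(1) _ _ fsigma_UNIV False] show ?thesis by auto
qed

section \<open>Complex curves in the group\<close>

lemma cscale_complex: "cscale ((*) \<i>) c z = c * z"
  by (simp add: cscale_def complex_eq_iff)

context clie_group
begin

lemma Ad_EXP_hol_compose:
  assumes l: "clinear_map i ((*) \<i>) l" and f: "\<And>l. clinear_map i ((*) \<i>) l \<Longrightarrow> (\<lambda>s. l (f s)) holomorphic_on UNIV"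
  shows "(\<lambda>s. l (AD (EXP (x + cscale i s y)) (f s))) holomorphic_on UNIV"
proof -
  obtain I :: "'l set" and m :: "'l \<Rightarrow> 'l \<Rightarrow> complex" where
    I: "finite I" and m: "\<And>b. clinear_map i ((*) \<i>) (m b)" and sum: "\<And>v. v = (\<Sum>b\<in>I. cscale i (m b v) b)"
    using complex_coordinates by blast
  have eq: "l (AD g w) = (\<Sum>b\<in>I. m b w * l (AD g b))" for g w
  proof -
    have c: "clinear_map i ((*) \<i>) (\<lambda>w. l (AD g w))" by (rule clinear_map_compose[OF clinear_Ad l])
    then have lin: "linear (\<lambda>w. l (AD g w))" by (simp add: clinear_map_def)
    have "l (AD g w) = l (AD g (\<Sum>b\<in>I. cscale i (m b w) b))" by (simp only: sum[symmetric])
    then show ?thesis by (simp add: linear_sum[OF lin] clinear_cscale[OF c] cscale_complex)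
  qed
  have "(\<lambda>s. l (AD (EXP (x + cscale i s y)) (f s))) = (\<lambda>s. \<Sum>b\<in>I. m b (f s) * l (AD (EXP (x + cscale i s y)) b))"
    by (rule ext) (rule eq)
  then show ?thesis by (auto intro!: holomorphic_intros f m Ad_EXP_entire l)
qed

text \<open>\<open>\<theta>\<close> is the complex velocity of the holomorphic curve \<open>k\<close>, translated to the identity
  from the right.\<close>

inductive gcurve :: "(complex \<Rightarrow> 'g) \<Rightarrow> (complex \<Rightarrow> 'l) \<Rightarrow> bool" where
  const: "gcurve (\<lambda>s. g) (\<lambda>s. 0)"
| step: "gcurve k \<theta> \<Longrightarrow> gcurve (\<lambda>s. EXP (cscale i s v) \<otimes> k s) (\<lambda>s. v + AD (EXP (cscale i s v)) (\<theta> s))"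

lemma gcurve_hol:
  assumes "gcurve k \<theta>" "clinear_map i ((*) \<i>) l"
  shows "(\<lambda>s. l (AD (k s) w)) holomorphic_on UNIV" "(\<lambda>s. l (\<theta> s)) holomorphic_on UNIV"
proof -
  have "(\<forall>l. clinear_map i ((*) \<i>) l \<longrightarrow> (\<lambda>s. l (AD (k s) w)) holomorphic_on UNIV) \<and>
    (\<forall>l. clinear_map i ((*) \<i>) l \<longrightarrow> (\<lambda>s. l (\<theta> s)) holomorphic_on UNIV)"
    using assms(1)
  proof induction
    case (const g)
    show ?case by (auto intro: holomorphic_on_const)
  next
    case (step k \<theta> v)
    have "(\<lambda>s. l (AD (EXP (cscale i s v) \<otimes> k s) w)) holomorphic_on UNIV"
      "(\<lambda>s. l (v + AD (EXP (cscale i s v)) (\<theta> s))) holomorphic_on UNIV" if l: "clinear_map i ((*) \<i>) l" for l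
    proof -
      show "(\<lambda>s. l (AD (EXP (cscale i s v) \<otimes> k s) w)) holomorphic_on UNIV"
        using Ad_EXP_hol_compose[OF l, of "\<lambda>s. AD (k s) w" 0 v] step.IH by (simp add: Ad_mult)
      have "(\<lambda>s. l (AD (EXP (cscale i s v)) (\<theta> s))) holomorphic_on UNIV"
        using Ad_EXP_hol_compose[OF l, of \<theta> 0 v] step.IH by simp
      moreover have "l (v + w) = l v + l w" for w using l by (simp add: clinear_map_def linear_add)
      ultimately show "(\<lambda>s. l (v + AD (EXP (cscale i s v)) (\<theta> s))) holomorphic_on UNIV"
        by (auto intro!: holomorphic_intros)
    qed
    then show ?case by auto
  qed
  then show "(\<lambda>s. l (AD (k s) w)) holomorphic_on UNIV" "(\<lambda>s. l (\<theta> s)) holomorphic_on UNIV"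
    using assms(2) by auto
qed

text \<open>Right translation makes the product rule additive: the new exponential factor
  contributes v and conjugates the velocity of the rest. \<delta> selects a real line in the
  parameter plane.\<close>

lemma gcurve_mder:
  assumes "gcurve k \<theta>"
  shows "mder vec_chart c0 (\<lambda>h::real. k (s0 + of_real h * \<delta>) \<otimes> inv (k s0)) 0 (\<lambda>h. h *\<^sub>R cscale i \<delta> (\<theta> s0))"
  using assms
proof induction
  case (const g)
  show ?case using mder_const[of vec_chart c0 0 \<one>] c0 by (simp add: cscale_simps)
next
  case (step k \<theta> v)
  define E where "E = EXP (cscale i s0 v)"
  have "mder c0 c0 (\<lambda>g. E \<otimes> g \<otimes> inv E) (k (s0 + of_real 0 * \<delta>) \<otimes> inv (k s0)) (AD E)"
    using mder_Ad[of E] by simp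
  from mder_compose[OF step.IH this]
  have 1: "mder vec_chart c0 (\<lambda>h::real. E \<otimes> (k (s0 + of_real h * \<delta>) \<otimes> inv (k s0)) \<otimes> inv E) 0 (\<lambda>h. AD E (h *\<^sub>R cscale i \<delta> (\<theta> s0)))" .
  have 2: "mder vec_chart c0 (\<lambda>h::real. EXP (h *\<^sub>R cscale i \<delta> v)) 0 (\<lambda>h. h *\<^sub>R cscale i \<delta> v)" by (rule mder_EXP_curve)
  have 3: "mder vec_chart c0 (\<lambda>h::real. EXP (h *\<^sub>R cscale i \<delta> v) \<otimes> (E \<otimes> (k (s0 + of_real h * \<delta>) \<otimes> inv (k s0)) \<otimes> inv E)) 0
    (\<lambda>h. h *\<^sub>R cscale i \<delta> v + AD E (h *\<^sub>R cscale i \<delta> (\<theta> s0)))"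
    by (rule mder_mult_one[OF 2 _ 1]) simp_all
  have "EXP (cscale i (s0 + of_real h * \<delta>) v) = EXP (h *\<^sub>R cscale i \<delta> v) \<otimes> E" for h :: real
  proof -
    have "cscale i (of_real h * \<delta>) v = h *\<^sub>R cscale i \<delta> v"
      unfolding cscale_simps(3)[symmetric] cscale_simps(5) ..
    then show ?thesis using EXP_cscale_add[of "of_real h * \<delta>" s0 v] by (simp add: E_def add.commute)
  qed
  moreover have "h *\<^sub>R cscale i \<delta> v + AD E (h *\<^sub>R cscale i \<delta> (\<theta> s0)) = h *\<^sub>R cscale i \<delta> (v + AD E (\<theta> s0))" for h
    by (simp add: Ad_simps cscale_simps scaleR_right_distrib)
  ultimately show ?case using 3 by (simp add: E_def[symmetric] m_assoc inv_mult_group)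
qed

text \<open>All exponential factors of a word run from s = 0 to s = 1 simultaneously, with one
  complex parameter.\<close>

lemma gcurve_connects:
  assumes "connected (UNIV :: 'g set)" shows "\<exists>k \<theta>. gcurve k \<theta> \<and> k 0 = g \<and> k 1 = g'"
proof -
  have "\<exists>k \<theta>. gcurve k \<theta> \<and> k 0 = g \<and> k 1 = h \<otimes> g" if "h \<in> exp_gen" for h
    using that
  proof induction
    case 1
    show ?case using gcurve.const[of g] by (intro exI[of _ "\<lambda>s. g"] exI[of _ "\<lambda>s. 0"]) simp
  next
    case (2 h v)
    then obtain k \<theta> where k: "gcurve k \<theta>" "k 0 = g" "k 1 = h \<otimes> g" by auto
    show ?case
      by (intro exI[of _ "\<lambda>s. EXP (cscale i s v) \<otimes> k s"] exI[of _ "\<lambda>s. v + AD (EXP (cscale i s v)) (\<theta> s)"])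
        (simp add: gcurve.step k cscale_simps m_assoc)
  qed
  from this[of "g' \<otimes> inv g"] show ?thesis using exp_gen_UNIV[OF assms] by (simp add: m_assoc)
qed

section \<open>Functions that are entire along exponential lines\<close>

text \<open>A substitute for holomorphy on the group that involves one variable only. The base
  vector x is there because the uniqueness argument on a real form uses the lines
  \<open>\<xi> + cscale i s \<eta>\<close>, which need not pass through 0.\<close>

definition nice :: "('g \<Rightarrow> complex) \<Rightarrow> bool" where
  "nice P \<longleftrightarrow> (\<forall>a b x y. (\<lambda>s. P (a \<otimes> EXP (x + cscale i s y) \<otimes> b)) holomorphic_on UNIV)"

lemma nice_one: "nice (\<lambda>_. 1)" by (simp add: nice_def)

lemma nice_mult: "nice P \<Longrightarrow> nice Q \<Longrightarrow> nice (\<lambda>g. P g * Q g)"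
  by (auto simp: nice_def intro!: holomorphic_intros)

lemma nice_Ad: "clinear_map i ((*) \<i>) l \<Longrightarrow> nice (\<lambda>g. l (AD g w))"
  unfolding nice_def using Ad_EXP_entire[OF clinear_map_compose[OF clinear_Ad]] by (simp add: Ad_mult)

text \<open>Absence of zero divisors, walking from a point where P does not vanish towards one where
  D does not, one exponential at a time. At each step two entire functions of s, neither identically
  zero, are both nonzero at some s.\<close>

lemma nice_mult_nonzero:
  assumes P: "nice P" "P g \<noteq> 0" and D: "nice D" "D g' \<noteq> 0" and conn: "connected (UNIV :: 'g set)"
  shows "\<exists>h. P h * D h \<noteq> 0"
proof -
  have "\<forall>q. P q \<noteq> 0 \<longrightarrow> D (h \<otimes> q) \<noteq> 0 \<longrightarrow> (\<exists>h. P h * D h \<noteq> 0)" if "h \<in> exp_gen" for h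
    using that
  proof induction
    case 1
    show ?case by auto
  next
    case (2 h v)
    show ?case
    proof (intro allI impI)
      fix q assume q: "P q \<noteq> 0" "D (EXP v \<otimes> h \<otimes> q) \<noteq> 0"
      \<comment> \<open>Chosen so that \<open>h \<otimes> EXP w = EXP v \<otimes> h\<close>: the
        exponential moves next to q, P can be followed along the same line, and the shorter word h
        remains.\<close>
      define w where "w = AD (inv h) v"
      have ew: "h \<otimes> EXP w = EXP v \<otimes> h" using EXP_Ad[of "inv h" v] by (simp add: w_def[symmetric] m_assoc inv_solve_left')
      define f1 where "f1 s = P (EXP (cscale i s w) \<otimes> q)" for s
      define f2 where "f2 s = D (h \<otimes> EXP (cscale i s w) \<otimes> q)" for s
      have 1: "f1 holomorphic_on UNIV"
        using P(1)[unfolded nice_def, rule_format, of \<one> 0 w q] by (simp add: f1_def[abs_def])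
      have 2: "f2 holomorphic_on UNIV"
        using D(1)[unfolded nice_def, rule_format, of h 0 w q] by (simp add: f2_def[abs_def])
      have "countable {s. f1 s = 0}" by (rule entire_countable_zeros[OF 1, of 0]) (simp add: f1_def cscale_simps q)
      moreover have "countable {s. f2 s = 0}" by (rule entire_countable_zeros[OF 2, of 1]) (simp add: f2_def cscale_simps q ew)
      ultimately have "countable ({s. f1 s = 0} \<union> {s. f2 s = 0})" by simp
      then have "{s. f1 s = 0} \<union> {s. f2 s = 0} \<noteq> UNIV" using uncountable_UNIV_complex by metis
      then obtain s where "f1 s \<noteq> 0" "f2 s \<noteq> 0" by auto
      then show "\<exists>h. P h * D h \<noteq> 0" using "2.IH" by (auto simp: f1_def f2_def m_assoc)
    qed
  qed
  from this[of "g' \<otimes> inv g"] show ?thesis using P(2) D(2) exp_gen_UNIV[OF conn] by (simp add: m_assoc)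
qed

text \<open>A real form is a uniqueness set: holomorphic functions are propagated from the real lines
  \<open>\<xi> + s \<eta>\<close> to \<open>s = \<i>\<close>.\<close>

lemma nice_nonzero_on_real_form:
  assumes P: "nice P" "P g1 \<noteq> 0" and conn: "connected (UNIV :: 'g set)"
    and G: "subgroup G L" "closed G" and lie: "\<And>v. \<exists>\<xi>\<in>lie_algebra_of L A G. \<exists>\<eta>\<in>lie_algebra_of L A G. v = \<xi> + i \<eta>"
  shows "\<exists>h\<in>G. P (h \<otimes> g0) \<noteq> 0"
proof (rule ccontr)
  assume neg: "\<not> (\<exists>h\<in>G. P (h \<otimes> g0) \<noteq> 0)"
  \<comment> \<open>Quantifying over all h in G makes the property inductive: for real s the
    exponential lies in G and is absorbed into h.\<close>
  define Q where "Q a \<longleftrightarrow> (\<forall>h\<in>G. P (a \<otimes> h \<otimes> g0) = 0)" for a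
  have Q1: "Q \<one>" using neg by (auto simp: Q_def)
  have step: "Q (a \<otimes> EXP v)" if a: "Q a" for a v
    unfolding Q_def
  proof
    fix h assume h: "h \<in> G"
    obtain \<xi> \<eta> where \<xi>: "\<xi> \<in> lie_algebra_of L A G" "\<eta> \<in> lie_algebra_of L A G" "v = \<xi> + i \<eta>" using lie by blast
    define f where "f s = P (a \<otimes> EXP (\<xi> + cscale i s \<eta>) \<otimes> (h \<otimes> g0))" for s
    have hol: "f holomorphic_on UNIV" using P(1) unfolding nice_def f_def by blast
    have zero: "f (of_real r) = 0" for r
    proof -
      have "\<xi> + r *\<^sub>R \<eta> \<in> lie_algebra_of L A G"
        using \<xi> subspace_lie_algebra[OF G] by (intro subspace_add subspace_scale)
      then have "EXP (1 *\<^sub>R (\<xi> + r *\<^sub>R \<eta>)) \<in> G" unfolding lie_algebra_iff by blast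
      then have "EXP (\<xi> + r *\<^sub>R \<eta>) \<otimes> h \<in> G" using h subgroup.m_closed[OF G(1)] by simp
      then have "P (a \<otimes> (EXP (\<xi> + r *\<^sub>R \<eta>) \<otimes> h) \<otimes> g0) = 0" using a by (simp only: Q_def)
      then show ?thesis by (simp add: f_def cscale_simps m_assoc)
    qed
    have "f \<i> = 0"
    proof (rule ccontr)
      assume "f \<i> \<noteq> 0"
      from entire_countable_zeros[OF hol this] have "countable {z. f z = 0}" .
      then have "countable (range (of_real :: real \<Rightarrow> complex))" by (rule countable_subset[rotated]) (auto simp: zero)
      from countable_image_inj_on[OF this] have "countable (UNIV :: real set)" by (simp add: inj_on_def)
      then show False using uncountable_UNIV_real by simp
    qed
    then show "P (a \<otimes> EXP v \<otimes> h \<otimes> g0) = 0" by (simp add: f_def \<xi>(3) cscale_simps m_assoc)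
  qed
  have "\<forall>a. Q a \<longrightarrow> Q (a \<otimes> g)" if "g \<in> exp_gen" for g
    using that
  proof induction
    case (2 g v)
    then show ?case using step by (metis m_assoc carrier_UNIV UNIV_I)
  qed simp
  then have "Q g" for g using Q1 exp_gen_UNIV[OF conn] by (metis UNIV_I l_one carrier_UNIV)
  from this[of "g1 \<otimes> inv g0"] have "P (g1 \<otimes> inv g0 \<otimes> \<one> \<otimes> g0) = 0"
    unfolding Q_def using subgroup.one_closed[OF G(1)] by blast
  then show False using P(2) by (simp add: m_assoc)
qed

end

section \<open>Generic points flow to the maximum\<close>

context cplx_action
begin

lemma LD_stabilizer:
  assumes v: "v \<in> uu" and w: "\<And>t. \<phi> (EXP (t *\<^sub>R w)) z = z" shows "LD v w z = 0"
proof -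
  have "((\<lambda>t. \<mu> (\<phi> (EXP (t *\<^sub>R w)) z) v) has_real_derivative LD v w (\<phi> (EXP (0 *\<^sub>R w)) z)) (at 0)"
    by (rule flow_derivative[OF v])
  then have "((\<lambda>t. \<mu> z v) has_real_derivative LD v w z) (at 0)" by (simp add: w)
  from DERIV_unique[OF this DERIV_const] show ?thesis .
qed

lemma LD_stabilizer_Ad:
  assumes v: "v \<in> uu" and w: "\<And>t. \<phi> (EXP (t *\<^sub>R w)) z = z" shows "LD v (AD g w) (\<phi> g z) = 0"
proof (rule LD_stabilizer[OF v])
  fix t
  have "EXP (t *\<^sub>R AD g w) \<otimes> g = g \<otimes> EXP (t *\<^sub>R w)"
    using EXP_Ad[of g "t *\<^sub>R w"] by (simp add: Ad_simps inv_solve_right')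
  from arg_cong[OF this, of "\<lambda>h. \<phi> h z"] show "\<phi> (EXP (t *\<^sub>R AD g w)) (\<phi> g z) = \<phi> g z"
    by (simp add: act_mult w)
qed

lemma LD_sum: "LD v (\<Sum>k\<in>I. f k) z = (\<Sum>k\<in>I. LD v (f k) z)"
  by (induction I rule: infinite_finite_induct) (auto simp: LD_linear)

lemma LD_cscale: "LD v (cscale i a w) z = Re a * LD v w z + Im a * LD v (i w) z"
  by (simp add: cscale_def LD_linear)

lemma LD_bounded:
  assumes v: "v \<in> uu" shows "\<exists>K\<ge>0. \<forall>y\<in>X. \<bar>LD v w y\<bar> \<le> K"
proof -
  have "continuous_on X (LD v w)" using isCont_LD[OF v] by (simp add: continuous_at_imp_continuous_on)
  from compact_imp_bounded[OF compact_continuous_image[OF this compact_orbit]]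
  obtain K where "\<forall>y\<in>LD v w ` X. norm y \<le> K" by (auto simp: bounded_iff)
  then show ?thesis by (intro exI[of _ "max K 0"]) (auto simp: le_max_iff_disj)
qed

end

section \<open>The limit of the flow near a fixed maximum\<close>

locale maximal_point = cplx_action +
  fixes v n e c g1
  assumes v: "v \<in> uu" and ortho: "H.ortho n e"
    and eig: "\<And>k t. k < n \<Longrightarrow> AD (EXP (t *\<^sub>R i v)) (e k) = exp (c k * t) *\<^sub>R e k"
    and basis: "\<And>w. w = (\<Sum>k<n. cscale i (H.coef e k w) (e k))"
    and max: "\<And>y. y \<in> X \<Longrightarrow> \<mu> y v \<le> \<mu> (\<phi> g1 x) v"
begin

abbreviation z where "z \<equiv> \<phi> g1 x"

text \<open>\<open>i (e k)\<close> is an eigenvector with the same eigenvalue, so the complex line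
  of \<open>e k\<close> consists of stabilising directions.\<close>

lemma z_stabilizer:
  assumes "k < n" "c k > 0" shows "\<phi> (EXP (t *\<^sub>R e k)) z = z" "\<phi> (EXP (t *\<^sub>R i (e k))) z = z"
proof -
  show "\<phi> (EXP (t *\<^sub>R e k)) z = z"
    by (rule max_unipotent_fixed[OF v _ max eig[OF assms(1)] assms(2)]) auto
  have "AD (EXP (t *\<^sub>R i v)) (i (e k)) = exp (c k * t) *\<^sub>R i (e k)" for t
    by (simp add: Ad_simps eig[OF assms(1)] j_simps)
  then show "\<phi> (EXP (t *\<^sub>R i (e k))) z = z"
    by (rule max_unipotent_fixed[OF v _ max _ assms(2), rotated 2]) auto
qed

text \<open>The columns with \<open>c k > 0\<close> lie in the stabiliser algebra of \<open>\<phi> g x\<close>; when \<open>DD g \<noteq> 0\<close>, they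
  and the eigenvectors with eigenvalue \<open>c k \<le> 0\<close> span the Lie algebra.\<close>

definition col where "col k g = (if c k > 0 then AD g (AD (inv g1) (e k)) else e k)"

definition DD where "DD g = cdet n (\<lambda>r s. H.coef e r (col s g))"

lemma DD_g1: "DD g1 = 1"
proof -
  have "col s g1 = e s" for s using Ad_mult[of g1 "inv g1" "e s"] by (simp add: col_def Ad_one)
  then show ?thesis unfolding DD_def by (intro cdet_identity) (simp add: H.ortho_coef[OF ortho])
qed

lemma nice_DD: "nice DD"
  unfolding nice_def
proof (intro allI)
  fix a b p y
  have "(\<lambda>s. H.coef e r (col k (a \<otimes> EXP (p + cscale i s y) \<otimes> b))) holomorphic_on UNIV" for r k
  proof (cases "c k > 0")
    case True
    have "nice (\<lambda>g. H.coef e r (AD g (AD (inv g1) (e k))))" by (rule nice_Ad[OF H.clinear_coef])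
    then show ?thesis using True by (simp add: nice_def col_def)
  qed (simp add: col_def)
  then show "(\<lambda>s. DD (a \<otimes> EXP (p + cscale i s y) \<otimes> b)) holomorphic_on UNIV"
    unfolding DD_def by (intro cdet_holomorphic)
qed

lemma col_gcurve_hol:
  assumes "gcurve k \<theta>" shows "(\<lambda>s. H.coef e r (col m (k s))) holomorphic_on UNIV"
  using gcurve_hol(1)[OF assms H.clinear_coef] by (cases "c m > 0") (auto simp: col_def)

text \<open>The column is a translate of \<open>e m\<close>, which stabilises z. Pushed forward by
  the flow it is the translate by h, and h carries z to the flowed point, so it is a stabilising
  direction there.\<close>

lemma LD_flow_col:
  assumes m: "m < n" "c m > 0"
  shows "LD v (AD (EXP (t *\<^sub>R i v)) (cscale i a (col m g))) (flow v t (\<phi> g x)) = 0"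
proof -
  define h where "h = EXP (t *\<^sub>R i v) \<otimes> g \<otimes> inv g1"
  have h: "\<phi> h z = flow v t (\<phi> g x)" by (simp add: h_def act_mult)
  have "AD (EXP (t *\<^sub>R i v)) (cscale i a (col m g)) = cscale i a (AD h (e m))"
    using m by (simp add: h_def col_def Ad_simps Ad_mult)
  then show ?thesis
    using LD_stabilizer_Ad[OF v z_stabilizer(1)[OF m], where g=h] LD_stabilizer_Ad[OF v z_stabilizer(2)[OF m], where g=h]
    by (simp add: LD_cscale h Ad_simps)
qed

lemma flow_curve_derivative:
  assumes k: "gcurve k \<theta>"
  shows "((\<lambda>r. \<mu> (flow v t (\<phi> (k (s0 + of_real r * \<delta>)) x)) v) has_real_derivative
    LD v (AD (EXP (t *\<^sub>R i v)) (cscale i \<delta> (\<theta> (s0 + of_real r * \<delta>)))) (flow v t (\<phi> (k (s0 + of_real r * \<delta>)) x))) (at r)"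
proof -
  define E where "E = EXP (t *\<^sub>R i v)"
  define s1 where "s1 = s0 + of_real r * \<delta>"
  have "mder c0 c0 (\<lambda>g. E \<otimes> g \<otimes> inv E) (k (s1 + of_real 0 * \<delta>) \<otimes> inv (k s1)) (AD E)"
    using mder_Ad[of E] by simp
  from mder_compose[OF gcurve_mder[OF k] this]
  have "mder vec_chart c0 (\<lambda>h::real. E \<otimes> (k (s1 + of_real h * \<delta>) \<otimes> inv (k s1)) \<otimes> inv E) 0
    (\<lambda>h. h *\<^sub>R AD E (cscale i \<delta> (\<theta> s1)))" by (simp add: Ad_simps)
  from LD_derivative[OF v this, of "flow v t (\<phi> (k s1) x)"]
  have "((\<lambda>h. \<mu> (\<phi> (E \<otimes> (k (s1 + of_real h * \<delta>) \<otimes> inv (k s1)) \<otimes> inv E) (flow v t (\<phi> (k s1) x))) v) has_real_derivative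
    LD v (AD E (cscale i \<delta> (\<theta> s1))) (flow v t (\<phi> (k s1) x))) (at 0)" by simp
  moreover have "\<phi> (E \<otimes> (k (s1 + of_real h * \<delta>) \<otimes> inv (k s1)) \<otimes> inv E) (flow v t (\<phi> (k s1) x))
    = flow v t (\<phi> (k (s0 + of_real (h + r) * \<delta>)) x)" for h
  proof -
    have "s1 + of_real h * \<delta> = s0 + of_real (h + r) * \<delta>" by (simp add: s1_def algebra_simps)
    then show ?thesis unfolding E_def[symmetric] by (simp add: act_mult)
  qed
  ultimately have "((\<lambda>h. \<mu> (flow v t (\<phi> (k (s0 + of_real (h + r) * \<delta>)) x)) v) has_real_derivative
    LD v (AD E (cscale i \<delta> (\<theta> s1))) (flow v t (\<phi> (k s1) x))) (at 0)" by simp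
  then show ?thesis unfolding E_def s1_def
    using DERIV_shift[of "\<lambda>r. \<mu> (flow v t (\<phi> (k (s0 + of_real r * \<delta>)) x)) v" _ 0 r] by simp
qed

text \<open>The Cramer coordinates of the velocity along the columns with \<open>c k > 0\<close> do not move the
  momentum, since these columns span stabiliser directions; the other coordinates are not expanded by the flow.\<close>

lemma lam_constant_on_segment:
  assumes k: "gcurve k \<theta>" and nz: "\<And>r. r \<in> {0..1} \<Longrightarrow> DD (k (s0 + of_real r * \<delta>)) \<noteq> 0"
  shows "lam v (\<phi> (k s0) x) = lam v (\<phi> (k (s0 + \<delta>)) x)"
proof -
  define y where "y r = \<phi> (k (s0 + of_real r * \<delta>)) x" for r :: real
  define w where "w r = cscale i \<delta> (\<theta> (s0 + of_real r * \<delta>))" for r :: real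
  have "\<exists>N. (\<forall>k'<n. \<forall>m<n. (\<lambda>s. N s k' m) holomorphic_on UNIV) \<and>
    (\<forall>s. \<forall>r<n. \<forall>m<n. (\<Sum>k'<n. H.coef e r (col k' (k s)) * N s k' m) = (if r = m then cdet n (\<lambda>r s'. H.coef e r (col s' (k s))) else 0))"
    by (rule cramer_holomorphic) (rule col_gcurve_hol[OF k])
  then obtain N where N: "\<And>k' m. k' < n \<Longrightarrow> m < n \<Longrightarrow> (\<lambda>s. N s k' m) holomorphic_on UNIV"
    and cr: "\<And>s r m. r < n \<Longrightarrow> m < n \<Longrightarrow> (\<Sum>k'<n. H.coef e r (col k' (k s)) * N s k' m) = (if r = m then DD (k s) else 0)"
    unfolding DD_def by blast
  \<comment> \<open>Numerators of the Cramer coordinates of the velocity, holomorphic in the whole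
    plane; they are divided by \<open>DD\<close> only on the segment, where it does not
    vanish.\<close>
  define b where "b m s = (\<Sum>j<n. N s m j * (\<delta> * H.coef e j (\<theta> s)))" for m s
  define a where "a m r = b m (s0 + of_real r * \<delta>) / DD (k (s0 + of_real r * \<delta>))" for m and r :: real
  have hol_b: "b m holomorphic_on UNIV" if "m < n" for m
    unfolding b_def using that by (auto intro!: holomorphic_intros N gcurve_hol(2)[OF k H.clinear_coef])
  have hol_D: "(\<lambda>s. DD (k s)) holomorphic_on UNIV"
    unfolding DD_def by (intro cdet_holomorphic col_gcurve_hol[OF k])
  have cont_a: "continuous_on {0..1} (a m)" if "m < n" for m
  proof -
    have "continuous_on {0..1} (\<lambda>r::real. f (s0 + of_real r * \<delta>))" if "f holomorphic_on UNIV" for f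
      by (rule continuous_on_compose2[OF holomorphic_on_imp_continuous_on[OF that]]) (auto intro!: continuous_intros)
    then show ?thesis unfolding a_def using nz hol_b[OF that] hol_D by (intro continuous_on_divide) auto
  qed
  have "\<exists>K\<ge>0. \<forall>r\<in>{0..1}. norm (a m r) \<le> K" if "m < n" for m
  proof -
    from compact_imp_bounded[OF compact_continuous_image[OF cont_a[OF that]]]
    obtain K where "\<forall>y\<in>a m ` {0..1}. norm y \<le> K" by (auto simp: bounded_iff)
    then show ?thesis by (intro exI[of _ "max K 0"]) (auto simp: le_max_iff_disj)
  qed
  then obtain Ka where Ka: "\<And>m. m < n \<Longrightarrow> Ka m \<ge> 0" "\<And>m r. m < n \<Longrightarrow> r \<in> {0..1} \<Longrightarrow> norm (a m r) \<le> Ka m"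
    by metis
  have w: "w r = (\<Sum>m<n. cscale i (a m r) (col m (k (s0 + of_real r * \<delta>))))" if r: "r \<in> {0..1}" for r
  proof -
    define s where "s = s0 + of_real r * \<delta>"
    define W where "W = (\<Sum>m<n. cscale i (a m r) (col m (k s)))"
    have D: "DD (k s) \<noteq> 0" using nz[OF r] by (simp add: s_def)
    have co: "H.coef e p W = H.coef e p (w r)" if p: "p < n" for p
    proof -
      have lin: "linear (H.coef e p)" using H.clinear_coef by (auto simp: clinear_map_def)
      have "H.coef e p W = (\<Sum>m<n. a m r * H.coef e p (col m (k s)))"
        unfolding W_def by (simp add: linear_sum[OF lin] clinear_cscale[OF H.clinear_coef] cscale_complex)
      also have "\<dots> = (\<Sum>m<n. \<Sum>j<n. H.coef e p (col m (k s)) * N s m j * (\<delta> * H.coef e j (\<theta> s) / DD (k s)))"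
        unfolding a_def b_def s_def[symmetric] by (simp add: sum_divide_distrib sum_distrib_right sum_distrib_left mult_ac)
      also have "\<dots> = (\<Sum>j<n. (\<Sum>m<n. H.coef e p (col m (k s)) * N s m j) * (\<delta> * H.coef e j (\<theta> s) / DD (k s)))"
        by (subst sum.swap) (simp add: sum_distrib_right sum_divide_distrib)
      also have "\<dots> = (\<Sum>j<n. if p = j then \<delta> * H.coef e j (\<theta> s) else 0)"
        using p D by (intro sum.cong) (auto simp: cr)
      also have "\<dots> = H.coef e p (w r)"
        using p by (simp add: w_def s_def[symmetric] clinear_cscale[OF H.clinear_coef] cscale_complex)
      finally show ?thesis .
    qed
    have "W = (\<Sum>k<n. cscale i (H.coef e k W) (e k))" by (rule basis)
    also have "\<dots> = (\<Sum>k<n. cscale i (H.coef e k (w r)) (e k))" by (rule sum.cong) (simp_all add: co)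
    also have "\<dots> = w r" by (rule basis[symmetric])
    finally have "W = w r" .
    then show ?thesis by (simp add: W_def s_def)
  qed
  define F where "F m r y' = Re (a m r) * LD v (e m) y' + Im (a m r) * LD v (i (e m)) y'" for m r y'
  \<comment> \<open>For these directions \<open>exp (c m * t) \<le> 1\<close> at nonnegative times;
    the remaining columns drop out by \<open>LD_flow_col\<close>.\<close>
  define S where "S = {m. m < n \<and> \<not> c m > 0}"
  have finS: "finite S" by (simp add: S_def)
  define d where "d t r = (\<Sum>m\<in>S. exp (c m * t) * F m r (flow v t (y r)))" for t r
  have der: "((\<lambda>r. \<mu> (flow v t (y r)) v) has_real_derivative d t r) (at r)" if r: "r \<in> {0..1}" for t r
  proof -
    have "LD v (AD (EXP (t *\<^sub>R i v)) (cscale i (a m r) (col m (k (s0 + of_real r * \<delta>))))) (flow v t (y r)) =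
      (if m \<in> S then exp (c m * t) * F m r (flow v t (y r)) else 0)" if m: "m < n" for m
    proof (cases "c m > 0")
      case True
      then show ?thesis using LD_flow_col[OF m True] by (simp add: S_def y_def)
    next
      case False
      then show ?thesis using m
        by (simp add: S_def col_def Ad_simps eig cscale_simps LD_linear LD_cscale F_def)
    qed
    then have "LD v (AD (EXP (t *\<^sub>R i v)) (w r)) (flow v t (y r)) = (\<Sum>m<n. if m \<in> S then exp (c m * t) * F m r (flow v t (y r)) else 0)"
      unfolding w[OF r] by (simp add: linear_sum[OF linear_Ad] LD_sum)
    also have "\<dots> = d t r"
      unfolding d_def by (subst sum.inter_restrict[symmetric]) (auto simp: S_def Int_def intro!: sum.cong)
    finally have "LD v (AD (EXP (t *\<^sub>R i v)) (w r)) (flow v t (y r)) = d t r" .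
    then show ?thesis using flow_curve_derivative[OF k, of t s0 \<delta> r] by (simp add: y_def w_def)
  qed
  define K where "K w = (SOME K. K \<ge> 0 \<and> (\<forall>y\<in>X. \<bar>LD v w y\<bar> \<le> K))" for w
  have "K w \<ge> 0 \<and> (\<forall>y\<in>X. \<bar>LD v w y\<bar> \<le> K w)" for w
    unfolding K_def by (rule someI_ex[OF LD_bounded[OF v]])
  then have K: "\<And>w. K w \<ge> 0" "\<And>w y. y \<in> X \<Longrightarrow> \<bar>LD v w y\<bar> \<le> K w" by blast+
  define K1 where "K1 m = K (e m)" for m
  define K2 where "K2 m = K (i (e m))" for m
  have K1: "K1 m \<ge> 0" "y \<in> X \<Longrightarrow> \<bar>LD v (e m) y\<bar> \<le> K1 m" for m y by (simp_all add: K1_def K)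
  have K2: "K2 m \<ge> 0" "y \<in> X \<Longrightarrow> \<bar>LD v (i (e m)) y\<bar> \<le> K2 m" for m y by (simp_all add: K2_def K)
  have yX: "flow v t (y r) \<in> X" for t r unfolding y_def by (rule X_act) (rule rangeI)
  have int: "((d t) has_integral (\<mu> (flow v t (y 1)) v - \<mu> (flow v t (y 0)) v)) {0..1}" for t
  proof (rule fundamental_theorem_of_calculus)
    show "((\<lambda>r. \<mu> (flow v t (y r)) v) has_vector_derivative d t r) (at r within {0..1})" if "r \<in> {0..1}" for r
      unfolding has_real_derivative_iff_has_vector_derivative[symmetric]
      by (rule has_field_derivative_at_within[OF der[OF that]])
  qed simp
  have bd: "norm (d (real q) r) \<le> (\<Sum>m\<in>S. Ka m * K1 m + Ka m * K2 m)" if r: "r \<in> {0..1}" for q r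
    unfolding d_def
  proof (rule sum_norm_le)
    fix m assume m: "m \<in> S"
    then have mn: "m < n" and "c m * real q \<le> 0" by (auto simp: S_def mult_nonpos_nonneg)
    then have e1: "exp (c m * real q) \<le> 1" by simp
    have a1: "\<bar>Re (a m r)\<bar> \<le> Ka m" "\<bar>Im (a m r)\<bar> \<le> Ka m"
      using Ka(2)[OF mn r] abs_Re_le_cmod[of "a m r"] abs_Im_le_cmod[of "a m r"] by linarith+
    have "\<bar>F m r (flow v (real q) (y r))\<bar> \<le> \<bar>Re (a m r) * LD v (e m) (flow v (real q) (y r))\<bar> + \<bar>Im (a m r) * LD v (i (e m)) (flow v (real q) (y r))\<bar>"
      unfolding F_def by (rule abs_triangle_ineq)
    also have "\<dots> \<le> Ka m * K1 m + Ka m * K2 m"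
      unfolding abs_mult using a1 K1 K2 yX Ka(1)[OF mn] by (intro add_mono mult_mono) auto
    finally have F: "\<bar>F m r (flow v (real q) (y r))\<bar> \<le> Ka m * K1 m + Ka m * K2 m" .
    have "\<bar>exp (c m * real q) * F m r (flow v (real q) (y r))\<bar> \<le> 1 * (Ka m * K1 m + Ka m * K2 m)"
      unfolding abs_mult using e1 F by (intro mult_mono) auto
    then show "norm (exp (c m * real q) * F m r (flow v (real q) (y r))) \<le> Ka m * K1 m + Ka m * K2 m" by simp
  qed
  have pt: "(\<lambda>q. d (real q) r) \<longlonglongrightarrow> 0" if r: "r \<in> {0..1}" for r
  proof -
    have "(\<lambda>q. exp (c m * real q) * F m r (flow v (real q) (y r))) \<longlonglongrightarrow> 0" if m: "m \<in> S" for m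
    proof (rule Lim_null_comparison)
      have yr: "y r \<in> X" by (simp add: y_def)
      have "(\<lambda>q. F m r (flow v (real q) (y r))) \<longlonglongrightarrow> Re (a m r) * 0 + Im (a m r) * 0"
        unfolding F_def by (intro tendsto_intros LD_tendsto_zero[OF v yr])
      then show "(\<lambda>q. \<bar>F m r (flow v (real q) (y r))\<bar>) \<longlonglongrightarrow> 0" by (simp add: tendsto_rabs_zero)
      have "norm (exp (c m * real q) * F m r (flow v (real q) (y r))) \<le> \<bar>F m r (flow v (real q) (y r))\<bar>" for q
      proof -
        have "exp (c m * real q) \<le> 1" using m by (auto simp: S_def mult_nonpos_nonneg)
        then show ?thesis by (simp add: abs_mult mult_left_le_one_le)
      qed
      then show "\<forall>\<^sub>F q in sequentially. norm (exp (c m * real q) * F m r (flow v (real q) (y r))) \<le> \<bar>F m r (flow v (real q) (y r))\<bar>"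
        by (intro always_eventually allI)
    qed
    then have "(\<lambda>q. d (real q) r) \<longlonglongrightarrow> (\<Sum>m\<in>S. 0)" unfolding d_def by (intro tendsto_sum)
    then show ?thesis by simp
  qed
  \<comment> \<open>The derivatives along the segment are bounded and tend to 0 pointwise, so their
    integrals tend to 0; these integrals are the differences of the end values, which tend to the
    difference of the two limits.\<close>
  have "(\<lambda>q. integral {0..1} (d (real q))) \<longlonglongrightarrow> integral {0..1} (\<lambda>r::real. 0::real)"
  proof (rule dominated_convergence(2))
    show "d (real q) integrable_on {0..1}" for q using int by blast
    show "(\<lambda>r. \<Sum>m\<in>S. Ka m * K1 m + Ka m * K2 m) integrable_on {0..1::real}" by (rule integrable_continuous_interval) (rule continuous_on_const)
  qed (use bd pt in auto)
  moreover have "integral {0..1} (d (real q)) = \<mu> (flow v (real q) (y 1)) v - \<mu> (flow v (real q) (y 0)) v" for q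
    using int by (rule integral_unique)
  ultimately have "(\<lambda>q. \<mu> (flow v (real q) (y 1)) v - \<mu> (flow v (real q) (y 0)) v) \<longlonglongrightarrow> 0" by simp
  moreover have "(\<lambda>q. \<mu> (flow v (real q) (y 1)) v - \<mu> (flow v (real q) (y 0)) v) \<longlonglongrightarrow> lam v (y 1) - lam v (y 0)"
    by (intro tendsto_diff lam_lim(1)[OF v]) (auto simp: y_def)
  ultimately have "lam v (y 1) - lam v (y 0) = 0" by (rule LIMSEQ_unique[rotated])
  then show ?thesis by (simp add: y_def)
qed

text \<open>Removing the countable zero set of \<open>DD\<close> along the curve leaves an open
  connected part of the plane, on which the limit is locally constant. At g1 it is the maximum,
  because z is fixed by the flow.\<close>

lemma lam_generic:
  assumes "DD g \<noteq> 0" shows "lam v (\<phi> g x) = \<mu> z v"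
proof -
  obtain k \<theta> where k: "gcurve k \<theta>" "k 0 = g1" "k 1 = g" using gcurve_connects[OF conn] by blast
  define f where "f s = lam v (\<phi> (k s) x)" for s
  have hol: "(\<lambda>s. DD (k s)) holomorphic_on UNIV"
    unfolding DD_def by (intro cdet_holomorphic col_gcurve_hol[OF k(1)])
  define Z where "Z = {s. DD (k s) = 0}"
  have "countable Z" unfolding Z_def by (rule entire_countable_zeros[OF hol, of 1]) (simp add: k assms)
  then have con: "connected (UNIV - Z)" by (intro connected_open_diff_countable) auto
  have cont: "continuous_on UNIV (\<lambda>s. DD (k s))" by (rule holomorphic_on_imp_continuous_on[OF hol])
  have op: "open (UNIV - Z)"
    using open_Collect_neq[OF cont continuous_on_const[of UNIV 0]] by (simp add: Z_def set_diff_eq)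
  have loc: "\<forall>\<^sub>F s' in at s within UNIV - Z. f s = f s'" if s: "s \<in> UNIV - Z" for s
  proof -
    obtain r where r: "r > 0" "ball s r \<subseteq> UNIV - Z" using op s open_contains_ball by metis
    have "f s = f s'" if s': "dist s' s < r" for s'
    proof -
      have "DD (k (s + of_real q * (s' - s))) \<noteq> 0" if q: "q \<in> {0..1}" for q
      proof -
        have "norm (of_real q * (s' - s)) \<le> 1 * norm (s' - s)"
          unfolding norm_mult using q by (intro mult_right_mono) auto
        then have "s + of_real q * (s' - s) \<in> ball s r" using s' by (simp add: dist_norm norm_minus_commute)
        then show ?thesis using r(2) by (auto simp: Z_def)
      qed
      from lam_constant_on_segment[OF k(1) this] show ?thesis by (simp add: f_def)
    qed
    then show ?thesis unfolding eventually_at using r(1) by auto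
  qed
  have "f 1 = f 0"
    by (rule connected_local_const[OF con _ _ ballI[OF loc]]) (auto simp: Z_def k assms DD_g1)
  moreover have "lam v z = \<mu> z v"
  proof -
    have "flow v t z = z" for t by (rule max_fixed[OF v _ max]) auto
    then show ?thesis using LIMSEQ_unique[OF lam_lim(1)[OF v, of z]] by auto
  qed
  ultimately show ?thesis by (simp add: f_def k)
qed

end

context cplx_action
begin

lemma maximizing_function:
  assumes v: "v \<in> uu"
  shows "\<exists>D g1. nice D \<and> D g1 \<noteq> 0 \<and> (\<forall>g. D g \<noteq> 0 \<longrightarrow> (\<forall>y\<in>X. \<mu> y v \<le> lam v (\<phi> g x)))"
proof -
  obtain n e c where e: "H.ortho n e" "\<forall>k<n. \<forall>t. AD (EXP (t *\<^sub>R i v)) (e k) = exp (c k * t) *\<^sub>R e k"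
    "\<forall>w. w = (\<Sum>k<n. cscale i (H.coef e k w) (e k))"
    using eigenbasis[OF v] by blast
  obtain g1 where g1: "\<forall>y\<in>X. \<mu> y v \<le> \<mu> (\<phi> g1 x) v" using mu_max[OF v] by auto
  interpret maximal_point L i A J B U \<omega> \<phi> \<mu> ip x v n e c g1
  proof unfold_locales
    show "v \<in> uu" by (rule v)
    show "H.ortho n e" by (rule e(1))
    show "w = (\<Sum>k<n. cscale i (H.coef e k w) (e k))" for w using e(3) by (rule spec)
    show "AD (EXP (t *\<^sub>R i v)) (e k) = exp (c k * t) *\<^sub>R e k" if "k < n" for k t using e(2) that by simp
    show "\<mu> y v \<le> \<mu> (\<phi> g1 x) v" if "y \<in> X" for y by (rule bspec[OF g1 that])
  qed
  show ?thesis
  proof (intro exI conjI allI impI ballI)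
    show "nice DD" by (rule nice_DD)
    show "DD g1 \<noteq> 0" by (simp add: DD_g1)
    show "\<mu> y v \<le> lam v (\<phi> g x)" if "DD g \<noteq> 0" "y \<in> X" for g y
      unfolding lam_generic[OF that(1)] by (rule max[OF that(2)])
  qed
qed

text \<open>The functions belonging to the finitely many directions are multiplied into a single
  one, which has a nonzero value on the translate of G by g0.\<close>

lemma generic_point:
  assumes V: "finite V" "V \<subseteq> uu" and G: "subgroup G L" "closed G"
    and lie: "\<And>v. \<exists>\<xi>\<in>lie_algebra_of L A G. \<exists>\<eta>\<in>lie_algebra_of L A G. v = \<xi> + i \<eta>"
  shows "\<exists>h\<in>G. \<forall>v\<in>V. \<forall>y'\<in>X. \<mu> y' v \<le> lam v (\<phi> (h \<otimes> g0) x)"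
proof -
  define W where "W P V \<longleftrightarrow> nice P \<and> (\<exists>g. P g \<noteq> 0) \<and> (\<forall>g. P g \<noteq> 0 \<longrightarrow> (\<forall>v\<in>V. \<forall>y\<in>X. \<mu> y v \<le> lam v (\<phi> g x)))" for P V
  have "\<exists>P. W P V"
    using V
  proof (induction rule: finite_induct)
    case empty
    have "W (\<lambda>_. 1) {}" by (simp add: W_def nice_one)
    then show ?case by (intro exI)
  next
    case (insert v V)
    have "\<exists>P. W P V" by (rule insert.IH) (use insert.prems in simp)
    then obtain P where W: "W P V" by (rule exE)
    then obtain g where P: "nice P" "P g \<noteq> 0" unfolding W_def by (elim conjE exE)
    have "v \<in> uu" using insert.prems by simp
    from maximizing_function[OF this]
    obtain D g1 where D: "nice D" "D g1 \<noteq> 0" and D3: "\<forall>g. D g \<noteq> 0 \<longrightarrow> (\<forall>y\<in>X. \<mu> y v \<le> lam v (\<phi> g x))"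
      by (elim exE conjE)
    have P3: "\<forall>g. P g \<noteq> 0 \<longrightarrow> (\<forall>v\<in>V. \<forall>y\<in>X. \<mu> y v \<le> lam v (\<phi> g x))" using W unfolding W_def by (elim conjE)
    have "W (\<lambda>g. P g * D g) (insert v V)"
      unfolding W_def
    proof (intro conjI allI impI ballI)
      show "nice (\<lambda>g. P g * D g)" by (rule nice_mult[OF P(1) D(1)])
      show "\<exists>g. P g * D g \<noteq> 0" by (rule nice_mult_nonzero[OF P D conn])
      show "\<mu> y u \<le> lam u (\<phi> g x)" if g: "P g * D g \<noteq> 0" and u: "u \<in> insert v V" and y: "y \<in> X" for g u y
      proof (cases "u = v")
        case True
        then show ?thesis using D3[rule_format, of g y] g y by simp
      next
        case False
        then show ?thesis using P3[rule_format, of g u y] g u y by simp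
      qed
    qed
    then show ?case by (intro exI)
  qed
  then obtain P where W: "W P V" by (rule exE)
  then obtain g where P: "nice P" "P g \<noteq> 0" unfolding W_def by (elim conjE exE)
  from nice_nonzero_on_real_form[OF P conn G lie, of g0]
  obtain h where h: "h \<in> G" "P (h \<otimes> g0) \<noteq> 0" by (rule bexE)
  then have "\<forall>v\<in>V. \<forall>y'\<in>X. \<mu> y' v \<le> lam v (\<phi> (h \<otimes> g0) x)" using W unfolding W_def by blast
  then show ?thesis using h(1) by (rule bexI)
qed

end

section \<open>The potential of the gradient map on an abelian subalgebra\<close>

text \<open>Composing with the projection to \<uu> extends the momentum linearly to the whole Lie
  algebra, where complex coordinates reduce the bound to finitely many functions on a compact
  set.\<close>

lemma (in cplx_action) mu_uniform_bound: "\<exists>C>0. \<forall>y\<in>X. \<forall>w\<in>uu. \<bar>\<mu> y w\<bar> \<le> C * norm w"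
proof -
  define g where "g y w = \<mu> y (fst (pr w))" for y w
  have lin: "linear (g y)" for y
    unfolding g_def by (rule linearI) (auto simp: pr_simps mu_linear(1) mu_linear(2)[OF pr(1) pr(1)] pr)
  have "\<exists>K. K \<ge> 0 \<and> (\<forall>y\<in>X. \<bar>g y b\<bar> \<le> K)" for b
  proof -
    have "continuous_on X (\<lambda>y. g y b)"
      unfolding g_def using isCont_mu[OF pr(1)] by (simp add: continuous_at_imp_continuous_on)
    from compact_imp_bounded[OF compact_continuous_image[OF this compact_orbit]]
    obtain K where "\<forall>y\<in>(\<lambda>y. g y b) ` X. norm y \<le> K" by (auto simp: bounded_iff)
    then show ?thesis by (intro exI[of _ "max K 0"]) (auto simp: le_max_iff_disj)
  qed
  then have "\<exists>K. \<forall>b. K b \<ge> 0 \<and> (\<forall>y\<in>X. \<bar>g y b\<bar> \<le> K b)" by (intro choice allI)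
  then obtain K where K: "\<And>b. K b \<ge> 0" "\<And>b y. y \<in> X \<Longrightarrow> \<bar>g y b\<bar> \<le> K b" by blast
  obtain I :: "'l set" and m :: "'l \<Rightarrow> 'l \<Rightarrow> complex" where
    I: "finite I" and m: "\<And>b. clinear_map i ((*) \<i>) (m b)" and sum: "\<And>v. v = (\<Sum>b\<in>I. cscale i (m b v) b)"
    using complex_coordinates by blast
  have "\<exists>M. M \<ge> 0 \<and> (\<forall>w. cmod (m b w) \<le> M * norm w)" for b
  proof -
    have "bounded_linear (m b)" using m[of b] by (intro linear_bounded) (simp add: clinear_map_def)
    from bounded_linear.nonneg_bounded[OF this] show ?thesis by (auto simp: mult.commute)
  qed
  then have "\<exists>M. \<forall>b. M b \<ge> 0 \<and> (\<forall>w. cmod (m b w) \<le> M b * norm w)" by (intro choice allI)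
  then obtain M where M: "\<And>b. M b \<ge> 0" "\<And>b w. cmod (m b w) \<le> M b * norm w" by blast
  define C where "C = (\<Sum>b\<in>I. M b * (K b + K (i b)))"
  have C0: "C \<ge> 0" unfolding C_def by (intro sum_nonneg mult_nonneg_nonneg add_nonneg_nonneg M K)
  have "\<bar>g y w\<bar> \<le> C * norm w" if y: "y \<in> X" for y w
  proof -
    have "g y w = g y (\<Sum>b\<in>I. cscale i (m b w) b)" by (simp only: sum[symmetric])
    also have "\<dots> = (\<Sum>b\<in>I. Re (m b w) * g y b + Im (m b w) * g y (i b))"
      unfolding linear_sum[OF lin] cscale_def linear_add[OF lin] linear_scale[OF lin] by simp
    finally have "\<bar>g y w\<bar> \<le> (\<Sum>b\<in>I. \<bar>Re (m b w) * g y b + Im (m b w) * g y (i b)\<bar>)" by (simp only: sum_abs)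
    also have "\<dots> \<le> (\<Sum>b\<in>I. M b * (K b + K (i b)) * norm w)"
    proof (rule sum_mono)
      fix b
      have "\<bar>Re (m b w) * g y b + Im (m b w) * g y (i b)\<bar> \<le> \<bar>Re (m b w)\<bar> * \<bar>g y b\<bar> + \<bar>Im (m b w)\<bar> * \<bar>g y (i b)\<bar>"
        unfolding abs_mult[symmetric] by (rule abs_triangle_ineq)
      also have "\<dots> \<le> (M b * norm w) * K b + (M b * norm w) * K (i b)"
        using M(2)[of b w] abs_Re_le_cmod[of "m b w"] abs_Im_le_cmod[of "m b w"] M(1)[of b]
        by (intro add_mono mult_mono K y) auto
      finally show "\<bar>Re (m b w) * g y b + Im (m b w) * g y (i b)\<bar> \<le> M b * (K b + K (i b)) * norm w"
        by (simp add: algebra_simps)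
    qed
    finally show ?thesis by (simp add: C_def sum_distrib_right)
  qed
  then have "\<bar>\<mu> y w\<bar> \<le> (C + 1) * norm w" if "y \<in> X" "w \<in> uu" for y w
  proof -
    have "pr w = (w, 0)" using that subspace_0[OF subspace_uu] by (intro pr_eqI) (auto simp: j_simps)
    then have "\<mu> y w = g y w" by (simp add: g_def)
    moreover have "C * norm w \<le> (C + 1) * norm w" by (intro mult_right_mono) auto
    ultimately show ?thesis using \<open>\<And>y w. y \<in> X \<Longrightarrow> \<bar>g y w\<bar> \<le> C * norm w\<close>[OF that(1), of w] by linarith
  qed
  then show ?thesis using C0 by (intro exI[of _ "C + 1"]) auto
qed

text \<open>S plays the role of -i \<aa>, so that the momentum is evaluated on it directly.\<close>

locale abelian_flow = cplx_action +
  fixes S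
  assumes S: "subspace S" "S \<subseteq> uu" and abelian: "\<And>v w. v \<in> S \<Longrightarrow> w \<in> S \<Longrightarrow> lie_bracket L A (i v) (i w) = 0"
begin

lemma SD: "0 \<in> S" "v \<in> S \<Longrightarrow> w \<in> S \<Longrightarrow> v + w \<in> S" "v \<in> S \<Longrightarrow> r *\<^sub>R v \<in> S" "v \<in> S \<Longrightarrow> v \<in> uu"
  "v \<in> S \<Longrightarrow> w \<in> S \<Longrightarrow> v - w \<in> S"
  using S by (auto simp: subspace_0 subspace_add subspace_scale subspace_diff)

lemma EXP_abelian: "v \<in> S \<Longrightarrow> w \<in> S \<Longrightarrow> EXP (i (v + w)) = EXP (i v) \<otimes> EXP (i w)"
  using EXP_add_if_bracket_zero[OF abelian] by (simp add: j_simps)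

text \<open>A potential of Kempf-Ness type: the line integral, over the segment from 0 to v, of the
  momentum pulled back to S by the action of \<open>EXP (i v)\<close>.\<close>

definition psi where "psi y v = integral {0..1} (\<lambda>t. \<mu> (flow v t y) v)"

text \<open>After differentiation under the integral, \<open>LD_symmetric\<close> exchanges v and w
  in the cross term; the integrand becomes the t-derivative of
  \<open>t * \<mu> (Y \<sigma>0 t) w\<close>, and only the endpoint t = 1 remains. Commutativity of
  the flows provides the derivative in \<sigma>.\<close>

lemma psi_derivative:
  assumes vw: "v \<in> S" "w \<in> S"
  shows "((\<lambda>\<sigma>. psi y (v + \<sigma> *\<^sub>R w)) has_real_derivative \<mu> (\<phi> (EXP (i (v + \<sigma>0 *\<^sub>R w))) y) w) (at \<sigma>0)"
proof -
  define Y where "Y \<sigma> t = \<phi> (EXP (i (t *\<^sub>R (v + \<sigma> *\<^sub>R w)))) y" for \<sigma> t :: real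
  define u where "u \<sigma> = v + \<sigma> *\<^sub>R w" for \<sigma>
  have uS: "u \<sigma> \<in> S" for \<sigma> unfolding u_def by (intro SD vw)
  have Y1: "Y \<sigma> t = flow (u \<sigma>) t y" for \<sigma> t by (simp add: Y_def u_def j_simps)
  have Y2: "Y \<sigma> t = \<phi> (EXP ((t * \<sigma>) *\<^sub>R i w)) (flow v t y)" for \<sigma> t
    using EXP_abelian[of "(t * \<sigma>) *\<^sub>R w" "t *\<^sub>R v"] vw
    by (simp add: Y_def SD scaleR_right_distrib add.commute j_simps act_mult)
  have dt: "((\<lambda>t. \<mu> (Y \<sigma> t) a) has_real_derivative LD a (i (u \<sigma>)) (Y \<sigma> t)) (at t)" if "a \<in> S" for a \<sigma> t
    unfolding Y1 by (rule flow_derivative) (simp add: SD that)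
  have ds: "((\<lambda>\<sigma>. \<mu> (Y \<sigma> t) a) has_real_derivative t * LD a (i w) (Y \<sigma> t)) (at \<sigma>)" if a: "a \<in> S" for a \<sigma> t
  proof -
    have "((\<lambda>r. \<mu> (\<phi> (EXP (r *\<^sub>R i w)) (flow v t y)) a) has_real_derivative LD a (i w) (\<phi> (EXP ((t * \<sigma>) *\<^sub>R i w)) (flow v t y))) (at (t * \<sigma>))"
      by (rule flow_derivative) (simp add: SD a)
    moreover have "((\<lambda>\<sigma>. t * \<sigma>) has_real_derivative t) (at \<sigma>)" by (auto intro!: derivative_eq_intros)
    ultimately have "((\<lambda>\<sigma>. \<mu> (\<phi> (EXP ((t * \<sigma>) *\<^sub>R i w)) (flow v t y)) a) has_real_derivative LD a (i w) (\<phi> (EXP ((t * \<sigma>) *\<^sub>R i w)) (flow v t y)) * t) (at \<sigma>)"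
      by (rule DERIV_chain2)
    then show ?thesis by (simp add: Y2 mult.commute)
  qed
  define f where "f \<sigma> t = \<mu> (Y \<sigma> t) (u \<sigma>)" for \<sigma> t
  define f' where "f' \<sigma> t = \<mu> (Y \<sigma> t) w + t * (LD w (i v) (Y \<sigma> t) + \<sigma> * LD w (i w) (Y \<sigma> t))" for \<sigma> t
  have LDu: "LD w (i (u \<sigma>)) z = LD w (i v) z + \<sigma> * LD w (i w) z" for \<sigma> z
    by (simp add: u_def j_simps LD_linear)
  have f_eq: "f \<sigma> t = \<mu> (Y \<sigma> t) v + \<sigma> * \<mu> (Y \<sigma> t) w" for \<sigma> t
    using vw by (simp add: f_def u_def mu_linear(1) mu_linear(2)[OF SD(4)[OF vw(2)] SD(4)[OF vw(2)]] SD)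
  have f_der: "((\<lambda>\<sigma>. f \<sigma> t) has_real_derivative f' \<sigma> t) (at \<sigma>)" for \<sigma> t
  proof -
    have "((\<lambda>\<sigma>. \<mu> (Y \<sigma> t) v + \<sigma> * \<mu> (Y \<sigma> t) w) has_real_derivative
      t * LD v (i w) (Y \<sigma> t) + (\<sigma> * (t * LD w (i w) (Y \<sigma> t)) + 1 * \<mu> (Y \<sigma> t) w)) (at \<sigma>)"
      by (intro DERIV_add ds vw DERIV_mult' DERIV_ident)
    then show ?thesis unfolding f_eq f'_def LD_symmetric[of v w] by (simp add: algebra_simps)
  qed
  have cY: "isCont (\<lambda>p. Y (fst p) (snd p)) p" for p
    unfolding Y_def by (intro isCont_act isCont_o2[OF _ isCont_EXP] isCont_o2[OF _ linear_continuous_at[OF bounded_linear_j]] continuous_intros)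
  have cmu: "isCont (\<lambda>p. \<mu> (Y (fst p) (snd p)) a) p" if "a \<in> S" for a p
    by (rule isCont_o2[OF cY isCont_mu]) (simp add: SD that)
  have cLD: "isCont (\<lambda>p. LD w b (Y (fst p) (snd p))) p" for b p
    by (rule isCont_o2[OF cY isCont_LD]) (simp add: SD vw)
  have "isCont (\<lambda>p. f' (fst p) (snd p)) p" for p
    unfolding f'_def by (intro continuous_intros cmu cLD vw)
  then have cf': "continuous_on T (\<lambda>(\<sigma>, t). f' \<sigma> t)" for T
    by (simp add: continuous_at_imp_continuous_on split_def)
  have "((\<lambda>\<sigma>. integral (cbox 0 1) (f \<sigma>)) has_real_derivative integral (cbox 0 1) (f' \<sigma>0)) (at \<sigma>0 within UNIV)"
  proof (rule leibniz_rule_field_derivative[OF _ _ cf'])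
    show "((\<lambda>\<sigma>. f \<sigma> t) has_real_derivative f' \<sigma> t) (at \<sigma> within UNIV)" for \<sigma> t using f_der by simp
    have "isCont (\<lambda>t. f \<sigma> t) t" for \<sigma> t
      unfolding f_def Y1 using isCont_o2[OF isCont_flow_time isCont_mu[OF SD(4)[OF uS]]] .
    then show "f \<sigma> integrable_on cbox 0 1" for \<sigma>
      by (intro integrable_continuous) (simp add: continuous_at_imp_continuous_on)
  qed auto
  moreover have "(f' \<sigma>0 has_integral (1 * \<mu> (Y \<sigma>0 1) w - 0 * \<mu> (Y \<sigma>0 0) w)) {0..1}"
  proof (rule fundamental_theorem_of_calculus)
    fix t :: real
    have "((\<lambda>t. t * \<mu> (Y \<sigma>0 t) w) has_real_derivative t * LD w (i (u \<sigma>0)) (Y \<sigma>0 t) + 1 * \<mu> (Y \<sigma>0 t) w) (at t)"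
      by (intro DERIV_mult' DERIV_ident dt vw)
    then have "((\<lambda>t. t * \<mu> (Y \<sigma>0 t) w) has_real_derivative f' \<sigma>0 t) (at t)" unfolding LDu f'_def by (simp add: add.commute)
    then show "((\<lambda>t. t * \<mu> (Y \<sigma>0 t) w) has_vector_derivative f' \<sigma>0 t) (at t within {0..1})"
      unfolding has_real_derivative_iff_has_vector_derivative[symmetric] by (rule has_field_derivative_at_within)
  qed simp
  from integral_unique[OF this] have "integral (cbox 0 1) (f' \<sigma>0) = \<mu> (Y \<sigma>0 1) w" by simp
  moreover have "psi y (v + \<sigma> *\<^sub>R w) = integral (cbox 0 1) (f \<sigma>)" for \<sigma>
    by (simp add: psi_def f_def[abs_def] u_def Y1[symmetric, unfolded u_def])
  ultimately show ?thesis by (simp add: Y_def)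
qed

lemma psi_Lipschitz:
  assumes y: "y \<in> X" and C: "\<And>y w. y \<in> X \<Longrightarrow> w \<in> uu \<Longrightarrow> \<bar>\<mu> y w\<bar> \<le> C * norm w" and vw: "v \<in> S" "w \<in> S"
  shows "\<bar>psi y w - psi y v\<bar> \<le> C * norm (w - v)"
proof -
  have wv: "w - v \<in> S" by (intro SD vw)
  have "\<exists>z. 0 < z \<and> z < 1 \<and> psi y (v + 1 *\<^sub>R (w - v)) - psi y (v + 0 *\<^sub>R (w - v)) = (1 - 0) * \<mu> (\<phi> (EXP (i (v + z *\<^sub>R (w - v)))) y) (w - v)"
    by (rule MVT2[of 0 1 "\<lambda>\<sigma>. psi y (v + \<sigma> *\<^sub>R (w - v))"]) (auto intro!: psi_derivative vw(1) wv)
  then obtain z where "psi y w - psi y v = \<mu> (\<phi> (EXP (i (v + z *\<^sub>R (w - v)))) y) (w - v)" by auto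
  then show ?thesis using C[OF X_act[OF y] SD(4)[OF wv]] by simp
qed

lemma psi_0: "psi y 0 = 0"
  using mu_linear(2)[OF SD(4)[OF SD(1)] SD(4)[OF SD(1)], of _ 0] by (simp add: psi_def)

text \<open>The derivative of the potential along the ray increases to \<open>lam u y\<close>, which
  is at least m, so the perturbed function eventually grows with slope at least
  \<open>e / 2\<close>.\<close>

lemma psi_ray:
  assumes y: "y \<in> X" and u: "u \<in> S" and m: "m \<le> lam u y" and e: "e > 0"
  shows "\<exists>R. \<forall>r\<ge>R. psi y (r *\<^sub>R u) - r * m + e * r \<ge> 0"
proof -
  define f where "f r = psi y (r *\<^sub>R u) - r * m + e * r" for r
  have der: "(f has_real_derivative \<mu> (flow u r y) u - m + e) (at r)" for r
    unfolding f_def using psi_derivative[OF SD(1) u, of y r]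
    by (auto intro!: derivative_eq_intros simp: j_simps)
  have "\<forall>\<^sub>F n in sequentially. lam u y - e / 2 < \<mu> (flow u (real n) y) u"
    by (rule order_tendstoD(1)[OF lam_lim(1)[OF SD(4)[OF u] y]]) (use e in simp)
  then obtain n where n: "lam u y - e / 2 < \<mu> (flow u (real n) y) u"
    unfolding eventually_sequentially by blast
  have lower: "\<mu> (flow u r y) u - m + e \<ge> e / 2" if "r \<ge> real n" for r
    using flow_mono[OF SD(4)[OF u] that, of y] n m by linarith
  have grow: "f r \<ge> f (real n) + (r - real n) * (e / 2)" if r: "r > real n" for r
  proof -
    obtain q where q: "q > real n" "f r - f (real n) = (r - real n) * (\<mu> (flow u q y) u - m + e)"
      using MVT2[OF r der] by blast
    have "(r - real n) * (e / 2) \<le> (r - real n) * (\<mu> (flow u q y) u - m + e)"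
      using r q(1) lower[of q] by (intro mult_left_mono) auto
    then show ?thesis using q(2) by linarith
  qed
  \<comment> \<open>Far enough for slope \<open>e / 2\<close> to outweigh the value at n; the extra
    1 makes r exceed n strictly.\<close>
  define R where "R = real n + 1 + \<bar>f (real n)\<bar> * 2 / e"
  have "f r \<ge> 0" if r: "r \<ge> R" for r
  proof -
    have "\<bar>f (real n)\<bar> * 2 / e \<le> r - real n" using r by (simp add: R_def)
    from mult_right_mono[OF this, of "e / 2"] have "\<bar>f (real n)\<bar> \<le> (r - real n) * (e / 2)" using e by simp
    moreover have "r > real n" using r e by (simp add: R_def add_pos_nonneg) (smt (verit) divide_nonneg_pos)
    ultimately show ?thesis using grow[of r] by linarith
  qed
  then show ?thesis unfolding f_def by blast
qed

end

lemma compact_convergent_subsequence: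
  fixes f :: "nat \<Rightarrow> 'a::first_countable_topology"
  assumes K: "compact K" and f: "\<And>n. f n \<in> K"
  shows "\<exists>l\<in>K. \<exists>r. strict_mono r \<and> (\<lambda>n. f (r n)) \<longlonglongrightarrow> l"
proof -
  obtain l r where "l \<in> K" "strict_mono (r :: nat \<Rightarrow> nat)" "(f \<circ> r) \<longlonglongrightarrow> l"
    using seq_compactE[OF compact_imp_seq_compact[OF K], of f] f by auto
  then show ?thesis by (auto simp: o_def)
qed

context abelian_flow
begin

text \<open>A critical point of \<open>psi y - \<mu> x' + \<epsilon> norm\<close> on \<open>S\<close> exists as soon as \<open>y\<close> flows
  to the maximum in finitely many directions, which form a net of the unit sphere.\<close>

lemma approximate_value:
  assumes G: "subgroup G L" "closed G"
    and lie: "\<And>v. \<exists>\<xi>\<in>lie_algebra_of L A G. \<exists>\<eta>\<in>lie_algebra_of L A G. v = \<xi> + i \<eta>"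
    and SG: "\<And>v. v \<in> S \<Longrightarrow> EXP (i v) \<in> G" and x': "x' \<in> X" and y0: "y0 \<in> X" and eps: "\<epsilon> > 0"
  shows "\<exists>g\<in>G. \<forall>w\<in>S. \<bar>\<mu> (\<phi> g y0) w - \<mu> x' w\<bar> \<le> \<epsilon> * norm w"
proof -
  obtain C where C0: "C > 0" and "\<forall>y\<in>X. \<forall>w\<in>uu. \<bar>\<mu> y w\<bar> \<le> C * norm w" using mu_uniform_bound by blast
  then have C: "\<And>y w. y \<in> X \<Longrightarrow> w \<in> uu \<Longrightarrow> \<bar>\<mu> y w\<bar> \<le> C * norm w" by blast
  \<comment> \<open>Replacing a direction by a point of the net costs at most
    \<open>2 * (C * \<delta>) = \<epsilon> / 2\<close> per unit length; the rays use the other half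
    of \<epsilon>.\<close>
  define \<delta> where "\<delta> = \<epsilon> / (4 * C)"
  have \<delta>: "\<delta> > 0" "2 * (C * \<delta>) = \<epsilon> / 2" using eps C0 by (auto simp: \<delta>_def)
  define Sph where "Sph = S \<inter> {u. norm u = 1}"
  have "compact Sph"
    unfolding Sph_def
    by (intro bounded_closed_compact closed_Int closed_subspace[OF S(1)] closed_Collect_eq continuous_intros)
      (auto simp: bounded_iff)
  from seq_compact_imp_totally_bounded[OF compact_imp_seq_compact[OF this], rule_format, OF \<delta>(1)]
  obtain k where k: "finite k" "k \<subseteq> Sph" "Sph \<subseteq> (\<Union>x\<in>k. ball x \<delta>)" by (elim exE conjE)
  obtain g0 where g0: "y0 = \<phi> g0 x" using y0 by auto
  have "k \<subseteq> uu" using k(2) S(2) by (auto simp: Sph_def)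
  from generic_point[OF k(1) this G lie, of g0]
  obtain h where h: "h \<in> G" and gen: "\<forall>v\<in>k. \<forall>y'\<in>X. \<mu> y' v \<le> lam v (\<phi> (h \<otimes> g0) x)" by (rule bexE)
  define y where "y = \<phi> h y0"
  have y: "y \<in> X" unfolding y_def by (rule X_act[OF y0])
  have gen': "\<mu> x' v \<le> lam v y" if "v \<in> k" for v
    using gen[rule_format, OF that x'] by (simp add: y_def g0 act_mult)
  define ell where "ell v = \<mu> x' v" for v
  have ell: "ell (v + w) = ell v + ell w" "ell (r *\<^sub>R v) = r * ell v" if "v \<in> S" "w \<in> S" for v w r
    using that by (auto simp: ell_def mu_linear(1) mu_linear(2)[OF SD(4)[OF that(1)] SD(4)[OF that(1)]] SD)
  have ell_diff: "\<bar>ell w - ell v\<bar> \<le> C * norm (w - v)" if "v \<in> S" "w \<in> S" for v w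
    using ell(1)[of v "w - v"] C[OF x' SD(4)[OF SD(5)[OF that(2,1)]]] that by (simp add: SD ell_def)
  define F where "F v = psi y v - ell v + \<epsilon> * norm v" for v
  have "\<exists>R. \<forall>r\<ge>R. psi y (r *\<^sub>R u) - r * ell u + \<epsilon> / 2 * r \<ge> 0" if u: "u \<in> k" for u
    by (rule psi_ray[OF y]) (use u k(2) gen'[OF u] eps in \<open>auto simp: Sph_def ell_def\<close>)
  then have "\<exists>R. \<forall>u\<in>k. \<forall>r\<ge>R u. psi y (r *\<^sub>R u) - r * ell u + \<epsilon> / 2 * r \<ge> 0" by (intro bchoice ballI)
  then obtain R where R: "\<And>u r. u \<in> k \<Longrightarrow> r \<ge> R u \<Longrightarrow> psi y (r *\<^sub>R u) - r * ell u + \<epsilon> / 2 * r \<ge> 0" by blast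
  \<comment> \<open>A sum instead of a maximum, so that an empty net (S = 0) needs no separate case;
    the added 1 keeps the radius positive.\<close>
  define R0 where "R0 = (\<Sum>u\<in>k. \<bar>R u\<bar>) + 1"
  have R0: "R u \<le> R0" if "u \<in> k" for u
    using member_le_sum[OF that, of "\<lambda>u. \<bar>R u\<bar>"] k(1) by (simp add: R0_def)
  have R0pos: "R0 > 0" unfolding R0_def by (intro add_nonneg_pos sum_nonneg) auto
  have coercive: "F v \<ge> 0" if v: "v \<in> S" "norm v \<ge> R0" for v
  proof -
    define r where "r = norm v"
    have r: "r > 0" "r \<ge> R0" using v R0pos by (auto simp: r_def)
    have "inverse r *\<^sub>R v \<in> Sph" using v r by (auto simp: Sph_def SD r_def)
    then obtain u where u: "u \<in> k" "norm (inverse r *\<^sub>R v - u) < \<delta>" using k(3) by (force simp: dist_norm norm_minus_commute)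
    have uS: "u \<in> S" "r *\<^sub>R u \<in> S" using u(1) k(2) by (auto simp: Sph_def SD)
    have "v - r *\<^sub>R u = r *\<^sub>R (inverse r *\<^sub>R v - u)" using r by (simp add: scaleR_right_diff_distrib)
    then have "norm (v - r *\<^sub>R u) \<le> r * \<delta>" using u(2) r by simp
    then have nb: "C * norm (v - r *\<^sub>R u) \<le> r * (C * \<delta>)" using C0 by (simp add: mult.left_commute)
    have "\<bar>psi y v - psi y (r *\<^sub>R u)\<bar> \<le> C * norm (v - r *\<^sub>R u)" by (rule psi_Lipschitz[OF y C uS(2) v(1)])
    moreover have "\<bar>ell v - ell (r *\<^sub>R u)\<bar> \<le> C * norm (v - r *\<^sub>R u)" by (rule ell_diff[OF uS(2) v(1)])
    moreover have "ell (r *\<^sub>R u) = r * ell u" by (rule ell(2)[OF uS(1) uS(1)])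
    moreover have "psi y (r *\<^sub>R u) - r * ell u + \<epsilon> / 2 * r \<ge> 0" using R[OF u(1)] R0[OF u(1)] r(2) by simp
    moreover have "2 * (r * (C * \<delta>)) = \<epsilon> / 2 * r" using \<delta>(2) by (metis mult.commute mult.left_commute)
    moreover have "\<epsilon> * norm v = \<epsilon> / 2 * r + \<epsilon> / 2 * r" by (simp add: r_def)
    ultimately show ?thesis unfolding F_def using nb by linarith
  qed
  have F0: "F 0 = 0" using ell(2)[OF SD(1) SD(1), of 0] by (simp add: F_def psi_0)
  define Q where "Q = S \<inter> cball 0 R0"
  have cQ: "compact Q"
    unfolding Q_def by (rule bounded_closed_compact[OF bounded_Int[OF disjI2] closed_Int[OF closed_subspace[OF S(1)]]]) auto
  have "(C + C + \<epsilon>)-lipschitz_on S F"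
    unfolding F_def
  proof (intro lipschitz_onI)
    fix v w assume vw: "v \<in> S" "w \<in> S"
    have "\<bar>\<epsilon> * norm v - \<epsilon> * norm w\<bar> \<le> \<epsilon> * norm (v - w)"
      unfolding right_diff_distrib[symmetric] abs_mult using eps by (simp add: norm_triangle_ineq3)
    then show "dist (psi y v - ell v + \<epsilon> * norm v) (psi y w - ell w + \<epsilon> * norm w) \<le> (C + C + \<epsilon>) * dist v w"
      using psi_Lipschitz[OF y C vw(2,1)] ell_diff[OF vw(2,1)]
      unfolding dist_norm real_norm_def distrib_right by linarith
  qed (use C0 eps in simp)
  then have "continuous_on Q F" by (intro continuous_on_subset[OF lipschitz_on_continuous_on]) (auto simp: Q_def)
  moreover have "Q \<noteq> {}" using SD(1) R0pos by (auto simp: Q_def)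
  ultimately have "\<exists>v\<in>Q. \<forall>w\<in>Q. F v \<le> F w" by (intro continuous_attains_inf[OF cQ])
  then obtain v0 where v0: "v0 \<in> Q" "\<forall>v\<in>Q. F v0 \<le> F v" by (elim bexE)
  have v0S: "v0 \<in> S" using v0(1) by (simp add: Q_def)
  have F00: "F v0 \<le> 0" using v0(2) F0 SD(1) R0pos by (force simp: Q_def)
  have min: "F v0 \<le> F v" if "v \<in> S" for v
  proof (cases "norm v \<le> R0")
    case True
    then show ?thesis using v0(2) that by (simp add: Q_def)
  next
    case False
    then show ?thesis using coercive[OF that] F00 by linarith
  qed
  define g where "g = EXP (i v0) \<otimes> h"
  have gG: "g \<in> G" unfolding g_def by (intro subgroup.m_closed[OF G(1)] SG v0S h)
  have lower: "\<mu> (\<phi> g y0) w - ell w \<ge> - (\<epsilon> * norm w)" if w: "w \<in> S" for w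
  proof -
    define D where "D = \<mu> (\<phi> g y0) w"
    have "((\<lambda>\<sigma>. psi y (v0 + \<sigma> *\<^sub>R w)) has_real_derivative D) (at 0)"
      using psi_derivative[OF v0S w, of y 0] by (simp add: D_def g_def y_def act_mult)
    \<comment> \<open>The norm need not be differentiable at v0. Its increment is bounded by
      \<open>\<sigma> * norm w\<close> through the triangle inequality, which suffices for a
      one-sided comparison at positive \<sigma>.\<close>
    then have "((\<lambda>\<sigma>. psi y (v0 + \<sigma> *\<^sub>R w) - \<sigma> * ell w + \<epsilon> * \<sigma> * norm w) has_real_derivative D - ell w + \<epsilon> * norm w) (at 0)"
      by (auto intro!: derivative_eq_intros)
    moreover define f where "f \<sigma> = psi y (v0 + \<sigma> *\<^sub>R w) - \<sigma> * ell w + \<epsilon> * \<sigma> * norm w" for \<sigma>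
    ultimately have der: "(f has_real_derivative D - ell w + \<epsilon> * norm w) (at 0)" by (simp add: f_def[abs_def])
    have f: "f 0 \<le> f \<sigma>" if s: "\<sigma> > 0" for \<sigma>
    proof -
      have "F v0 \<le> F (v0 + \<sigma> *\<^sub>R w)" by (rule min) (intro SD v0S w)
      moreover have "ell (v0 + \<sigma> *\<^sub>R w) = ell v0 + \<sigma> * ell w" using ell(1)[OF v0S SD(3)[OF w]] ell(2)[OF w w] by simp
      moreover have "\<epsilon> * norm (v0 + \<sigma> *\<^sub>R w) \<le> \<epsilon> * norm v0 + \<epsilon> * \<sigma> * norm w"
        using norm_triangle_ineq[of v0 "\<sigma> *\<^sub>R w"] eps s mult_left_mono[of "norm (v0 + \<sigma> *\<^sub>R w)" "norm v0 + \<sigma> * norm w" \<epsilon>]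
        by (simp add: distrib_left mult.assoc)
      ultimately show ?thesis by (simp add: F_def f_def)
    qed
    have "D - ell w + \<epsilon> * norm w \<ge> 0"
    proof (rule ccontr)
      assume "\<not> ?thesis"
      then obtain d where "d > 0" "\<forall>h>0. h < d \<longrightarrow> f (0 + h) < f 0" using DERIV_neg_dec_right[OF der] by auto
      then have "f (d / 2) < f 0" by simp
      then show False using f[of "d / 2"] \<open>d > 0\<close> by simp
    qed
    then show ?thesis by (simp add: D_def)
  qed
  have "\<bar>\<mu> (\<phi> g y0) w - \<mu> x' w\<bar> \<le> \<epsilon> * norm w" if w: "w \<in> S" for w
  proof -
    have "- w \<in> S" using SD(3)[OF w, of "- 1"] by simp
    from lower[OF this] have "\<mu> (\<phi> g y0) w - ell w \<le> \<epsilon> * norm w"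
      using mu_linear(2)[OF SD(4)[OF w] SD(4)[OF w], of _ "- 1"] by (simp add: ell_def)
    then show ?thesis using lower[OF w] by (simp add: ell_def)
  qed
  then show ?thesis using gG by (intro bexI[of _ g] ballI)
qed

text \<open>Approximate values with errors \<open>1 / (n + 1)\<close> have an accumulation point in
  the compact orbit of y0.\<close>

lemma value_attained:
  assumes G: "subgroup G L" "closed G"
    and lie: "\<And>v. \<exists>\<xi>\<in>lie_algebra_of L A G. \<exists>\<eta>\<in>lie_algebra_of L A G. v = \<xi> + i \<eta>"
    and SG: "\<And>v. v \<in> S \<Longrightarrow> EXP (i v) \<in> G" and x': "x' \<in> X" and y0: "y0 \<in> X"
    and comp: "compact ((\<lambda>g. \<phi> g y0) ` G)"
  shows "\<exists>y\<in>(\<lambda>g. \<phi> g y0) ` G. \<forall>w\<in>S. \<mu> y w = \<mu> x' w"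
proof -
  have "\<exists>g\<in>G. \<forall>w\<in>S. \<bar>\<mu> (\<phi> g y0) w - \<mu> x' w\<bar> \<le> inverse (real (Suc n)) * norm w" for n
    by (rule approximate_value[OF G lie SG x' y0]) auto
  then have "\<exists>g. \<forall>n. g n \<in> G \<and> (\<forall>w\<in>S. \<bar>\<mu> (\<phi> (g n) y0) w - \<mu> x' w\<bar> \<le> inverse (real (Suc n)) * norm w)"
    by (intro choice allI) (simp only: Bex_def)
  then obtain g where g: "\<And>n. g n \<in> G" and b: "\<And>n w. w \<in> S \<Longrightarrow> \<bar>\<mu> (\<phi> (g n) y0) w - \<mu> x' w\<bar> \<le> inverse (real (Suc n)) * norm w"
    by blast
  define f where "f n = \<phi> (g n) y0" for n
  have "f n \<in> (\<lambda>g. \<phi> g y0) ` G" for n unfolding f_def by (rule imageI[OF g])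
  with comp have "\<exists>y\<in>(\<lambda>g. \<phi> g y0) ` G. \<exists>r. strict_mono r \<and> (\<lambda>n. f (r n)) \<longlonglongrightarrow> y"
    by (rule compact_convergent_subsequence)
  then obtain y r where
    y: "y \<in> (\<lambda>g. \<phi> g y0) ` G" "strict_mono (r :: nat \<Rightarrow> nat)" "(\<lambda>n. f (r n)) \<longlonglongrightarrow> y"
    by (elim bexE exE conjE)
  have "\<mu> y w = \<mu> x' w" if w: "w \<in> S" for w
  proof (rule LIMSEQ_unique)
    show "(\<lambda>n. \<mu> (f (r n)) w) \<longlonglongrightarrow> \<mu> y w"
      by (rule isCont_tendsto_compose[OF isCont_mu[OF SD(4)[OF w]] y(3)])
    have "(\<lambda>n. \<mu> (f n) w - \<mu> x' w) \<longlonglongrightarrow> 0"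
    proof (rule Lim_null_comparison)
      show "\<forall>\<^sub>F n in sequentially. norm (\<mu> (f n) w - \<mu> x' w) \<le> inverse (real (Suc n)) * norm w"
        unfolding real_norm_def by (intro always_eventually allI b[OF w, folded f_def])
      show "(\<lambda>n. inverse (real (Suc n)) * norm w) \<longlonglongrightarrow> 0"
        by (intro tendsto_mult_left_zero LIMSEQ_inverse_real_of_nat)
    qed
    from LIMSEQ_subseq_LIMSEQ[OF LIM_zero_cancel[OF this] y(2)]
    show "(\<lambda>n. \<mu> (f (r n)) w) \<longlonglongrightarrow> \<mu> x' w" by (simp add: o_def)
  qed
  then show ?thesis using y(1) by (intro bexI[of _ y] ballI)
qed

end

section \<open>The image of the gradient map\<close>

text \<open>A Gram-Schmidt step: the projection p of the new vector a to the old span is itself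
  obtained from the induction hypothesis, applied to the functional \<open>q a\<close>.\<close>

lemma (in hermitian_space) riesz_span:
  assumes "finite C" and "linear F"
  shows "\<exists>m\<in>span C. \<forall>b\<in>span C. q m b = (F b :: real)"
  using assms
proof (induction C arbitrary: F rule: finite_induct)
  case empty
  then show ?case by (simp add: q_simps linear_0)
next
  case (insert a C)
  obtain p where p: "p \<in> span C" "\<forall>b\<in>span C. q p b = q a b" using insert.IH[OF q_linear2] by blast
  obtain m where m: "m \<in> span C" "\<forall>b\<in>span C. q m b = F b" using insert.IH[OF insert.prems] by blast
  define a' where "a' = a - p"
  \<comment> \<open>If a' is 0, division by zero makes r equal to 0, which is consistent because
    \<open>F a'\<close> is then 0 as well.\<close>
  define r where "r = F a' / q a' a'"
  have orth: "q a' b = 0" "q b a' = 0" if "b \<in> span C" for b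
    using p(2) that q_sym[of b a'] by (auto simp: a'_def q_simps)
  have aa: "r * q a' a' = F a'"
    using q_pos[of a'] linear_0[OF insert.prems] by (cases "a' = 0") (auto simp: r_def)
  have a'in: "a' \<in> span (insert a C)"
    unfolding a'_def by (intro span_diff set_mp[OF span_mono[OF subset_insertI] p(1)]) (simp add: span_base)
  show ?case
  proof (intro bexI[of _ "m + r *\<^sub>R a'"] ballI)
    show "m + r *\<^sub>R a' \<in> span (insert a C)"
      by (intro span_add span_scale a'in set_mp[OF span_mono[OF subset_insertI] m(1)])
    fix b assume "b \<in> span (insert a C)"
    then obtain k where "b - k *\<^sub>R a \<in> span C" by (auto simp: span_insert)
    moreover define s where "s = b - k *\<^sub>R a'"
    moreover have "s = (b - k *\<^sub>R a) + k *\<^sub>R p" by (simp add: s_def a'_def algebra_simps)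
    ultimately have s: "s \<in> span C" using p(1) by (simp add: span_add span_scale)
    have b: "b = s + k *\<^sub>R a'" by (simp add: s_def)
    have "q (m + r *\<^sub>R a') b = q m s + k * (r * q a' a')"
      unfolding b using orth[OF s] orth[OF m(1)] by (simp add: q_simps)
    then show "q (m + r *\<^sub>R a') b = F b"
      unfolding b aa using m(2) s by (simp add: linear_add[OF insert.prems] linear_scale[OF insert.prems])
  qed
qed

lemma (in hermitian_space) riesz_subspace:
  assumes W: "subspace W" and F: "linear F"
  shows "\<exists>m\<in>W. \<forall>b\<in>W. q m b = (F b :: real)"
proof -
  obtain T where T: "finite T" "span T = (UNIV :: 'a set)" using fin_span by blast
  obtain C where C: "C \<subseteq> W" "independent C" "W \<subseteq> span C" using maximal_independent_subset[of W] by auto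
  have "finite C" using independent_span_bound[OF T(1) C(2)] T(2) by simp
  moreover have "span C = W" using C(1,3) span_minimal[OF C(1) W] by auto
  ultimately show ?thesis using riesz_span[OF _ F] by metis
qed

text \<open>The group is the continuous image of the connected product of U with a vector
  space.\<close>

lemma (in clie_group) connected_if_polar:
  assumes "connected U" "subspace V" "(\<lambda>(u, \<beta>). u \<otimes> EXP \<beta>) ` (U \<times> V) = UNIV"
  shows "connected (UNIV :: 'g set)"
proof -
  have "isCont (\<lambda>p. fst p \<otimes> EXP (snd p)) p" for p :: "'g \<times> 'l"
    by (intro isCont_mult isCont_o2[OF _ isCont_EXP] continuous_intros)
  then have "continuous_on (U \<times> V) (\<lambda>(u, \<beta>). u \<otimes> EXP \<beta>)"
    by (simp add: continuous_at_imp_continuous_on split_def)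
  from connected_continuous_image[OF this connected_Times[OF assms(1) convex_connected[OF subspace_imp_convex[OF assms(2)]]]]
  show ?thesis unfolding assms(3) .
qed

context cplx_action
begin

lemma transported_ip_eq:
  assumes "b \<in> i ` uu" "b' \<in> i ` uu" shows "transported_ip i ip b b' = hq b b'"
proof -
  have "pr (i v) = (0, v)" if "v \<in> uu" for v
    using that subspace_0[OF subspace_uu] by (intro pr_eqI) auto
  then show ?thesis using assms subspace_0[OF subspace_uu] by (auto simp: transported_ip_def hq_def ipu0)
qed

lemma gradient_map_characterization:
  assumes W: "subspace W" "W \<subseteq> i ` uu"
  shows "gradient_map i ip W \<mu> y \<in> W" "b \<in> W \<Longrightarrow> hq (gradient_map i ip W \<mu> y) b = \<mu> y (- i b)"
proof -
  define F where "F b = \<mu> y (snd (pr b))" for b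
  have F: "F b = \<mu> y (- i b)" if "b \<in> W" for b
  proof -
    obtain v where v: "b = i v" "v \<in> uu" using \<open>b \<in> W\<close> W(2) by auto
    have "pr b = (0, v)" unfolding v(1) using v(2) subspace_0[OF subspace_uu] by (intro pr_eqI) auto
    then show ?thesis by (simp add: F_def v(1))
  qed
  have "linear F"
    unfolding F_def by (rule linearI) (auto simp: pr_simps mu_linear(1) mu_linear(2)[OF pr(2) pr(2)] pr)
  from H.riesz_subspace[OF W(1) this] obtain m where m: "m \<in> W" "\<forall>b\<in>W. hq m b = F b" by (elim bexE)
  have tip: "transported_ip i ip a b = hq a b" if "a \<in> W" "b \<in> W" for a b
    using that W(2) by (intro transported_ip_eq) auto
  have "gradient_map i ip W \<mu> y = m"
    unfolding gradient_map_def
  proof (rule the_equality)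
    show "m \<in> W \<and> (\<forall>\<beta>\<in>W. transported_ip i ip m \<beta> = \<mu> y (- i \<beta>))" using m F tip by simp
    fix m' assume m': "m' \<in> W \<and> (\<forall>\<beta>\<in>W. transported_ip i ip m' \<beta> = \<mu> y (- i \<beta>))"
    have d: "m' - m \<in> W" using m' m(1) W(1) by (simp add: subspace_diff)
    then have "hq m' (m' - m) = hq m (m' - m)" using m' m(2) F tip[of m' "m' - m"] by simp
    then have "hq (m' - m) (m' - m) = 0" by (simp add: H.q_simps)
    then show "m' = m" using H.q_pos[of "m' - m"] by auto
  qed
  then show "gradient_map i ip W \<mu> y \<in> W" "b \<in> W \<Longrightarrow> hq (gradient_map i ip W \<mu> y) b = \<mu> y (- i b)"
    using m F by auto
qed

text \<open>The conditions describing the projection involve only pairings with elements of V, so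
  the two definite descriptions have equivalent predicates.\<close>

lemma abelian_gradient_map_cong:
  assumes W: "subspace W" "W \<subseteq> i ` uu" and V: "V \<subseteq> W" and eq: "\<And>b. b \<in> V \<Longrightarrow> \<mu> y (- i b) = \<mu> y' (- i b)"
  shows "abelian_gradient_map i ip W V \<mu> y = abelian_gradient_map i ip W V \<mu> y'"
proof -
  have "transported_ip i ip (gradient_map i ip W \<mu> y - w) b = \<mu> y (- i b) - hq w b"
    if "w \<in> V" "b \<in> V" for w b y
  proof -
    have "gradient_map i ip W \<mu> y - w \<in> W"
      using that V gradient_map_characterization(1)[OF W] by (intro subspace_diff[OF W(1)]) auto
    then have "transported_ip i ip (gradient_map i ip W \<mu> y - w) b = hq (gradient_map i ip W \<mu> y - w) b"
      using that V W(2) by (intro transported_ip_eq) auto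
    then show ?thesis using that V gradient_map_characterization(2)[OF W, of b y] by (auto simp: H.q_simps)
  qed
  then have "(w \<in> V \<and> (\<forall>b\<in>V. transported_ip i ip (gradient_map i ip W \<mu> y - w) b = 0)) =
    (w \<in> V \<and> (\<forall>b\<in>V. transported_ip i ip (gradient_map i ip W \<mu> y' - w) b = 0))" for w
    using eq by auto
  then show ?thesis by (simp add: abelian_gradient_map_def orthogonal_projection_def)
qed

lemma abelian_gradient_image:
  assumes G: "subgroup G L" "closed G" and rf: "real_form L i A U G" and Vp: "V \<subseteq> \<pp>_part L i A U G"
    and V: "abelian_subalgebra L A V"
    and O: "O' = (\<lambda>g. \<phi> g y0) ` G" "closedin (top_of_set X) O'" and y0: "y0 \<in> X"
  shows "abelian_gradient_map i ip (\<pp>_part L i A U G) V \<mu> ` X = abelian_gradient_map i ip (\<pp>_part L i A U G) V \<mu> ` O'"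
proof -
  define P where "P = \<pp>_part L i A U G"
  have P: "P \<subseteq> lie_algebra_of L A G" "P \<subseteq> i ` uu" by (auto simp: P_def \<pp>_part_def)
  have sP: "subspace P"
    unfolding P_def \<pp>_part_def
    by (intro subspace_inter subspace_lie_algebra[OF G] linear_subspace_image[OF linear_j subspace_uu])
  have VP: "V \<subseteq> P" using Vp by (simp add: P_def)
  have sV: "subspace V" using V by (simp add: abelian_subalgebra_def)
  have kG: "v \<in> lie_algebra_of L A (G \<inter> U) \<Longrightarrow> v \<in> lie_algebra_of L A G" for v
    by (simp add: lie_algebra_iff)
  have uu: "\<exists>a\<in>lie_algebra_of L A G. \<exists>b\<in>lie_algebra_of L A G. v = a + i b" if "v \<in> uu" for v
  proof -
    have "uu = {v + w | v w. v \<in> lie_algebra_of L A (G \<inter> U) \<and> w \<in> i ` P}"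
      using rf by (simp add: real_form_def direct_sum_decomposition_def P_def)
    then obtain a b where "a \<in> lie_algebra_of L A (G \<inter> U)" "b \<in> P" "v = a + i b" using \<open>v \<in> uu\<close> by auto
    then show ?thesis using P(1) kG by blast
  qed
  \<comment> \<open>By the real form condition \<uu> lies in \<gg> + i \<gg>, hence so does the
    whole Lie algebra \<uu> + i \<uu>.\<close>
  have lie: "\<exists>\<xi>\<in>lie_algebra_of L A G. \<exists>\<eta>\<in>lie_algebra_of L A G. v = \<xi> + i \<eta>" for v
  proof -
    obtain a b where 1: "a \<in> lie_algebra_of L A G" "b \<in> lie_algebra_of L A G" "fst (pr v) = a + i b"
      using uu[OF pr(1)[of v]] by blast
    obtain c d where 2: "c \<in> lie_algebra_of L A G" "d \<in> lie_algebra_of L A G" "snd (pr v) = c + i d"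
      using uu[OF pr(2)[of v]] by blast
    have "v = (a + i b) + i (c + i d)" unfolding 1(3)[symmetric] 2(3)[symmetric] by (rule pr(3))
    also have "\<dots> = (a - d) + i (b + c)" by (simp add: j_simps)
    finally show ?thesis
      using 1 2 subspace_diff[OF subspace_lie_algebra[OF G]] subspace_add[OF subspace_lie_algebra[OF G]] by blast
  qed
  define S where "S = {v \<in> uu. i v \<in> V}"
  have sS: "subspace S"
    using subspace_uu sV unfolding S_def subspace_def by (auto simp: j_simps)
  have "abelian_flow L i A J B U \<omega> \<phi> \<mu> ip x S"
  proof (intro abelian_flow.intro abelian_flow_axioms.intro cplx_action_axioms)
    show "subspace S" by (rule sS)
    show "S \<subseteq> uu" by (auto simp: S_def)
    show "lie_bracket L A (i v) (i w) = 0" if "v \<in> S" "w \<in> S" for v w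
      using that V by (simp add: S_def abelian_subalgebra_def)
  qed
  then interpret F: abelian_flow L i A J B U \<omega> \<phi> \<mu> ip x S .
  have SG: "EXP (i v) \<in> G" if "v \<in> S" for v
  proof -
    have "i v \<in> lie_algebra_of L A G" using that VP P(1) by (auto simp: S_def)
    then have "EXP (1 *\<^sub>R i v) \<in> G" unfolding lie_algebra_iff by (rule spec)
    then show ?thesis by simp
  qed
  have comp: "compact ((\<lambda>g. \<phi> g y0) ` G)"
    using closedin_compact[OF compact_orbit O(2)] by (simp add: O(1))
  have "\<exists>y\<in>O'. abelian_gradient_map i ip P V \<mu> x' = abelian_gradient_map i ip P V \<mu> y" if x': "x' \<in> X" for x'
  proof -
    have "\<exists>y\<in>O'. \<forall>w\<in>S. \<mu> y w = \<mu> x' w"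
      unfolding O(1) by (rule F.value_attained[OF G lie SG x' y0 comp])
    then obtain y where y: "y \<in> O'" "\<forall>w\<in>S. \<mu> y w = \<mu> x' w" by (elim bexE)
    have "\<mu> x' (- i b) = \<mu> y (- i b)" if "b \<in> V" for b
    proof -
      obtain v where v: "b = i v" "v \<in> uu" using \<open>b \<in> V\<close> VP P(2) by auto
      then have "v \<in> S" using \<open>b \<in> V\<close> by (simp add: S_def)
      then show ?thesis using y(2) v(1) by simp
    qed
    then have "abelian_gradient_map i ip P V \<mu> x' = abelian_gradient_map i ip P V \<mu> y"
      by (rule abelian_gradient_map_cong[OF sP P(2) VP])
    then show ?thesis using y(1) by (rule bexI)
  qed
  moreover have "O' \<subseteq> X" unfolding O(1) by (intro image_subsetI X_act[OF y0])
  ultimately show ?thesis unfolding P_def by (intro equalityI image_subsetI image_mono) (auto intro: image_eqI)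
qed

end

theorem proposition1p1:
  fixes UC :: "'g::{t2_space, second_countable_topology} monoid"
    and i :: "'l::real_normed_vector \<Rightarrow> 'l"
    and A :: "('g, 'l) chart set"
    and U G :: "'g set"
    and J :: "'e::real_normed_vector \<Rightarrow> 'e"
    and B :: "('z::{t2_space, second_countable_topology}, 'e) chart set"
    and \<omega> :: "'z \<Rightarrow> 'e \<Rightarrow> 'e \<Rightarrow> real"
    and \<phi> :: "'g \<Rightarrow> 'z \<Rightarrow> 'z"
    and \<mu> :: "'z \<Rightarrow> 'l \<Rightarrow> real"
    and ip :: "'l \<Rightarrow> 'l \<Rightarrow> real"
    and \<pp> \<aa> :: "'l set"
    and x :: 'z
    and X \<O> :: "'z set"
  assumes "complexification_of UC i A U"
    and "compatible_subgroup UC i A U G"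
    and "connected G"
    and "real_form UC i A U G"
    and "kaehler_manifold J B \<omega>"
    and "holomorphic_action UC i A J B \<phi>"
    and "invariant_two_form B \<phi> U \<omega>"
    and "momentum_map UC A U B \<phi> \<omega> \<mu>"
    and "Ad_invariant_inner_product UC A U ip"
    and "X = orbit UC \<phi> x"
    and "compact X"
    and "\<O> \<in> closed_orbits_in UC \<phi> G X"
    and "\<pp> = \<pp>_part UC i A U G"
    and "\<aa> \<subseteq> \<pp>"
    and "abelian_subalgebra UC A \<aa>"
  shows "abelian_gradient_map i ip \<pp> \<aa> \<mu> ` X = abelian_gradient_map i ip \<pp> \<aa> \<mu> ` \<O>"
proof -
  have c: "complex_lie_group UC i A" "subgroup U UC" "compact U" "connected U"
    "direct_sum_decomposition UNIV (lie_algebra_of UC A U) (i ` lie_algebra_of UC A U)"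
    "diffeomorphism_on (prod_atlas A vec_atlas) A (U \<times> i ` lie_algebra_of UC A U) UNIV (\<lambda>(u, \<beta>). u \<otimes>\<^bsub>UC\<^esub> lie_exp UC A \<beta>)"
    using assms(1) by (simp_all add: complexification_of_def)
  have closedU: "closed U" using c(3) by (rule compact_imp_closed)
  have ham: "hamiltonian_action UC i A J B U \<omega> \<phi> \<mu>"
  proof (intro hamiltonian_action.intro hamiltonian_action_axioms.intro clie_group.intro
      clie_group_axioms.intro cplx_manifold.intro)
    show "group UC" "complex_manifold i A" using c(1) by (simp_all add: complex_lie_group_def)
    show "complex_manifold J B" using assms(5) by (simp add: kaehler_manifold_def)
  qed (use c(1,2) closedU assms(5,6,8) in simp_all)
  interpret h: hamiltonian_action UC i A J B U \<omega> \<phi> \<mu> by (rule ham)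
  \<comment> \<open>Connectedness comes from the polar decomposition of the complexification; it is
    what makes the exponentials generate the group.\<close>
  have "connected (UNIV :: 'g set)"
  proof (rule h.connected_if_polar[OF c(4)])
    show "subspace (i ` lie_algebra_of UC A U)" by (rule linear_subspace_image[OF h.linear_j h.subspace_uu])
    show "(\<lambda>(u, \<beta>). u \<otimes>\<^bsub>UC\<^esub> h.EXP \<beta>) ` (U \<times> i ` lie_algebra_of UC A U) = UNIV"
      using c(6) unfolding diffeomorphism_on_def bij_betw_def h.lie_exp_EXP by simp
  qed
  moreover have X: "X = range (\<lambda>g. \<phi> g x)"
    unfolding assms(10) orbit_def by auto
  ultimately have act: "cplx_action UC i A J B U \<omega> \<phi> \<mu> ip x"
    using ham c(5) assms(9,11) by (intro cplx_action.intro cplx_action_axioms.intro) simp_all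
  have G: "subgroup G UC" "closed G" using assms(2) by (simp_all add: compatible_subgroup_def)
  obtain y0 where y0: "y0 \<in> X" "\<O> = orbit (UC\<lparr>carrier := G\<rparr>) \<phi> y0" and cl: "closedin (top_of_set X) \<O>"
    using assms(12) by (auto simp: closed_orbits_in_def orbits_def)
  have O: "\<O> = (\<lambda>g. \<phi> g y0) ` G" unfolding y0(2) orbit_def by auto
  show ?thesis
    using cplx_action.abelian_gradient_image[OF act G assms(4) _ assms(15) O] assms(14) cl y0(1)
    unfolding X assms(13) by simp
qed

end
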